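(* Let $\mathcal T$ be a locally finite tree and let $G$ be a group acting by automorphisms on $\mathcal T$ in such a way that the subgroup $G^+$ of type-preserving automorphisms in $G$ is strongly transitive. Let $e$ be a distinguished edge of $\mathcal T$, let $\mathcal B$ be the subgroup of $G$ fixing $e$ pointwise, and let $\mathcal A$ be a doubly-infinite geodesic containing $e$. (Then $(G,\mathcal B)$ and $(G^+,\mathcal B)$ are Hecke pairs.) If $G\ne G^+$, let $i\in G$ be an element which inverts the edge $e$ and stabilizes $\mathcal A$ (such an element exists). Then: (1) The algebras $\mathbb C[G,\mathcal B]$ and $\mathbb C[G^+,\mathcal B]$ are isomorphic to the group algebra of the infinite dihedral group $D_\infty$. (2) The canonical basis of $\mathbb C[G^+,\mathcal B]$ (respectively of $\mathbb C[G,\mathcal B]$ if $G\neq G^+$), consisting of the double cosets of $\mathcal B$, is parametrized by the automorphism group of the bipartite graph (respectively the abstract graph) underlying $\mathcal A$. More precisely: (a) Let $N^+$ be the stabilizer of $\mathcal A$ in $G^+$ and $T$ the fixator of $\mathcal A$ in $G^+$. Then (i) every automorphism of $\mathcal A$ as a bipartite graph is realized by some element of $N^+$, and hence $N^+/T$ is isomorphic to the group of automorphisms of the bipartite graph $\mathcal A$, which is the infinite dihedral group $D_\infty$; (ii) $T=N^+\cap\mathcal B$, and therefore, given $n\in N^+$ with image $w$ in $W:=N^+/T$, all elements of $nT$ have the same left coset, the same right coset and the same double coset with respect to $\mathcal B$, which may consequently be written $w\mathcal B$, $\mathcal Bw$ and $\mathcal Bw\mathcal B$ respectively; (iii) $G^+$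 is the disjoint union $\bigsqcup_{w\in W}\mathcal Bw\mathcal B$. (b) If $G\ne G^+$, let $N$ be the stabilizer of $\mathcal A$ in $G$ and $T$ the fixator of $\mathcal A$ in $G$. Then (i) every graph automorphism of $\mathcal A$ is realized by some element of $N$, and $\widetilde W:=N/T$ is isomorphic to the group of automorphisms of the graph $\mathcal A$, which is the split extension of $N^+/T$ by the group $N/N^+\cong\mathbb Z/2\mathbb Z$ and is abstractly isomorphic to $D_\infty$; (ii) since $T\subseteq\mathcal B$, given $\widetilde n\in N$ with image $\widetilde w$ in $\widetilde W$, all elements of $\widetilde nT$ have the same left coset, the same right coset and the same double coset with respect to $\mathcal B$, which may consequently be written $\widetilde w\mathcal B$, $\mathcal B\widetilde w$ and $\mathcal B\widetilde w\mathcal B$ respectively; (iii) $G$ is the disjoint union $\bigsqcup_{\widetilde w\in\widetilde W}\mathcal B\widetilde w\mathcal B$. Denote by $s$ and $t$ the generators of $W\cong D_\infty$ that map the edge $e$ to its two neighbouring edges in $\mathcal A$; denote by $\Delta_w$ the element of $\mathbb C[G^+,\mathcal B]$ or $\mathbb C[G,\mathcal B]$ defined by $\mathcal Bw\mathcal B$ for $w$ in $W$ or $\widetilde W$; and, if $G\ne G^+$, denote by $\Delta_i$ the element of $\mathbb C[G,\mathcal B]$ with underlying set $\mathcal Bi\mathcal B=\mathcal Bi=i\mathcal B$. The image of $i$ in $\widetilde W$, also denoted $i$, interchanges the odd and the even vertex of $e$ and conjugates $s$ to $t$. The algebra $\mathbb C[G^+,\mathcal B]$ is generated by the identity $\mathcal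 B$, $\Delta_s$ and $\Delta_t$, and in case $G\ne G^+$ the algebra $\mathbb C[G,\mathcal B]$ is generated by the identity $\mathcal B$, $\Delta_i$ and $\Delta_s$. More precisely: if $s_1\cdots s_n$ is a reduced decomposition of $w\in W$ as a word in $\{s,t\}$, then $\Delta_w=\Delta_{s_1}\cdots\Delta_{s_n}$ and $R(\Delta_w)=\prod_{j=1}^nR(\Delta_{s_j})$. Furthermore (if $G\neq G^+$), $\Delta_i\Delta_{\widetilde w}=\Delta_{i\widetilde w}$ for every $\widetilde w\in\widetilde W$. (3) (a) Put $q_r:=R(\Delta_r)$ for $r\in\{s,t\}$. Left and right multiplication with the generators $\Delta_r$, $r\in\{s,t\}$, on the basis $\{\Delta_w: w\in W\}$ of the $\mathbb Z$-module underlying $\mathbb Z[G^+,\mathcal B]$ is given by $$\Delta_r\Delta_w=q_r\Delta_{rw}+(q_r-1)\Delta_w\quad\text{if } w \text{ begins with } r,$$ $$\Delta_w\Delta_r=q_r\Delta_{wr}+(q_r-1)\Delta_w\quad\text{if } w \text{ ends with } r,$$ $$\Delta_r\Delta_w=\Delta_{rw}\quad\text{if } w \text{ does not begin with } r,$$ $$\Delta_w\Delta_r=\Delta_{wr}\quad\text{if } w \text{ does not end with } r.$$ Furthermore, the set of relations $\Delta_r^2-\bigl(q_r+(q_r-1)\Delta_r\bigr)$, $r\in\{s,t\}$, defines a presentation of $\mathbb Z[G^+,\mathcal B]$ as a ring with unit (on the generators $\Delta_s,\Delta_t$). (b) Suppose $G\ne G^+$. For $w\in W$ write $\overline w$ for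 the image of $w$ under the automorphism of $W$ which exchanges the generators $s$ and $t$; this automorphism is implemented by conjugation with the element $iT$ in $\widetilde W$. The group $\mathbb Z/2\mathbb Z$ acts on $\mathbb Z[G^+,\mathcal B]$, with the non-trivial element sending $\Delta_w$ to $\Delta_{\overline w}$ for $w\in W$. The Hecke algebra $\mathbb Z[G,\mathcal B]$ is isomorphic to the twisted tensor product of this action of $\mathbb Z/2\mathbb Z$ on $\mathbb Z[G^+,\mathcal B]$. Furthermore, the set of relations $$\Delta_r^2-\bigl(q_r+(q_r-1)\Delta_r\bigr)\ (r\in\{s,t\}),\qquad \Delta_i^2-1,\qquad \Delta_i\Delta_s\Delta_i^{-1}-\Delta_t$$ defines a presentation of $\mathbb Z[G,\mathcal B]$ as a ring with unit (on the generators $\Delta_s,\Delta_t,\Delta_i$).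
   Context: Hecke algebras. A pair $(G,H)$ of a group and a subgroup is a Hecke pair if every double coset $HgH$ is a finite union of right cosets $Hx$ (equivalently, every double coset is a finite union of left cosets $xH$; equivalently, for all $g\in G$ the subgroup $H\cap gHg^{-1}$ has finite index in both $H$ and $gHg^{-1}$). For a Hecke pair, $\mathbb Z[G,H]$ is the free $\mathbb Z$-module on the set $H\backslash G/H$ of double cosets (the canonical basis) with the associative multiplication $$HgH\cdot Hg'H=\sum_{HxH\in H\backslash G/H}\alpha(g,g';x)\,HxH,\qquad \alpha(g,g';x)=\#\{(i,j): g_ig'_j\in Hx\},$$ where $HgH=\bigsqcup_i Hg_i$ and $Hg'H=\bigsqcup_j Hg'_j$. Its unit is $H$. Put $\mathbb C[G,H]=\mathbb Z[G,H]\otimes_{\mathbb Z}\mathbb C$. $R(HxH)$ denotes the number of right $H$-cosets contained in $HxH$. Trees. The vertex set of a tree has a unique bipartition into two classes (types, "even" and "odd") such that adjacent vertices lie in different classes; an automorphism is type-preserving if it preserves each class. An element inverts an edge if it exchanges its two vertices. A doubly-infinite geodesic is a subgraph isomorphic to the real line triangulated by $\mathbb Z$; it is regarded as a bipartite graph through the types of its vertices. Stabilizer means setwise stabilizer; fixator means pointwise stabilizer. Strong transitivity. A group of type-preserving automorphisms of a tree is strongly transitive if it acts transitively on the set of doubly-infinite geodesics of the tree and the stabilizer of some doubly-infinite geodesic $\mathcal A'$ acts transitively on the set of edges of $\mathcal A'$. Words. Every $w\in W$ has a unique reduced decomposition as an alternating word in the involutions $s,t$; "begins with"/"ends with" refers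 to this word (the empty word neither begins nor ends with any letter). Twisted tensor product. If a group $\Omega$ acts by automorphisms on a ring $R$, the twisted tensor product is the $\mathbb Z$-module $\mathbb Z[\Omega]\otimes_{\mathbb Z}R$ with multiplication $(\omega\otimes r)\cdot(\omega'\otimes r')=\omega\omega'\otimes\omega'^{-1}(r)\,r'$ for $\omega,\omega'\in\Omega$, $r,r'\in R$. *)

theory Defs
  imports Complex_Main "HOL-Algebra.Algebra" "HOL-Library.Disjoint_Sets"
begin

section \<open>Trees and their automorphisms\<close>

text \<open>A graph is given by a vertex set \<open>V\<close> and a set \<open>E\<close> of edges, each edge being the
  two-element set of its end vertices. Graphs may be infinite.\<close>

definition simple_graph :: "'v set \<Rightarrow> 'v set set \<Rightarrow> bool" where
  "simple_graph V E \<longleftrightarrow> (\<forall>a\<in>E. a \<subseteq> V \<and> card a = 2)"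

definition walk :: "'v set set \<Rightarrow> 'v list \<Rightarrow> bool" where
  "walk E xs \<longleftrightarrow> xs \<noteq> [] \<and> successively (\<lambda>u v. {u, v} \<in> E) xs"

definition connected_graph :: "'v set \<Rightarrow> 'v set set \<Rightarrow> bool" where
  "connected_graph V E \<longleftrightarrow>
     V \<noteq> {} \<and> (\<forall>u\<in>V. \<forall>v\<in>V. u = v \<or> (\<exists>xs. walk E xs \<and> hd xs = u \<and> last xs = v))"

definition circuit :: "'v set set \<Rightarrow> 'v list \<Rightarrow> bool" where
  "circuit E xs \<longleftrightarrow> 3 \<le> length xs \<and> distinct xs \<and> walk E xs \<and> {last xs, hd xs} \<in> E"

definition tree :: "'v set \<Rightarrow> 'v set set \<Rightarrow> bool" where
  "tree V E \<longleftrightarrow> simple_graph V E \<and> connected_graph V E \<and> (\<nexists>xs. circuit E xs)"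

definition locally_finite :: "'v set \<Rightarrow> 'v set set \<Rightarrow> bool" where
  "locally_finite V E \<longleftrightarrow> (\<forall>v\<in>V. finite {a \<in> E. v \<in> a})"

definition bipartition :: "'v set \<Rightarrow> 'v set set \<Rightarrow> 'v set \<Rightarrow> 'v set \<Rightarrow> bool" where
  "bipartition V E Ve Vo \<longleftrightarrow>
     Ve \<union> Vo = V \<and> Ve \<inter> Vo = {} \<and> (\<forall>a\<in>E. a \<inter> Ve \<noteq> {} \<and> a \<inter> Vo \<noteq> {})"

definition graph_aut :: "'v set \<Rightarrow> 'v set set \<Rightarrow> ('v \<Rightarrow> 'v) monoid" where
  "graph_aut V E = BijGroup V \<lparr>carrier := {f \<in> Bij V. (`) f ` E = E}\<rparr>"

definition type_preserving :: "'v set \<Rightarrow> 'v set \<Rightarrow> ('v \<Rightarrow> 'v) \<Rightarrow> bool" where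
  "type_preserving Ve Vo f \<longleftrightarrow> f ` Ve = Ve \<and> f ` Vo = Vo"

text \<open>Automorphisms of the bipartite graph \<open>(VA, EA)\<close> whose two classes are cut out of \<open>VA\<close> by
  \<open>Ve\<close> and \<open>Vo\<close>.\<close>

definition bip_aut :: "'v set \<Rightarrow> 'v set set \<Rightarrow> 'v set \<Rightarrow> 'v set \<Rightarrow> ('v \<Rightarrow> 'v) monoid" where
  "bip_aut VA EA Ve Vo =
     graph_aut VA EA
       \<lparr>carrier := {f \<in> carrier (graph_aut VA EA). type_preserving (VA \<inter> Ve) (VA \<inter> Vo) f}\<rparr>"

text \<open>Doubly-infinite geodesics are subgraphs (vertex set and edge set), not parametrized lines.\<close>

definition geodesic :: "'v set \<Rightarrow> 'v set set \<Rightarrow> 'v set \<Rightarrow> 'v set set \<Rightarrow> bool" where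
  "geodesic V E VA EA \<longleftrightarrow> VA \<subseteq> V \<and> EA \<subseteq> E \<and>
     (\<exists>\<gamma> :: int \<Rightarrow> 'v. inj \<gamma> \<and> VA = range \<gamma> \<and> EA = range (\<lambda>k. {\<gamma> k, \<gamma> (k + 1)}))"

text \<open>In the following, \<open>\<phi>\<close> is an action on the vertices and \<open>K\<close> a set of group elements.\<close>

definition stabilizer_of :: "('g \<Rightarrow> 'v \<Rightarrow> 'v) \<Rightarrow> 'g set \<Rightarrow> 'v set \<Rightarrow> 'v set set \<Rightarrow> 'g set" where
  "stabilizer_of \<phi> K VA EA = {g \<in> K. \<phi> g ` VA = VA \<and> (`) (\<phi> g) ` EA = EA}"

definition fixator :: "('g \<Rightarrow> 'v \<Rightarrow> 'v) \<Rightarrow> 'g set \<Rightarrow> 'v set \<Rightarrow> 'g set" where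
  "fixator \<phi> K S = {g \<in> K. \<forall>v\<in>S. \<phi> g v = v}"

definition inverts_edge :: "('g \<Rightarrow> 'v \<Rightarrow> 'v) \<Rightarrow> 'g \<Rightarrow> 'v set \<Rightarrow> bool" where
  "inverts_edge \<phi> g a \<longleftrightarrow> (\<exists>u v. u \<noteq> v \<and> a = {u, v} \<and> \<phi> g u = v \<and> \<phi> g v = u)"

definition strongly_transitive ::
  "'v set \<Rightarrow> 'v set set \<Rightarrow> ('g \<Rightarrow> 'v \<Rightarrow> 'v) \<Rightarrow> 'g set \<Rightarrow> bool" where
  "strongly_transitive V E \<phi> K \<longleftrightarrow>
     (\<forall>V1 E1 V2 E2. geodesic V E V1 E1 \<longrightarrow> geodesic V E V2 E2 \<longrightarrow>
        (\<exists>g\<in>K. \<phi> g ` V1 = V2 \<and> (`) (\<phi> g) ` E1 = E2)) \<and>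
     (\<exists>V' E'. geodesic V E V' E' \<and>
        (\<forall>a\<in>E'. \<forall>b\<in>E'. \<exists>g\<in>stabilizer_of \<phi> K V' E'. \<phi> g ` a = b))"

text \<open>The group of the maps \<open>k \<mapsto> a + k\<close> and \<open>k \<mapsto> a - k\<close> of the integers, the latter
  being the pairs \<open>(a, True)\<close>.\<close>

definition D_inf :: "(int \<times> bool) monoid" where
  "D_inf = \<lparr>carrier = UNIV,
            monoid.mult = (\<lambda>(a, \<epsilon>) (b, \<delta>). (if \<epsilon> then a - b else a + b, \<epsilon> \<noteq> \<delta>)),
            monoid.one = (0, False)\<rparr>"

section \<open>Free modules, monoid algebras, Hecke algebras\<close>

definition fin_supp :: "'a set \<Rightarrow> ('a \<Rightarrow> 'k::zero) set" where
  "fin_supp S = {f. finite {x. f x \<noteq> 0} \<and> {x. f x \<noteq> 0} \<subseteq> S}"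

definition basis_elt :: "'a \<Rightarrow> 'a \<Rightarrow> 'k::zero_neq_one" where
  "basis_elt x = (\<lambda>y. if y = x then 1 else 0)"

definition monoid_algebra :: "('a, 'm) monoid_scheme \<Rightarrow> ('k::comm_ring_1, 'a \<Rightarrow> 'k) module" where
  "monoid_algebra M =
     \<lparr>carrier = fin_supp (carrier M),
      monoid.mult = (\<lambda>f g x. \<Sum>(a, b) | f a \<noteq> 0 \<and> g b \<noteq> 0 \<and> a \<otimes>\<^bsub>M\<^esub> b = x. f a * g b),
      monoid.one = basis_elt \<one>\<^bsub>M\<^esub>,
      ring.zero = (\<lambda>_. 0),
      ring.add = (\<lambda>f g x. f x + g x),
      module.smult = (\<lambda>c f x. c * f x)\<rparr>"

definition dcoset :: "('g, 'm) monoid_scheme \<Rightarrow> 'g set \<Rightarrow> 'g \<Rightarrow> 'g set" where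
  "dcoset G H g = (H #>\<^bsub>G\<^esub> g) <#>\<^bsub>G\<^esub> H"

definition dcosets :: "('g, 'm) monoid_scheme \<Rightarrow> 'g set \<Rightarrow> 'g set set" where
  "dcosets G H = dcoset G H ` carrier G"

definition rcosets_in :: "('g, 'm) monoid_scheme \<Rightarrow> 'g set \<Rightarrow> 'g set \<Rightarrow> 'g set set" where
  "rcosets_in G H D = {C \<in> rcosets\<^bsub>G\<^esub> H. C \<subseteq> D}"

definition R_num :: "('g, 'm) monoid_scheme \<Rightarrow> 'g set \<Rightarrow> 'g set \<Rightarrow> nat" where
  "R_num G H D = card (rcosets_in G H D)"

definition hecke_pair :: "('g, 'm) monoid_scheme \<Rightarrow> 'g set \<Rightarrow> bool" where
  "hecke_pair G H \<longleftrightarrow>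
     group G \<and> subgroup H G \<and> (\<forall>g\<in>carrier G. finite (rcosets_in G H (dcoset G H g)))"

definition rep :: "'g set \<Rightarrow> 'g" where
  "rep C = (SOME c. c \<in> C)"

text \<open>The representatives \<open>g\<^sub>i\<close> and \<open>g'\<^sub>j\<close> of the right cosets in two double cosets are
  those picked by \<^const>\<open>rep\<close>; the number obtained does not depend on this choice, nor on
  the choice of \<open>x\<close> in its double coset.\<close>

definition hecke_coeff ::
  "('g, 'm) monoid_scheme \<Rightarrow> 'g set \<Rightarrow> 'g set \<Rightarrow> 'g set \<Rightarrow> 'g \<Rightarrow> nat" where
  "hecke_coeff G H D D' x =
     card {(C, C'). C \<in> rcosets_in G H D \<and> C' \<in> rcosets_in G H D' \<and>
                    rep C \<otimes>\<^bsub>G\<^esub> rep C' \<in> H #>\<^bsub>G\<^esub> x}"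

text \<open>The Hecke algebra with coefficients in a commutative ring \<open>'k\<close>: the free module on the
  double cosets, with the integral structure constants. For \<open>'k = int\<close> this is
  \<open>\<int>[G,H]\<close>, and for \<open>'k = complex\<close> it is the scalar extension of \<open>\<int>[G,H]\<close> to
  the complex numbers.\<close>

definition hecke_algebra ::
  "('g, 'm) monoid_scheme \<Rightarrow> 'g set \<Rightarrow> ('k::comm_ring_1, 'g set \<Rightarrow> 'k) module" where
  "hecke_algebra G H =
     \<lparr>carrier = fin_supp (dcosets G H),
      monoid.mult = (\<lambda>f f' D. if D \<in> dcosets G H
                then \<Sum>D1 | f D1 \<noteq> 0. \<Sum>D2 | f' D2 \<noteq> 0.
                       f D1 * f' D2 * of_nat (hecke_coeff G H D1 D2 (rep D))
                else 0),
      monoid.one = basis_elt H,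
      ring.zero = (\<lambda>_. 0),
      ring.add = (\<lambda>f g D. f D + g D),
      module.smult = (\<lambda>c f D. c * f D)\<rparr>"

text \<open>Here \<open>w\<close> is a coset \<open>n T\<close> of a subgroup \<open>T\<close> of \<open>H\<close>, and the double
  coset \<open>H w H\<close> is a product of sets.\<close>

definition Delta :: "('g, 'm) monoid_scheme \<Rightarrow> 'g set \<Rightarrow> 'g set \<Rightarrow> 'g set \<Rightarrow> 'k::zero_neq_one" where
  "Delta G H w = basis_elt (H <#>\<^bsub>G\<^esub> w <#>\<^bsub>G\<^esub> H)"

definition algebra_isomorphic ::
  "('k, 'a) module \<Rightarrow> ('k, 'b) module \<Rightarrow> bool" where
  "algebra_isomorphic A A' \<longleftrightarrow>
     (\<exists>h\<in>ring_iso A A'. \<forall>c. \<forall>x\<in>carrier A. h (c \<odot>\<^bsub>A\<^esub> x) = c \<odot>\<^bsub>A'\<^esub> h x)"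

definition generates_algebra :: "('k, 'a) module \<Rightarrow> 'a set \<Rightarrow> bool" where
  "generates_algebra A S \<longleftrightarrow> S \<subseteq> carrier A \<and>
     (\<forall>U. S \<subseteq> U \<and> U \<subseteq> carrier A \<and> \<zero>\<^bsub>A\<^esub> \<in> U \<and>
          (\<forall>x\<in>U. \<forall>y\<in>U. x \<oplus>\<^bsub>A\<^esub> y \<in> U \<and> x \<otimes>\<^bsub>A\<^esub> y \<in> U) \<and>
          (\<forall>c. \<forall>x\<in>U. c \<odot>\<^bsub>A\<^esub> x \<in> U)
        \<longrightarrow> U = carrier A)"

section \<open>Words\<close>

definition word_prod :: "('a, 'm) monoid_scheme \<Rightarrow> 'a list \<Rightarrow> 'a" where
  "word_prod M ws = foldr (monoid.mult M) ws \<one>\<^bsub>M\<^esub>"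

definition reduced_word :: "('a, 'm) monoid_scheme \<Rightarrow> 'a set \<Rightarrow> 'a \<Rightarrow> 'a list \<Rightarrow> bool" where
  "reduced_word M S w ws \<longleftrightarrow>
     set ws \<subseteq> S \<and> word_prod M ws = w \<and>
     (\<forall>us. set us \<subseteq> S \<longrightarrow> word_prod M us = w \<longrightarrow> length ws \<le> length us)"

definition begins_with :: "('a, 'm) monoid_scheme \<Rightarrow> 'a set \<Rightarrow> 'a \<Rightarrow> 'a \<Rightarrow> bool" where
  "begins_with M S w r \<longleftrightarrow> (\<exists>ws. reduced_word M S w ws \<and> ws \<noteq> [] \<and> hd ws = r)"

definition ends_with :: "('a, 'm) monoid_scheme \<Rightarrow> 'a set \<Rightarrow> 'a \<Rightarrow> 'a \<Rightarrow> bool" where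
  "ends_with M S w r \<longleftrightarrow> (\<exists>ws. reduced_word M S w ws \<and> ws \<noteq> [] \<and> last ws = r)"

section \<open>Presentations of rings with unit\<close>

definition free_monoid :: "'x set \<Rightarrow> 'x list monoid" where
  "free_monoid L = \<lparr>carrier = lists L, monoid.mult = (@), monoid.one = []\<rparr>"

text \<open>The free unital associative ring \<open>\<int>\<langle>L\<rangle>\<close> on the letters \<open>L\<close>.\<close>

definition free_ring :: "'x set \<Rightarrow> (int, 'x list \<Rightarrow> int) module" where
  "free_ring L = monoid_algebra (free_monoid L)"

definition letter :: "'x \<Rightarrow> 'x list \<Rightarrow> int" where
  "letter x = basis_elt [x]"

definition free_ring_eval ::
  "('a, 'm) ring_scheme \<Rightarrow> ('x \<Rightarrow> 'a) \<Rightarrow> ('x list \<Rightarrow> int) \<Rightarrow> 'a" where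
  "free_ring_eval R gen f =
     finsum R (\<lambda>xs. [f xs] \<cdot>\<^bsub>R\<^esub> word_prod R (map gen xs)) {xs. f xs \<noteq> 0}"

text \<open>The homomorphism from the free ring sending each letter \<open>x\<close> to \<open>gen x\<close> is onto
  \<open>R\<close>, and its kernel is the two-sided ideal generated by \<open>rels\<close>.\<close>

definition ring_presentation ::
  "('a, 'm) ring_scheme \<Rightarrow> 'x set \<Rightarrow> ('x \<Rightarrow> 'a) \<Rightarrow> ('x list \<Rightarrow> int) set \<Rightarrow> bool" where
  "ring_presentation R L gen rels \<longleftrightarrow>
     ring R \<and> gen ` L \<subseteq> carrier R \<and> rels \<subseteq> carrier (free_ring L) \<and>
     free_ring_eval R gen ` carrier (free_ring L) = carrier R \<and>
     a_kernel (free_ring L) R (free_ring_eval R gen) = Idl\<^bsub>free_ring L\<^esub> rels"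

definition quadratic_rel :: "('k::comm_ring_1, 'a) module \<Rightarrow> nat \<Rightarrow> 'a \<Rightarrow> 'a" where
  "quadratic_rel F q x =
     x \<otimes>\<^bsub>F\<^esub> x \<ominus>\<^bsub>F\<^esub> (of_nat q \<odot>\<^bsub>F\<^esub> \<one>\<^bsub>F\<^esub> \<oplus>\<^bsub>F\<^esub> (of_nat q - 1) \<odot>\<^bsub>F\<^esub> x)"

datatype gen_letter = Gen_s | Gen_t | Gen_i

section \<open>Twisted tensor products\<close>

definition ring_action ::
  "('w, 'm) monoid_scheme \<Rightarrow> ('r, 'n) ring_scheme \<Rightarrow> ('w \<Rightarrow> 'r \<Rightarrow> 'r) \<Rightarrow> bool" where
  "ring_action \<Omega> R act \<longleftrightarrow>
     group \<Omega> \<and> ring R \<and> (\<forall>\<omega>\<in>carrier \<Omega>. act \<omega> \<in> ring_iso R R) \<and>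
     (\<forall>r\<in>carrier R. act \<one>\<^bsub>\<Omega>\<^esub> r = r) \<and>
     (\<forall>\<omega>\<in>carrier \<Omega>. \<forall>\<omega>'\<in>carrier \<Omega>. \<forall>r\<in>carrier R.
        act (\<omega> \<otimes>\<^bsub>\<Omega>\<^esub> \<omega>') r = act \<omega> (act \<omega>' r))"

text \<open>The tensor product \<open>\<int>[\<Omega>] \<otimes> R\<close> over the integers is the direct sum of the copies
  \<open>\<omega> \<otimes> R\<close> of \<open>R\<close>, because \<open>\<int>[\<Omega>]\<close> is free on \<open>\<Omega>\<close>. A finitely supported
  function \<open>F\<close> stands for the sum of the \<open>\<omega> \<otimes> F \<omega>\<close>, and the multiplication extends
  \<open>(\<omega> \<otimes> r) (\<omega>' \<otimes> r') = \<omega> \<omega>' \<otimes> \<omega>'\<^sup>-\<^sup>1(r) r'\<close> biadditively.\<close>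

definition twisted_tensor ::
  "('w, 'm) monoid_scheme \<Rightarrow> ('r, 'n) ring_scheme \<Rightarrow> ('w \<Rightarrow> 'r \<Rightarrow> 'r) \<Rightarrow> ('w \<Rightarrow> 'r) ring" where
  "twisted_tensor \<Omega> R act =
     \<lparr>carrier = {F. (\<forall>\<omega>. F \<omega> \<in> carrier R) \<and> finite {\<omega>. F \<omega> \<noteq> \<zero>\<^bsub>R\<^esub>} \<and>
                    {\<omega>. F \<omega> \<noteq> \<zero>\<^bsub>R\<^esub>} \<subseteq> carrier \<Omega>},
      monoid.mult = (\<lambda>F F' x. finsum R (\<lambda>(\<omega>, \<omega>'). act (inv\<^bsub>\<Omega>\<^esub> \<omega>') (F \<omega>) \<otimes>\<^bsub>R\<^esub> F' \<omega>')
                {(\<omega>, \<omega>'). F \<omega> \<noteq> \<zero>\<^bsub>R\<^esub> \<and> F' \<omega>' \<noteq> \<zero>\<^bsub>R\<^esub> \<and> \<omega> \<otimes>\<^bsub>\<Omega>\<^esub> \<omega>' = x}),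
      monoid.one = (\<lambda>x. if x = \<one>\<^bsub>\<Omega>\<^esub> then \<one>\<^bsub>R\<^esub> else \<zero>\<^bsub>R\<^esub>),
      ring.zero = (\<lambda>_. \<zero>\<^bsub>R\<^esub>),
      ring.add = (\<lambda>F F' x. F x \<oplus>\<^bsub>R\<^esub> F' x)\<rparr>"

definition pure_tensor :: "('r, 'n) ring_scheme \<Rightarrow> 'w \<Rightarrow> 'r \<Rightarrow> 'w \<Rightarrow> 'r" where
  "pure_tensor R \<omega> r = (\<lambda>x. if x = \<omega> then r else \<zero>\<^bsub>R\<^esub>)"

lemma twisted_tensor_mult_pure:
  assumes act: "ring_action \<Omega> R act"
    and w: "\<omega> \<in> carrier \<Omega>" "\<omega>' \<in> carrier \<Omega>" and r: "r \<in> carrier R" "r' \<in> carrier R"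
  shows "pure_tensor R \<omega> r \<otimes>\<^bsub>twisted_tensor \<Omega> R act\<^esub> pure_tensor R \<omega>' r' =
         pure_tensor R (\<omega> \<otimes>\<^bsub>\<Omega>\<^esub> \<omega>') (act (inv\<^bsub>\<Omega>\<^esub> \<omega>') r \<otimes>\<^bsub>R\<^esub> r')"
proof -
  interpret R: ring R using act by (simp add: ring_action_def)
  interpret W: group \<Omega> using act by (simp add: ring_action_def)
  have iso: "act (inv\<^bsub>\<Omega>\<^esub> \<omega>') \<in> ring_hom R R"
    using act w by (auto simp: ring_action_def ring_iso_def)
  have cl: "act (inv\<^bsub>\<Omega>\<^esub> \<omega>') r \<in> carrier R"
    using ring_hom_closed[OF iso] r by simp
  have z: "act (inv\<^bsub>\<Omega>\<^esub> \<omega>') \<zero>\<^bsub>R\<^esub> = \<zero>\<^bsub>R\<^esub>"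
    using ring_hom_zero[OF iso R.ring_axioms R.ring_axioms] .
  show ?thesis
  proof
    fix x
    let ?S = "{(a, b). pure_tensor R \<omega> r a \<noteq> \<zero>\<^bsub>R\<^esub> \<and> pure_tensor R \<omega>' r' b \<noteq> \<zero>\<^bsub>R\<^esub> \<and>
                       a \<otimes>\<^bsub>\<Omega>\<^esub> b = x}"
    let ?f = "\<lambda>(a, b). act (inv\<^bsub>\<Omega>\<^esub> b) (pure_tensor R \<omega> r a) \<otimes>\<^bsub>R\<^esub> pure_tensor R \<omega>' r' b"
    have S: "?S = (if r \<noteq> \<zero>\<^bsub>R\<^esub> \<and> r' \<noteq> \<zero>\<^bsub>R\<^esub> \<and> \<omega> \<otimes>\<^bsub>\<Omega>\<^esub> \<omega>' = x then {(\<omega>, \<omega>')} else {})"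
      by (auto simp: pure_tensor_def split: if_splits)
    have "finsum R ?f {(\<omega>, \<omega>')} = act (inv\<^bsub>\<Omega>\<^esub> \<omega>') r \<otimes>\<^bsub>R\<^esub> r'"
      using cl r by (subst R.finsum_insert) (auto simp: pure_tensor_def)
    then show "(pure_tensor R \<omega> r \<otimes>\<^bsub>twisted_tensor \<Omega> R act\<^esub> pure_tensor R \<omega>' r') x =
          pure_tensor R (\<omega> \<otimes>\<^bsub>\<Omega>\<^esub> \<omega>') (act (inv\<^bsub>\<Omega>\<^esub> \<omega>') r \<otimes>\<^bsub>R\<^esub> r') x"
      unfolding twisted_tensor_def monoid.simps S
      using cl r z by (auto simp: pure_tensor_def)
  qed
qed

end

theory Submission
  imports Defs
begin

text \<open>
  Fix a parametrisation \<open>\<gamma>\<close> of \<open>\<A>\<close> with \<open>e = {\<gamma> 0, \<gamma> 1}\<close>. Folding the tree onto \<open>\<A>\<close> around \<open>e\<close>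
  turns the edge \<open>g e\<close> into the image of \<open>e\<close> under a unique automorphism \<open>\<kappa> g\<close> of the line, so \<open>\<kappa>\<close> takes
  values in the infinite dihedral group. Strong transitivity makes \<open>G\<close> the union of the sets \<open>B n B\<close> with
  \<open>n\<close> in the stabiliser of \<open>\<A>\<close>, so the double cosets of \<open>B\<close> are exactly the fibres of \<open>\<kappa>\<close>. The other
  edges at the vertex of \<open>g e\<close> far from \<open>e\<close> lie further out than \<open>g e\<close>; of those at the near vertex
  precisely one lies further in and the rest are equally far. Counting them gives the structure
  constants of \<open>\<Delta>\<^sub>w \<Delta>\<^sub>r\<close>.

  The Hecke algebras of \<open>G\<^sup>+\<close> and of \<open>G \<noteq> G\<^sup>+\<close> are thereby both Iwahori--Hecke algebras of the infinite
  dihedral group: with generators \<open>s, t\<close> and parameters \<open>q\<^sub>s, q\<^sub>t\<close> in the first case, with generators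
  \<open>s, i\<close> and parameters \<open>q\<^sub>s, 1\<close> in the second. Such an algebra has its basis indexed by alternating words,
  which yields the presentation. Over the complex numbers the substitution
  \<open>\<Delta>\<^sub>r \<mapsto> (q\<^sub>r - 1) / 2 + (q\<^sub>r + 1) / 2 \<cdot> r\<close> changes the parameters to \<open>1\<close> and hence identifies the algebra with
  the group algebra.
\<close>

section \<open>Algebras given by structure constants\<close>

text \<open>The product of \<open>hecke_algebra\<close> is defined through chosen representatives.
  Associativity and structure constants rest on \<open>hecke_coeff_eq\<close>, which counts right
  cosets \<open>H c\<close> with \<open>c\<close> in the second factor and
  \<open>x c\<^sup>-\<^sup>1\<close> in the first, and no longer depends on choices. The map
  \<kappa> is multiplicative on the stabiliser of the line, but in general not on the whole group.
  Its values are automorphisms of the full line, among which the type-preserving ones have even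
  first component; hence the two rescalings \<open>\<kappa>\<^sub>p\<close> and
  \<open>\<kappa>\<^sub>t\<close>, which turn \<open>{s, t}\<close> and \<open>{s, i}\<close> into
  the standard generators. For the presentations, independence of words in the presented ring never
  has to be shown: the quadratic relations hold in the quotient of the free ring, so the universal
  property of the Hecke algebra gives a map back. The letter for \<open>t\<close> is eliminated
  through \<open>t = i s i\<close>. In the complex substitution, \<open>(q - 1) / 2\<close> is the
  midpoint of the roots \<open>q\<close> and \<open>-1\<close> of the quadratic relation, and
  \<open>(q + 1) / 2\<close> half their difference.\<close>

lemma finite_support: "f \<in> fin_supp S \<Longrightarrow> finite {x. f x \<noteq> 0}"
  by (simp add: fin_supp_def)

lemma fin_supp_outside: "f \<in> fin_supp S \<Longrightarrow> x \<notin> S \<Longrightarrow> f x = 0"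
  by (auto simp: fin_supp_def)

lemma fin_supp_zero [simp]: "(\<lambda>_. 0) \<in> fin_supp S"
  by (simp add: fin_supp_def)

lemma fin_supp_add:
  fixes f g :: "'a \<Rightarrow> 'k::comm_ring_1"
  assumes "f \<in> fin_supp S" "g \<in> fin_supp S"
  shows "(\<lambda>x. f x + g x) \<in> fin_supp S"
proof -
  have "{x. f x + g x \<noteq> 0} \<subseteq> {x. f x \<noteq> 0} \<union> {x. g x \<noteq> 0}" by auto
  then show ?thesis using assms unfolding fin_supp_def
    by (auto intro: finite_subset)
qed

lemma fin_supp_smult:
  fixes f :: "'a \<Rightarrow> 'k::comm_ring_1"
  assumes "f \<in> fin_supp S"
  shows "(\<lambda>x. k * f x) \<in> fin_supp S"
proof -
  have "{x. k * f x \<noteq> 0} \<subseteq> {x. f x \<noteq> 0}" by auto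
  then show ?thesis using assms unfolding fin_supp_def
    by (auto intro: finite_subset)
qed

lemma support_basis_elt: "{x. basis_elt a x \<noteq> (0::'k::zero_neq_one)} = {a}"
  by (auto simp: basis_elt_def)

lemma basis_elt_fin_supp [simp]: "basis_elt a \<in> (fin_supp S :: ('a \<Rightarrow> 'k::zero_neq_one) set) \<longleftrightarrow> a \<in> S"
  by (simp add: fin_supp_def support_basis_elt)

lemma basis_elt_self [simp]: "basis_elt a a = 1"
  by (simp add: basis_elt_def)

text \<open>Peels off one support point at a time. The step adds an arbitrary multiple of a basis
  element, which is the form in which a bilinear identity reduces to basis elements by additivity
  and homogeneity.\<close>

lemma fin_supp_induct [consumes 1, case_names zero add]:
  fixes f :: "'a \<Rightarrow> 'k::comm_ring_1"
  assumes f: "f \<in> fin_supp S" and z: "P (\<lambda>_. 0)"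
    and step: "\<And>k a f. a \<in> S \<Longrightarrow> f \<in> fin_supp S \<Longrightarrow> P f \<Longrightarrow> P (\<lambda>x. k * basis_elt a x + f x)"
  shows "P f"
proof -
  have "finite F \<Longrightarrow> (\<forall>f. {x. f x \<noteq> 0} = F \<longrightarrow> f \<in> fin_supp S \<longrightarrow> P f)" for F
  proof (induction F rule: finite_induct)
    case empty
    have "f = (\<lambda>_. 0)" if "{x. f x \<noteq> 0} = {}" for f :: "'a \<Rightarrow> 'k"
      using that by auto
    then show ?case using z by blast
  next
    case (insert a F)
    show ?case
    proof (intro allI impI)
      fix f :: "'a \<Rightarrow> 'k"
      assume 1: "{x. f x \<noteq> 0} = insert a F" and 2: "f \<in> fin_supp S"
      let ?f = "f(a := 0)"
      have 3: "{x. ?f x \<noteq> 0} = F" using 1 insert.hyps by (auto simp: set_eq_iff)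
      have 4: "?f \<in> fin_supp S" using 1 2 3 by (auto simp: fin_supp_def)
      have "a \<in> S" using 1 2 by (auto simp: fin_supp_def)
      then have "P (\<lambda>x. f a * basis_elt a x + ?f x)" using 3 4 insert.IH step by blast
      moreover have "(\<lambda>x. f a * basis_elt a x + ?f x) = f" by (auto simp: basis_elt_def)
      ultimately show "P f" by simp
    qed
  qed
  then show ?thesis using f by (auto simp: fin_supp_def)
qed

text \<open>Common interface for group algebras, free rings and Hecke algebras: a free module on
  \<open>S\<close> whose product is fixed by structure constants. The ring axioms reduce to the unit
  laws and associativity on basis elements, which are the last three assumptions.\<close>

locale fs_algebra =
  fixes A :: "('k::comm_ring_1, 'x \<Rightarrow> 'k) module" and S :: "'x set"
    and c :: "'x \<Rightarrow> 'x \<Rightarrow> 'x \<Rightarrow> 'k" and u :: 'x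
  assumes carrier_eq: "carrier A = fin_supp S"
    and mult_eq: "\<And>f g. f \<in> fin_supp S \<Longrightarrow> g \<in> fin_supp S \<Longrightarrow>
        f \<otimes>\<^bsub>A\<^esub> g = (\<lambda>x. \<Sum>a | f a \<noteq> 0. \<Sum>b | g b \<noteq> 0. f a * g b * c a b x)"
    and one_eq: "\<one>\<^bsub>A\<^esub> = basis_elt u" and u_in: "u \<in> S"
    and zero_eq: "\<zero>\<^bsub>A\<^esub> = (\<lambda>_. 0)"
    and add_eq: "\<And>f g. f \<oplus>\<^bsub>A\<^esub> g = (\<lambda>x. f x + g x)"
    and smult_eq: "\<And>k f. k \<odot>\<^bsub>A\<^esub> f = (\<lambda>x. k * f x)"
    and c_fin_supp: "\<And>a b. a \<in> S \<Longrightarrow> b \<in> S \<Longrightarrow> c a b \<in> fin_supp S"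
    and c_unit_left: "\<And>a. a \<in> S \<Longrightarrow> c u a = basis_elt a"
    and c_unit_right: "\<And>a. a \<in> S \<Longrightarrow> c a u = basis_elt a"
    and c_assoc: "\<And>a b d x. a \<in> S \<Longrightarrow> b \<in> S \<Longrightarrow> d \<in> S \<Longrightarrow>
        (\<Sum>y | c a b y \<noteq> 0. c a b y * c y d x) = (\<Sum>y | c b d y \<noteq> 0. c b d y * c a y x)"
begin

text \<open>Cancellation makes the support of a sum hard to control, so bilinearity is proved by
  expanding all products over the same finite index sets.\<close>

lemma mult_superset:
  assumes "f \<in> fin_supp S" "g \<in> fin_supp S" "finite F" "finite H"
    and "{x. f x \<noteq> 0} \<subseteq> F" "{x. g x \<noteq> 0} \<subseteq> H"
  shows "(f \<otimes>\<^bsub>A\<^esub> g) x = (\<Sum>a\<in>F. \<Sum>b\<in>H. f a * g b * c a b x)"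
proof -
  have "(f \<otimes>\<^bsub>A\<^esub> g) x = (\<Sum>a | f a \<noteq> 0. \<Sum>b | g b \<noteq> 0. f a * g b * c a b x)"
    using mult_eq assms by simp
  also have "\<dots> = (\<Sum>a | f a \<noteq> 0. \<Sum>b\<in>H. f a * g b * c a b x)"
    using assms by (intro sum.cong[OF refl] sum.mono_neutral_left) auto
  also have "\<dots> = (\<Sum>a\<in>F. \<Sum>b\<in>H. f a * g b * c a b x)"
    using assms by (intro sum.mono_neutral_left) auto
  finally show ?thesis .
qed

lemma mult_closed:
  assumes f: "f \<in> fin_supp S" and g: "g \<in> fin_supp S"
  shows "f \<otimes>\<^bsub>A\<^esub> g \<in> fin_supp S"
proof -
  let ?U = "\<Union>a\<in>{a. f a \<noteq> 0}. \<Union>b\<in>{b. g b \<noteq> 0}. {x. c a b x \<noteq> 0}"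
  have S: "a \<in> S" "b \<in> S" if "f a \<noteq> 0" "g b \<noteq> 0" for a b
    using that f g by (auto simp: fin_supp_def)
  have "{x. (f \<otimes>\<^bsub>A\<^esub> g) x \<noteq> 0} \<subseteq> ?U"
  proof
    fix x assume "x \<in> {x. (f \<otimes>\<^bsub>A\<^esub> g) x \<noteq> 0}"
    then have "(\<Sum>a | f a \<noteq> 0. \<Sum>b | g b \<noteq> 0. f a * g b * c a b x) \<noteq> 0"
      using mult_eq f g by simp
    then obtain a where "f a \<noteq> 0" "(\<Sum>b | g b \<noteq> 0. f a * g b * c a b x) \<noteq> 0"
      by (metis (mono_tags, lifting) mem_Collect_eq sum.not_neutral_contains_not_neutral)
    then obtain b where "g b \<noteq> 0" "f a * g b * c a b x \<noteq> 0"
      by (metis (mono_tags, lifting) mem_Collect_eq sum.not_neutral_contains_not_neutral)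
    then have "c a b x \<noteq> 0" by auto
    then show "x \<in> ?U" using \<open>f a \<noteq> 0\<close> \<open>g b \<noteq> 0\<close> by auto
  qed
  moreover have "finite ?U" using finite_support[OF f] finite_support[OF g] S c_fin_supp
    by (auto simp: fin_supp_def)
  moreover have "?U \<subseteq> S" using S c_fin_supp by (fastforce simp: fin_supp_def)
  ultimately show ?thesis unfolding fin_supp_def by (auto intro: finite_subset)
qed

lemma mult_basis:
  assumes "a \<in> S" "b \<in> S"
  shows "basis_elt a \<otimes>\<^bsub>A\<^esub> basis_elt b = c a b"
  using mult_eq[of "basis_elt a" "basis_elt b"] assms
  by (simp add: support_basis_elt)

lemma mult_basis_right:
  assumes "f \<in> fin_supp S" "b \<in> S"
  shows "f \<otimes>\<^bsub>A\<^esub> basis_elt b = (\<lambda>x. \<Sum>a | f a \<noteq> 0. f a * c a b x)"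
  using mult_eq[of f "basis_elt b"] assms
  by (simp add: support_basis_elt)

lemma mult_basis_left:
  assumes "f \<in> fin_supp S" "a \<in> S"
  shows "basis_elt a \<otimes>\<^bsub>A\<^esub> f = (\<lambda>x. \<Sum>b | f b \<noteq> 0. f b * c a b x)"
  using mult_eq[of "basis_elt a" f] assms
  by (simp add: support_basis_elt)

lemma mult_add_left:
  assumes "f \<in> fin_supp S" "g \<in> fin_supp S" "h \<in> fin_supp S"
  shows "(\<lambda>x. f x + g x) \<otimes>\<^bsub>A\<^esub> h = (\<lambda>x. (f \<otimes>\<^bsub>A\<^esub> h) x + (g \<otimes>\<^bsub>A\<^esub> h) x)"
proof
  fix x
  let ?F = "{x. f x \<noteq> 0} \<union> {x. g x \<noteq> 0}" and ?H = "{x. h x \<noteq> 0}"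
  have "finite ?F" "finite ?H" using assms by (auto simp: fin_supp_def)
  then show "((\<lambda>x. f x + g x) \<otimes>\<^bsub>A\<^esub> h) x = (f \<otimes>\<^bsub>A\<^esub> h) x + (g \<otimes>\<^bsub>A\<^esub> h) x"
    using assms fin_supp_add[OF assms(1,2)]
    by (subst (1 2 3) mult_superset[where F = ?F and H = ?H])
       (auto simp: sum.distrib[symmetric] algebra_simps)
qed

lemma mult_add_right:
  assumes "f \<in> fin_supp S" "g \<in> fin_supp S" "h \<in> fin_supp S"
  shows "h \<otimes>\<^bsub>A\<^esub> (\<lambda>x. f x + g x) = (\<lambda>x. (h \<otimes>\<^bsub>A\<^esub> f) x + (h \<otimes>\<^bsub>A\<^esub> g) x)"
proof
  fix x
  let ?F = "{x. f x \<noteq> 0} \<union> {x. g x \<noteq> 0}" and ?H = "{x. h x \<noteq> 0}"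
  have "finite ?F" "finite ?H" using assms by (auto simp: fin_supp_def)
  then show "(h \<otimes>\<^bsub>A\<^esub> (\<lambda>x. f x + g x)) x = (h \<otimes>\<^bsub>A\<^esub> f) x + (h \<otimes>\<^bsub>A\<^esub> g) x"
    using assms fin_supp_add[OF assms(1,2)]
    by (subst (1 2 3) mult_superset[where F = ?H and H = ?F])
       (auto simp: sum.distrib[symmetric] algebra_simps)
qed

lemma mult_smult_left:
  assumes "f \<in> fin_supp S" "h \<in> fin_supp S"
  shows "(\<lambda>x. k * f x) \<otimes>\<^bsub>A\<^esub> h = (\<lambda>x. k * (f \<otimes>\<^bsub>A\<^esub> h) x)"
proof
  fix x
  let ?F = "{x. f x \<noteq> 0}" and ?H = "{x. h x \<noteq> 0}"
  have "finite ?F" "finite ?H" using assms by (auto simp: fin_supp_def)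
  then show "((\<lambda>x. k * f x) \<otimes>\<^bsub>A\<^esub> h) x = k * (f \<otimes>\<^bsub>A\<^esub> h) x"
    using assms fin_supp_smult[OF assms(1)]
    by (subst (1 2) mult_superset[where F = ?F and H = ?H])
       (auto simp: sum_distrib_left algebra_simps)
qed

lemma mult_smult_right:
  assumes "f \<in> fin_supp S" "h \<in> fin_supp S"
  shows "h \<otimes>\<^bsub>A\<^esub> (\<lambda>x. k * f x) = (\<lambda>x. k * (h \<otimes>\<^bsub>A\<^esub> f) x)"
proof
  fix x
  let ?F = "{x. f x \<noteq> 0}" and ?H = "{x. h x \<noteq> 0}"
  have "finite ?F" "finite ?H" using assms by (auto simp: fin_supp_def)
  then show "(h \<otimes>\<^bsub>A\<^esub> (\<lambda>x. k * f x)) x = k * (h \<otimes>\<^bsub>A\<^esub> f) x"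
    using assms fin_supp_smult[OF assms(1)]
    by (subst (1 2) mult_superset[where F = ?H and H = ?F])
       (auto simp: sum_distrib_left algebra_simps)
qed

lemma mult_zero:
  "f \<in> fin_supp S \<Longrightarrow> (\<lambda>_. 0) \<otimes>\<^bsub>A\<^esub> f = (\<lambda>_. 0)"
  "f \<in> fin_supp S \<Longrightarrow> f \<otimes>\<^bsub>A\<^esub> (\<lambda>_. 0) = (\<lambda>_. 0)"
  by (simp_all add: mult_eq)

lemma smult_basis_fin_supp: "a \<in> S \<Longrightarrow> (\<lambda>x. (k :: 'k) * basis_elt a x) \<in> fin_supp S"
  by (simp add: fin_supp_smult)

lemmas bilinear = mult_add_left mult_add_right mult_smult_left mult_smult_right mult_closed
  fin_supp_add fin_supp_smult smult_basis_fin_supp mult_zero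

text \<open>By trilinearity it is enough to treat basis elements, where the claim is
  \<open>c_assoc\<close>; the arguments are then freed one at a time, starting from the
  right.\<close>

lemma mult_assoc:
  assumes "f \<in> fin_supp S" "g \<in> fin_supp S" "h \<in> fin_supp S"
  shows "(f \<otimes>\<^bsub>A\<^esub> g) \<otimes>\<^bsub>A\<^esub> h = f \<otimes>\<^bsub>A\<^esub> (g \<otimes>\<^bsub>A\<^esub> h)"
proof -
  have 1: "(basis_elt a \<otimes>\<^bsub>A\<^esub> basis_elt b) \<otimes>\<^bsub>A\<^esub> basis_elt d =
      basis_elt a \<otimes>\<^bsub>A\<^esub> (basis_elt b \<otimes>\<^bsub>A\<^esub> basis_elt d)" if "a \<in> S" "b \<in> S" "d \<in> S" for a b d
    using that mult_basis_right[OF c_fin_supp[of a b], of d] mult_basis_left[OF c_fin_supp[of b d], of a]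
    by (simp add: mult_basis c_assoc)
  have 2: "(basis_elt a \<otimes>\<^bsub>A\<^esub> basis_elt b) \<otimes>\<^bsub>A\<^esub> h =
      basis_elt a \<otimes>\<^bsub>A\<^esub> (basis_elt b \<otimes>\<^bsub>A\<^esub> h)" if "a \<in> S" "b \<in> S" for a b
    using assms(3) that by (induction h rule: fin_supp_induct) (simp_all add: bilinear 1)
  have 3: "(basis_elt a \<otimes>\<^bsub>A\<^esub> g) \<otimes>\<^bsub>A\<^esub> h =
      basis_elt a \<otimes>\<^bsub>A\<^esub> (g \<otimes>\<^bsub>A\<^esub> h)" if "a \<in> S" for a
    using assms(2) that assms(3) by (induction g rule: fin_supp_induct) (simp_all add: bilinear 2)
  show ?thesis
    using assms(1) assms(2,3) by (induction f rule: fin_supp_induct) (simp_all add: bilinear 3)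
qed

lemma mult_one:
  assumes "f \<in> fin_supp S"
  shows "basis_elt u \<otimes>\<^bsub>A\<^esub> f = f" "f \<otimes>\<^bsub>A\<^esub> basis_elt u = f"
  using assms u_in
  by (induction f rule: fin_supp_induct)
     (simp_all add: bilinear mult_basis c_unit_left c_unit_right)

lemma is_ring: "ring A"
proof (rule ringI)
  show "abelian_group A"
  proof (rule abelian_groupI)
    fix f assume "f \<in> carrier A"
    then show "\<exists>g\<in>carrier A. g \<oplus>\<^bsub>A\<^esub> f = \<zero>\<^bsub>A\<^esub>"
      using fin_supp_smult[of f S "-1"] by (intro bexI[of _ "\<lambda>x. -1 * f x"])
        (auto simp: carrier_eq add_eq zero_eq)
  qed (auto simp: carrier_eq add_eq zero_eq fin_supp_add algebra_simps)
  show "Group.monoid A"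
    by (rule monoidI) (auto simp: carrier_eq one_eq u_in mult_closed mult_assoc mult_one)
qed (auto simp: carrier_eq add_eq mult_add_left mult_add_right)

sublocale R: ring A by (rule is_ring)

lemma smult_closed: "f \<in> carrier A \<Longrightarrow> k \<odot>\<^bsub>A\<^esub> f \<in> carrier A"
  by (simp add: carrier_eq smult_eq fin_supp_smult)

lemma smult_mult_left:
  "f \<in> carrier A \<Longrightarrow> g \<in> carrier A \<Longrightarrow> (k \<odot>\<^bsub>A\<^esub> f) \<otimes>\<^bsub>A\<^esub> g = k \<odot>\<^bsub>A\<^esub> (f \<otimes>\<^bsub>A\<^esub> g)"
  by (simp add: carrier_eq smult_eq mult_smult_left)

lemma smult_mult_right:
  "f \<in> carrier A \<Longrightarrow> g \<in> carrier A \<Longrightarrow> f \<otimes>\<^bsub>A\<^esub> (k \<odot>\<^bsub>A\<^esub> g) = k \<odot>\<^bsub>A\<^esub> (f \<otimes>\<^bsub>A\<^esub> g)"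
  by (simp add: carrier_eq smult_eq mult_smult_right)

lemma minus_eq: 
  assumes "f \<in> carrier A" "g \<in> carrier A"
  shows "f \<ominus>\<^bsub>A\<^esub> g = (\<lambda>x. f x - g x)"
proof -
  have g: "(\<lambda>x. -1 * g x) \<in> carrier A"
    using assms by (simp only: carrier_eq fin_supp_smult)
  have "\<ominus>\<^bsub>A\<^esub> g = (\<lambda>x. -1 * g x)"
    by (rule R.minus_equality[OF _ assms(2) g]) (simp add: add_eq zero_eq)
  then show ?thesis by (simp add: a_minus_def add_eq)
qed

end

section \<open>Linear extension to a ring\<close>

text \<open>A \<open>ring_scheme\<close> has no scalar multiplication, so coefficients enter through
  central elements \<open>sc k\<close>. The two instances are \<open>k \<odot> \<one>\<close> in an
  algebra and the integer multiples of \<one> in an arbitrary ring.\<close>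

locale scalars = ring R for R :: "('b, 'm) ring_scheme" (structure) +
  fixes sc :: "'k::comm_ring_1 \<Rightarrow> 'b"
  assumes sc_closed [simp]: "sc k \<in> carrier R"
    and sc_add: "sc (k + l) = sc k \<oplus> sc l"
    and sc_mult: "sc (k * l) = sc k \<otimes> sc l"
    and sc_one: "sc 1 = \<one>"
    and sc_central: "x \<in> carrier R \<Longrightarrow> sc k \<otimes> x = x \<otimes> sc k"
begin

lemma sc_zero [simp]: "sc 0 = \<zero>"
  using sc_add[of 0 0] by (metis add.l_cancel_one' add.right_neutral sc_closed)

end

definition lin_ext ::
  "('b, 'm) ring_scheme \<Rightarrow> ('k::zero \<Rightarrow> 'b) \<Rightarrow> ('x \<Rightarrow> 'b) \<Rightarrow> ('x \<Rightarrow> 'k) \<Rightarrow> 'b" where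
  "lin_ext R sc v f = finsum R (\<lambda>x. sc (f x) \<otimes>\<^bsub>R\<^esub> v x) {x. f x \<noteq> 0}"

context scalars
begin

context
  fixes v :: "'x \<Rightarrow> 'b" and S :: "'x set"
  assumes v_closed: "\<And>a. a \<in> S \<Longrightarrow> v a \<in> carrier R"
begin

lemma lin_ext_superset:
  assumes "f \<in> fin_supp S" "finite F" "{x. f x \<noteq> 0} \<subseteq> F" "F \<subseteq> S"
  shows "lin_ext R sc v f = finsum R (\<lambda>x. sc (f x) \<otimes> v x) F"
  unfolding lin_ext_def using assms v_closed
  by (intro add.finprod_mono_neutral_cong_left) (auto simp: l_null)

lemma lin_ext_closed: "f \<in> fin_supp S \<Longrightarrow> lin_ext R sc v f \<in> carrier R"
  unfolding lin_ext_def using v_closed by (intro finsum_closed) (auto simp: fin_supp_def)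

lemma lin_ext_zero: "lin_ext R sc v (\<lambda>_. 0) = \<zero>"
  by (simp add: lin_ext_def)

lemma lin_ext_basis: "a \<in> S \<Longrightarrow> lin_ext R sc v (basis_elt a) = v a"
  unfolding lin_ext_def using v_closed
  by (simp add: support_basis_elt) (simp add: basis_elt_def sc_one)

lemma lin_ext_add:
  assumes "f \<in> fin_supp S" "g \<in> fin_supp S"
  shows "lin_ext R sc v (\<lambda>x. f x + g x) = lin_ext R sc v f \<oplus> lin_ext R sc v g"
proof -
  let ?F = "{x. f x \<noteq> 0} \<union> {x. g x \<noteq> 0}"
  have F: "finite ?F" "?F \<subseteq> S" using assms by (auto simp: fin_supp_def)
  then have v: "v x \<in> carrier R" if "x \<in> ?F" for x using that v_closed by blast
  have "lin_ext R sc v (\<lambda>x. f x + g x) = finsum R (\<lambda>x. sc (f x + g x) \<otimes> v x) ?F"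
    using F fin_supp_add[OF assms] by (intro lin_ext_superset) auto
  also have "\<dots> = finsum R (\<lambda>x. sc (f x) \<otimes> v x \<oplus> sc (g x) \<otimes> v x) ?F"
    using v by (intro finsum_cong') (auto simp: sc_add l_distr)
  also have "\<dots> = finsum R (\<lambda>x. sc (f x) \<otimes> v x) ?F \<oplus> finsum R (\<lambda>x. sc (g x) \<otimes> v x) ?F"
    using v by (intro finsum_addf) auto
  also have "\<dots> = lin_ext R sc v f \<oplus> lin_ext R sc v g"
    using F assms by (subst (1 2) lin_ext_superset[where F = ?F]) auto
  finally show ?thesis .
qed

lemma lin_ext_smult:
  assumes "f \<in> fin_supp S"
  shows "lin_ext R sc v (\<lambda>x. k * f x) = sc k \<otimes> lin_ext R sc v f"
proof -
  let ?F = "{x. f x \<noteq> 0}"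
  have F: "finite ?F" "?F \<subseteq> S" using assms by (auto simp: fin_supp_def)
  then have v: "v x \<in> carrier R" if "x \<in> ?F" for x using that v_closed by blast
  have "lin_ext R sc v (\<lambda>x. k * f x) = finsum R (\<lambda>x. sc (k * f x) \<otimes> v x) ?F"
    using F fin_supp_smult[OF assms] by (intro lin_ext_superset) auto
  also have "\<dots> = finsum R (\<lambda>x. sc k \<otimes> (sc (f x) \<otimes> v x)) ?F"
    using v by (intro finsum_cong') (auto simp: sc_mult m_assoc)
  also have "\<dots> = sc k \<otimes> lin_ext R sc v f"
    unfolding lin_ext_def using v F by (subst finsum_rdistr) auto
  finally show ?thesis .
qed

lemmas lin_ext_simps = lin_ext_zero lin_ext_basis lin_ext_add lin_ext_smult lin_ext_closed

end

end

text \<open>A ring homomorphism out of \<open>A\<close> is determined by where it sends basis elements.\<close>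

lemma (in fs_algebra) lin_ext_hom:
  assumes R: "scalars R sc" and v: "\<And>a. a \<in> S \<Longrightarrow> v a \<in> carrier R" and one: "v u = \<one>\<^bsub>R\<^esub>"
    and mult: "\<And>a b. a \<in> S \<Longrightarrow> b \<in> S \<Longrightarrow> lin_ext R sc v (c a b) = v a \<otimes>\<^bsub>R\<^esub> v b"
  shows "lin_ext R sc v \<in> ring_hom A R"
proof (rule ring_hom_memI)
  interpret T: scalars R sc by (rule R)
  note simps = T.lin_ext_simps[OF v]
  have 1: "lin_ext R sc v (basis_elt a \<otimes>\<^bsub>A\<^esub> g) = v a \<otimes>\<^bsub>R\<^esub> lin_ext R sc v g"
    if "a \<in> S" "g \<in> fin_supp S" for a g
    using that(2,1)
  proof (induction g rule: fin_supp_induct)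
    case zero
    then show ?case by (simp add: bilinear simps v)
  next
    case (add k b g)
    \<comment> \<open>Centrality of \<open>sc k\<close> moves the coefficient past
      \<open>v a\<close>; the target may be non-commutative.\<close>
    have "sc k \<otimes>\<^bsub>R\<^esub> (v a \<otimes>\<^bsub>R\<^esub> v b) = v a \<otimes>\<^bsub>R\<^esub> (sc k \<otimes>\<^bsub>R\<^esub> v b)"
      using add v by (simp add: T.m_assoc[symmetric]) (simp add: T.sc_central)
    then show ?case
      using add by (simp add: bilinear simps mult mult_basis c_fin_supp v T.r_distr)
  qed
  show "lin_ext R sc v (f \<otimes>\<^bsub>A\<^esub> g) = lin_ext R sc v f \<otimes>\<^bsub>R\<^esub> lin_ext R sc v g"
    if "f \<in> carrier A" "g \<in> carrier A" for f g
    using that(1) that unfolding carrier_eq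
    by (induction f rule: fin_supp_induct)
       (simp_all add: bilinear simps 1 v T.l_distr T.m_assoc)
qed (auto simp: carrier_eq one_eq add_eq u_in v one scalars.lin_ext_simps[OF R v])

lemma (in fs_algebra) scalars_smult_one: "scalars A (\<lambda>k. k \<odot>\<^bsub>A\<^esub> \<one>\<^bsub>A\<^esub>)"
  by unfold_locales
     (auto simp: carrier_eq smult_eq one_eq add_eq bilinear mult_one u_in algebra_simps)

lemma (in fs_algebra) scalar_mult:
  "f \<in> carrier A \<Longrightarrow> (k \<odot>\<^bsub>A\<^esub> \<one>\<^bsub>A\<^esub>) \<otimes>\<^bsub>A\<^esub> f = k \<odot>\<^bsub>A\<^esub> f"
  using smult_mult_left[OF R.one_closed] by simp

lemma (in ring) scalars_int: "scalars R (\<lambda>k::int. [k] \<cdot>\<^bsub>R\<^esub> \<one>)"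
proof
  fix k l :: int
  show "[(k + l)] \<cdot>\<^bsub>R\<^esub> \<one> = [k] \<cdot>\<^bsub>R\<^esub> \<one> \<oplus> [l] \<cdot>\<^bsub>R\<^esub> \<one>" by (simp add: add.int_pow_mult)
  show "[(k * l)] \<cdot>\<^bsub>R\<^esub> \<one> = [k] \<cdot>\<^bsub>R\<^esub> \<one> \<otimes> [l] \<cdot>\<^bsub>R\<^esub> \<one>"
    by (simp add: add_pow_ldistr_int add.int_pow_pow mult.commute)
  show "[k] \<cdot>\<^bsub>R\<^esub> \<one> \<otimes> x = x \<otimes> [k] \<cdot>\<^bsub>R\<^esub> \<one>" if "x \<in> carrier R" for x
    using that by (simp add: add_pow_ldistr_int add_pow_rdistr_int)
qed auto

lemma (in ring) scalar_int_mult: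
  "x \<in> carrier R \<Longrightarrow> ([(k::int)] \<cdot>\<^bsub>R\<^esub> \<one>) \<otimes> x = [k] \<cdot>\<^bsub>R\<^esub> x"
  by (simp add: add_pow_ldistr_int)

text \<open>Integer scalars act in two ways, by \<open>\<odot>\<close> in a module and by repeated
  addition in a ring; additivity makes them correspond. With \<open>h = id\<close> this identifies
  the two inside \<open>A\<close>.\<close>

lemma additive_int_smult:
  fixes A :: "(int, 'x \<Rightarrow> int) module"
  assumes A: "fs_algebra A S c u" and R: "ring R" and h: "h \<in> ring_hom A R" and f: "f \<in> carrier A"
  shows "h (k \<odot>\<^bsub>A\<^esub> f) = [k] \<cdot>\<^bsub>R\<^esub> h f"
proof -
  interpret A: fs_algebra A S c u by (rule A)
  interpret R: ring R by (rule R)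
  note [simp] = ring_hom_closed[OF h] f A.smult_closed
  have z: "h \<zero>\<^bsub>A\<^esub> = \<zero>\<^bsub>R\<^esub>" using ring_hom_zero[OF h A.is_ring R] .
  have "h (\<ominus>\<^bsub>A\<^esub> f) \<oplus>\<^bsub>R\<^esub> h f = \<zero>\<^bsub>R\<^esub>"
    using ring_hom_add[OF h, of "\<ominus>\<^bsub>A\<^esub> f" f, symmetric] by (simp add: A.R.l_neg z)
  then have m: "h (\<ominus>\<^bsub>A\<^esub> f) = \<ominus>\<^bsub>R\<^esub> h f"
    by (intro R.minus_equality[symmetric]) auto
  have p: "(k + 1) \<odot>\<^bsub>A\<^esub> f = k \<odot>\<^bsub>A\<^esub> f \<oplus>\<^bsub>A\<^esub> f" "(k - 1) \<odot>\<^bsub>A\<^esub> f = k \<odot>\<^bsub>A\<^esub> f \<ominus>\<^bsub>A\<^esub> f" for k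
    using A.minus_eq[OF A.smult_closed[OF f, of k] f] by (auto simp: A.smult_eq A.add_eq algebra_simps)
  show ?thesis
  proof (induction k rule: int_induct[where k = 0])
    case base
    show ?case using z by (simp add: A.smult_eq A.zero_eq add_pow_int_ge)
  next
    case (step1 i)
    then show ?case
      using ring_hom_add[OF h] by (simp add: p R.add.int_pow_mult R.add.int_pow_1)
  next
    case (step2 i)
    have "h ((i - 1) \<odot>\<^bsub>A\<^esub> f) = h (i \<odot>\<^bsub>A\<^esub> f) \<oplus>\<^bsub>R\<^esub> h (\<ominus>\<^bsub>A\<^esub> f)"
      unfolding p a_minus_def by (rule ring_hom_add[OF h]) auto
    then show ?case using step2 m
      by (simp add: R.add.int_pow_diff R.add.int_pow_1)
  qed
qed

section \<open>Monoid algebras and free rings\<close>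

text \<open>The defining sum runs over the pairs with product \<open>x\<close>; moving this
  condition into the factor \<open>basis_elt (a \<otimes> b) x\<close> turns it into a sum over a
  full rectangle.\<close>

lemma (in monoid) monoid_algebra_fs_algebra:
  "fs_algebra (monoid_algebra G :: ('k::comm_ring_1, 'a \<Rightarrow> 'k) module) (carrier G)
     (\<lambda>a b. basis_elt (a \<otimes> b)) \<one>"
proof
  fix f g :: "'a \<Rightarrow> 'k"
  assume f: "f \<in> fin_supp (carrier G)" and g: "g \<in> fin_supp (carrier G)"
  show "f \<otimes>\<^bsub>monoid_algebra G\<^esub> g =
      (\<lambda>x. \<Sum>a | f a \<noteq> 0. \<Sum>b | g b \<noteq> 0. f a * g b * basis_elt (a \<otimes> b) x)"
  proof
    fix x
    let ?T = "{a. f a \<noteq> 0} \<times> {b. g b \<noteq> 0}"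
    have "(\<Sum>a | f a \<noteq> 0. \<Sum>b | g b \<noteq> 0. f a * g b * basis_elt (a \<otimes> b) x) =
        (\<Sum>(a, b)\<in>?T. f a * g b * basis_elt (a \<otimes> b) x)"
      by (rule sum.cartesian_product)
    also have "\<dots> = (\<Sum>(a, b) | f a \<noteq> 0 \<and> g b \<noteq> 0 \<and> a \<otimes> b = x. f a * g b)"
      using f g by (intro sum.mono_neutral_cong_right) (auto simp: fin_supp_def basis_elt_def split: if_splits)
    finally show "(f \<otimes>\<^bsub>monoid_algebra G\<^esub> g) x =
        (\<Sum>a | f a \<noteq> 0. \<Sum>b | g b \<noteq> 0. f a * g b * basis_elt (a \<otimes> b) x)"
      by (simp add: monoid_algebra_def)
  qed
qed (auto simp: monoid_algebra_def support_basis_elt m_assoc)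

lemma free_monoid_is_monoid: "Group.monoid (free_monoid L)"
  by (rule monoidI) (auto simp: free_monoid_def)

lemma free_ring_fs_algebra:
  "fs_algebra (free_ring L) (lists L) (\<lambda>xs ys. basis_elt (xs @ ys)) []"
  using monoid.monoid_algebra_fs_algebra[OF free_monoid_is_monoid[of L]]
  by (simp add: free_ring_def free_monoid_def)

lemma word_prod_Nil [simp]: "word_prod M [] = \<one>\<^bsub>M\<^esub>"
  and word_prod_Cons [simp]: "word_prod M (x # xs) = x \<otimes>\<^bsub>M\<^esub> word_prod M xs"
  by (simp_all add: word_prod_def)

lemma (in monoid) word_prod_closed: "set xs \<subseteq> carrier G \<Longrightarrow> word_prod G xs \<in> carrier G"
  by (induction xs) auto

lemma (in monoid) word_prod_append:
  "set xs \<subseteq> carrier G \<Longrightarrow> set ys \<subseteq> carrier G \<Longrightarrow>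
   word_prod G (xs @ ys) = word_prod G xs \<otimes> word_prod G ys"
  by (induction xs) (auto simp: m_assoc word_prod_closed)

lemma word_prod_map_hom:
  assumes h: "h \<in> hom M M'" and one: "h \<one>\<^bsub>M\<^esub> = \<one>\<^bsub>M'\<^esub>" and M: "Group.monoid M" and xs: "set xs \<subseteq> carrier M"
  shows "h (word_prod M xs) = word_prod M' (map h xs)"
  using xs by (induction xs)
    (auto simp: one hom_mult[OF h] monoid.word_prod_closed[OF M])

lemma (in ring) free_ring_eval_lin_ext:
  assumes "gen ` L \<subseteq> carrier R" "f \<in> carrier (free_ring L)"
  shows "free_ring_eval R gen f =
    lin_ext R (\<lambda>k. [k] \<cdot>\<^bsub>R\<^esub> \<one>) (\<lambda>xs. word_prod R (map gen xs)) f"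
  unfolding free_ring_eval_def lin_ext_def
proof (rule finsum_cong')
  interpret F: fs_algebra "free_ring L" "lists L" "\<lambda>xs ys. basis_elt (xs @ ys)" "[]"
    by (rule free_ring_fs_algebra)
  have w: "word_prod R (map gen xs) \<in> carrier R" if "f xs \<noteq> 0" for xs
    using that assms(1) fin_supp_outside[OF assms(2)[unfolded F.carrier_eq]]
    by (intro word_prod_closed) auto
  then show "(\<lambda>xs. ([f xs] \<cdot>\<^bsub>R\<^esub> \<one>) \<otimes> word_prod R (map gen xs)) \<in> {xs. f xs \<noteq> 0} \<rightarrow> carrier R"
    by auto
  show "[f xs] \<cdot>\<^bsub>R\<^esub> word_prod R (map gen xs) = ([f xs] \<cdot>\<^bsub>R\<^esub> \<one>) \<otimes> word_prod R (map gen xs)"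
    if "xs \<in> {xs. f xs \<noteq> 0}" for xs
    using that w by (simp add: scalar_int_mult)
qed simp

lemma (in ring) free_ring_eval_hom:
  assumes gen: "gen ` L \<subseteq> carrier R"
  shows "free_ring_eval R gen \<in> ring_hom (free_ring L) R"
    and "x \<in> L \<Longrightarrow> free_ring_eval R gen (letter x) = gen x"
proof -
  interpret F: fs_algebra "free_ring L" "lists L" "\<lambda>xs ys. basis_elt (xs @ ys)" "[]"
    by (rule free_ring_fs_algebra)
  let ?h = "lin_ext R (\<lambda>k::int. [k] \<cdot>\<^bsub>R\<^esub> \<one>) (\<lambda>xs. word_prod R (map gen xs))"
  have w: "word_prod R (map gen xs) \<in> carrier R" if "xs \<in> lists L" for xs
    using that gen by (intro word_prod_closed) auto
  note b = scalars.lin_ext_basis[OF scalars_int, of "lists L" "\<lambda>xs. word_prod R (map gen xs)", OF w]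
  have "?h \<in> ring_hom (free_ring L) R"
  proof (rule F.lin_ext_hom[OF scalars_int])
    show "?h (basis_elt (xs @ ys)) = word_prod R (map gen xs) \<otimes> word_prod R (map gen ys)"
      if "xs \<in> lists L" "ys \<in> lists L" for xs ys
      using that gen by (subst b) (auto intro!: word_prod_append simp: image_subset_iff)
  qed (use w in auto)
  then show "free_ring_eval R gen \<in> ring_hom (free_ring L) R"
    using free_ring_eval_lin_ext[OF gen]
    by (auto simp: ring_hom_def F.R.a_closed F.R.m_closed)
  show "free_ring_eval R gen (letter x) = gen x" if "x \<in> L"
    using that gen b[of "[x]"] by (subst free_ring_eval_lin_ext[OF gen])
      (auto simp: letter_def F.carrier_eq image_subset_iff)
qed

lemma letter_in_free_ring: "x \<in> L \<Longrightarrow> letter x \<in> carrier (free_ring L)"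
  by (simp add: letter_def fs_algebra.carrier_eq[OF free_ring_fs_algebra])

text \<open>Words are products of letters, and additive maps respect integer coefficients
  automatically, so agreement on letters propagates to the whole free ring.\<close>

lemma free_ring_hom_unique:
  assumes R: "ring R" and h: "h \<in> ring_hom (free_ring L) R" "h' \<in> ring_hom (free_ring L) R"
    and eq: "\<And>x. x \<in> L \<Longrightarrow> h (letter x) = h' (letter x)" and f: "f \<in> carrier (free_ring L)"
  shows "h f = h' f"
proof -
  interpret F: fs_algebra "free_ring L" "lists L" "\<lambda>xs ys. basis_elt (xs @ ys)" "[]"
    by (rule free_ring_fs_algebra)
  have b: "h (basis_elt xs) = h' (basis_elt xs)" if "xs \<in> lists L" for xs
    using that
  proof (induction xs)
    case Nil
    then show ?case using ring_hom_one[OF h(1)] ring_hom_one[OF h(2)] by (simp add: F.one_eq)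
  next
    case (Cons x xs)
    then have "basis_elt (x # xs) = letter x \<otimes>\<^bsub>free_ring L\<^esub> basis_elt xs"
      by (simp add: letter_def F.mult_basis)
    then show ?case using Cons eq ring_hom_mult[OF h(1)] ring_hom_mult[OF h(2)]
      by (simp add: letter_in_free_ring[of x L, unfolded F.carrier_eq] F.carrier_eq)
  qed
  show ?thesis using f unfolding F.carrier_eq
  proof (induction f rule: fin_supp_induct)
    case zero
    then show ?case
      using ring_hom_zero[OF h(1) F.is_ring R] ring_hom_zero[OF h(2) F.is_ring R]
      by (simp add: F.zero_eq)
  next
    case (add k a f)
    have "h (k \<odot>\<^bsub>free_ring L\<^esub> basis_elt a \<oplus>\<^bsub>free_ring L\<^esub> f) = h' (k \<odot>\<^bsub>free_ring L\<^esub> basis_elt a \<oplus>\<^bsub>free_ring L\<^esub> f)"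
      using add b ring_hom_add[OF h(1)] ring_hom_add[OF h(2)]
        additive_int_smult[OF free_ring_fs_algebra R h(1)] additive_int_smult[OF free_ring_fs_algebra R h(2)]
      by (simp add: F.carrier_eq F.smult_closed[unfolded F.carrier_eq])
    then show ?case by (simp add: F.smult_eq F.add_eq)
  qed
qed

text \<open>A presentation amounts to a section of the evaluation map modulo the ideal of relations.\<close>

lemma ring_presentationI:
  assumes R: "ring R" and gen: "gen ` L \<subseteq> carrier R" and rels: "rels \<subseteq> carrier (free_ring L)"
    and rel0: "\<And>f. f \<in> rels \<Longrightarrow> free_ring_eval R gen f = \<zero>\<^bsub>R\<^esub>"
    and surj: "free_ring_eval R gen ` carrier (free_ring L) = carrier R"
    and inverse: "\<psi> \<in> ring_hom R (free_ring L Quot Idl\<^bsub>free_ring L\<^esub> rels)"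
      "\<And>x. x \<in> L \<Longrightarrow> \<psi> (gen x) = Idl\<^bsub>free_ring L\<^esub> rels +>\<^bsub>free_ring L\<^esub> letter x"
  shows "ring_presentation R L gen rels"
proof -
  interpret R: ring R by (rule R)
  interpret F: fs_algebra "free_ring L" "lists L" "\<lambda>xs ys. basis_elt (xs @ ys)" "[]"
    by (rule free_ring_fs_algebra)
  let ?F = "free_ring L" and ?ev = "free_ring_eval R gen"
  let ?I = "Idl\<^bsub>?F\<^esub> rels"
  note ev = R.free_ring_eval_hom[OF gen]
  interpret ev: ring_hom_ring ?F R ?ev
    by (rule ring_hom_ringI2[OF F.is_ring R ev(1)])
  interpret I: ideal ?I ?F by (rule F.R.genideal_ideal[OF rels])
  have Q: "ring (?F Quot ?I)" by (rule I.quotient_is_ring)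
  have "?I \<subseteq> a_kernel ?F R ?ev"
  proof (rule F.R.genideal_minimal[OF ev.kernel_is_ideal])
    show "rels \<subseteq> a_kernel ?F R ?ev"
      unfolding a_kernel_def' using rel0 rels by blast
  qed
  moreover have "f \<in> ?I" if f: "f \<in> a_kernel ?F R ?ev" for f
  proof -
    have f': "f \<in> carrier ?F" "?ev f = \<zero>\<^bsub>R\<^esub>" using f unfolding a_kernel_def' by blast+
    \<comment> \<open>Both maps from the free ring to the quotient send a letter to its class. So
      \<psi> undoes evaluation modulo the ideal, and an element evaluating to zero has zero
      class.\<close>
    have "(\<psi> \<circ> ?ev) f = ((+>\<^bsub>?F\<^esub>) ?I) f"
    proof (rule free_ring_hom_unique[OF Q _ I.rcos_ring_hom _ f'(1)])
      show "\<psi> \<circ> ?ev \<in> ring_hom ?F (?F Quot ?I)"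
        using ev(1) inverse(1) by (rule ring_hom_trans)
    qed (simp add: ev inverse)
    moreover have "\<psi> \<zero>\<^bsub>R\<^esub> = ?I"
      using ring_hom_zero[OF inverse(1) R Q] by (simp add: FactRing_def)
    ultimately have "?I +>\<^bsub>?F\<^esub> f = ?I" by (simp only: o_apply f')
    then show ?thesis using I.a_rcos_self f'(1) by blast
  qed
  ultimately show ?thesis
    unfolding ring_presentation_def using R gen rels surj by blast
qed

section \<open>Hecke algebras\<close>

locale group_subgroup = group G for G :: "('g, 'm) monoid_scheme" (structure) +
  fixes H :: "'g set"
  assumes sub: "subgroup H G"
begin

lemma H_closed [simp]: "h \<in> H \<Longrightarrow> h \<in> carrier G"
  by (rule subgroup.mem_carrier[OF sub])

lemma H_mult [simp]: "h \<in> H \<Longrightarrow> k \<in> H \<Longrightarrow> h \<otimes> k \<in> H"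
  by (rule subgroup.m_closed[OF sub])

lemma H_inv [simp]: "h \<in> H \<Longrightarrow> inv h \<in> H"
  by (rule subgroup.m_inv_closed[OF sub])

lemma H_one [simp]: "\<one> \<in> H"
  by (rule subgroup.one_closed[OF sub])

lemma mem_dcoset: "x \<in> dcoset G H g \<longleftrightarrow> (\<exists>h\<in>H. \<exists>k\<in>H. x = h \<otimes> g \<otimes> k)"
  by (auto simp: dcoset_def set_mult_def r_coset_def)

lemma mem_dcoset_self: "g \<in> carrier G \<Longrightarrow> g \<in> dcoset G H g"
  unfolding mem_dcoset by (intro bexI[of _ \<one>]) auto

lemma dcoset_sub_eq:
  assumes g: "g \<in> carrier G" and h: "h \<in> H" "k \<in> H"
  shows "dcoset G H (h \<otimes> g \<otimes> k) \<subseteq> dcoset G H g"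
proof
  fix x assume "x \<in> dcoset G H (h \<otimes> g \<otimes> k)"
  then obtain h' k' where "h' \<in> H" "k' \<in> H" "x = h' \<otimes> (h \<otimes> g \<otimes> k) \<otimes> k'"
    unfolding mem_dcoset by blast
  then have "x = (h' \<otimes> h) \<otimes> g \<otimes> (k \<otimes> k')" "h' \<otimes> h \<in> H" "k \<otimes> k' \<in> H"
    using g h by (auto simp: m_assoc)
  then show "x \<in> dcoset G H g" unfolding mem_dcoset by blast
qed

lemma dcoset_eq:
  assumes g: "g \<in> carrier G" and x: "x \<in> dcoset G H g"
  shows "dcoset G H x = dcoset G H g"
proof -
  obtain h k where hk: "h \<in> H" "k \<in> H" "x = h \<otimes> g \<otimes> k" using x unfolding mem_dcoset by blast
  have "g = inv h \<otimes> x \<otimes> inv k"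
    using hk g by (simp add: m_assoc inv_solve_left inv_solve_right')
  then show ?thesis
    using dcoset_sub_eq[of g h k] dcoset_sub_eq[of x "inv h" "inv k"] hk g
    by auto
qed

lemma rep_in: "x \<in> C \<Longrightarrow> rep C \<in> C"
  unfolding rep_def by (rule someI)

lemma dcosets_props:
  assumes "D \<in> dcosets G H"
  shows "rep D \<in> D" "D \<subseteq> carrier G" "x \<in> D \<Longrightarrow> dcoset G H x = D"
proof -
  obtain g where g: "g \<in> carrier G" "D = dcoset G H g" using assms unfolding dcosets_def by blast
  show "rep D \<in> D" using rep_in[OF mem_dcoset_self[OF g(1)]] g(2) by simp
  show "D \<subseteq> carrier G" using g by (auto simp: mem_dcoset)
  show "x \<in> D \<Longrightarrow> dcoset G H x = D" using dcoset_eq[OF g(1)] g(2) by simp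
qed

lemma rep_dcoset_closed [simp]: "D \<in> dcosets G H \<Longrightarrow> rep D \<in> carrier G"
  using dcosets_props(1,2)[of D] by auto

lemma dcoset_in_dcosets: "x \<in> carrier G \<Longrightarrow> dcoset G H x \<in> dcosets G H"
  by (simp add: dcosets_def)

lemma dcosets_mem_iff: 
  "D \<in> dcosets G H \<Longrightarrow> x \<in> carrier G \<Longrightarrow> x \<in> D \<longleftrightarrow> dcoset G H x = D"
  using dcosets_props(3)[of D x] mem_dcoset_self[of x] by auto

lemma dcosets_stable:
  assumes "D \<in> dcosets G H" "x \<in> carrier G" "h \<in> H"
  shows "h \<otimes> x \<in> D \<longleftrightarrow> x \<in> D" "x \<otimes> h \<in> D \<longleftrightarrow> x \<in> D"
proof -
  have "h \<otimes> x \<in> dcoset G H x" "x \<otimes> h \<in> dcoset G H x"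
    unfolding mem_dcoset using assms(2,3) 
    by (intro bexI[of _ h] bexI[of _ \<one>], simp_all, intro bexI[of _ \<one>] bexI[of _ h], simp_all)
  then show "h \<otimes> x \<in> D \<longleftrightarrow> x \<in> D" "x \<otimes> h \<in> D \<longleftrightarrow> x \<in> D"
    using dcoset_eq[OF assms(2), of "h \<otimes> x"] dcoset_eq[OF assms(2), of "x \<otimes> h"] assms
    by (simp_all add: dcosets_mem_iff)
qed

lemma rcosets_rep:
  assumes "C \<in> rcosets H"
  shows "rep C \<in> C" "rep C \<in> carrier G" "H #> rep C = C"
proof -
  obtain x where x: "x \<in> carrier G" "C = H #> x" using assms unfolding RCOSETS_def by blast
  then show 1: "rep C \<in> C" using rep_in[OF rcos_self[OF x(1) sub]] by simp
  then show "rep C \<in> carrier G" using x r_coset_subset_G[OF subgroup.subset[OF sub] x(1)] by auto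
  show "H #> rep C = C" using repr_independence[OF _ x(1) sub, of "rep C"] 1 x by simp
qed

lemma rcos_eq_iff:
  assumes "x \<in> carrier G" "y \<in> carrier G"
  shows "H #> x = H #> y \<longleftrightarrow> x \<otimes> inv y \<in> H"
proof -
  have "H #> x = H #> y \<longleftrightarrow> x \<in> H #> y"
    using repr_independence[OF _ assms(2) sub, of x] rcos_self[OF assms(1) sub] by auto
  also have "\<dots> \<longleftrightarrow> x \<otimes> inv y \<in> H"
    using subgroup.rcos_module[OF sub is_group assms(2,1)] by simp
  finally show ?thesis .
qed

text \<open>A chosen representative is known only up to a left factor from \<open>H\<close>, so
  every property counted over right cosets has to be invariant under such factors.\<close>

lemma rep_rcos: "x \<in> carrier G \<Longrightarrow> \<exists>h\<in>H. rep (H #> x) = h \<otimes> x"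
  using rep_in[OF rcos_self[OF _ sub]] by (auto simp: r_coset_def)

lemma rcos_in_rcosets [simp]: "x \<in> carrier G \<Longrightarrow> H #> x \<in> rcosets H"
  using subgroup.subset[OF sub] by (intro rcosetsI)

lemma rcosets_in_iff:
  assumes "D \<in> dcosets G H"
  shows "C \<in> rcosets_in G H D \<longleftrightarrow> C \<in> rcosets H \<and> rep C \<in> D"
proof
  assume "C \<in> rcosets_in G H D"
  then show "C \<in> rcosets H \<and> rep C \<in> D" using rcosets_rep by (auto simp: rcosets_in_def)
next
  assume C: "C \<in> rcosets H \<and> rep C \<in> D"
  have "C \<subseteq> D"
  proof
    fix x assume "x \<in> C"
    then obtain h where "h \<in> H" "x = h \<otimes> rep C"
      using rcosets_rep(3)[of C] C by (auto simp: r_coset_def)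
    then show "x \<in> D" using C assms rcosets_rep(2)[of C] by (simp add: dcosets_stable)
  qed
  then show "C \<in> rcosets_in G H D" using C by (simp add: rcosets_in_def)
qed

lemma rcosets_in_own: "C \<in> rcosets H \<Longrightarrow> C \<in> rcosets_in G H (dcoset G H (rep C))"
  using rcosets_rep(2)[of C] by (simp add: rcosets_in_iff dcoset_in_dcosets mem_dcoset_self)

end

locale hecke = group_subgroup G H for G :: "('g, 'm) monoid_scheme" (structure) and H +
  assumes fin: "\<And>g. g \<in> carrier G \<Longrightarrow> finite (rcosets_in G H (dcoset G H g))"
begin

lemma finite_rcosets_in: "D \<in> dcosets G H \<Longrightarrow> finite (rcosets_in G H D)"
  using fin by (auto simp: dcosets_def)

text \<open>Substitution \<open>c \<mapsto> c z\<close> in a count of right cosets \<open>H c\<close>.\<close>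

lemma card_rcosets_shift:
  assumes z: "z \<in> carrier G" and P: "\<And>h c. h \<in> H \<Longrightarrow> c \<in> carrier G \<Longrightarrow> P (h \<otimes> c) = P c"
  shows "card {C \<in> rcosets H. P (rep C \<otimes> z)} = card {C \<in> rcosets H. P (rep C)}"
proof (rule bij_betw_same_card[of "\<lambda>C. C #> z"])
  have rep: "P (rep (H #> x)) = P x" if "x \<in> carrier G" for x
    using rep_rcos[OF that] P that by auto
  have tr: "C #> z = H #> (rep C \<otimes> z)" if "C \<in> rcosets H" for C
    using rcosets_rep[OF that] coset_mult_assoc[of H "rep C" z] subgroup.subset[OF sub] z by simp
  have *: "(C #> z) #> inv z = C" "(C #> inv z) #> z = C" if "C \<in> rcosets H" for C
  proof -
    have "C \<subseteq> carrier G" by (rule subgroup.rcosets_carrier[OF sub is_group that])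
    then show "(C #> z) #> inv z = C" "(C #> inv z) #> z = C"
      using z by (simp_all add: coset_mult_assoc)
  qed
  show "bij_betw (\<lambda>C. C #> z) {C \<in> rcosets H. P (rep C \<otimes> z)} {C \<in> rcosets H. P (rep C)}"
  proof (rule bij_betwI[where g = "\<lambda>C. C #> inv z"])
    show "(\<lambda>C. C #> z) \<in> {C \<in> rcosets H. P (rep C \<otimes> z)} \<rightarrow> {C \<in> rcosets H. P (rep C)}"
      using rcosets_rep z by (auto simp: tr rep)
    show "(\<lambda>C. C #> inv z) \<in> {C \<in> rcosets H. P (rep C)} \<rightarrow> {C \<in> rcosets H. P (rep C \<otimes> z)}"
    proof
      fix C assume "C \<in> {C \<in> rcosets H. P (rep C)}"
      then have C: "C \<in> rcosets H" "P (rep C)" by auto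
      have cc: "C #> inv z = H #> (rep C \<otimes> inv z)"
        using rcosets_rep[OF C(1)] coset_mult_assoc[of H "rep C" "inv z"] subgroup.subset[OF sub] z by simp
      obtain h where h: "h \<in> H" "rep (H #> (rep C \<otimes> inv z)) = h \<otimes> (rep C \<otimes> inv z)"
        using rep_rcos[of "rep C \<otimes> inv z"] rcosets_rep(2)[OF C(1)] z by auto
      have "h \<otimes> (rep C \<otimes> inv z) \<otimes> z = h \<otimes> rep C"
        using h z rcosets_rep(2)[OF C(1)] by (simp add: m_assoc)
      then show "C #> inv z \<in> {C \<in> rcosets H. P (rep C \<otimes> z)}"
        using cc h C P z rcosets_rep(2)[OF C(1)] by simp
    qed
  qed (use * in auto)
qed

text \<open>Once \<open>x\<close> and the second coset \<open>H c\<close> are fixed, the first coset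
  can only be \<open>H x c\<^sup>-\<^sup>1\<close>. Pairs are thus counted by their second
  component, and the resulting condition is the same for all representatives of
  \<open>H c\<close>.\<close>

lemma hecke_coeff_eq:
  assumes D: "D \<in> dcosets G H" and D': "D' \<in> dcosets G H" and x: "x \<in> carrier G"
  shows "hecke_coeff G H D D' x = card {C \<in> rcosets H. rep C \<in> D' \<and> x \<otimes> inv (rep C) \<in> D}"
  unfolding hecke_coeff_def
proof (rule bij_betw_same_card[of snd])
  let ?S = "{(C, C'). C \<in> rcosets_in G H D \<and> C' \<in> rcosets_in G H D' \<and> rep C \<otimes> rep C' \<in> H #> x}"
  have key: "C = H #> (x \<otimes> inv (rep C')) \<and> x \<otimes> inv (rep C') \<in> D" if CC: "(C, C') \<in> ?S" for C C'
  proof -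
    have C: "C \<in> rcosets H" "rep C \<in> D" "C' \<in> rcosets H" using that D D' by (auto simp: rcosets_in_iff)
    note c = rcosets_rep[OF C(1)] rcosets_rep[OF C(3)]
    obtain h where h: "h \<in> H" "rep C \<otimes> rep C' = h \<otimes> x" using CC by (auto simp: r_coset_def)
    have "rep C = (rep C \<otimes> rep C') \<otimes> inv (rep C')"
      using c by (simp add: m_assoc)
    then have "rep C = h \<otimes> (x \<otimes> inv (rep C'))"
      using h c x by (simp add: m_assoc)
    then have 1: "rep C \<in> H #> (x \<otimes> inv (rep C'))" "x \<otimes> inv (rep C') \<in> D"
      using h D C(2) c x by (auto simp: r_coset_def dcosets_stable)
    moreover have "H #> (x \<otimes> inv (rep C')) = H #> rep C"
      using repr_independence[OF 1(1) _ sub] x c by simp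
    ultimately show ?thesis using c by simp
  qed
  show "bij_betw snd ?S {C \<in> rcosets H. rep C \<in> D' \<and> x \<otimes> inv (rep C) \<in> D}"
    unfolding bij_betw_def
  proof
    show "inj_on snd ?S"
      using key by (auto simp: inj_on_def)
    show "snd ` ?S = {C \<in> rcosets H. rep C \<in> D' \<and> x \<otimes> inv (rep C) \<in> D}"
    proof
      show "snd ` ?S \<subseteq> {C \<in> rcosets H. rep C \<in> D' \<and> x \<otimes> inv (rep C) \<in> D}"
        using key D' by (auto simp: rcosets_in_iff)
      show "{C \<in> rcosets H. rep C \<in> D' \<and> x \<otimes> inv (rep C) \<in> D} \<subseteq> snd ` ?S"
      proof
        fix C' assume "C' \<in> {C \<in> rcosets H. rep C \<in> D' \<and> x \<otimes> inv (rep C) \<in> D}"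
        then have C': "C' \<in> rcosets H" "rep C' \<in> D'" "x \<otimes> inv (rep C') \<in> D" by auto
        note c = rcosets_rep[OF C'(1)]
        let ?C = "H #> (x \<otimes> inv (rep C'))"
        obtain h where h: "h \<in> H" "rep ?C = h \<otimes> (x \<otimes> inv (rep C'))"
          using rep_rcos[of "x \<otimes> inv (rep C')"] c x by auto
        have "rep ?C \<otimes> rep C' = h \<otimes> x" using h c x by (simp add: m_assoc)
        then have "rep ?C \<otimes> rep C' \<in> H #> x" using h by (auto simp: r_coset_def)
        moreover have "rep ?C \<in> D" using h c x C' D by (simp add: dcosets_stable)
        ultimately have "(?C, C') \<in> ?S" using C' c x D D' by (simp add: rcosets_in_iff)
        then show "C' \<in> snd ` ?S" by force
      qed
    qed
  qed
qed

lemma stable_mult_inv: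
  assumes "D \<in> dcosets G H" "x \<in> carrier G" "c \<in> carrier G" "h \<in> H"
  shows "x \<otimes> inv (h \<otimes> c) \<in> D \<longleftrightarrow> x \<otimes> inv c \<in> D"
  using assms dcosets_stable(2)[of D "x \<otimes> inv c" "inv h"]
  by (simp add: inv_mult_group m_assoc)

text \<open>Writing \<open>x = h y k\<close>, the left factor is absorbed by \<open>D\<close>, the
  right factor by the substitution \<open>c \<mapsto> c k\<close>, which preserves
  \<open>D'\<close>. So evaluating at \<open>rep D\<close> in the definition of the product involves
  no real choice.\<close>

lemma hecke_coeff_cong:
  assumes D: "D \<in> dcosets G H" and D': "D' \<in> dcosets G H" and y: "y \<in> carrier G"
    and x: "x \<in> dcoset G H y"
  shows "hecke_coeff G H D D' x = hecke_coeff G H D D' y"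
proof -
  obtain h k where hk: "h \<in> H" "k \<in> H" "x = h \<otimes> y \<otimes> k" using x by (auto simp: mem_dcoset)
  then have xc: "x \<in> carrier G" using y by simp
  have "card {C \<in> rcosets H. rep C \<in> D' \<and> x \<otimes> inv (rep C) \<in> D} =
        card {C \<in> rcosets H. rep C \<otimes> k \<in> D' \<and> x \<otimes> inv (rep C \<otimes> k) \<in> D}"
    using hk(2) xc D D' by (intro card_rcosets_shift[symmetric]) (simp_all add: dcosets_stable stable_mult_inv)
  also have "{C \<in> rcosets H. rep C \<otimes> k \<in> D' \<and> x \<otimes> inv (rep C \<otimes> k) \<in> D} =
      {C \<in> rcosets H. rep C \<in> D' \<and> y \<otimes> inv (rep C) \<in> D}"
  proof (intro Collect_cong conj_cong refl)
    fix C assume C: "C \<in> rcosets H"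
    note c = rcosets_rep[OF C]
    show "rep C \<otimes> k \<in> D' \<longleftrightarrow> rep C \<in> D'" using c hk D' by (simp add: dcosets_stable)
    have "x \<otimes> inv (rep C \<otimes> k) = h \<otimes> (y \<otimes> inv (rep C))"
    proof -
      have "x \<otimes> inv (rep C \<otimes> k) = h \<otimes> (y \<otimes> (k \<otimes> (inv k \<otimes> inv (rep C))))"
        using hk y c by (simp add: inv_mult_group m_assoc)
      also have "k \<otimes> (inv k \<otimes> inv (rep C)) = inv (rep C)"
        using hk c by (simp add: m_assoc[symmetric])
      finally show ?thesis .
    qed
    then show "x \<otimes> inv (rep C \<otimes> k) \<in> D \<longleftrightarrow> y \<otimes> inv (rep C) \<in> D"
      using hk y c D by (simp add: dcosets_stable)
  qed
  finally show ?thesis using D D' y hk by (simp add: hecke_coeff_eq)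
qed

section \<open>Associativity of the Hecke product\<close>

definition support :: "'g set \<Rightarrow> 'g set \<Rightarrow> 'g set set" where
  "support D D' = {U \<in> dcosets G H. hecke_coeff G H D D' (rep U) \<noteq> 0}"

text \<open>A double coset occurring in the product contains some product of representatives, and
  there are only finitely many pairs of these.\<close>

lemma finite_support_coeff:
  assumes D: "D \<in> dcosets G H" and D': "D' \<in> dcosets G H"
  shows "finite (support D D')"
proof (rule finite_subset)
  let ?P = "rcosets_in G H D \<times> rcosets_in G H D'"
  show "finite ((\<lambda>(C, C'). dcoset G H (rep C \<otimes> rep C')) ` ?P)"
    using finite_rcosets_in D D' by simp
  show "support D D' \<subseteq> (\<lambda>(C, C'). dcoset G H (rep C \<otimes> rep C')) ` ?P"
  proof
    fix U assume "U \<in> support D D'"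
    then have U: "U \<in> dcosets G H" "hecke_coeff G H D D' (rep U) \<noteq> 0" by (auto simp: support_def)
    then obtain C C' where C: "(C, C') \<in> ?P" "rep C \<otimes> rep C' \<in> H #> rep U"
      unfolding hecke_coeff_def by (auto simp: card_eq_0_iff)
    have "rep C \<otimes> rep C' \<in> U"
      using C(2) U(1) dcosets_stable(1)[OF U(1)] dcosets_props(1)[OF U(1)] by (auto simp: r_coset_def)
    then have "dcoset G H (rep C \<otimes> rep C') = U" using dcosets_props(3)[OF U(1)] by simp
    then show "U \<in> (\<lambda>(C, C'). dcoset G H (rep C \<otimes> rep C')) ` ?P" using C by force
  qed
qed

text \<open>Sorts right cosets by the double coset containing them. The condition \<open>P\<close>
  carries the constraint from the remaining factor in the proof of associativity and is trivial in
  the degree formula.\<close>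

lemma sum_support_rcosets:
  fixes g :: "'g set \<Rightarrow> nat"
  assumes Y: "finite Y" "Y \<subseteq> dcosets G H"
  shows "(\<Sum>y\<in>Y. g y * card {C \<in> rcosets H. rep C \<in> y \<and> P C}) =
    (\<Sum>C | C \<in> rcosets H \<and> dcoset G H (rep C) \<in> Y \<and> P C. g (dcoset G H (rep C)))"
proof -
  let ?B = "\<lambda>y. {C \<in> rcosets H. rep C \<in> y \<and> P C}"
  have fin: "finite (?B y)" if "y \<in> Y" for y
    using finite_rcosets_in[of y] that Y rcosets_in_iff[of y]
    by (auto intro: finite_subset[of _ "rcosets_in G H y"])
  have d: "dcoset G H (rep C) = y" if "rep C \<in> y" "y \<in> Y" for C y
    using dcosets_props(3)[of y "rep C"] that Y by auto
  have disj: "?B y \<inter> ?B z = {}" if "y \<in> Y" "z \<in> Y" "y \<noteq> z" for y z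
    using d[of _ y] d[of _ z] that by auto
  have "(\<Sum>C\<in>(\<Union>y\<in>Y. ?B y). g (dcoset G H (rep C))) = (\<Sum>y\<in>Y. \<Sum>C\<in>?B y. g (dcoset G H (rep C)))"
    using Y(1) fin disj by (intro sum.UNION_disjoint) auto
  also have "\<dots> = (\<Sum>y\<in>Y. \<Sum>C\<in>?B y. g y)"
    using d by (intro sum.cong refl) auto
  finally have "(\<Sum>y\<in>Y. g y * card (?B y)) = (\<Sum>C\<in>(\<Union>y\<in>Y. ?B y). g (dcoset G H (rep C)))"
    by (simp add: mult.commute)
  also have "(\<Union>y\<in>Y. ?B y) = {C \<in> rcosets H. dcoset G H (rep C) \<in> Y \<and> P C}"
    using d mem_dcoset_self[OF rcosets_rep(2)] by auto
  finally show ?thesis by simp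
qed

lemma hecke_coeff_rep:
  "D \<in> dcosets G H \<Longrightarrow> D' \<in> dcosets G H \<Longrightarrow> x \<in> carrier G \<Longrightarrow>
   hecke_coeff G H D D' (rep (dcoset G H x)) = hecke_coeff G H D D' x"
  using dcosets_props(1)[OF dcoset_in_dcosets] by (intro hecke_coeff_cong) auto

lemma mem_support:
  "D \<in> dcosets G H \<Longrightarrow> D' \<in> dcosets G H \<Longrightarrow> x \<in> carrier G \<Longrightarrow>
   dcoset G H x \<in> support D D' \<longleftrightarrow> hecke_coeff G H D D' x \<noteq> 0"
  by (simp add: support_def dcoset_in_dcosets hecke_coeff_rep)

text \<open>Both bracketings are brought to the same normal form: a sum, over the right cosets
  \<open>H c\<close> in the last factor, of the coefficient of \<open>x c\<^sup>-\<^sup>1\<close> in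
  \<open>a b\<close>. For \<open>(a b) d\<close> this amounts to grouping these cosets by the double
  coset of \<open>x c\<^sup>-\<^sup>1\<close>.\<close>

lemma coeff_mult_left:
  assumes a: "a \<in> dcosets G H" and b: "b \<in> dcosets G H" and d: "d \<in> dcosets G H" and x: "x \<in> carrier G"
  shows "(\<Sum>y\<in>support a b. hecke_coeff G H a b (rep y) * hecke_coeff G H y d x) =
    (\<Sum>C\<in>rcosets_in G H d. hecke_coeff G H a b (x \<otimes> inv (rep C)))"
proof -
  let ?f = "\<lambda>C. dcoset G H (x \<otimes> inv (rep C))"
  have S: "support a b \<subseteq> dcosets G H" by (auto simp: support_def)
  have cl: "x \<otimes> inv (rep C) \<in> carrier G" if "C \<in> rcosets_in G H d" for C
    using that d x rcosets_rep(2) by (simp add: rcosets_in_iff)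
  have "(\<Sum>C\<in>rcosets_in G H d. hecke_coeff G H a b (x \<otimes> inv (rep C))) =
      (\<Sum>C | C \<in> rcosets_in G H d \<and> ?f C \<in> support a b. hecke_coeff G H a b (x \<otimes> inv (rep C)))"
    using finite_rcosets_in[OF d] mem_support[OF a b cl] by (intro sum.mono_neutral_right) auto
  also have "\<dots> = (\<Sum>y\<in>support a b. \<Sum>C | C \<in> {C \<in> rcosets_in G H d. ?f C \<in> support a b} \<and> ?f C = y.
      hecke_coeff G H a b (x \<otimes> inv (rep C)))"
    using finite_rcosets_in[OF d] finite_support_coeff[OF a b]
    by (intro sum.group[symmetric]) auto
  also have "\<dots> = (\<Sum>y\<in>support a b. \<Sum>C | C \<in> rcosets H \<and> rep C \<in> d \<and> x \<otimes> inv (rep C) \<in> y.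
      hecke_coeff G H a b (rep y))"
  proof (intro sum.cong refl)
    fix y assume y: "y \<in> support a b"
    then have y': "y \<in> dcosets G H" using S by blast
    have iff: "x \<otimes> inv (rep C) \<in> y \<longleftrightarrow> ?f C = y" if "C \<in> rcosets_in G H d" for C
      using dcosets_mem_iff[OF y' cl[OF that]] .
    show "{C \<in> {C \<in> rcosets_in G H d. ?f C \<in> support a b}. ?f C = y} =
        {C \<in> rcosets H. rep C \<in> d \<and> x \<otimes> inv (rep C) \<in> y}"
      using y iff rcosets_in_iff[OF d] by auto
    fix C assume "C \<in> {C \<in> rcosets H. rep C \<in> d \<and> x \<otimes> inv (rep C) \<in> y}"
    then show "hecke_coeff G H a b (x \<otimes> inv (rep C)) = hecke_coeff G H a b (rep y)"
      using hecke_coeff_rep[OF a b cl, of C] iff rcosets_in_iff[OF d] by auto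
  qed
  also have "\<dots> = (\<Sum>y\<in>support a b. hecke_coeff G H a b (rep y) * hecke_coeff G H y d x)"
    using d x S by (intro sum.cong refl) (auto simp: hecke_coeff_eq)
  finally show ?thesis by simp
qed

lemma coeff_mult_right:
  assumes a: "a \<in> dcosets G H" and b: "b \<in> dcosets G H" and d: "d \<in> dcosets G H" and x: "x \<in> carrier G"
  shows "(\<Sum>y\<in>support b d. hecke_coeff G H b d (rep y) * hecke_coeff G H a y x) =
    (\<Sum>C\<in>rcosets_in G H d. hecke_coeff G H a b (x \<otimes> inv (rep C)))"
proof -
  let ?P = "\<lambda>C. x \<otimes> inv (rep C) \<in> a"
  let ?Z = "{C \<in> rcosets H. dcoset G H (rep C) \<in> support b d \<and> ?P C}"
  have S: "support b d \<subseteq> dcosets G H" "finite (support b d)"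
    using finite_support_coeff[OF b d] by (auto simp: support_def)
  have "finite (\<Union>y\<in>support b d. rcosets_in G H y)" using S finite_rcosets_in by blast
  moreover have "?Z \<subseteq> (\<Union>y\<in>support b d. rcosets_in G H y)"
    by (auto dest: rcosets_in_own)
  ultimately have finZ: "finite ?Z" by (rule finite_subset[rotated])
  have "(\<Sum>y\<in>support b d. hecke_coeff G H b d (rep y) * hecke_coeff G H a y x) =
      (\<Sum>y\<in>support b d. hecke_coeff G H b d (rep y) * card {C \<in> rcosets H. rep C \<in> y \<and> ?P C})"
    using S a x by (intro sum.cong refl) (auto simp: hecke_coeff_eq)
  also have "\<dots> = (\<Sum>C\<in>?Z. hecke_coeff G H b d (rep (dcoset G H (rep C))))"
    using sum_support_rcosets[OF S(2,1)] .
  also have "\<dots> = (\<Sum>C\<in>?Z. \<Sum>C'\<in>rcosets_in G H d. if rep C \<otimes> inv (rep C') \<in> b then 1 else 0)"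
  proof (intro sum.cong refl)
    fix C assume C: "C \<in> ?Z"
    then have "hecke_coeff G H b d (rep (dcoset G H (rep C))) =
        card {C' \<in> rcosets_in G H d. rep C \<otimes> inv (rep C') \<in> b}"
      using rcosets_rep(2) b d by (simp add: hecke_coeff_rep hecke_coeff_eq rcosets_in_iff conj_assoc)
    then show "hecke_coeff G H b d (rep (dcoset G H (rep C))) =
        (\<Sum>C'\<in>rcosets_in G H d. if rep C \<otimes> inv (rep C') \<in> b then 1 else 0)"
      using finite_rcosets_in[OF d] by (simp add: sum.If_cases Int_def)
  qed
  \<comment> \<open>For \<open>a (b d)\<close> the count is over a coset \<open>C\<close> in the
    support of \<open>b d\<close> and a coset \<open>C'\<close> in \<open>d\<close>; exchanging the
    sums keeps \<open>C'\<close> outside, as in the normal form.\<close>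
  also have "\<dots> = (\<Sum>C'\<in>rcosets_in G H d. \<Sum>C\<in>?Z. if rep C \<otimes> inv (rep C') \<in> b then 1 else 0)"
    by (rule sum.swap)
  also have "\<dots> = (\<Sum>C'\<in>rcosets_in G H d. hecke_coeff G H a b (x \<otimes> inv (rep C')))"
  proof (intro sum.cong refl)
    fix C' assume C': "C' \<in> rcosets_in G H d"
    then have C'': "C' \<in> rcosets H" "rep C' \<in> d" using d by (auto simp: rcosets_in_iff)
    note c' = rcosets_rep(2)[OF C''(1)]
    \<comment> \<open>The restriction of \<open>C\<close> to the support of \<open>b d\<close> is
      automatic: \<open>C'\<close> itself witnesses that the coefficient of \<open>b d\<close> at
      \<open>rep C\<close> is nonzero.\<close>
    have Z: "dcoset G H (rep C) \<in> support b d" if "C \<in> rcosets H" "rep C \<otimes> inv (rep C') \<in> b" for C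
    proof -
      have "C' \<in> {C' \<in> rcosets H. rep C' \<in> d \<and> rep C \<otimes> inv (rep C') \<in> b}" using that C'' by simp
      moreover have "finite {C' \<in> rcosets H. rep C' \<in> d \<and> rep C \<otimes> inv (rep C') \<in> b}"
        using finite_rcosets_in[OF d] d by (auto intro: finite_subset[of _ "rcosets_in G H d"] simp: rcosets_in_iff)
      ultimately have "card {C' \<in> rcosets H. rep C' \<in> d \<and> rep C \<otimes> inv (rep C') \<in> b} \<noteq> 0" by auto
      then show ?thesis using that rcosets_rep(2) b d by (simp add: mem_support hecke_coeff_eq)
    qed
    have "(\<Sum>C\<in>?Z. if rep C \<otimes> inv (rep C') \<in> b then 1 else 0) =
        card {C \<in> rcosets H. rep C \<otimes> inv (rep C') \<in> b \<and> x \<otimes> inv (rep C) \<in> a}"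
      using finZ Z by (simp add: sum.If_cases Int_def) (rule arg_cong[where f = card], auto)
    \<comment> \<open>Substituting \<open>c \<mapsto> c c'\<close> cancels \<open>c'\<close> in the
      first condition and moves it to \<open>x\<close> in the second, which leaves the count for the
      coefficient at \<open>x c'\<^sup>-\<^sup>1\<close>.\<close>
    also have "\<dots> = card {C \<in> rcosets H. (rep C \<otimes> rep C') \<otimes> inv (rep C') \<in> b \<and> x \<otimes> inv (rep C \<otimes> rep C') \<in> a}"
      using c' x a b by (intro card_rcosets_shift[symmetric])
        (simp_all add: stable_mult_inv m_assoc dcosets_stable)
    also have "{C \<in> rcosets H. (rep C \<otimes> rep C') \<otimes> inv (rep C') \<in> b \<and> x \<otimes> inv (rep C \<otimes> rep C') \<in> a} =
        {C \<in> rcosets H. rep C \<in> b \<and> (x \<otimes> inv (rep C')) \<otimes> inv (rep C) \<in> a}"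
      using c' x rcosets_rep(2) by (intro Collect_cong conj_cong refl) (auto simp: m_assoc inv_mult_group)
    finally show "(\<Sum>C\<in>?Z. if rep C \<otimes> inv (rep C') \<in> b then 1 else 0) =
        hecke_coeff G H a b (x \<otimes> inv (rep C'))"
      using a b x c' by (simp add: hecke_coeff_eq)
  qed
  finally show ?thesis .
qed

lemma H_dcoset: "H \<in> dcosets G H" "dcoset G H \<one> = H"
proof -
  have "x \<in> dcoset G H \<one>" if "x \<in> H" for x
    unfolding mem_dcoset using that by (intro bexI[of _ x] bexI[of _ \<one>]) auto
  then show "dcoset G H \<one> = H" by (auto simp: mem_dcoset)
  then show "H \<in> dcosets G H" using dcoset_in_dcosets[OF one_closed] by simp
qed

lemma coeff_unit_left:
  assumes "a \<in> dcosets G H" "x \<in> carrier G"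
  shows "hecke_coeff G H H a x = (if x \<in> a then 1 else 0)"
proof -
  have "C \<in> rcosets H \<and> rep C \<in> a \<and> x \<otimes> inv (rep C) \<in> H \<longleftrightarrow> C = H #> x \<and> x \<in> a" for C
  proof
    assume C: "C \<in> rcosets H \<and> rep C \<in> a \<and> x \<otimes> inv (rep C) \<in> H"
    then have c: "rep C \<in> carrier G" "H #> rep C = C" using rcosets_rep by auto
    then have 1: "H #> x = C" using C assms rcos_eq_iff[of x "rep C"] by simp
    have "inv (x \<otimes> inv (rep C)) \<otimes> x = rep C"
      using c assms by (simp add: inv_mult_group m_assoc)
    then have "x \<in> a" using dcosets_stable(1)[OF assms, of "inv (x \<otimes> inv (rep C))"] C by simp
    then show "C = H #> x \<and> x \<in> a" using 1 by simp
  next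
    assume C: "C = H #> x \<and> x \<in> a"
    then have "C \<in> rcosets H" using assms by simp
    note c = rcosets_rep[OF this]
    then have "x \<otimes> inv (rep C) \<in> H" using C assms rcos_eq_iff[of x "rep C"] by simp
    moreover have "rep C \<in> a" using rep_rcos[OF assms(2)] C assms by (auto simp: dcosets_stable)
    ultimately show "C \<in> rcosets H \<and> rep C \<in> a \<and> x \<otimes> inv (rep C) \<in> H" using \<open>C \<in> rcosets H\<close> by simp
  qed
  then have "{C \<in> rcosets H. rep C \<in> a \<and> x \<otimes> inv (rep C) \<in> H} = (if x \<in> a then {H #> x} else {})"
    by auto
  then show ?thesis using assms by (simp add: hecke_coeff_eq H_dcoset)
qed

lemma rcosets_in_H: "C \<in> rcosets H \<and> rep C \<in> H \<longleftrightarrow> C = H"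
proof
  assume C: "C \<in> rcosets H \<and> rep C \<in> H"
  then show "C = H" using rcosets_rep(3)[of C] subgroup.rcos_const[OF sub is_group, of "rep C"] by simp
next
  assume "C = H"
  then show "C \<in> rcosets H \<and> rep C \<in> H"
    using rep_in[OF H_one] subgroup.subgroup_in_rcosets[OF sub is_group] by simp
qed

lemma coeff_unit_right:
  assumes "a \<in> dcosets G H" "x \<in> carrier G"
  shows "hecke_coeff G H a H x = (if x \<in> a then 1 else 0)"
proof -
  have "{C \<in> rcosets H. rep C \<in> H \<and> x \<otimes> inv (rep C) \<in> a} = {C. C = H \<and> x \<otimes> inv (rep C) \<in> a}"
    using rcosets_in_H by blast
  also have "\<dots> = (if x \<in> a then {H} else {})"
    using assms rep_in[OF H_one] by (auto simp: dcosets_stable)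
  finally show ?thesis using assms by (simp add: hecke_coeff_eq H_dcoset)
qed

text \<open>The value is set to zero off the double cosets, where \<open>rep\<close> carries no
  meaning; this keeps products supported on \<open>dcosets G H\<close>.\<close>

definition coeff :: "'g set \<Rightarrow> 'g set \<Rightarrow> 'g set \<Rightarrow> 'k::comm_ring_1" where
  "coeff D D' U = (if U \<in> dcosets G H then of_nat (hecke_coeff G H D D' (rep U)) else 0)"

text \<open>Only an inclusion: in positive characteristic \<open>of_nat\<close> may annihilate a
  nonzero count.\<close>

lemma coeff_support: "{U. coeff D D' U \<noteq> (0::'k::comm_ring_1)} \<subseteq> support D D'"
  by (auto simp: coeff_def support_def intro!: gr0I)

lemma hecke_fs_algebra:
  "fs_algebra (hecke_algebra G H :: ('k::comm_ring_1, 'g set \<Rightarrow> 'k) module) (dcosets G H) coeff H"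
proof
  fix f g :: "'g set \<Rightarrow> 'k"
  show "f \<otimes>\<^bsub>hecke_algebra G H\<^esub> g =
      (\<lambda>x. \<Sum>a | f a \<noteq> 0. \<Sum>b | g b \<noteq> 0. f a * g b * coeff a b x)"
    by (auto simp: hecke_algebra_def coeff_def)
next
  fix a b assume ab: "a \<in> dcosets G H" "b \<in> dcosets G H"
  note 1 = coeff_support[of a b, where ?'k = 'k]
  moreover have "support a b \<subseteq> dcosets G H" by (auto simp: support_def)
  ultimately show "(coeff a b :: _ \<Rightarrow> 'k) \<in> fin_supp (dcosets G H)"
    using finite_subset[OF 1 finite_support_coeff[OF ab]] by (simp add: fin_supp_def)
next
  fix a assume a: "a \<in> dcosets G H"
  have "rep x \<in> a \<longleftrightarrow> x = a" if "x \<in> dcosets G H" for x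
    using dcosets_props(3)[OF a, of "rep x"] dcosets_props(3)[OF that, of "rep x"] dcosets_props(1)[OF that] by auto
  then show "(coeff H a :: _ \<Rightarrow> 'k) = basis_elt a" "(coeff a H :: _ \<Rightarrow> 'k) = basis_elt a"
    using a by (auto simp: coeff_def basis_elt_def coeff_unit_left coeff_unit_right)
next
  fix a b d x assume S: "a \<in> dcosets G H" "b \<in> dcosets G H" "d \<in> dcosets G H"
  show "(\<Sum>y | (coeff a b y :: 'k) \<noteq> 0. coeff a b y * coeff y d x :: 'k) =
      (\<Sum>y | (coeff b d y :: 'k) \<noteq> 0. coeff b d y * coeff a y x :: 'k)"
  proof (cases "x \<in> dcosets G H")
    case True
    \<comment> \<open>Summing over \<open>support a b\<close>, which is defined by natural numbers,
      lets the identity between counts be transferred by \<open>of_nat\<close>.\<close>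
    have "(\<Sum>y | (coeff a b y :: 'k) \<noteq> 0. coeff a b y * coeff y d x :: 'k) =
        (\<Sum>y\<in>support a b. coeff a b y * coeff y d x :: 'k)"
      using finite_support_coeff[OF S(1,2)]
      by (intro sum.mono_neutral_left coeff_support) auto
    also have "\<dots> = of_nat (\<Sum>y\<in>support a b. hecke_coeff G H a b (rep y) * hecke_coeff G H y d (rep x))"
      using True by (simp add: coeff_def support_def)
    also have "\<dots> = of_nat (\<Sum>y\<in>support b d. hecke_coeff G H b d (rep y) * hecke_coeff G H a y (rep x))"
      using S True by (simp only: coeff_mult_left coeff_mult_right rep_dcoset_closed)
    also have "\<dots> = (\<Sum>y\<in>support b d. coeff b d y * coeff a y x :: 'k)"
      using True by (simp add: coeff_def support_def)
    also have "\<dots> = (\<Sum>y | (coeff b d y :: 'k) \<noteq> 0. coeff b d y * coeff a y x :: 'k)"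
      using finite_support_coeff[OF S(2,3)]
      by (intro sum.mono_neutral_right coeff_support) auto
    finally show ?thesis .
  qed (simp add: coeff_def)
qed (auto simp: hecke_algebra_def H_dcoset)

text \<open>\<open>R\<close> is the degree homomorphism of the Hecke algebra.\<close>

lemma R_num_mult:
  assumes D: "D \<in> dcosets G H" and D': "D' \<in> dcosets G H"
  shows "R_num G H D * R_num G H D' =
    (\<Sum>U\<in>support D D'. hecke_coeff G H D D' (rep U) * R_num G H U)"
proof -
  let ?P = "rcosets_in G H D \<times> rcosets_in G H D'"
  let ?f = "\<lambda>(C, C'). H #> (rep C \<otimes> rep C')"
  let ?Z = "{C \<in> rcosets H. dcoset G H (rep C) \<in> support D D' \<and> True}"
  have S: "support D D' \<subseteq> dcosets G H" "finite (support D D')"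
    using finite_support_coeff[OF D D'] by (auto simp: support_def)
  have "finite (\<Union>y\<in>support D D'. rcosets_in G H y)" using S finite_rcosets_in by blast
  moreover have "?Z \<subseteq> (\<Union>y\<in>support D D'. rcosets_in G H y)"
    by (auto dest: rcosets_in_own)
  ultimately have finZ: "finite ?Z" by (rule finite_subset[rotated])
  have finP: "finite ?P" using finite_rcosets_in D D' by simp
  have cl: "rep C \<in> carrier G" "rep C' \<in> carrier G" if "(C, C') \<in> ?P" for C C'
    using that D D' rcosets_rep(2) by (auto simp: rcosets_in_iff)
  \<comment> \<open>The map \<open>?f\<close> sends a pair of right cosets to the right coset of the
    product of their representatives, and the Hecke coefficient is the size of its fibre. Adding up
    the fibres counts all pairs, which is the left-hand side.\<close>
  have coeff: "hecke_coeff G H D D' (rep Z) = card {p \<in> ?P. ?f p = Z}" if "Z \<in> rcosets H" for Z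
  proof -
    note z = rcosets_rep[OF that]
    have "rep C \<otimes> rep C' \<in> H #> rep Z \<longleftrightarrow> H #> (rep C \<otimes> rep C') = Z" if "(C, C') \<in> ?P" for C C'
      using cl[OF that] z rcos_self[OF _ sub, of "rep C \<otimes> rep C'"]
        repr_independence[OF _ z(2) sub, of "rep C \<otimes> rep C'"] by auto
    then show ?thesis unfolding hecke_coeff_def
      by (intro arg_cong[where f = card]) auto
  qed
  have "?f ` ?P \<subseteq> ?Z"
  proof
    fix Z assume "Z \<in> ?f ` ?P"
    then obtain p where p: "p \<in> ?P" "Z = ?f p" by blast
    have Z: "Z \<in> rcosets H" using p cl by auto
    have "card {p \<in> ?P. ?f p = Z} \<noteq> 0" using p finP by auto
    then show "Z \<in> ?Z" using Z rcosets_rep(2)[OF Z] coeff[OF Z] D D' by (simp add: mem_support)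
  qed
  then have "card ?P = (\<Sum>Z\<in>?Z. card {p \<in> ?P. ?f p = Z})"
    using finP finZ sum.group[of ?P ?Z ?f "\<lambda>_. 1 :: nat"] by simp
  also have "\<dots> = (\<Sum>Z\<in>?Z. hecke_coeff G H D D' (rep (dcoset G H (rep Z))))"
    using coeff rcosets_rep(2) D D' by (intro sum.cong refl) (simp add: hecke_coeff_rep)
  also have "\<dots> = (\<Sum>U\<in>support D D'. hecke_coeff G H D D' (rep U) * card {C \<in> rcosets H. rep C \<in> U \<and> True})"
    using sum_support_rcosets[OF S(2,1), where P = "\<lambda>_. True"] by simp
  also have "\<dots> = (\<Sum>U\<in>support D D'. hecke_coeff G H D D' (rep U) * R_num G H U)"
    using S rcosets_in_iff unfolding R_num_def
    by (intro sum.cong refl arg_cong2[where f = "(*)"] arg_cong[where f = card]) auto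
  finally show ?thesis by (simp add: R_num_def card_cartesian_product)
qed

end

section \<open>Words in the infinite dihedral group\<close>

lemma D_inf_simps [simp]:
  "carrier D_inf = UNIV" "\<one>\<^bsub>D_inf\<^esub> = (0, False)"
  "(a, \<epsilon>) \<otimes>\<^bsub>D_inf\<^esub> (b, \<delta>) = (if \<epsilon> then a - b else a + b, \<epsilon> \<noteq> \<delta>)"
  by (simp_all add: D_inf_def)

lemma D_inf_group: "group D_inf"
proof (rule groupI)
  fix x :: "int \<times> bool"
  obtain a \<epsilon> where x: "x = (a, \<epsilon>)" by (cases x)
  show "\<exists>y\<in>carrier D_inf. y \<otimes>\<^bsub>D_inf\<^esub> x = \<one>\<^bsub>D_inf\<^esub>"
    by (rule bexI[of _ "(if \<epsilon> then a else - a, \<epsilon>)"]) (auto simp: x)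
qed (auto split: prod.splits)

interpretation D: group D_inf by (rule D_inf_group)

lemma D_inf_inv: "inv\<^bsub>D_inf\<^esub> (a, \<epsilon>) = (if \<epsilon> then a else - a, \<epsilon>)"
  by (rule D.inv_equality) auto

text \<open>The reflections \<open>k \<mapsto> 1 - k\<close> (for \<open>True\<close>) and
  \<open>k \<mapsto> - k\<close> (for \<open>False\<close>) of the integers. Booleans name the
  generators, so negation passes to the other one.\<close>

definition dgen :: "bool \<Rightarrow> int \<times> bool" where
  "dgen x = (if x then 1 else 0, True)"

lemma dgen_dgen [simp]: "dgen x \<otimes>\<^bsub>D_inf\<^esub> dgen x = (0, False)"
  "d \<otimes>\<^bsub>D_inf\<^esub> dgen x \<otimes>\<^bsub>D_inf\<^esub> dgen x = d" "dgen x \<otimes>\<^bsub>D_inf\<^esub> (dgen x \<otimes>\<^bsub>D_inf\<^esub> d) = d"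
  by (cases d; simp add: dgen_def)+

abbreviation dword :: "bool list \<Rightarrow> int \<times> bool" where
  "dword ws \<equiv> word_prod D_inf (map dgen ws)"

lemma dword_append: "dword (us @ ws) = dword us \<otimes>\<^bsub>D_inf\<^esub> dword ws"
  using D.word_prod_append[of "map dgen us" "map dgen ws"] by simp

lemma dword_snoc [simp]: "word_prod D_inf (map dgen us @ [dgen x]) = dword us \<otimes>\<^bsub>D_inf\<^esub> dgen x"
  using dword_append[of us "[x]"] by (cases "dgen x") simp

text \<open>The argument \<open>x\<close> is the last letter, because words grow on the right in the
  multiplication rule for basis elements.\<close>

fun alternating :: "nat \<Rightarrow> bool \<Rightarrow> bool list" where
  "alternating 0 x = []"
| "alternating (Suc n) x = alternating n (\<not> x) @ [x]"

text \<open>Closed form of the word length: a product of two distinct generators is a translation by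
  1 or -1, whence the factor 2 for translations, and a reflection takes an odd number of
  letters.\<close>

definition dlen :: "int \<times> bool \<Rightarrow> nat" where
  "dlen d = (case d of (a, \<epsilon>) \<Rightarrow> nat (if \<epsilon> then \<bar>2 * a - 1\<bar> else 2 * \<bar>a\<bar>))"

text \<open>The value \<open>False\<close> at the identity is a mere default:
  \<open>alternating 0\<close> is empty for either letter.\<close>

definition dlast :: "int \<times> bool \<Rightarrow> bool" where
  "dlast d = (case d of (a, \<epsilon>) \<Rightarrow> if \<epsilon> then a \<ge> 1 else a < 0)"

definition nf :: "int \<times> bool \<Rightarrow> bool list" where
  "nf d = alternating (dlen d) (dlast d)"

lemma length_alternating [simp]: "length (alternating n x) = n"
  by (induction n x rule: alternating.induct) auto

lemma dword_alternating:
  "dword (alternating n x) =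
     (if even n then (if x then - int (n div 2) else int (n div 2), False)
      else (if x then int (n div 2) + 1 else - int (n div 2), True))"
  by (induction n x rule: alternating.induct) (simp_all, auto simp: dgen_def)

lemma dlen_dlast_alternating:
  "dlen (dword (alternating n x)) = n" "n > 0 \<Longrightarrow> dlast (dword (alternating n x)) = x"
  by (auto simp: dword_alternating dlen_def dlast_def elim!: evenE oddE)

lemma dword_nf [simp]: "dword (nf d) = d"
  by (cases d) (auto simp: nf_def dword_alternating dlen_def dlast_def even_nat_iff nat_mult_distrib
      split: if_splits, (auto simp: abs_if split: if_splits)?)

lemma distinct_adj_snoc: "distinct_adj (ws @ [x]) \<longleftrightarrow> distinct_adj ws \<and> (ws = [] \<or> last ws \<noteq> x)"
  by (auto simp: distinct_adj_append_iff)

lemma alternating_Nil [simp]: "alternating n x = [] \<longleftrightarrow> n = 0"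
  by (cases n) auto

lemma last_alternating: "n > 0 \<Longrightarrow> last (alternating n x) = x"
  by (cases n) auto

lemma distinct_adj_alternating [simp]: "distinct_adj (alternating n x)"
proof (induction n x rule: alternating.induct)
  case (2 n x)
  then show ?case using last_alternating[of n "\<not> x"] by (cases "n = 0") (simp_all add: distinct_adj_snoc)
qed simp

lemma distinct_adj_eq_alternating: "distinct_adj ws \<Longrightarrow> ws = alternating (length ws) (last ws)"
proof (induction ws rule: rev_induct)
  case (snoc x ws)
  then show ?case by (cases "ws = []") (auto simp: distinct_adj_snoc)
qed simp

lemma distinct_adj_nf [simp]: "distinct_adj (nf d)"
  by (simp add: nf_def)

text \<open>An alternating word is fixed by its length and last letter, and both can be recovered
  from the group element. With \<open>dword_nf\<close> this makes \<open>nf\<close> a bijection onto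
  the alternating words.\<close>

lemma nf_dword: 
  assumes "distinct_adj ws"
  shows "nf (dword ws) = ws"
proof -
  have ws: "ws = alternating (length ws) (last ws)" by (rule distinct_adj_eq_alternating[OF assms])
  have "nf (dword (alternating n x)) = alternating n x" for n x
    by (cases "n = 0", simp add: nf_def dlen_def) (simp add: nf_def dlen_dlast_alternating)
  then show ?thesis using ws by metis
qed

lemma length_nf: "length (nf d) = dlen d"
  by (simp add: nf_def)

definition ends :: "bool \<Rightarrow> int \<times> bool \<Rightarrow> bool" where
  "ends x d \<longleftrightarrow> nf d \<noteq> [] \<and> last (nf d) = x"

definition begins :: "bool \<Rightarrow> int \<times> bool \<Rightarrow> bool" where
  "begins x d \<longleftrightarrow> nf d \<noteq> [] \<and> hd (nf d) = x"

text \<open>In coordinates the condition becomes an inequality, which is the form it takes for the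
  positions of edges relative to a fixed one.\<close>

lemma ends_iff:
  "ends x (a, \<epsilon>) \<longleftrightarrow> (if \<epsilon> then x = (a \<ge> 1) else if x then a < 0 else a > 0)"
proof -
  have "ends x (a, \<epsilon>) \<longleftrightarrow> dlen (a, \<epsilon>) > 0 \<and> dlast (a, \<epsilon>) = x"
    using last_alternating[of "dlen (a, \<epsilon>)" "dlast (a, \<epsilon>)"] length_nf[of "(a, \<epsilon>)"]
    by (cases "dlen (a, \<epsilon>) = 0") (auto simp: ends_def nf_def)
  then show ?thesis by (auto simp: dlen_def dlast_def; presburger)
qed

lemma nf_snoc: "\<not> ends x d \<Longrightarrow> nf (d \<otimes>\<^bsub>D_inf\<^esub> dgen x) = nf d @ [x]"
  using nf_dword[of "nf d @ [x]"] by (auto simp: ends_def distinct_adj_snoc)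

lemma nf_Cons: "\<not> begins x d \<Longrightarrow> nf (dgen x \<otimes>\<^bsub>D_inf\<^esub> d) = x # nf d"
  using nf_dword[of "x # nf d"] by (auto simp: begins_def distinct_adj_Cons)

lemma nf_dgen [simp]: "nf (dgen x) = [x]"
  using nf_dword[of "[x]"] by (cases x) (simp_all add: dgen_def)

lemma nf_one [simp]: "nf (0, False) = []"
  using nf_dword[of "[]"] by simp

lemma ends_mult:
  assumes "ends x d"
  shows "\<not> ends x (d \<otimes>\<^bsub>D_inf\<^esub> dgen x)"
proof -
  let ?ws = "butlast (nf d)"
  have ne: "nf d \<noteq> []" and l: "last (nf d) = x" using assms unfolding ends_def by simp_all
  have ws: "nf d = ?ws @ [x]" using append_butlast_last_id[OF ne] unfolding l by (rule sym)
  then have "dword (nf d) = dword (?ws @ [x])" by (rule arg_cong)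
  then have "d = dword ?ws \<otimes>\<^bsub>D_inf\<^esub> dgen x"
    by (simp only: dword_nf dword_snoc list.map map_append)
  then have d: "d \<otimes>\<^bsub>D_inf\<^esub> dgen x = dword ?ws" by (metis dgen_dgen(2))
  have "distinct_adj (?ws @ [x])" using distinct_adj_nf[of d] ws by simp
  then have "distinct_adj ?ws" "?ws = [] \<or> last ?ws \<noteq> x" by (auto simp: distinct_adj_snoc)
  then show ?thesis unfolding d by (auto simp: ends_def nf_dword)
qed

lemma begins_mult:
  assumes "begins x d"
  shows "\<not> begins x (dgen x \<otimes>\<^bsub>D_inf\<^esub> d)"
proof -
  let ?ws = "tl (nf d)"
  have ne: "nf d \<noteq> []" and l: "hd (nf d) = x" using assms unfolding begins_def by simp_all
  have ws: "nf d = x # ?ws" using list.collapse[OF ne] unfolding l by (rule sym)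
  then have "d = dgen x \<otimes>\<^bsub>D_inf\<^esub> dword ?ws" using dword_nf[of d] by (metis list.map(2) word_prod_Cons)
  then have d: "dgen x \<otimes>\<^bsub>D_inf\<^esub> d = dword ?ws" by (metis dgen_dgen(3))
  have "distinct_adj (x # ?ws)" using distinct_adj_nf[of d] ws by simp
  then have "distinct_adj ?ws" "?ws = [] \<or> hd ?ws \<noteq> x" by (auto simp: distinct_adj_Cons)
  then show ?thesis unfolding d by (auto simp: begins_def nf_dword)
qed

lemma dlen_mult_dgen: "dlen (d \<otimes>\<^bsub>D_inf\<^esub> dgen x) \<le> Suc (dlen d)"
proof -
  have "nat (2 * \<bar>a - 1\<bar>) \<le> Suc (nat \<bar>2 * a - 1\<bar>)" for a :: int
  proof -
    have "2 * \<bar>a - 1\<bar> \<le> \<bar>2 * a - 1\<bar> + 1" by arith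
    then have "nat (2 * \<bar>a - 1\<bar>) \<le> nat (\<bar>2 * a - 1\<bar> + 1)" by (rule nat_mono)
    then show ?thesis by (simp add: Suc_nat_eq_nat_zadd1)
  qed
  then show ?thesis by (cases d) (auto simp: dlen_def dgen_def)
qed

lemma dlen_dword: "dlen (dword ws) \<le> length ws"
proof (induction ws rule: rev_induct)
  case Nil
  then show ?case by (simp add: dlen_def)
next
  case (snoc x ws)
  then show ?case using dlen_mult_dgen[of "dword ws" x] by simp
qed

text \<open>A word with two equal neighbouring letters can be shortened by two, so a word of minimal
  length alternates and is therefore the normal form.\<close>

lemma short_word_unique:
  assumes "length ws = dlen (dword ws)"
  shows "ws = nf (dword ws)"
proof -
  have "distinct_adj ws" using assms
  proof (induction ws rule: rev_induct)
    case (snoc x ws)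
    have l: "length ws = dlen (dword ws)"
      using snoc.prems dlen_mult_dgen[of "dword ws" x] dlen_dword[of ws] by simp
    then have d: "distinct_adj ws" using snoc.IH by simp
    have "ws = [] \<or> last ws \<noteq> x"
    proof (rule ccontr)
      assume "\<not> (ws = [] \<or> last ws \<noteq> x)"
      then have ne: "ws \<noteq> []" and l: "last ws = x" by simp_all
      have "ws = butlast ws @ [x]" using append_butlast_last_id[OF ne] unfolding l by (rule sym)
      then have "dword ws = dword (butlast ws @ [x])" by (rule arg_cong)
      then have "dword ws = dword (butlast ws) \<otimes>\<^bsub>D_inf\<^esub> dgen x"
        by (simp only: dword_snoc list.map map_append)
      then have "dword (ws @ [x]) = dword (butlast ws)" by simp
      then show False using snoc.prems dlen_dword[of "butlast ws"] by simp
    qed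
    then show ?case using d by (simp add: distinct_adj_snoc)
  qed simp
  then show ?thesis by (simp add: nf_dword)
qed

text \<open>Bridges the abstract notion of a shortest word in \<open>M\<close> and the normal form
  in coordinates; first and last letters of reduced words are then read off from
  \<open>nf\<close>.\<close>

lemma reduced_word_dihedral:
  assumes M: "Group.monoid M" and \<mu>: "\<mu> \<in> iso D_inf M" 
  shows "reduced_word M {\<mu> (dgen True), \<mu> (dgen False)} (\<mu> d) ws \<longleftrightarrow> ws = map (\<lambda>x. \<mu> (dgen x)) (nf d)"
proof -
  let ?m = "map (\<lambda>x. \<mu> (dgen x))"
  have hom: "\<mu> \<in> hom D_inf M" and bij: "bij_betw \<mu> UNIV (carrier M)" using \<mu> by (auto simp: iso_def)
  \<comment> \<open>\<open>M\<close> is only known to be a monoid, so preservation of the unit is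
    derived from surjectivity: some \<open>d\<close> maps to the unit of \<open>M\<close>, and
    multiplying by the image of the unit gives the claim.\<close>
  have one: "\<mu> \<one>\<^bsub>D_inf\<^esub> = \<one>\<^bsub>M\<^esub>"
  proof -
    interpret M: Group.monoid M by (rule M)
    obtain d where d: "\<mu> d = \<one>\<^bsub>M\<^esub>" using bij M.one_closed by (metis bij_betw_iff_bijections)
    have "\<mu> \<one>\<^bsub>D_inf\<^esub> = \<mu> d \<otimes>\<^bsub>M\<^esub> \<mu> \<one>\<^bsub>D_inf\<^esub>"
      using d hom_in_carrier[OF hom, of "\<one>\<^bsub>D_inf\<^esub>"] by simp
    also have "\<dots> = \<mu> (d \<otimes>\<^bsub>D_inf\<^esub> \<one>\<^bsub>D_inf\<^esub>)" by (rule hom_mult[OF hom, symmetric]) auto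
    also have "d \<otimes>\<^bsub>D_inf\<^esub> \<one>\<^bsub>D_inf\<^esub> = d" by (rule D.r_one) simp
    finally show ?thesis using d by simp
  qed
  have wp: "word_prod M (?m us) = \<mu> (dword us)" for us
    using word_prod_map_hom[OF hom one D.monoid_axioms, of "map dgen us"] by (simp add: o_def)
  have inj: "\<mu> x = \<mu> y \<longleftrightarrow> x = y" for x y using bij by (metis bij_betw_imp_inj_on inj_eq)
  have letters: "\<exists>us. ws = ?m us" if "set ws \<subseteq> {\<mu> (dgen True), \<mu> (dgen False)}" for ws
    using that
  proof (induction ws)
    case (Cons y ws)
    then obtain us where "ws = ?m us" by auto
    moreover obtain x where "y = \<mu> (dgen x)" using Cons.prems by auto
    ultimately have "y # ws = ?m (x # us)" by simp
    then show ?case by (rule exI)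
  qed simp
  have set: "set (?m us) \<subseteq> {\<mu> (dgen True), \<mu> (dgen False)}" for us
    by auto (metis (full_types))
  show ?thesis
  proof
    assume r: "reduced_word M {\<mu> (dgen True), \<mu> (dgen False)} (\<mu> d) ws"
    then obtain us where us: "ws = ?m us" using letters unfolding reduced_word_def by blast
    have d: "dword us = d" using r us wp inj unfolding reduced_word_def by simp
    have min: "length ws \<le> length us"
      if "set us \<subseteq> {\<mu> (dgen True), \<mu> (dgen False)}" "word_prod M us = \<mu> d" for us
      using r that unfolding reduced_word_def by simp
    have "length ws \<le> length (?m (nf d))"
      by (rule min[OF set]) (simp only: wp dword_nf)
    then have "length us = dlen (dword us)"
      using dlen_dword[of us] us d by (simp add: length_nf)
    then show "ws = ?m (nf d)" using short_word_unique us d by metis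
  next
    assume ws: "ws = ?m (nf d)"
    have "length (?m (nf d)) \<le> length us'"
      if us': "set us' \<subseteq> {\<mu> (dgen True), \<mu> (dgen False)}" "word_prod M us' = \<mu> d" for us'
    proof -
      obtain us where us: "us' = ?m us" using letters[OF us'(1)] by blast
      then have "dword us = d" using us' wp inj by simp
      then show ?thesis using dlen_dword[of us] us by (simp add: length_nf)
    qed
    then show "reduced_word M {\<mu> (dgen True), \<mu> (dgen False)} (\<mu> d) ws"
      unfolding reduced_word_def using ws set wp by simp
  qed
qed

lemma
  assumes M: "Group.monoid M" and \<mu>: "\<mu> \<in> iso D_inf M" 
  shows begins_with_dihedral:
      "begins_with M {\<mu> (dgen True), \<mu> (dgen False)} (\<mu> d) (\<mu> (dgen x)) \<longleftrightarrow> begins x d"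
    and ends_with_dihedral:
      "ends_with M {\<mu> (dgen True), \<mu> (dgen False)} (\<mu> d) (\<mu> (dgen x)) \<longleftrightarrow> ends x d"
proof -
  have inj: "\<mu> (dgen x) = \<mu> (dgen y) \<longleftrightarrow> x = y" for x y
  proof -
    have "inj \<mu>" using \<mu> by (auto simp: iso_def bij_betw_def)
    then show ?thesis by (cases x; cases y) (auto simp: inj_eq dgen_def)
  qed
  show "begins_with M {\<mu> (dgen True), \<mu> (dgen False)} (\<mu> d) (\<mu> (dgen x)) \<longleftrightarrow> begins x d"
    unfolding begins_with_def reduced_word_dihedral[OF assms] begins_def
    using inj by (auto simp: hd_map)
  show "ends_with M {\<mu> (dgen True), \<mu> (dgen False)} (\<mu> d) (\<mu> (dgen x)) \<longleftrightarrow> ends x d"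
    unfolding ends_with_def reduced_word_dihedral[OF assms] ends_def
    using inj by (auto simp: last_map)
qed

section \<open>Dihedral Hecke algebras\<close>

text \<open>The Iwahori--Hecke algebra of the infinite dihedral group with parameters \<open>q True\<close>,
  \<open>q False\<close>; for \<open>\<int>[G, B]\<close> with \<open>G \<noteq> G\<^sup>+\<close> the second generator is the inversion
  \<open>i\<close>, with parameter \<open>1\<close>.\<close>

locale dihedral_algebra = fs_algebra A S c u
  for A :: "('k::comm_ring_1, 'x \<Rightarrow> 'k) module" and S c u +
  fixes \<beta> :: "int \<times> bool \<Rightarrow> 'x" and q :: "bool \<Rightarrow> nat"
  assumes \<beta>: "bij_betw \<beta> UNIV S" and \<beta>_one: "\<beta> (0, False) = u"
    and coeff_right: "\<And>d x. c (\<beta> d) (\<beta> (dgen x)) =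
      (if ends x d
       then (\<lambda>y. of_nat (q x) * basis_elt (\<beta> (d \<otimes>\<^bsub>D_inf\<^esub> dgen x)) y + (of_nat (q x) - 1) * basis_elt (\<beta> d) y)
       else basis_elt (\<beta> (d \<otimes>\<^bsub>D_inf\<^esub> dgen x)))"
begin

definition T :: "int \<times> bool \<Rightarrow> 'x \<Rightarrow> 'k" where
  "T d = basis_elt (\<beta> d)"

lemma \<beta>_in [simp]: "\<beta> d \<in> S"
  using \<beta> by (auto simp: bij_betw_def)

lemma \<beta>_surj: "a \<in> S \<Longrightarrow> \<exists>d. a = \<beta> d"
  using \<beta> by (auto simp: bij_betw_def)

lemma T_fin_supp [simp]: "T d \<in> fin_supp S"
  by (simp add: T_def)

lemma T_closed [simp]: "T d \<in> carrier A"
  by (simp add: carrier_eq)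

lemma T_one: "T (0, False) = \<one>\<^bsub>A\<^esub>"
  by (simp add: T_def \<beta>_one one_eq)

lemma T_mult_dgen:
  "\<not> ends x d \<Longrightarrow> T d \<otimes>\<^bsub>A\<^esub> T (dgen x) = T (d \<otimes>\<^bsub>D_inf\<^esub> dgen x)"
  "ends x d \<Longrightarrow> T d \<otimes>\<^bsub>A\<^esub> T (dgen x) =
     of_nat (q x) \<odot>\<^bsub>A\<^esub> T (d \<otimes>\<^bsub>D_inf\<^esub> dgen x) \<oplus>\<^bsub>A\<^esub> (of_nat (q x) - 1) \<odot>\<^bsub>A\<^esub> T d"
  by (simp_all add: T_def mult_basis coeff_right add_eq smult_eq)

lemma T_square: "T (dgen x) \<otimes>\<^bsub>A\<^esub> T (dgen x) =
    of_nat (q x) \<odot>\<^bsub>A\<^esub> \<one>\<^bsub>A\<^esub> \<oplus>\<^bsub>A\<^esub> (of_nat (q x) - 1) \<odot>\<^bsub>A\<^esub> T (dgen x)"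
proof -
  have "ends x (dgen x)" by (simp add: ends_def)
  then show ?thesis using T_mult_dgen(2)[of x "dgen x"] by (simp add: T_one)
qed

lemma T_alternating: "distinct_adj ws \<Longrightarrow> T (dword ws) = word_prod A (map (\<lambda>x. T (dgen x)) ws)"
proof (induction ws rule: rev_induct)
  case Nil
  then show ?case by (simp add: T_one)
next
  case (snoc x ws)
  then have "\<not> ends x (dword ws)" by (auto simp: ends_def nf_dword distinct_adj_snoc)
  then have "T (dword ws \<otimes>\<^bsub>D_inf\<^esub> dgen x) = T (dword ws) \<otimes>\<^bsub>A\<^esub> T (dgen x)"
    by (simp add: T_mult_dgen)
  moreover have "set (map (\<lambda>x. T (dgen x)) ws) \<subseteq> carrier A" by auto
  ultimately show ?case
    using snoc by (simp add: distinct_adj_snoc R.word_prod_append)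
qed

lemma T_word: "T d = word_prod A (map (\<lambda>x. T (dgen x)) (nf d))"
  using T_alternating[of "nf d"] by simp

text \<open>The locale prescribes right multiplication. Prepending a letter to an alternating word
  gives the first rule; the second follows by splitting \<open>T d\<close> as
  \<open>T (dgen x)\<close> times a shorter element and using the quadratic relation.\<close>

lemma T_dgen_mult:
  "\<not> begins x d \<Longrightarrow> T (dgen x) \<otimes>\<^bsub>A\<^esub> T d = T (dgen x \<otimes>\<^bsub>D_inf\<^esub> d)"
  "begins x d \<Longrightarrow> T (dgen x) \<otimes>\<^bsub>A\<^esub> T d =
     of_nat (q x) \<odot>\<^bsub>A\<^esub> T (dgen x \<otimes>\<^bsub>D_inf\<^esub> d) \<oplus>\<^bsub>A\<^esub> (of_nat (q x) - 1) \<odot>\<^bsub>A\<^esub> T d"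
proof -
  show 1: "T (dgen x) \<otimes>\<^bsub>A\<^esub> T d = T (dgen x \<otimes>\<^bsub>D_inf\<^esub> d)" if "\<not> begins x d" for d
    using nf_Cons[OF that] T_word[of d] T_word[of "dgen x \<otimes>\<^bsub>D_inf\<^esub> d"] by simp
  assume b: "begins x d"
  let ?d = "dgen x \<otimes>\<^bsub>D_inf\<^esub> d"
  have d: "T d = T (dgen x) \<otimes>\<^bsub>A\<^esub> T ?d" using 1[OF begins_mult[OF b]] by simp
  have "T (dgen x) \<otimes>\<^bsub>A\<^esub> T d = (T (dgen x) \<otimes>\<^bsub>A\<^esub> T (dgen x)) \<otimes>\<^bsub>A\<^esub> T ?d"
    by (subst d) (simp add: R.m_assoc)
  also have "\<dots> = of_nat (q x) \<odot>\<^bsub>A\<^esub> T ?d \<oplus>\<^bsub>A\<^esub> (of_nat (q x) - 1) \<odot>\<^bsub>A\<^esub> (T (dgen x) \<otimes>\<^bsub>A\<^esub> T ?d)"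
    by (simp add: T_square R.l_distr smult_closed smult_mult_left)
  finally show "T (dgen x) \<otimes>\<^bsub>A\<^esub> T d =
     of_nat (q x) \<odot>\<^bsub>A\<^esub> T ?d \<oplus>\<^bsub>A\<^esub> (of_nat (q x) - 1) \<odot>\<^bsub>A\<^esub> T d"
    using d by simp
qed

lemma carrier_induct [consumes 1, case_names zero add]:
  assumes "f \<in> carrier A" "P \<zero>\<^bsub>A\<^esub>"
    and "\<And>k d f. f \<in> carrier A \<Longrightarrow> P f \<Longrightarrow> P (k \<odot>\<^bsub>A\<^esub> T d \<oplus>\<^bsub>A\<^esub> f)"
  shows "P f"
  using assms(1) unfolding carrier_eq
proof (induction f rule: fin_supp_induct)
  case zero
  then show ?case using assms(2) by (simp add: zero_eq)
next
  case (add k a f)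
  then obtain d where "a = \<beta> d" using \<beta>_surj by blast
  then show ?case using assms(3)[of f k d] add by (simp add: carrier_eq T_def smult_eq add_eq)
qed

lemma generated:
  assumes T: "\<And>x. T (dgen x) \<in> U" and one: "\<one>\<^bsub>A\<^esub> \<in> U" and zero: "\<zero>\<^bsub>A\<^esub> \<in> U"
    and add: "\<And>x y. x \<in> U \<Longrightarrow> y \<in> U \<Longrightarrow> x \<oplus>\<^bsub>A\<^esub> y \<in> U"
    and mult: "\<And>x y. x \<in> U \<Longrightarrow> y \<in> U \<Longrightarrow> x \<otimes>\<^bsub>A\<^esub> y \<in> U"
    and smult: "\<And>k x. x \<in> U \<Longrightarrow> k \<odot>\<^bsub>A\<^esub> x \<in> U"
    and f: "f \<in> carrier A"
  shows "f \<in> U"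
proof -
  have w: "word_prod A (map (\<lambda>x. T (dgen x)) ws) \<in> U" for ws
    by (induction ws) (simp_all add: one mult T)
  have T: "T d \<in> U" for d
    unfolding T_word[of d] by (rule w)
  from f show ?thesis by (induction f rule: carrier_induct) (simp_all add: zero add smult T)
qed

lemma generates: "generates_algebra A {\<one>\<^bsub>A\<^esub>, T (dgen x), T (dgen (\<not> x))}"
  unfolding generates_algebra_def
proof (intro conjI allI impI)
  fix U assume U: "{\<one>\<^bsub>A\<^esub>, T (dgen x), T (dgen (\<not> x))} \<subseteq> U \<and> U \<subseteq> carrier A \<and> \<zero>\<^bsub>A\<^esub> \<in> U \<and>
      (\<forall>x\<in>U. \<forall>y\<in>U. x \<oplus>\<^bsub>A\<^esub> y \<in> U \<and> x \<otimes>\<^bsub>A\<^esub> y \<in> U) \<and> (\<forall>k. \<forall>x\<in>U. k \<odot>\<^bsub>A\<^esub> x \<in> U)"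
  then have T: "T (dgen y) \<in> U" for y by (cases "y = x") auto
  have "f \<in> U" if "f \<in> carrier A" for f
    by (rule generated[OF T _ _ _ _ _ that]) (use U in auto)
  then show "U = carrier A" using U by blast
qed auto

text \<open>The target is a ring without scalars, so linearity is expressed by a common function
  \<open>act\<close> giving the effect of a scalar there. The lemma serves to recognise composite
  homomorphisms as identities.\<close>

lemma linear_hom_eq:
  assumes R: "ring R" and h: "h \<in> ring_hom A R" "h' \<in> ring_hom A R"
    and lin: "\<And>k d. h (k \<odot>\<^bsub>A\<^esub> T d) = act k (h (T d))" "\<And>k d. h' (k \<odot>\<^bsub>A\<^esub> T d) = act k (h' (T d))"
    and gen: "\<And>x. h (T (dgen x)) = h' (T (dgen x))"
    and f: "f \<in> carrier A"
  shows "h f = h' f"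
proof -
  have w: "h (word_prod A (map (\<lambda>x. T (dgen x)) ws)) = h' (word_prod A (map (\<lambda>x. T (dgen x)) ws))" for ws
  proof (induction ws)
    case Nil
    then show ?case using ring_hom_one[OF h(1)] ring_hom_one[OF h(2)] by simp
  next
    case (Cons x ws)
    have "set (map (\<lambda>x. T (dgen x)) ws) \<subseteq> carrier A" by auto
    then have "word_prod A (map (\<lambda>x. T (dgen x)) ws) \<in> carrier A" by (rule R.word_prod_closed)
    then show ?case using Cons ring_hom_mult[OF h(1)] ring_hom_mult[OF h(2)] by (simp add: gen)
  qed
  have T: "h (T d) = h' (T d)" for d using w[of "nf d"] by (simp add: T_word[symmetric])
  from f show ?thesis
  proof (induction f rule: carrier_induct)
    case zero
    then show ?case using ring_hom_zero[OF h(1) is_ring R] ring_hom_zero[OF h(2) is_ring R] by simp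
  next
    case (add k d f)
    then show ?case using ring_hom_add[OF h(1)] ring_hom_add[OF h(2)]
      by (simp add: smult_closed lin T)
  qed
qed

text \<open>The quadratic relations define \<open>A\<close>: a pair of elements satisfying them extends to a
  homomorphism. Multiplicativity only has to be checked for right multiplication by generators.\<close>

lemma universal:
  assumes R: "scalars R sc" and X: "\<And>x. Y x \<in> carrier R"
    and quad: "\<And>x. Y x \<otimes>\<^bsub>R\<^esub> Y x = sc (of_nat (q x)) \<oplus>\<^bsub>R\<^esub> sc (of_nat (q x) - 1) \<otimes>\<^bsub>R\<^esub> Y x"
  obtains h where "h \<in> ring_hom A R" "\<And>x. h (T (dgen x)) = Y x"
    "\<And>k f. f \<in> carrier A \<Longrightarrow> h (k \<odot>\<^bsub>A\<^esub> f) = sc k \<otimes>\<^bsub>R\<^esub> h f"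
proof -
  interpret R': scalars R sc by (rule R)
  \<comment> \<open>The image of a basis element is forced: it is the product of the
    \<open>Y x\<close> along the normal form.\<close>
  define v where "v a = word_prod R (map Y (nf (inv_into UNIV \<beta> a)))" for a
  have inv: "inv_into UNIV \<beta> (\<beta> d) = d" for d
    using \<beta> by (auto simp: bij_betw_def)
  have v: "v (\<beta> d) = word_prod R (map Y (nf d))" for d by (simp add: v_def inv)
  have Yws: "set (map Y ws) \<subseteq> carrier R" for ws using X by auto
  have v_closed: "v a \<in> carrier R" for a unfolding v_def by (rule R'.word_prod_closed[OF Yws])
  define h where "h = lin_ext R sc v"
  note lin = R'.lin_ext_simps[of S v, OF v_closed, folded h_def]
  have hT: "h (T d) = v (\<beta> d)" for d unfolding T_def by (rule lin) simp
  have v_snoc: "v (\<beta> (d \<otimes>\<^bsub>D_inf\<^esub> dgen x)) = v (\<beta> d) \<otimes>\<^bsub>R\<^esub> Y x" if "\<not> ends x d" for d x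
    using nf_snoc[OF that] R'.word_prod_append[OF Yws Yws[of "[x]"], of "nf d"] X by (simp add: v)
  have 1: "h (T d \<otimes>\<^bsub>A\<^esub> T (dgen x)) = v (\<beta> d) \<otimes>\<^bsub>R\<^esub> Y x" for d x
  proof (cases "ends x d")
    case False
    then show ?thesis by (simp add: T_mult_dgen hT v_snoc)
  next
    case True
    let ?d = "d \<otimes>\<^bsub>D_inf\<^esub> dgen x"
    \<comment> \<open>Since \<open>d\<close> ends with \<open>x\<close>, its value is that of
      \<open>d x\<close> times \<open>Y x\<close>, so multiplying by \<open>Y x\<close> produces a
      square to which the quadratic relation applies.\<close>
    have d: "v (\<beta> d) = v (\<beta> ?d) \<otimes>\<^bsub>R\<^esub> Y x" using v_snoc[OF ends_mult[OF True]] by simp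
    have "h (T d \<otimes>\<^bsub>A\<^esub> T (dgen x)) =
        sc (of_nat (q x)) \<otimes>\<^bsub>R\<^esub> v (\<beta> ?d) \<oplus>\<^bsub>R\<^esub> sc (of_nat (q x) - 1) \<otimes>\<^bsub>R\<^esub> v (\<beta> d)"
      using True by (simp add: T_mult_dgen smult_eq add_eq lin fin_supp_smult hT)
    also have "\<dots> = v (\<beta> ?d) \<otimes>\<^bsub>R\<^esub> sc (of_nat (q x)) \<oplus>\<^bsub>R\<^esub> v (\<beta> ?d) \<otimes>\<^bsub>R\<^esub> (sc (of_nat (q x) - 1) \<otimes>\<^bsub>R\<^esub> Y x)"
      unfolding d using R'.sc_central[OF v_closed[of "\<beta> ?d"]] v_closed X
      by (simp add: R'.m_assoc[symmetric])
    also have "\<dots> = v (\<beta> ?d) \<otimes>\<^bsub>R\<^esub> (Y x \<otimes>\<^bsub>R\<^esub> Y x)"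
      unfolding quad using v_closed X by (simp add: R'.r_distr)
    also have "\<dots> = v (\<beta> d) \<otimes>\<^bsub>R\<^esub> Y x"
      unfolding d using v_closed X by (simp add: R'.m_assoc)
    finally show ?thesis .
  qed
  have 2: "h (f \<otimes>\<^bsub>A\<^esub> T (dgen x)) = h f \<otimes>\<^bsub>R\<^esub> Y x" if "f \<in> carrier A" for f x
    using that
  proof (induction f rule: carrier_induct)
    case zero
    then show ?case using X by (simp add: lin zero_eq mult_zero)
  next
    case (add k d f)
    have "(k \<odot>\<^bsub>A\<^esub> T d \<oplus>\<^bsub>A\<^esub> f) \<otimes>\<^bsub>A\<^esub> T (dgen x) =
        k \<odot>\<^bsub>A\<^esub> (T d \<otimes>\<^bsub>A\<^esub> T (dgen x)) \<oplus>\<^bsub>A\<^esub> f \<otimes>\<^bsub>A\<^esub> T (dgen x)"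
      using add by (simp add: R.l_distr smult_closed smult_mult_left)
    then have "h ((k \<odot>\<^bsub>A\<^esub> T d \<oplus>\<^bsub>A\<^esub> f) \<otimes>\<^bsub>A\<^esub> T (dgen x)) =
        h (k \<odot>\<^bsub>A\<^esub> (T d \<otimes>\<^bsub>A\<^esub> T (dgen x)) \<oplus>\<^bsub>A\<^esub> f \<otimes>\<^bsub>A\<^esub> T (dgen x))" by (rule arg_cong)
    also have "\<dots> = sc k \<otimes>\<^bsub>R\<^esub> (v (\<beta> d) \<otimes>\<^bsub>R\<^esub> Y x) \<oplus>\<^bsub>R\<^esub> h f \<otimes>\<^bsub>R\<^esub> Y x"
      using add 1 by (simp add: carrier_eq smult_eq add_eq lin bilinear)
    also have "\<dots> = (sc k \<otimes>\<^bsub>R\<^esub> v (\<beta> d) \<oplus>\<^bsub>R\<^esub> h f) \<otimes>\<^bsub>R\<^esub> Y x"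
      using add v_closed X by (simp add: R'.l_distr R'.m_assoc lin carrier_eq)
    also have "sc k \<otimes>\<^bsub>R\<^esub> v (\<beta> d) \<oplus>\<^bsub>R\<^esub> h f = h (k \<odot>\<^bsub>A\<^esub> T d \<oplus>\<^bsub>A\<^esub> f)"
      using add by (simp add: carrier_eq smult_eq add_eq lin fin_supp_smult hT)
    finally show ?case .
  qed
  \<comment> \<open>Multiplicativity in the right factor, by appending one generator of an
    alternating word at a time.\<close>
  have 3: "h (f \<otimes>\<^bsub>A\<^esub> T (dword ws)) = h f \<otimes>\<^bsub>R\<^esub> word_prod R (map Y ws)"
    if "distinct_adj ws" "f \<in> carrier A" for f ws
    using that
  proof (induction ws rule: rev_induct)
    case Nil
    then show ?case by (simp add: T_one carrier_eq lin)
  next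
    case (snoc x ws)
    then have "\<not> ends x (dword ws)" by (auto simp: ends_def nf_dword distinct_adj_snoc)
    then have "T (dword (ws @ [x])) = T (dword ws) \<otimes>\<^bsub>A\<^esub> T (dgen x)"
      by (simp add: T_mult_dgen)
    then have "h (f \<otimes>\<^bsub>A\<^esub> T (dword (ws @ [x]))) = h ((f \<otimes>\<^bsub>A\<^esub> T (dword ws)) \<otimes>\<^bsub>A\<^esub> T (dgen x))"
      using snoc by (simp add: R.m_assoc)
    also have "\<dots> = h f \<otimes>\<^bsub>R\<^esub> word_prod R (map Y ws) \<otimes>\<^bsub>R\<^esub> Y x"
      using snoc by (simp add: 2 distinct_adj_snoc)
    also have "\<dots> = h f \<otimes>\<^bsub>R\<^esub> word_prod R (map Y (ws @ [x]))"
      using R'.word_prod_append[OF Yws Yws[of "[x]"], of ws] snoc.prems X R'.word_prod_closed[OF Yws, of ws]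
      by (simp add: R'.m_assoc carrier_eq lin)
    finally show ?case .
  qed
  have "h \<in> ring_hom A R" unfolding h_def
  proof (rule lin_ext_hom[OF R])
    have "v (\<beta> (0, False)) = \<one>\<^bsub>R\<^esub>" unfolding v by simp
    then show "v u = \<one>\<^bsub>R\<^esub>" by (simp add: \<beta>_one)
    fix a b assume "a \<in> S" "b \<in> S"
    then obtain d d' where ab: "a = \<beta> d" "b = \<beta> d'" using \<beta>_surj by blast
    have "lin_ext R sc v (c a b) = h (T d \<otimes>\<^bsub>A\<^esub> T (dword (nf d')))"
      by (simp add: h_def T_def mult_basis ab)
    also have "\<dots> = v a \<otimes>\<^bsub>R\<^esub> v b" by (subst 3) (simp_all add: hT ab v)
    finally show "lin_ext R sc v (c a b) = v a \<otimes>\<^bsub>R\<^esub> v b" .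
  qed (rule v_closed)
  moreover have "h (T (dgen x)) = Y x" for x unfolding hT v using X by simp
  moreover have "h (k \<odot>\<^bsub>A\<^esub> f) = sc k \<otimes>\<^bsub>R\<^esub> h f" if "f \<in> carrier A" for k f
    using that by (simp add: carrier_eq smult_eq lin)
  ultimately show ?thesis by (rule that)
qed

end

lemma (in ring_hom_ring) word_prod_hom:
  "set xs \<subseteq> carrier R \<Longrightarrow> h (word_prod R xs) = word_prod S (map h xs)"
  by (induction xs) (auto simp: R.word_prod_closed)

text \<open>The quadratic relations hold in the quotient of the free ring, so the universal property
  of \<open>A\<close> supplies the map back that \<open>ring_presentationI\<close> asks for.
  \<open>L\<close> may contain letters beyond the generators \<open>l x\<close>; the last assumption
  eliminates these by words modulo the ideal.\<close>

lemma dihedral_presentation: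
  fixes A :: "(int, 'x \<Rightarrow> int) module" and L :: "'l set"
  assumes A: "dihedral_algebra A S c u \<beta> q"
    and gen: "gen ` L \<subseteq> carrier A" and rels: "rels \<subseteq> carrier (free_ring L)"
    and rel0: "\<And>f. f \<in> rels \<Longrightarrow> free_ring_eval A gen f = \<zero>\<^bsub>A\<^esub>"
    and l: "\<And>x. l x \<in> L" "\<And>x. gen (l x) = dihedral_algebra.T \<beta> (dgen x)"
    and quad: "\<And>x. quadratic_rel (free_ring L) (q x) (letter (l x)) \<in> Idl\<^bsub>free_ring L\<^esub> rels"
    and other: "\<And>y. y \<in> L \<Longrightarrow> \<exists>ws. gen y = word_prod A (map (\<lambda>x. gen (l x)) ws) \<and>
      letter y \<ominus>\<^bsub>free_ring L\<^esub> word_prod (free_ring L) (map (\<lambda>x. letter (l x)) ws) \<in> Idl\<^bsub>free_ring L\<^esub> rels"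
  shows "ring_presentation A L gen rels"
proof -
  interpret dihedral_algebra A S c u \<beta> q by (rule A)
  interpret F: fs_algebra "free_ring L" "lists L" "\<lambda>xs ys. basis_elt (xs @ ys)" "[]"
    by (rule free_ring_fs_algebra)
  let ?F = "free_ring L"
  let ?I = "Idl\<^bsub>?F\<^esub> rels"
  let ?Q = "?F Quot ?I" and ?\<pi> = "(+>\<^bsub>?F\<^esub>) ?I"
  interpret I: ideal ?I ?F by (rule F.R.genideal_ideal[OF rels])
  interpret Q: ring ?Q by (rule I.quotient_is_ring)
  interpret \<pi>: ring_hom_ring ?F ?Q ?\<pi> by (rule I.rcos_ring_hom_ring)
  note \<pi>_smult = additive_int_smult[OF free_ring_fs_algebra Q.ring_axioms I.rcos_ring_hom]
  have lF [simp]: "letter (l x) \<in> carrier ?F" for x by (rule letter_in_free_ring[OF l(1)])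
  have eqI: "?\<pi> a = ?\<pi> b" if "a \<ominus>\<^bsub>?F\<^esub> b \<in> ?I" "a \<in> carrier ?F" "b \<in> carrier ?F" for a b
    using F.R.quotient_eq_iff_same_a_r_cos[OF I.ideal_axioms that(2,3)] that(1) by simp
  have q: "?\<pi> (letter (l x)) \<otimes>\<^bsub>?Q\<^esub> ?\<pi> (letter (l x)) =
      ([int (q x)] \<cdot>\<^bsub>?Q\<^esub> \<one>\<^bsub>?Q\<^esub>) \<oplus>\<^bsub>?Q\<^esub> ([(int (q x) - 1)] \<cdot>\<^bsub>?Q\<^esub> \<one>\<^bsub>?Q\<^esub>) \<otimes>\<^bsub>?Q\<^esub> ?\<pi> (letter (l x))" for x
  proof -
    let ?l = "letter (l x)"
    have "?\<pi> (?l \<otimes>\<^bsub>?F\<^esub> ?l) = ?\<pi> (int (q x) \<odot>\<^bsub>?F\<^esub> \<one>\<^bsub>?F\<^esub> \<oplus>\<^bsub>?F\<^esub> (int (q x) - 1) \<odot>\<^bsub>?F\<^esub> ?l)"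
      using quad[of x] unfolding quadratic_rel_def by (intro eqI) (simp_all add: F.smult_closed)
    also have "\<dots> = ?\<pi> (int (q x) \<odot>\<^bsub>?F\<^esub> \<one>\<^bsub>?F\<^esub>) \<oplus>\<^bsub>?Q\<^esub> ?\<pi> ((int (q x) - 1) \<odot>\<^bsub>?F\<^esub> ?l)"
      by (rule \<pi>.hom_add) (simp_all add: F.smult_closed)
    also have "?\<pi> (int (q x) \<odot>\<^bsub>?F\<^esub> \<one>\<^bsub>?F\<^esub>) = [int (q x)] \<cdot>\<^bsub>?Q\<^esub> \<one>\<^bsub>?Q\<^esub>"
      by (subst \<pi>_smult) simp_all
    also have "?\<pi> ((int (q x) - 1) \<odot>\<^bsub>?F\<^esub> ?l) = ([(int (q x) - 1)] \<cdot>\<^bsub>?Q\<^esub> \<one>\<^bsub>?Q\<^esub>) \<otimes>\<^bsub>?Q\<^esub> ?\<pi> ?l"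
      by (subst \<pi>_smult) (simp_all add: Q.scalar_int_mult)
    finally show ?thesis by simp
  qed
  obtain \<psi> where \<psi>: "\<psi> \<in> ring_hom A ?Q" "\<And>x. \<psi> (T (dgen x)) = ?\<pi> (letter (l x))"
    by (rule universal[OF Q.scalars_int, of "\<lambda>x. ?\<pi> (letter (l x))"]) (use q in simp_all)
  interpret \<psi>: ring_hom_ring A ?Q \<psi>
    by (rule ring_hom_ringI2[OF is_ring Q.ring_axioms \<psi>(1)])
  have ev: "free_ring_eval A gen \<in> ring_hom ?F A" "\<And>y. y \<in> L \<Longrightarrow> free_ring_eval A gen (letter y) = gen y"
    using R.free_ring_eval_hom[OF gen] by auto
  interpret ev: ring_hom_ring ?F A "free_ring_eval A gen"
    by (rule ring_hom_ringI2[OF F.is_ring is_ring ev(1)])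
  show ?thesis
  proof (rule ring_presentationI[OF is_ring gen rels rel0 _ \<psi>(1)])
    have "f \<in> free_ring_eval A gen ` carrier ?F" if "f \<in> carrier A" for f
    proof (rule generated[OF _ _ _ _ _ _ that])
      show "T (dgen x) \<in> free_ring_eval A gen ` carrier ?F" for x
        using ev(2)[OF l(1)] l(2) by (intro image_eqI[of _ _ "letter (l x)"]) simp_all
      show "\<one>\<^bsub>A\<^esub> \<in> free_ring_eval A gen ` carrier ?F"
        by (intro image_eqI[of _ _ "\<one>\<^bsub>?F\<^esub>"]) simp_all
      show "\<zero>\<^bsub>A\<^esub> \<in> free_ring_eval A gen ` carrier ?F"
        by (intro image_eqI[of _ _ "\<zero>\<^bsub>?F\<^esub>"]) simp_all
      fix x y assume "x \<in> free_ring_eval A gen ` carrier ?F" 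
      then obtain a where a: "a \<in> carrier ?F" "x = free_ring_eval A gen a" by blast
      \<comment> \<open>The identity map shows that scalar multiples in \<open>A\<close> are integer
        multiples, so the image of the evaluation map is closed under them.\<close>
      have "id \<in> ring_hom A A" by (rule ring_hom_memI) auto
      then have "k \<odot>\<^bsub>A\<^esub> x = [k] \<cdot>\<^bsub>A\<^esub> x" for k
        using additive_int_smult[OF fs_algebra_axioms is_ring, of id x k] a by simp
      then show "k \<odot>\<^bsub>A\<^esub> x \<in> free_ring_eval A gen ` carrier ?F" for k
        using a F.smult_closed additive_int_smult[OF free_ring_fs_algebra is_ring ev(1) a(1), of k]
        by (intro image_eqI[of _ _ "k \<odot>\<^bsub>?F\<^esub> a"]) simp_all
      assume "y \<in> free_ring_eval A gen ` carrier ?F" 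
      then obtain b where b: "b \<in> carrier ?F" "y = free_ring_eval A gen b" by blast
      show "x \<oplus>\<^bsub>A\<^esub> y \<in> free_ring_eval A gen ` carrier ?F"
        using a b by (intro image_eqI[of _ _ "a \<oplus>\<^bsub>?F\<^esub> b"]) simp_all
      show "x \<otimes>\<^bsub>A\<^esub> y \<in> free_ring_eval A gen ` carrier ?F"
        using a b by (intro image_eqI[of _ _ "a \<otimes>\<^bsub>?F\<^esub> b"]) simp_all
    qed
    then show "free_ring_eval A gen ` carrier ?F = carrier A" by auto
  next
    fix y assume y: "y \<in> L"
    obtain ws where ws: "gen y = word_prod A (map (\<lambda>x. gen (l x)) ws)"
      "letter y \<ominus>\<^bsub>?F\<^esub> word_prod ?F (map (\<lambda>x. letter (l x)) ws) \<in> ?I" using other[OF y] by blast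
    have c: "set (map (\<lambda>x. letter (l x)) ws) \<subseteq> carrier ?F" "set (map (\<lambda>x. gen (l x)) ws) \<subseteq> carrier A"
      using l by auto
    have "\<psi> (gen y) = word_prod ?Q (map (\<lambda>x. ?\<pi> (letter (l x))) ws)"
      unfolding ws(1) using \<psi>.word_prod_hom[OF c(2)] by (simp add: o_def l \<psi>)
    also have "\<dots> = ?\<pi> (word_prod ?F (map (\<lambda>x. letter (l x)) ws))"
      using \<pi>.word_prod_hom[OF c(1)] by (simp add: o_def)
    also have "\<dots> = ?\<pi> (letter y)"
      using eqI[OF ws(2) letter_in_free_ring[OF y] F.R.word_prod_closed[OF c(1)]] by simp
    finally show "\<psi> (gen y) = ?\<pi> (letter y)" .
  qed
qed

section \<open>Change of parameters and the group algebra\<close>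

context dihedral_algebra
begin

definition affine :: "'k \<Rightarrow> 'k \<Rightarrow> bool \<Rightarrow> 'x \<Rightarrow> 'k" where
  "affine a b x = a \<odot>\<^bsub>A\<^esub> \<one>\<^bsub>A\<^esub> \<oplus>\<^bsub>A\<^esub> b \<odot>\<^bsub>A\<^esub> T (dgen x)"

lemma affine_closed [simp]: "affine a b x \<in> carrier A"
  by (simp add: affine_def smult_closed)

lemma affine_mult:
  "affine a b x \<otimes>\<^bsub>A\<^esub> affine a' b' x =
   affine (a * a' + b * b' * of_nat (q x)) (a * b' + a' * b + b * b' * (of_nat (q x) - 1)) x"
proof -
  have "basis_elt u \<in> fin_supp S" by (simp add: u_in)
  then show ?thesis
    using T_square[of x] unfolding affine_def
    by (simp add: smult_eq add_eq one_eq bilinear mult_one) (simp add: fun_eq_iff algebra_simps)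
qed

end

text \<open>The two equations compare the coefficients of \<one> and of the generator
  \<open>T\<close> of \<open>A'\<close> in \<open>X X = q + (q - 1) X\<close> for
  \<open>X = a + b T\<close>, where \<open>T\<close> has parameter \<open>q'\<close>. They say that
  the affine images satisfy the relations of \<open>A\<close>.\<close>

lemma change_parameters:
  assumes A: "dihedral_algebra A S c u \<beta> q" and A': "dihedral_algebra A' S' c' u' \<beta>' q'"
    and eq: "\<And>x. a x * a x + b x * b x * of_nat (q' x) = of_nat (q x) + (of_nat (q x) - 1) * a x"
      "\<And>x. 2 * a x * b x + b x * b x * (of_nat (q' x) - 1) = (of_nat (q x) - 1) * b x"
  obtains h where "h \<in> ring_hom A A'"
    "\<And>x. h (dihedral_algebra.T \<beta> (dgen x)) = dihedral_algebra.affine A' \<beta>' (a x) (b x) x"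
    "\<And>k f. f \<in> carrier A \<Longrightarrow> h (k \<odot>\<^bsub>A\<^esub> f) = k \<odot>\<^bsub>A'\<^esub> h f"
proof -
  interpret A: dihedral_algebra A S c u \<beta> q by (rule A)
  interpret A': dihedral_algebra A' S' c' u' \<beta>' q' by (rule A')
  let ?sc = "\<lambda>k. k \<odot>\<^bsub>A'\<^esub> \<one>\<^bsub>A'\<^esub>"
  have quad: "A'.affine (a x) (b x) x \<otimes>\<^bsub>A'\<^esub> A'.affine (a x) (b x) x =
      ?sc (of_nat (q x)) \<oplus>\<^bsub>A'\<^esub> ?sc (of_nat (q x) - 1) \<otimes>\<^bsub>A'\<^esub> A'.affine (a x) (b x) x" for x
  proof -
    have "A'.affine (a x) (b x) x \<otimes>\<^bsub>A'\<^esub> A'.affine (a x) (b x) x =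
        A'.affine (of_nat (q x) + (of_nat (q x) - 1) * a x) ((of_nat (q x) - 1) * b x) x"
      unfolding A'.affine_mult eq[symmetric] by (simp add: algebra_simps)
    also have "\<dots> = ?sc (of_nat (q x)) \<oplus>\<^bsub>A'\<^esub> (of_nat (q x) - 1) \<odot>\<^bsub>A'\<^esub> A'.affine (a x) (b x) x"
      by (simp add: A'.affine_def A'.smult_eq A'.add_eq fun_eq_iff algebra_simps)
    finally show ?thesis by (simp add: A'.scalar_mult)
  qed
  obtain h where h: "h \<in> ring_hom A A'" "\<And>x. h (A.T (dgen x)) = A'.affine (a x) (b x) x"
      "\<And>k f. f \<in> carrier A \<Longrightarrow> h (k \<odot>\<^bsub>A\<^esub> f) = ?sc k \<otimes>\<^bsub>A'\<^esub> h f"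
    by (rule A.universal[OF A'.scalars_smult_one A'.affine_closed quad]) blast
  show ?thesis
  proof (rule that[OF h(1,2)])
    show "h (k \<odot>\<^bsub>A\<^esub> f) = k \<odot>\<^bsub>A'\<^esub> h f" if "f \<in> carrier A" for k f
      using h(3)[OF that] ring_hom_closed[OF h(1) that] by (simp add: A'.scalar_mult)
  qed
qed

text \<open>For parameter 1 the term with factor \<open>q - 1\<close> vanishes, and the
  multiplication rule becomes that of group elements.\<close>

lemma monoid_algebra_D_inf:
  "dihedral_algebra (monoid_algebra D_inf :: ('k::comm_ring_1, _) module) UNIV
     (\<lambda>a b. basis_elt (a \<otimes>\<^bsub>D_inf\<^esub> b)) (0, False) id (\<lambda>_. 1)"
proof -
  have "fs_algebra (monoid_algebra D_inf :: ('k, _) module) UNIV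
     (\<lambda>a b. basis_elt (a \<otimes>\<^bsub>D_inf\<^esub> b)) (0, False)"
    using D.monoid_algebra_fs_algebra by simp
  then show ?thesis by (simp add: dihedral_algebra_def dihedral_algebra_axioms_def)
qed

text \<open>Over the complex numbers \<open>(\<Delta> - q) (\<Delta> + 1) = 0\<close> has the distinct roots \<open>q\<close> and
  \<open>-1\<close>, and the affine substitution moving them to \<open>1\<close> and \<open>-1\<close> identifies the
  algebras for all parameters.\<close>

lemma dihedral_algebra_iso_group_algebra:
  fixes A :: "(complex, 'x \<Rightarrow> complex) module"
  assumes A: "dihedral_algebra A S c u \<beta> q"
  shows "algebra_isomorphic A (monoid_algebra D_inf)"
proof -
  let ?M = "monoid_algebra D_inf :: (complex, int \<times> bool \<Rightarrow> complex) module"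
  interpret A: dihedral_algebra A S c u \<beta> q by (rule A)
  interpret M: dihedral_algebra ?M UNIV "\<lambda>a b. basis_elt (a \<otimes>\<^bsub>D_inf\<^esub> b)" "(0, False)" id "\<lambda>_. 1"
    by (rule monoid_algebra_D_inf)
  define Q :: "bool \<Rightarrow> complex" where "Q x = of_nat (q x)" for x
  \<comment> \<open>The parameters are natural numbers, so \<open>Q x + 1\<close> can serve as a
    denominator.\<close>
  have Q: "Q x + 1 \<noteq> 0" for x
    unfolding Q_def by (metis of_nat_Suc of_nat_eq_0_iff add.commute nat.simps(3))
  obtain h where h: "h \<in> ring_hom A ?M" "\<And>x. h (A.T (dgen x)) = M.affine ((Q x - 1) / 2) ((Q x + 1) / 2) x"
      "\<And>k f. f \<in> carrier A \<Longrightarrow> h (k \<odot>\<^bsub>A\<^esub> f) = k \<odot>\<^bsub>?M\<^esub> h f"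
    by (rule change_parameters[OF A monoid_algebra_D_inf,
          of "\<lambda>x. (Q x - 1) / 2" "\<lambda>x. (Q x + 1) / 2"])
       (simp_all add: Q_def field_simps)
  \<comment> \<open>The two conditions of \<open>change_parameters\<close> for the inverse
    substitution, whose source has parameter 1 and whose target has parameter
    \<open>z\<close>.\<close>
  have frac: "(1 - z) / (z + 1) * ((1 - z) / (z + 1)) + 2 / (z + 1) * (2 / (z + 1)) * z = 1"
      "2 * ((1 - z) / (z + 1)) * (2 / (z + 1)) + 2 / (z + 1) * (2 / (z + 1)) * (z - 1) = 0"
    if z: "z + 1 \<noteq> 0" for z :: complex
  proof -
    have "(1 - z) / (z + 1) * ((1 - z) / (z + 1)) + 2 / (z + 1) * (2 / (z + 1)) * z =
        ((1 - z) * (1 - z) + 4 * z) / ((z + 1) * (z + 1))"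
      by (simp add: add_divide_distrib)
    also have "(1 - z) * (1 - z) + 4 * z = (z + 1) * (z + 1)" by (simp add: algebra_simps)
    finally show "(1 - z) / (z + 1) * ((1 - z) / (z + 1)) + 2 / (z + 1) * (2 / (z + 1)) * z = 1"
      using z by simp
    have "2 * ((1 - z) / (z + 1)) * (2 / (z + 1)) + 2 / (z + 1) * (2 / (z + 1)) * (z - 1) =
        (4 * (1 - z) + 4 * (z - 1)) / ((z + 1) * (z + 1))"
      by (simp only: add_divide_distrib times_divide_eq_left times_divide_eq_right divide_divide_eq_left) simp
    then show "2 * ((1 - z) / (z + 1)) * (2 / (z + 1)) + 2 / (z + 1) * (2 / (z + 1)) * (z - 1) = 0"
      by simp
  qed
  \<comment> \<open>The two affine substitutions undo each other; \<open>o1\<close> and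
    \<open>t\<close> stand for the values of the unit and of a generator at one point.\<close>
  have inverse_affine: "(z - 1) / 2 * o1 + (z + 1) / 2 * ((1 - z) / (z + 1) * o1 + 2 / (z + 1) * t) = t"
      "(1 - z) / (z + 1) * o1 + 2 / (z + 1) * ((z - 1) / 2 * o1 + (z + 1) / 2 * t) = t"
    if z: "z + 1 \<noteq> 0" for z o1 t :: complex
  proof -
    define w where "w = inverse (z + 1)"
    have w: "(z + 1) * w = 1" using z by (simp add: w_def)
    have "(z - 1) / 2 * o1 + (z + 1) / 2 * ((1 - z) * w * o1 + 2 * w * t) =
        (z - 1) / 2 * o1 + ((z + 1) * w) * ((1 - z) / 2 * o1 + t)"
      by (simp add: field_simps)
    also have "\<dots> = t" unfolding w by (simp add: field_simps)
    finally show "(z - 1) / 2 * o1 + (z + 1) / 2 * ((1 - z) / (z + 1) * o1 + 2 / (z + 1) * t) = t"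
      by (simp only: divide_inverse w_def)
    have "(1 - z) * w * o1 + 2 * w * ((z - 1) / 2 * o1 + (z + 1) / 2 * t) = ((z + 1) * w) * t"
      by (simp add: field_simps)
    then show "(1 - z) / (z + 1) * o1 + 2 / (z + 1) * ((z - 1) / 2 * o1 + (z + 1) / 2 * t) = t"
      unfolding w by (simp only: divide_inverse w_def mult_1)
  qed
  obtain h' where h': "h' \<in> ring_hom ?M A" "\<And>x. h' (M.T (dgen x)) = A.affine ((1 - Q x) / (Q x + 1)) (2 / (Q x + 1)) x"
      "\<And>k f. f \<in> carrier ?M \<Longrightarrow> h' (k \<odot>\<^bsub>?M\<^esub> f) = k \<odot>\<^bsub>A\<^esub> h' f"
    by (rule change_parameters[OF monoid_algebra_D_inf A,
          of "\<lambda>x. (1 - Q x) / (Q x + 1)" "\<lambda>x. 2 / (Q x + 1)"])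
       (use frac[OF Q] in \<open>simp_all add: Q_def[symmetric]\<close>)
  interpret h: ring_hom_ring A ?M h by (rule ring_hom_ringI2[OF A.is_ring M.is_ring h(1)])
  interpret h': ring_hom_ring ?M A h' by (rule ring_hom_ringI2[OF M.is_ring A.is_ring h'(1)])
  have 1: "h' (h f) = f" if f: "f \<in> carrier A" for f
  proof -
    have "(h' \<circ> h) f = id f"
    proof (rule A.linear_hom_eq[OF A.is_ring ring_hom_trans[OF h(1) h'(1)], where act = "smult A"])
      show "id \<in> ring_hom A A" by (rule ring_hom_memI) auto
      fix x
      have "(h' \<circ> h) (A.T (dgen x)) = ((Q x - 1) / 2) \<odot>\<^bsub>A\<^esub> \<one>\<^bsub>A\<^esub> \<oplus>\<^bsub>A\<^esub>
          ((Q x + 1) / 2) \<odot>\<^bsub>A\<^esub> A.affine ((1 - Q x) / (Q x + 1)) (2 / (Q x + 1)) x"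
        unfolding o_apply h(2) M.affine_def by (simp add: h' M.smult_closed)
      also have "\<dots> = A.T (dgen x)"
        unfolding A.affine_def A.smult_eq A.add_eq by (rule ext) (rule inverse_affine(1)[OF Q])
      finally show "(h' \<circ> h) (A.T (dgen x)) = id (A.T (dgen x))" by simp
    qed (use f in \<open>simp_all add: h h'\<close>)
    then show ?thesis by simp
  qed
  have 2: "h (h' f) = f" if f: "f \<in> carrier ?M" for f
  proof -
    have "(h \<circ> h') f = id f"
    proof (rule M.linear_hom_eq[OF M.is_ring ring_hom_trans[OF h'(1) h(1)], where act = "smult ?M"])
      show "id \<in> ring_hom ?M ?M" by (rule ring_hom_memI) auto
      fix x
      have "(h \<circ> h') (M.T (dgen x)) = ((1 - Q x) / (Q x + 1)) \<odot>\<^bsub>?M\<^esub> \<one>\<^bsub>?M\<^esub> \<oplus>\<^bsub>?M\<^esub>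
          (2 / (Q x + 1)) \<odot>\<^bsub>?M\<^esub> M.affine ((Q x - 1) / 2) ((Q x + 1) / 2) x"
        unfolding o_apply h'(2) A.affine_def by (simp add: h A.smult_closed)
      also have "\<dots> = M.T (dgen x)"
        unfolding M.affine_def M.smult_eq M.add_eq by (rule ext) (rule inverse_affine(2)[OF Q])
      finally show "(h \<circ> h') (M.T (dgen x)) = id (M.T (dgen x))" by simp
    qed (use f in \<open>simp_all add: h h'\<close>)
    then show ?thesis by simp
  qed
  have "bij_betw h (carrier A) (carrier ?M)"
    by (rule bij_betwI[where g = h']) (auto simp: 1 2)
  then show ?thesis
    unfolding algebra_isomorphic_def ring_iso_def using h by (auto intro!: bexI[of _ h])
qed

section \<open>Distances and ends in trees\<close>

locale bip_tree =
  fixes V Ve Vo :: "'v set" and E :: "'v set set"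
  assumes is_tree: "tree V E" and bip: "bipartition V E Ve Vo"
begin

text \<open>A relation instead of a set of edges, so that walks of length \<open>n\<close> are
  \<open>adj ^^ n\<close>.\<close>

definition adj :: "('v \<times> 'v) set" where
  "adj = {(u, v). {u, v} \<in> E}"

lemma adj_iff: "(u, v) \<in> adj \<longleftrightarrow> {u, v} \<in> E"
  by (simp add: adj_def)

lemma adj_sym: "(u, v) \<in> adj \<Longrightarrow> (v, u) \<in> adj"
  by (simp add: adj_iff insert_commute)

lemma edge_props: "a \<in> E \<Longrightarrow> a \<subseteq> V" "a \<in> E \<Longrightarrow> card a = 2"
  using is_tree by (auto simp: tree_def simple_graph_def)

lemma adj_props: "(u, v) \<in> adj \<Longrightarrow> u \<in> V" "(u, v) \<in> adj \<Longrightarrow> v \<in> V" "(u, v) \<in> adj \<Longrightarrow> u \<noteq> v"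
  using edge_props[of "{u, v}"] by (auto simp: adj_iff card_2_iff doubleton_eq_iff split: if_splits)

lemma types: "Ve \<union> Vo = V" "Ve \<inter> Vo = {}"
  using bip by (auto simp: bipartition_def)

lemma adj_types:
  assumes "(u, v) \<in> adj"
  shows "u \<in> Ve \<longleftrightarrow> v \<notin> Ve"
proof -
  have "{u, v} \<inter> Ve \<noteq> {}" "{u, v} \<inter> Vo \<noteq> {}"
    using bip assms by (auto simp: bipartition_def adj_iff)
  then show ?thesis using types by auto
qed

lemma relpow_adj_sym: "(u, v) \<in> adj ^^ n \<Longrightarrow> (v, u) \<in> adj ^^ n"
proof (induction n arbitrary: u v)
  case (Suc n)
  then obtain w where "(u, w) \<in> adj ^^ n" "(w, v) \<in> adj" by auto
  then have "(v, w) \<in> adj" "(w, u) \<in> adj ^^ n" using Suc.IH adj_sym by auto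
  then show ?case by (rule relpow_Suc_I2)
qed simp

lemma relpow_adj_types: "(u, v) \<in> adj ^^ n \<Longrightarrow> (u \<in> Ve \<longleftrightarrow> v \<in> Ve) \<longleftrightarrow> even n"
proof (induction n arbitrary: v)
  case (Suc n)
  then obtain w where w: "(u, w) \<in> adj ^^ n" "(w, v) \<in> adj" by auto
  show ?case using Suc.IH[OF w(1)] adj_types[OF w(2)] by auto
qed simp

lemma relpow_adj_V: "(u, v) \<in> adj ^^ n \<Longrightarrow> u \<in> V \<Longrightarrow> v \<in> V"
  by (cases n) (auto dest: adj_props)

lemma connected:
  assumes "u \<in> V" "v \<in> V"
  shows "\<exists>n. (u, v) \<in> adj ^^ n"
proof (cases "u = v")
  case False
  then obtain xs where xs: "walk E xs" "hd xs = u" "last xs = v"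
    using is_tree assms by (auto simp: tree_def connected_graph_def)
  have "xs \<noteq> [] \<Longrightarrow> successively (\<lambda>u v. {u, v} \<in> E) xs \<Longrightarrow> (hd xs, last xs) \<in> adj\<^sup>*" for xs
  proof (induction xs rule: induct_list012)
    case (3 x y zs)
    then have "(y, last (y # zs)) \<in> adj\<^sup>*" "(x, y) \<in> adj" by (auto simp: adj_iff)
    then show ?case by (simp add: converse_rtrancl_into_rtrancl)
  qed auto
  then have "(u, v) \<in> adj\<^sup>*" using xs by (auto simp: walk_def)
  then show ?thesis by (simp add: rtrancl_power)
qed (auto intro: exI[of _ 0])

definition d :: "'v \<Rightarrow> 'v \<Rightarrow> nat" where
  "d u v = (LEAST n. (u, v) \<in> adj ^^ n)"

lemma d_relpow: "u \<in> V \<Longrightarrow> v \<in> V \<Longrightarrow> (u, v) \<in> adj ^^ d u v"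
  unfolding d_def using connected[of u v] by (auto intro: LeastI)

lemma d_le: "(u, v) \<in> adj ^^ n \<Longrightarrow> d u v \<le> n"
  unfolding d_def by (rule Least_le)

lemma d_self [simp]: "d u u = 0"
  using d_le[of u u 0] by simp

lemma d_eq_0: "u \<in> V \<Longrightarrow> v \<in> V \<Longrightarrow> d u v = 0 \<longleftrightarrow> u = v"
  using d_relpow[of u v] by auto

lemma d_sym: "u \<in> V \<Longrightarrow> v \<in> V \<Longrightarrow> d u v = d v u"
  using d_le[OF relpow_adj_sym[OF d_relpow]] by (simp add: antisym)

text \<open>Extending a walk by an edge changes the distance by at most one, and the bipartition
  fixes the parity of walks between given vertices, so neighbours are never equidistant from
  \<open>u\<close>.\<close>

lemma d_adj:
  assumes u: "u \<in> V" and vw: "(v, w) \<in> adj"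
  shows "d u w = d u v + 1 \<or> d u v = d u w + 1"
proof -
  have V: "v \<in> V" "w \<in> V" using vw adj_props by auto
  have "(u, w) \<in> adj ^^ Suc (d u v)" "(u, v) \<in> adj ^^ Suc (d u w)"
    using d_relpow[OF u V(1)] d_relpow[OF u V(2)] vw adj_sym[OF vw] by auto
  then have "d u w \<le> Suc (d u v)" "d u v \<le> Suc (d u w)" using d_le by blast+
  moreover have "d u v \<noteq> d u w"
    using relpow_adj_types[OF d_relpow[OF u V(1)]] relpow_adj_types[OF d_relpow[OF u V(2)]] adj_types[OF vw]
    by auto
  ultimately show ?thesis by linarith
qed

lemma closer_exists:
  assumes "u \<in> V" "v \<in> V" "u \<noteq> v"
  shows "\<exists>w. (v, w) \<in> adj \<and> d u v = d u w + 1"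
proof -
  obtain n where n: "d u v = Suc n" using d_eq_0[OF assms(1,2)] assms(3) by (cases "d u v") auto
  then obtain w where w: "(u, w) \<in> adj ^^ n" "(w, v) \<in> adj" using d_relpow[OF assms(1,2)] by auto
  then have "d u w \<le> n" using d_le by blast
  then show ?thesis using d_adj[OF assms(1) w(2)] n adj_sym[OF w(2)] by (intro exI[of _ w]) auto
qed

text \<open>Two neighbours of \<open>v\<close> closer to \<open>u\<close> continue to paths towards \<open>u\<close>, which
  together with \<open>v\<close> form a circuit up to the vertex where they meet.\<close>

lemma closer_unique:
  assumes u: "u \<in> V" and w: "(v, w) \<in> adj" "d u v = d u w + 1" and w': "(v, w') \<in> adj" "d u v = d u w' + 1"
  shows "w = w'"
proof (rule ccontr)
  assume neq: "w \<noteq> w'"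
  define par where "par x = (SOME y. (x, y) \<in> adj \<and> d u x = d u y + 1)" for x
  have par: "(x, par x) \<in> adj" "d u x = d u (par x) + 1" if "x \<in> V" "d u x \<noteq> 0" for x
  proof -
    have "u \<noteq> x" using that(2) by auto
    then have "(x, par x) \<in> adj \<and> d u x = d u (par x) + 1"
      unfolding par_def by (intro someI_ex[OF closer_exists[OF u that(1)]])
    then show "(x, par x) \<in> adj" "d u x = d u (par x) + 1" by simp_all
  qed
  define k where "k = d u w"
  have p: "i \<le> k \<Longrightarrow> (par ^^ i) x \<in> V \<and> d u ((par ^^ i) x) = k - i"
    if "x \<in> V" "d u x = k" for x i
  proof (induction i)
    case (Suc i)
    then have "d u ((par ^^ i) x) \<noteq> 0" "(par ^^ i) x \<in> V" by auto
    from par[OF this(2,1)] show ?case using Suc adj_props(2) by auto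
  qed (use that in auto)
  have wV: "w \<in> V" "d u w = k" "w' \<in> V" "d u w' = k" using w w' adj_props k_def by auto
  let ?p = "\<lambda>i. (par ^^ i) w" and ?q = "\<lambda>i. (par ^^ i) w'"
  note pp = p[OF wV(1,2)] and qq = p[OF wV(3,4)]
  have step: "((par ^^ i) x, (par ^^ Suc i) x) \<in> adj" if "x \<in> V" "d u x = k" "i < k" for x i
    using par(1)[of "(par ^^ i) x"] p[OF that(1,2), of i] that(3) by simp
  have meet: "?p k = ?q k"
    using pp[of k] qq[of k] d_eq_0[OF u] by auto
  \<comment> \<open>Both paths reach \<open>u\<close> after \<open>k\<close> steps, so they meet.
    Comparing equal indices suffices, because the index is determined by the distance to
    \<open>u\<close>.\<close>
  define j where "j = (LEAST i. ?p i = ?q i)"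
  have j: "?p j = ?q j" unfolding j_def by (rule LeastI[of _ k]) (rule meet)
  have jk: "j \<le> k" unfolding j_def by (rule Least_le) (rule meet)
  have jmin: "?p i \<noteq> ?q i" if "i < j" for i using that not_less_Least unfolding j_def by blast
  have j0: "j > 0" using j neq by (cases j) auto
  \<comment> \<open>From \<open>v\<close> down the first path to the meeting point and back up the
    second. As \<open>w \<noteq> w'\<close>, the index \<open>j\<close> is positive, so there are at
    least three vertices.\<close>
  let ?xs = "v # map ?p [0..<Suc j] @ rev (map ?q [0..<j])"
  have a: "inj_on ?p {0..<Suc j}"
    by (rule inj_onI) (use pp jk in \<open>metis atLeastLessThan_iff diff_diff_cancel le_trans less_Suc_eq_le\<close>)
  have b: "inj_on ?q {0..<j}"
    by (rule inj_onI) (use qq jk in \<open>metis atLeastLessThan_iff diff_diff_cancel le_trans less_imp_le\<close>)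
  have c: "?p a \<noteq> ?q b" if "a < Suc j" "b < j" for a b
  proof
    assume eq: "?p a = ?q b"
    then have "k - a = k - b" using pp[of a] qq[of b] that jk by auto
    then have "a = b" using that jk by auto
    then show False using jmin[OF that(2)] eq by simp
  qed
  have v: "?p a \<noteq> v" "?q a \<noteq> v" if "a < Suc j" for a
    using pp[of a] qq[of a] that jk w(2) k_def by auto
  have disj: "?p ` {0..<Suc j} \<inter> ?q ` {0..<j} = {}"
  proof (rule equals0I)
    fix y assume "y \<in> ?p ` {0..<Suc j} \<inter> ?q ` {0..<j}"
    then obtain m n where "m < Suc j" "n < j" "y = ?p m" "y = ?q n" by auto
    then show False using c[of m n] by simp
  qed
  have nv: "v \<notin> ?p ` {0..<Suc j}" "v \<notin> ?q ` {0..<j}"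
  proof -
    show "v \<notin> ?p ` {0..<Suc j}"
    proof
      assume "v \<in> ?p ` {0..<Suc j}"
      then obtain m where "m < Suc j" "v = ?p m" by auto
      then show False using v(1)[of m] by simp
    qed
    show "v \<notin> ?q ` {0..<j}"
    proof
      assume "v \<in> ?q ` {0..<j}"
      then obtain m where "m < j" "v = ?q m" by auto
      then show False using v(2)[of m] by simp
    qed
  qed
  have "distinct ?xs"
    unfolding distinct.simps distinct_append distinct_rev set_append set_rev set_map set_upt distinct_map
    using a b disj nv by (simp del: upt_Suc)
  moreover have "walk E ?xs"
  proof -
    have "successively (\<lambda>u v. {u, v} \<in> E) (map ?p [0..<Suc j])"
      unfolding successively_conv_nth using step[OF wV(1,2)] jk by (auto simp: adj_iff simp del: upt_Suc)
    moreover have "successively (\<lambda>u v. {u, v} \<in> E) (map ?q [0..<j])"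
      unfolding successively_conv_nth using step[OF wV(3,4)] jk by (auto simp: adj_iff)
    then have "successively (\<lambda>u v. {u, v} \<in> E) (rev (map ?q [0..<j]))"
      by (simp only: successively_rev insert_commute)
    moreover have "{?p j, last (map ?q [0..<j])} \<in> E"
    proof -
      obtain n where n: "j = Suc n" using j0 by (cases j) auto
      then have "last (map ?q [0..<j]) = ?q n" by simp
      moreover have "(?q n, ?q (Suc n)) \<in> adj" using step[OF wV(3,4), of n] jk n by simp
      then have "(?q (Suc n), ?q n) \<in> adj" by (rule adj_sym)
      ultimately show ?thesis using j n by (simp only: adj_iff)
    qed
    moreover have "hd (rev (map ?q [0..<j])) = last (map ?q [0..<j])" by (rule hd_rev)
    moreover have "last (map ?p [0..<Suc j]) = ?p j" by simp
    moreover have "hd (map ?p [0..<Suc j]) = w" by (simp add: hd_map del: upt_Suc)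
    moreover have "{v, w} \<in> E" using w(1) by (simp add: adj_iff)
    ultimately show ?thesis unfolding walk_def
      by (simp only: successively_Cons successively_append_iff hd_append) auto
  qed
  moreover have "last ?xs = w'"
  proof -
    have "last ?xs = last (rev (map ?q [0..<j]))" using j0 by simp
    also have "\<dots> = w'" using j0 by (simp add: last_rev hd_map)
    finally show ?thesis .
  qed
  then have "{last ?xs, hd ?xs} \<in> E" using adj_sym[OF w'(1)] by (simp only: adj_iff list.sel)
  moreover have "3 \<le> length ?xs" using j0 by simp
  ultimately have "circuit E ?xs" unfolding circuit_def by blast
  then show False using is_tree unfolding tree_def by blast
qed

text \<open>A vertex at distance \<open>n + 1\<close> has a neighbour in the ball of radius
  \<open>n\<close>, and each member of that ball has finitely many neighbours.\<close>

lemma finite_ball: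
  assumes lf: "locally_finite V E" and u: "u \<in> V"
  shows "finite {v \<in> V. d u v \<le> n}"
proof (induction n)
  case 0
  have "{v \<in> V. d u v \<le> 0} \<subseteq> {u}" using d_eq_0[OF u] by auto
  then show ?case by (rule finite_subset) simp
next
  case (Suc n)
  have fin: "finite {w. (v, w) \<in> adj}" if "v \<in> V" for v
  proof -
    have "finite a" if "a \<in> E" for a
      using edge_props(2)[OF that] card.infinite[of a] by fastforce
    then have "finite (\<Union>{a \<in> E. v \<in> a})"
      using lf that by (intro finite_Union) (auto simp: locally_finite_def)
    then show ?thesis by (rule rev_finite_subset) (auto simp: adj_iff)
  qed
  have "{v \<in> V. d u v \<le> Suc n} \<subseteq> {v \<in> V. d u v \<le> n} \<union> (\<Union>v\<in>{v \<in> V. d u v \<le> n}. {w. (v, w) \<in> adj})"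
  proof
    fix v assume v: "v \<in> {v \<in> V. d u v \<le> Suc n}"
    show "v \<in> {v \<in> V. d u v \<le> n} \<union> (\<Union>v\<in>{v \<in> V. d u v \<le> n}. {w. (v, w) \<in> adj})"
    proof (cases "d u v \<le> n")
      case False
      then have "u \<noteq> v" by auto
      then obtain w where "(v, w) \<in> adj" "d u v = d u w + 1" using closer_exists[OF u] v by auto
      then have "w \<in> {v \<in> V. d u v \<le> n}" "(w, v) \<in> adj"
        using v adj_sym[of v w] adj_props(2)[of v w] by auto
      then show ?thesis by blast
    qed (use v in simp)
  qed
  then show ?case by (rule finite_subset) (use Suc fin in auto)
qed

lemma relpow_adj_map:
  assumes f: "\<And>u v. (u, v) \<in> adj \<Longrightarrow> (f u, f v) \<in> adj" and "(u, v) \<in> adj ^^ n"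
  shows "(f u, f v) \<in> adj ^^ n"
  using assms(2) by (induction n arbitrary: v) (auto intro!: relcompI f)

text \<open>Adjacency-preserving maps carry walks to walks of the same length, and the parity of the
  length tells whether two vertices have equal type. So types are kept everywhere or exchanged
  everywhere.\<close>

lemma types_map:
  assumes f: "\<And>u v. (u, v) \<in> adj \<Longrightarrow> (f u, f v) \<in> adj" and V: "u \<in> V" "v \<in> V"
  shows "(f u \<in> Ve \<longleftrightarrow> u \<in> Ve) \<longleftrightarrow> (f v \<in> Ve \<longleftrightarrow> v \<in> Ve)"
  using relpow_adj_types[OF d_relpow[OF V]]
    relpow_adj_types[OF relpow_adj_map[where f = f, OF f d_relpow[OF V]]] by blast

end

section \<open>Retraction onto a line\<close>

locale tree_line = bip_tree V Ve Vo E
  for V Ve Vo :: "'v set" and E +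
  fixes \<gamma> :: "int \<Rightarrow> 'v"
  assumes inj_\<gamma>: "inj \<gamma>" and adj_\<gamma>: "\<And>k. (\<gamma> k, \<gamma> (k + 1)) \<in> adj"
begin

lemma \<gamma>_V [simp]: "\<gamma> k \<in> V"
  using adj_\<gamma> adj_props by blast

lemma \<gamma>_eq [simp]: "\<gamma> j = \<gamma> k \<longleftrightarrow> j = k"
  using inj_\<gamma> by (simp add: inj_eq)

lemma adj_\<gamma>_iff: "k = j + 1 \<or> j = k + 1 \<Longrightarrow> (\<gamma> j, \<gamma> k) \<in> adj"
  using adj_\<gamma> adj_sym by blast

text \<open>Folding around the edge from \<open>\<gamma> 0\<close> to \<open>\<gamma> 1\<close>: the
  nearer end decides the side, the distance to \<open>\<gamma> 0\<close> the position. Only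
  distances to these two ends enter, which makes the map invariant under automorphisms fixing
  both.\<close>

definition \<rho> :: "'v \<Rightarrow> int" where
  "\<rho> v = (if d (\<gamma> 1) v < d (\<gamma> 0) v then int (d (\<gamma> 0) v) else - int (d (\<gamma> 0) v))"

lemma adj01: "(\<gamma> 0, \<gamma> 1) \<in> adj"
  using adj_\<gamma>[of 0] by simp

lemma d01: "v \<in> V \<Longrightarrow> d (\<gamma> 1) v = d (\<gamma> 0) v + 1 \<or> d (\<gamma> 0) v = d (\<gamma> 1) v + 1"
  using d_adj[of v "\<gamma> 0" "\<gamma> 1"] adj01 d_sym[of v] by simp

lemma \<rho>_0: "v \<in> V \<Longrightarrow> \<rho> v = 0 \<longleftrightarrow> v = \<gamma> 0"
  using d01[of v] d_eq_0[of "\<gamma> 0" v] by (auto simp: \<rho>_def)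

lemma \<rho>_1: "v \<in> V \<Longrightarrow> \<rho> v = 1 \<longleftrightarrow> v = \<gamma> 1"
  using d01[of v] d_eq_0[of "\<gamma> 1" v] by (auto simp: \<rho>_def)

lemma \<rho>_01 [simp]: "\<rho> (\<gamma> 0) = 0" "\<rho> (\<gamma> 1) = 1"
  by (simp_all add: \<rho>_0 \<rho>_1)

lemma \<rho>_reverse: "v \<in> V \<Longrightarrow> \<rho> v = 1 - (if d (\<gamma> 0) v < d (\<gamma> 1) v then int (d (\<gamma> 1) v) else - int (d (\<gamma> 1) v))"
  using d01[of v] by (auto simp: \<rho>_def)

text \<open>If \<open>v\<close> were not \<open>\<gamma> 1\<close>, its step towards
  \<open>\<gamma> 1\<close> would also lead towards \<open>\<gamma> 0\<close>, as does the step to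
  \<open>w\<close>. By uniqueness of the closer neighbour the two steps would coincide, although
  \<open>w\<close> is farther from \<open>\<gamma> 1\<close>.\<close>

lemma crossing:
  assumes vw: "(v, w) \<in> adj" and v: "d (\<gamma> 1) v < d (\<gamma> 0) v" and w: "d (\<gamma> 0) w < d (\<gamma> 1) w"
  shows "v = \<gamma> 1 \<and> w = \<gamma> 0"
proof -
  have V: "v \<in> V" "w \<in> V" using vw adj_props by auto
  note n = d01[OF V(1)] d01[OF V(2)] d_adj[OF \<gamma>_V[of 0] vw] d_adj[OF \<gamma>_V[of 1] vw]
  have eq: "d (\<gamma> 0) v = d (\<gamma> 0) w + 1" "d (\<gamma> 1) w = d (\<gamma> 1) v + 1" "d (\<gamma> 0) w = d (\<gamma> 1) v"
    using v w n by arith+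
  have "v = \<gamma> 1"
  proof (rule ccontr)
    assume "v \<noteq> \<gamma> 1"
    then obtain x where x: "(v, x) \<in> adj" "d (\<gamma> 1) v = d (\<gamma> 1) x + 1"
      using closer_exists[OF \<gamma>_V[of 1] V(1)] by auto
    have "x \<in> V" using x(1) adj_props by auto
    then have "d (\<gamma> 0) v = d (\<gamma> 0) x + 1"
      using d_adj[OF \<gamma>_V[of 0] x(1)] d01[of x] n(1) v x(2) by arith
    then have "x = w" by (rule closer_unique[OF \<gamma>_V x(1) _ vw eq(1)])
    then show False using x eq by simp
  qed
  then have "d (\<gamma> 0) w = 0" using eq by simp
  then show ?thesis using \<open>v = \<gamma> 1\<close> d_eq_0[OF \<gamma>_V[of 0] V(2)] by auto
qed

lemma \<rho>_adj:
  assumes vw: "(v, w) \<in> adj"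
  shows "\<rho> w = \<rho> v + 1 \<or> \<rho> v = \<rho> w + 1"
proof -
  have V: "v \<in> V" "w \<in> V" using vw adj_props by auto
  consider "d (\<gamma> 1) v < d (\<gamma> 0) v \<longleftrightarrow> d (\<gamma> 1) w < d (\<gamma> 0) w"
    | "d (\<gamma> 1) v < d (\<gamma> 0) v" "d (\<gamma> 0) w < d (\<gamma> 1) w" | "d (\<gamma> 1) w < d (\<gamma> 0) w" "d (\<gamma> 0) v < d (\<gamma> 1) v"
    using d01[OF V(1)] d01[OF V(2)] by linarith
  then show ?thesis
  proof cases
    case 1
    then show ?thesis using d_adj[OF \<gamma>_V[of 0] vw] by (auto simp: \<rho>_def)
  next
    case 2
    then show ?thesis using crossing[OF vw 2] by simp
  next
    case 3
    then show ?thesis using crossing[OF adj_sym[OF vw] 3] by simp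
  qed
qed

text \<open>The direction from \<open>v\<close> towards the central edge in the folded picture. At
  positions 0 and 1 the step across that edge counts as inner, so both halves of the line are
  treated symmetrically.\<close>

definition inner :: "'v \<Rightarrow> 'v \<Rightarrow> bool" where
  "inner v w \<longleftrightarrow> (\<rho> v \<ge> 1 \<and> \<rho> w = \<rho> v - 1) \<or> (\<rho> v \<le> 0 \<and> \<rho> w = \<rho> v + 1)"

text \<open>Moving inwards means approaching \<open>\<gamma> 0\<close>, where the closer neighbour
  is unique. The exception is \<open>\<rho> v = 0\<close>, where it means moving to
  \<open>\<gamma> 1\<close>, the only vertex with value 1.\<close>

lemma inner_unique:
  assumes vw: "(v, w) \<in> adj" and vw': "(v, w') \<in> adj" and i: "inner v w" "inner v w'"
  shows "w = w'"
proof (cases "\<rho> v = 0")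
  case True
  have "w \<in> V" "w' \<in> V" using vw vw' adj_props by auto
  moreover have "\<rho> w = 1" "\<rho> w' = 1" using i True by (auto simp: inner_def)
  ultimately show ?thesis using \<rho>_1 by auto
next
  case False
  have abs: "int (d (\<gamma> 0) x) = \<bar>\<rho> x\<bar>" for x by (simp add: \<rho>_def)
  have "d (\<gamma> 0) v = d (\<gamma> 0) w + 1" "d (\<gamma> 0) v = d (\<gamma> 0) w' + 1"
    using abs[of v] abs[of w] abs[of w'] i False by (auto simp: inner_def)
  then show ?thesis using closer_unique[OF \<gamma>_V[of 0] vw _ vw'] by blast
qed

lemma inner_exists:
  assumes "v \<in> V" "\<rho> v \<ge> 1"
  shows "\<exists>w. (v, w) \<in> adj \<and> \<rho> w = \<rho> v - 1"
proof -
  have "v \<noteq> \<gamma> 0" using assms by auto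
  then obtain w where w: "(v, w) \<in> adj" "d (\<gamma> 0) v = d (\<gamma> 0) w + 1"
    using closer_exists[OF \<gamma>_V assms(1), of 0] by auto
  then have "\<bar>\<rho> w\<bar> = \<bar>\<rho> v\<bar> - 1" by (auto simp: \<rho>_def split: if_splits)
  then have "\<rho> w = \<rho> v - 1" using \<rho>_adj[OF w(1)] assms(2) by auto
  then show ?thesis using w by blast
qed

text \<open>A path without backtracking that has started to move outwards keeps doing so.\<close>

lemma outward:
  assumes adj: "\<And>n::nat. (f n, f (Suc n)) \<in> adj" and ne: "\<And>n. f (Suc (Suc n)) \<noteq> f n"
    and start: "\<rho> (f 0) \<ge> 0" "\<rho> (f 1) = \<rho> (f 0) + 1"
  shows "\<rho> (f n) = \<rho> (f 0) + int n"
proof -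
  have "\<rho> (f n) = \<rho> (f 0) + int n \<and> \<rho> (f (Suc n)) = \<rho> (f 0) + int (Suc n)"
  proof (induction n)
    case (Suc n)
    have "\<rho> (f (Suc (Suc n))) \<noteq> \<rho> (f n)"
    proof
      assume "\<rho> (f (Suc (Suc n))) = \<rho> (f n)"
      then have "inner (f (Suc n)) (f (Suc (Suc n)))" "inner (f (Suc n)) (f n)"
        using Suc start by (auto simp: inner_def)
      then show False using inner_unique[OF adj[of "Suc n"] adj_sym[OF adj[of n]]] ne[of n] by simp
    qed
    then show ?case using Suc \<rho>_adj[OF adj[of "Suc n"]] by auto
  qed (use start in simp)
  then show ?thesis by simp
qed

text \<open>Reversal about the midpoint of the central edge exchanges the two halves of the line, so
  arguments can be given for the positive half and transported.\<close>

lemma tree_line_reverse: "tree_line V Ve Vo E (\<lambda>k. \<gamma> (1 - k))"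
proof
  show "inj (\<lambda>k. \<gamma> (1 - k))" by (auto intro!: injI)
  show "(\<gamma> (1 - k), \<gamma> (1 - (k + 1))) \<in> adj" for k by (rule adj_\<gamma>_iff) simp
qed

lemma reverse_\<rho>: "v \<in> V \<Longrightarrow> tree_line.\<rho> E (\<lambda>k. \<gamma> (1 - k)) v = 1 - \<rho> v"
  using \<rho>_reverse[of v] by (simp add: tree_line.\<rho>_def[OF tree_line_reverse])

lemma \<rho>_\<gamma>_nonneg: "\<rho> (\<gamma> (int n)) = int n"
  using outward[of "\<lambda>n. \<gamma> (int n)" n] adj_\<gamma>_iff by simp

lemma \<rho>_\<gamma> [simp]: "\<rho> (\<gamma> k) = k"
proof (cases "k \<ge> 0")
  case True
  then show ?thesis using \<rho>_\<gamma>_nonneg[of "nat k"] by simp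
next
  case False
  interpret r: tree_line V Ve Vo E "\<lambda>k. \<gamma> (1 - k)" by (rule tree_line_reverse)
  show ?thesis using r.\<rho>_\<gamma>_nonneg[of "nat (1 - k)"] reverse_\<rho>[of "\<gamma> k"] False by simp
qed

lemma descending_path:
  assumes "v \<in> V" "\<rho> v = int m"
  shows "\<exists>f. f m = v \<and> (\<forall>j<m. (f j, f (Suc j)) \<in> adj) \<and> (\<forall>j\<le>m. \<rho> (f j) = int j)"
  using assms
proof (induction m arbitrary: v)
  case 0
  then show ?case by (intro exI[of _ "\<lambda>_. v"]) simp
next
  case (Suc m)
  then obtain w where w: "(v, w) \<in> adj" "\<rho> w = int m" using inner_exists[of v] by auto
  then obtain f where f: "f m = w" "\<forall>j<m. (f j, f (Suc j)) \<in> adj" "\<forall>j\<le>m. \<rho> (f j) = int j"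
    using Suc.IH[of w] adj_props(2) by blast
  then show ?case using w adj_sym[OF w(1)] Suc.prems
    by (intro exI[of _ "f(Suc m := v)"]) (auto simp: less_Suc_eq le_Suc_eq)
qed

text \<open>The new line is glued from the part of \<gamma> before 0, a path from
  \<open>\<gamma> 0\<close> through \<open>\<gamma> 1\<close> to \<open>\<beta> 0\<close>, and the
  ray of \<beta>, which keeps moving away by \<open>outward\<close>. The values of \<rho> increase
  by one at each step, so no vertex is repeated.\<close>

lemma common_line_positive:
  fixes \<beta> :: "int \<Rightarrow> 'v"
  assumes \<beta>: "\<And>k. (\<beta> k, \<beta> (k + 1)) \<in> adj" "inj \<beta>" and m: "\<rho> (\<beta> 0) \<ge> 1" "\<rho> (\<beta> 1) = \<rho> (\<beta> 0) + 1"
  shows "\<exists>\<delta> m. tree_line V Ve Vo E \<delta> \<and> \<delta> 0 = \<gamma> 0 \<and> \<delta> 1 = \<gamma> 1 \<and> \<delta> m = \<beta> 0 \<and> \<delta> (m + 1) = \<beta> 1"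
proof -
  define m where "m = nat (\<rho> (\<beta> 0))"
  have m': "\<rho> (\<beta> 0) = int m" "m \<ge> 1" using m by (auto simp: m_def)
  have \<beta>V: "\<beta> 0 \<in> V" using \<beta>(1) adj_props by blast
  obtain f where f: "f m = \<beta> 0" "\<And>j. j < m \<Longrightarrow> (f j, f (Suc j)) \<in> adj" "\<And>j. j \<le> m \<Longrightarrow> \<rho> (f j) = int j"
    using descending_path[OF \<beta>V m'(1)] by blast
  have ray: "\<rho> (\<beta> (int n)) = int m + int n" for n
  proof -
    have "(\<beta> (int n), \<beta> (int (Suc n))) \<in> adj" for n using \<beta>(1)[of "int n"] by (simp add: add.commute)
    then show ?thesis
      using outward[of "\<lambda>n. \<beta> (int n)" n] \<beta>(2) m m' by (simp add: inj_eq)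
  qed
  define \<delta> where "\<delta> j = (if j < 0 then \<gamma> j else if j \<le> int m then f (nat j) else \<beta> (j - int m))" for j
  have fV: "f j \<in> V" if "j \<le> m" for j
    using f(1) f(2)[of j] \<beta>V that adj_props(1) by (cases "j = m") auto
  have f0: "f 0 = \<gamma> 0" using f(3)[of 0] \<rho>_0[OF fV[of 0]] by simp
  have f1: "f 1 = \<gamma> 1" using f(3)[of 1] \<rho>_1[OF fV[of 1]] m' by simp
  have \<rho>\<delta>: "\<rho> (\<delta> j) = j" for j
    using f(3)[of "nat j"] ray[of "nat (j - int m)"] by (auto simp: \<delta>_def)
  have "(\<delta> j, \<delta> (j + 1)) \<in> adj" for j
  proof -
    consider "j < -1" | "j = -1" | "j \<ge> 0" "j < int m" | "j = int m" | "j > int m" by linarith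
    then show ?thesis
    proof cases
      case 1
      then show ?thesis using adj_\<gamma>[of j] by (simp add: \<delta>_def)
    next
      case 2
      then show ?thesis using adj_\<gamma>[of j] f0 by (simp add: \<delta>_def)
    next
      case 3
      then show ?thesis using f(2)[of "nat j"] by (simp add: \<delta>_def nat_add_distrib)
    next
      case 4
      then show ?thesis using \<beta>(1)[of 0] f(1) by (simp add: \<delta>_def)
    next
      case 5
      then show ?thesis using \<beta>(1)[of "j - int m"] by (simp add: \<delta>_def algebra_simps)
    qed
  qed
  moreover have "inj \<delta>" by (rule injI) (metis \<rho>\<delta>)
  ultimately have "tree_line V Ve Vo E \<delta>" by unfold_locales
  moreover have "\<delta> 0 = \<gamma> 0" "\<delta> 1 = \<gamma> 1" "\<delta> (int m) = \<beta> 0" "\<delta> (int m + 1) = \<beta> 1"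
    using f0 f1 f(1) m' by (auto simp: \<delta>_def)
  ultimately show ?thesis by blast
qed

lemma common_line_up:
  fixes \<beta> :: "int \<Rightarrow> 'v"
  assumes \<beta>: "\<And>k. (\<beta> k, \<beta> (k + 1)) \<in> adj" "inj \<beta>" and up: "\<rho> (\<beta> 1) = \<rho> (\<beta> 0) + 1"
  shows "\<exists>\<delta> m. tree_line V Ve Vo E \<delta> \<and> {\<delta> 0, \<delta> 1} = {\<gamma> 0, \<gamma> 1} \<and> {\<delta> m, \<delta> (m + 1)} = {\<beta> 0, \<beta> 1}"
proof -
  have \<beta>V: "\<beta> k \<in> V" for k using \<beta>(1) adj_props by blast
  consider "\<rho> (\<beta> 0) \<ge> 1" | "\<rho> (\<beta> 0) = 0" | "\<rho> (\<beta> 0) \<le> -1" by linarith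
  then show ?thesis
  proof cases
    case 1
    obtain \<delta> m where "tree_line V Ve Vo E \<delta>" "\<delta> 0 = \<gamma> 0" "\<delta> 1 = \<gamma> 1" "\<delta> m = \<beta> 0" "\<delta> (m + 1) = \<beta> 1"
      using common_line_positive[OF \<beta> 1 up] by blast
    then show ?thesis by (intro exI[of _ \<delta>] exI[of _ m]) simp
  next
    case 2
    then have "\<beta> 0 = \<gamma> 0" "\<beta> 1 = \<gamma> 1" using up \<rho>_0[OF \<beta>V] \<rho>_1[OF \<beta>V] by auto
    then show ?thesis using tree_line_axioms by (intro exI[of _ \<gamma>] exI[of _ 0]) simp
  next
    case 3
    \<comment> \<open>The edge lies in the negative half: reversing both lines makes its position
      positive and turns the ray of \<beta> outwards.\<close>
    interpret r: tree_line V Ve Vo E "\<lambda>k. \<gamma> (1 - k)" by (rule tree_line_reverse)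
    have \<beta>': "(\<beta> (1 - k), \<beta> (1 - (k + 1))) \<in> adj" for k
      using adj_sym[OF \<beta>(1)[of "-k"]] by (simp add: algebra_simps)
    have "inj (\<lambda>k. \<beta> (1 - k))" using \<beta>(2) by (auto intro!: injI simp: inj_eq)
    then obtain \<delta> m where "tree_line V Ve Vo E \<delta>" "\<delta> 0 = \<gamma> 1" "\<delta> 1 = \<gamma> 0" "\<delta> m = \<beta> 1" "\<delta> (m + 1) = \<beta> 0"
      using r.common_line_positive[of "\<lambda>k. \<beta> (1 - k)", OF \<beta>'] 3 up by (auto simp: reverse_\<rho> \<beta>V)
    then show ?thesis by (intro exI[of _ \<delta>] exI[of _ m]) (simp add: insert_commute)
  qed
qed

text \<open>The line \<beta> extends the second edge outwards, so leaves of the tree are no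
  obstacle. Its orientation is first adjusted by reversal.\<close>

lemma common_line:
  fixes \<beta> :: "int \<Rightarrow> 'v"
  assumes \<beta>: "\<And>k. (\<beta> k, \<beta> (k + 1)) \<in> adj" "inj \<beta>"
  shows "\<exists>\<delta> m. tree_line V Ve Vo E \<delta> \<and> {\<delta> 0, \<delta> 1} = {\<gamma> 0, \<gamma> 1} \<and> {\<delta> m, \<delta> (m + 1)} = {\<beta> 0, \<beta> 1}"
proof (cases "\<rho> (\<beta> 1) = \<rho> (\<beta> 0) + 1")
  case True
  then show ?thesis using common_line_up[OF \<beta>] by blast
next
  case False
  then have up: "\<rho> (\<beta> 0) = \<rho> (\<beta> 1) + 1" using \<rho>_adj[OF \<beta>(1)[of 0]] by simp
  have \<beta>': "(\<beta> (1 - k), \<beta> (1 - (k + 1))) \<in> adj" for k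
    using adj_sym[OF \<beta>(1)[of "-k"]] by (simp add: algebra_simps)
  have "inj (\<lambda>k. \<beta> (1 - k))" using \<beta>(2) by (auto intro!: injI simp: inj_eq)
  then show ?thesis
    using common_line_up[of "\<lambda>k. \<beta> (1 - k)", OF \<beta>'] up by (simp add: insert_commute)
qed

end

section \<open>Hecke pairs with double cosets indexed by the infinite dihedral group\<close>

lemma ends_mult_iff: "ends x (d \<otimes>\<^bsub>D_inf\<^esub> dgen x) \<longleftrightarrow> \<not> ends x d"
  using ends_mult[of x d] nf_snoc[of x d] ends_def[of x "d \<otimes>\<^bsub>D_inf\<^esub> dgen x"] by auto

lemma mult_dgen_neq: "d \<otimes>\<^bsub>D_inf\<^esub> dgen x \<noteq> d"
proof
  assume "d \<otimes>\<^bsub>D_inf\<^esub> dgen x = d"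
  then have "ends x (d \<otimes>\<^bsub>D_inf\<^esub> dgen x) = ends x d" by (rule arg_cong)
  then show False unfolding ends_mult_iff by blast
qed

lemma mult_dgen_eq_iff: "d = e \<otimes>\<^bsub>D_inf\<^esub> dgen x \<longleftrightarrow> e = d \<otimes>\<^bsub>D_inf\<^esub> dgen x"
  by auto

lemma D_inf_inv_dgen [simp]: "inv\<^bsub>D_inf\<^esub> (dgen x) = dgen x"
  by (simp add: dgen_def D_inf_inv)

text \<open>A Hecke pair whose double cosets are the fibres of a map \<open>\<kappa>\<close> to the infinite
  dihedral group. Geometrically \<open>\<kappa> g\<close> is the position of the chamber \<open>g e\<close> relative
  to \<open>e\<close>, and the last four assumptions describe the positions of the chambers \<open>g z e\<close>
  in the panel of \<open>g e\<close> of type \<open>x\<close>: all of them lie further out if \<open>g e\<close> is the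
  chamber of the panel nearest to \<open>e\<close>; otherwise exactly one lies further in.\<close>

locale dihedral_hecke = hecke G H for G :: "('g, 'm) monoid_scheme" (structure) and H +
  fixes \<kappa> :: "'g \<Rightarrow> int \<times> bool"
  assumes \<kappa>_surj: "\<exists>g\<in>carrier G. \<kappa> g = d"
    and \<kappa>_dcoset: "g \<in> carrier G \<Longrightarrow> h \<in> carrier G \<Longrightarrow> h \<in> dcoset G H g \<longleftrightarrow> \<kappa> h = \<kappa> g"
    and \<kappa>_one: "\<kappa> \<one> = (0, False)"
    and \<kappa>_inv: "g \<in> carrier G \<Longrightarrow> \<kappa> (inv g) = inv\<^bsub>D_inf\<^esub> \<kappa> g"
    and far: "g \<in> carrier G \<Longrightarrow> z \<in> carrier G \<Longrightarrow> \<kappa> z = dgen x \<Longrightarrow> \<not> ends x (\<kappa> g) \<Longrightarrow>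
      \<kappa> (g \<otimes> z) = \<kappa> g \<otimes>\<^bsub>D_inf\<^esub> dgen x"
    and near: "g \<in> carrier G \<Longrightarrow> z \<in> carrier G \<Longrightarrow> \<kappa> z = dgen x \<Longrightarrow> ends x (\<kappa> g) \<Longrightarrow>
      \<kappa> (g \<otimes> z) = \<kappa> g \<otimes>\<^bsub>D_inf\<^esub> dgen x \<or> \<kappa> (g \<otimes> z) = \<kappa> g"
    and near_unique: "g \<in> carrier G \<Longrightarrow> z \<in> carrier G \<Longrightarrow> z' \<in> carrier G \<Longrightarrow>
      \<kappa> z = dgen x \<Longrightarrow> \<kappa> z' = dgen x \<Longrightarrow> ends x (\<kappa> g) \<Longrightarrow>
      \<kappa> (g \<otimes> z) = \<kappa> g \<otimes>\<^bsub>D_inf\<^esub> dgen x \<Longrightarrow> \<kappa> (g \<otimes> z') = \<kappa> g \<otimes>\<^bsub>D_inf\<^esub> dgen x \<Longrightarrow> inv z \<otimes> z' \<in> H"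
    and near_exists: "g \<in> carrier G \<Longrightarrow>
      \<exists>z\<in>carrier G. \<kappa> z = dgen x \<and> \<kappa> (g \<otimes> z) = \<kappa> g \<otimes>\<^bsub>D_inf\<^esub> dgen x"
begin

definition \<beta> :: "int \<times> bool \<Rightarrow> 'g set" where
  "\<beta> d = {g \<in> carrier G. \<kappa> g = d}"

definition q :: "bool \<Rightarrow> nat" where
  "q x = R_num G H (\<beta> (dgen x))"

lemma mem_\<beta>: "g \<in> \<beta> d \<longleftrightarrow> g \<in> carrier G \<and> \<kappa> g = d"
  by (simp add: \<beta>_def)

lemma dcoset_\<beta>: "g \<in> carrier G \<Longrightarrow> dcoset G H g = \<beta> (\<kappa> g)"
  using dcosets_props(2)[OF dcoset_in_dcosets, of g] by (auto simp: \<beta>_def \<kappa>_dcoset)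

lemma \<beta>_dcosets [simp]: "\<beta> d \<in> dcosets G H"
  using \<kappa>_surj[of d] dcoset_\<beta> dcoset_in_dcosets by auto

lemma \<beta>_cases: "U \<in> dcosets G H \<Longrightarrow> \<exists>d. U = \<beta> d"
  using dcoset_\<beta> unfolding dcosets_def by blast

lemma \<beta>_one: "\<beta> (0, False) = H"
  using dcoset_\<beta>[OF one_closed] H_dcoset(2) by (simp add: \<kappa>_one)

lemma \<beta>_bij: "bij_betw \<beta> UNIV (dcosets G H)"
  unfolding bij_betw_def
proof
  show "inj \<beta>"
  proof (rule injI)
    fix d e assume "\<beta> d = \<beta> e"
    then show "d = e" using \<kappa>_surj[of d] by (auto simp: \<beta>_def)
  qed
  show "range \<beta> = dcosets G H"
  proof
    show "range \<beta> \<subseteq> dcosets G H" by auto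
    show "dcosets G H \<subseteq> range \<beta>" by (auto simp: dcosets_def dcoset_\<beta>)
  qed
qed

lemma \<kappa>_rep_\<beta> [simp]: "\<kappa> (rep (\<beta> d)) = d"
  using dcosets_props(1)[OF \<beta>_dcosets, of d] by (simp add: \<beta>_def)

lemma finite_rcosets_\<beta>: "finite {C \<in> rcosets H. \<kappa> (rep C) = d}"
proof (rule finite_subset[OF _ finite_rcosets_in[OF \<beta>_dcosets]])
  show "{C \<in> rcosets H. \<kappa> (rep C) = d} \<subseteq> rcosets_in G H (\<beta> d)"
    using rcosets_rep(2) by (auto simp: rcosets_in_iff mem_\<beta>)
qed

lemma q_card: "q x = card {C \<in> rcosets H. \<kappa> (rep C) = dgen x}"
  unfolding q_def R_num_def using rcosets_rep(2)
  by (intro arg_cong[where f = card]) (auto simp: rcosets_in_iff mem_\<beta>)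

text \<open>\<open>hecke_coeff_eq\<close> sees a coset \<open>H c\<close> through
  \<open>g c\<^sup>-\<^sup>1\<close>, so \<open>z = c\<^sup>-\<^sup>1\<close> is the chamber being
  counted; generators are involutions, so \<open>z\<close> and \<open>c\<close> have the same
  position. Existence and uniqueness of the coset are \<open>near_exists\<close> and
  \<open>near_unique\<close>.\<close>

lemma card_near:
  assumes g: "g \<in> carrier G" and e: "ends x (\<kappa> g)"
  shows "card {C \<in> rcosets H. \<kappa> (rep C) = dgen x \<and> \<kappa> (g \<otimes> inv (rep C)) = \<kappa> g \<otimes>\<^bsub>D_inf\<^esub> dgen x} = 1"
proof -
  let ?M = "{C \<in> rcosets H. \<kappa> (rep C) = dgen x \<and> \<kappa> (g \<otimes> inv (rep C)) = \<kappa> g \<otimes>\<^bsub>D_inf\<^esub> dgen x}"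
  obtain z where z: "z \<in> carrier G" "\<kappa> z = dgen x" "\<kappa> (g \<otimes> z) = \<kappa> g \<otimes>\<^bsub>D_inf\<^esub> dgen x"
    using near_exists[OF g] by blast
  let ?C = "H #> inv z"
  have C: "?C \<in> rcosets H" using z by simp
  obtain h where h: "h \<in> H" "rep ?C = h \<otimes> inv z" using rep_rcos[of "inv z"] z by auto
  have inv_rep: "inv (rep ?C) = z \<otimes> inv h" using h z by (simp add: inv_mult_group)
  have "rep ?C \<in> dcoset G H (inv z)"
    unfolding mem_dcoset using h z by (intro bexI[of _ h] bexI[of _ \<one>]) simp_all
  then have 1: "\<kappa> (rep ?C) = dgen x"
    using \<kappa>_dcoset[of "inv z" "rep ?C"] rcosets_rep(2)[OF C] z by (simp add: \<kappa>_inv)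
  have "g \<otimes> inv (rep ?C) \<in> dcoset G H (g \<otimes> z)"
    unfolding mem_dcoset inv_rep using h z g by (intro bexI[of _ \<one>] bexI[of _ "inv h"]) (simp_all add: m_assoc)
  then have "\<kappa> (g \<otimes> inv (rep ?C)) = \<kappa> g \<otimes>\<^bsub>D_inf\<^esub> dgen x"
    using \<kappa>_dcoset[of "g \<otimes> z" "g \<otimes> inv (rep ?C)"] rcosets_rep(2)[OF C] z g by simp
  with 1 C have in_M: "?C \<in> ?M" by simp
  have "D = ?C" if D: "D \<in> ?M" for D
  proof -
    note r = rcosets_rep[OF C] and r' = rcosets_rep[of D]
    have D': "D \<in> rcosets H" "rep D \<in> carrier G" "H #> rep D = D" using D r' by auto
    have "inv (inv (rep D)) \<otimes> inv (rep ?C) \<in> H"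
      by (rule near_unique[OF g, of _ _ x]) (use D in_M D' r e in \<open>simp_all add: \<kappa>_inv\<close>)
    then have "rep D \<otimes> inv (rep ?C) \<in> H" using D' by simp
    then have "H #> rep D = H #> rep ?C" by (simp only: rcos_eq_iff[OF D'(2) r(2)])
    then show ?thesis unfolding D'(3) r(3) .
  qed
  then have "?M = {?C}" using in_M by blast
  then show ?thesis by simp
qed

text \<open>Ensures that the truncated difference \<open>q x - 1\<close> of naturals agrees with the
  difference in the coefficient ring.\<close>

lemma q_pos: "q x \<ge> 1"
proof -
  obtain g where g: "g \<in> carrier G" "\<kappa> g = dgen x" using \<kappa>_surj by blast
  then have "ends x (\<kappa> g)" by (simp add: ends_def)
  from card_near[OF g(1) this] show ?thesis unfolding q_card
    using card_mono[OF finite_rcosets_\<beta>[of "dgen x"],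
      of "{C \<in> rcosets H. \<kappa> (rep C) = dgen x \<and> \<kappa> (g \<otimes> inv (rep C)) = \<kappa> g \<otimes>\<^bsub>D_inf\<^esub> dgen x}"]
    by auto
qed

text \<open>The locale describes \<open>\<kappa> (g z)\<close> starting from \<open>g\<close>, while
  the coefficient asks for which \<open>z\<close> this value is \<open>d\<close>. Hence the proof
  splits on whether \<open>\<kappa> g\<close> ends with \<open>x\<close>; when
  \<open>\<kappa> g\<close> is \<open>d\<close> times the generator, exactly one of the two
  does.\<close>

lemma hecke_coeff_dgen:
  assumes g: "g \<in> carrier G"
  shows "hecke_coeff G H (\<beta> d) (\<beta> (dgen x)) g =
    (if ends x d then (if \<kappa> g = d \<otimes>\<^bsub>D_inf\<^esub> dgen x then q x else if \<kappa> g = d then q x - 1 else 0)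
     else if \<kappa> g = d \<otimes>\<^bsub>D_inf\<^esub> dgen x then 1 else 0)"
proof -
  let ?r = "dgen x"
  let ?M = "{C \<in> rcosets H. \<kappa> (rep C) = ?r}"
  have "hecke_coeff G H (\<beta> d) (\<beta> ?r) g = card {C \<in> rcosets H. rep C \<in> \<beta> ?r \<and> g \<otimes> inv (rep C) \<in> \<beta> d}"
    using g by (simp add: hecke_coeff_eq)
  also have "{C \<in> rcosets H. rep C \<in> \<beta> ?r \<and> g \<otimes> inv (rep C) \<in> \<beta> d} = {C \<in> ?M. \<kappa> (g \<otimes> inv (rep C)) = d}"
    using g rcosets_rep(2) by (auto simp: mem_\<beta>)
  finally have c: "hecke_coeff G H (\<beta> d) (\<beta> ?r) g = card {C \<in> ?M. \<kappa> (g \<otimes> inv (rep C)) = d}" .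
  have z: "inv (rep C) \<in> carrier G" "\<kappa> (inv (rep C)) = ?r" if "C \<in> ?M" for C
    using that rcosets_rep(2)[of C] by (auto simp: \<kappa>_inv)
  note ne = mult_dgen_neq[of _ x]
  show ?thesis
  proof (cases "ends x (\<kappa> g)")
    case False
    then have "{C \<in> ?M. \<kappa> (g \<otimes> inv (rep C)) = d} = (if d = \<kappa> g \<otimes>\<^bsub>D_inf\<^esub> ?r then ?M else {})"
      using far[OF g z] by auto
    then have "hecke_coeff G H (\<beta> d) (\<beta> ?r) g = (if \<kappa> g = d \<otimes>\<^bsub>D_inf\<^esub> ?r then q x else 0)"
      unfolding c q_card mult_dgen_eq_iff[of d] by simp
    moreover have "ends x d" if "\<kappa> g = d \<otimes>\<^bsub>D_inf\<^esub> ?r" using False that ends_mult_iff[of x d] by simp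
    moreover have "\<kappa> g \<noteq> d" if "ends x d" using False that by auto
    ultimately show ?thesis by auto
  next
    case True
    let ?N = "{C \<in> ?M. \<kappa> (g \<otimes> inv (rep C)) = \<kappa> g \<otimes>\<^bsub>D_inf\<^esub> ?r}"
    have N: "card ?N = 1" using card_near[OF g True] by (simp add: conj_assoc)
    have alt: "\<kappa> (g \<otimes> inv (rep C)) = \<kappa> g \<otimes>\<^bsub>D_inf\<^esub> ?r \<or> \<kappa> (g \<otimes> inv (rep C)) = \<kappa> g" if "C \<in> ?M" for C
      by (rule near[OF g z[OF that] True])
    have sets: "{C \<in> ?M. \<kappa> (g \<otimes> inv (rep C)) = d} =
        (if d = \<kappa> g \<otimes>\<^bsub>D_inf\<^esub> ?r then ?N else if d = \<kappa> g then ?M - ?N else {})"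
    proof -
      consider "d = \<kappa> g \<otimes>\<^bsub>D_inf\<^esub> ?r" | "d \<noteq> \<kappa> g \<otimes>\<^bsub>D_inf\<^esub> ?r" "d = \<kappa> g"
        | "d \<noteq> \<kappa> g \<otimes>\<^bsub>D_inf\<^esub> ?r" "d \<noteq> \<kappa> g" by blast
      then show ?thesis
      proof cases
        case 2
        have "\<kappa> (g \<otimes> inv (rep C)) = \<kappa> g \<longleftrightarrow> \<kappa> (g \<otimes> inv (rep C)) \<noteq> \<kappa> g \<otimes>\<^bsub>D_inf\<^esub> ?r"
          if "C \<in> ?M" for C
          using alt[OF that] ne[of "\<kappa> g"] by (elim disjE) simp_all
        then have "{C \<in> ?M. \<kappa> (g \<otimes> inv (rep C)) = \<kappa> g} = {C \<in> ?M. \<kappa> (g \<otimes> inv (rep C)) \<noteq> \<kappa> g \<otimes>\<^bsub>D_inf\<^esub> ?r}"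
          by blast
        also have "\<dots> = ?M - ?N" by blast
        finally show ?thesis using 2 by simp
      next
        case 3
        then have "{C \<in> ?M. \<kappa> (g \<otimes> inv (rep C)) = d} = {}" using alt by blast
        then show ?thesis using 3 by simp
      qed simp
    qed
    have rest: "card (?M - ?N) = q x - 1"
    proof -
      have "?N \<subseteq> ?M" by auto
      then show ?thesis using N finite_subset[OF _ finite_rcosets_\<beta>] unfolding q_card
        by (subst card_Diff_subset) auto
    qed
    have "hecke_coeff G H (\<beta> d) (\<beta> ?r) g =
        (if d = \<kappa> g \<otimes>\<^bsub>D_inf\<^esub> ?r then 1 else if d = \<kappa> g then q x - 1 else 0)"
      unfolding c sets using N rest by (simp only: if_distrib[of card] card.empty)
    then have "hecke_coeff G H (\<beta> d) (\<beta> ?r) g =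
        (if \<kappa> g = d \<otimes>\<^bsub>D_inf\<^esub> ?r then 1 else if \<kappa> g = d then q x - 1 else 0)"
      unfolding mult_dgen_eq_iff[of d "\<kappa> g" x] eq_commute[of d "\<kappa> g"] .
    moreover have "\<not> ends x d" if "\<kappa> g = d \<otimes>\<^bsub>D_inf\<^esub> ?r" using True that ends_mult_iff[of x d] by simp
    moreover have "\<kappa> g \<noteq> d" if "\<not> ends x d" using True that by auto
    ultimately show ?thesis
      by (cases "ends x d"; cases "\<kappa> g = d \<otimes>\<^bsub>D_inf\<^esub> ?r"; cases "\<kappa> g = d") simp_all
  qed
qed

lemma hecke_dihedral_algebra:
  "dihedral_algebra (hecke_algebra G H :: ('k::comm_ring_1, 'g set \<Rightarrow> 'k) module)
     (dcosets G H) coeff H \<beta> q"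
proof -
  interpret fs_algebra "hecke_algebra G H :: ('k, 'g set \<Rightarrow> 'k) module" "dcosets G H" coeff H
    by (rule hecke_fs_algebra)
  show ?thesis
  proof
    show "bij_betw \<beta> UNIV (dcosets G H)" by (rule \<beta>_bij)
    show "\<beta> (0, False) = H" by (rule \<beta>_one)
    fix d x
    have inj: "\<beta> d = \<beta> e \<longleftrightarrow> d = e" for d e using \<beta>_bij by (auto simp: bij_betw_def inj_eq)
    show "(coeff (\<beta> d) (\<beta> (dgen x)) :: _ \<Rightarrow> 'k) =
      (if ends x d
       then (\<lambda>y. of_nat (q x) * basis_elt (\<beta> (d \<otimes>\<^bsub>D_inf\<^esub> dgen x)) y + (of_nat (q x) - 1) * basis_elt (\<beta> d) y)
       else basis_elt (\<beta> (d \<otimes>\<^bsub>D_inf\<^esub> dgen x)))" (is "_ = ?rhs")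
    proof
      fix y
      show "coeff (\<beta> d) (\<beta> (dgen x)) y = ?rhs y"
      proof (cases "y \<in> dcosets G H")
        case True
        then obtain e where y: "y = \<beta> e" using \<beta>_cases by blast
        note mult_dgen_neq[of d x]
        moreover have "(of_nat (q x - 1) :: 'k) = of_nat (q x) - 1" using q_pos by (simp add: of_nat_diff)
        ultimately show ?thesis
          unfolding y coeff_def using hecke_coeff_dgen[of "rep (\<beta> e)" d x]
          by (auto simp: basis_elt_def inj)
      next
        case False
        then have "y \<noteq> \<beta> e" for e by auto
        then show ?thesis using False by (simp add: coeff_def basis_elt_def)
      qed
    qed
  qed
qed

text \<open>The product has a single term, with coefficient 1, so the degree identity
  \<open>R_num_mult\<close> has one summand.\<close>

lemma R_num_snoc:
  assumes "\<not> ends x d"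
  shows "R_num G H (\<beta> (d \<otimes>\<^bsub>D_inf\<^esub> dgen x)) = R_num G H (\<beta> d) * q x"
proof -
  let ?e = "d \<otimes>\<^bsub>D_inf\<^esub> dgen x"
  have c: "hecke_coeff G H (\<beta> d) (\<beta> (dgen x)) (rep (\<beta> e)) = (if e = ?e then 1 else 0)" for e
    using assms hecke_coeff_dgen[of "rep (\<beta> e)" d x] by simp
  have "support (\<beta> d) (\<beta> (dgen x)) = {\<beta> ?e}"
  proof (rule Set.set_eqI)
    fix U
    show "U \<in> support (\<beta> d) (\<beta> (dgen x)) \<longleftrightarrow> U \<in> {\<beta> ?e}"
    proof (cases "U \<in> dcosets G H")
      case True
      then obtain e where "U = \<beta> e" using \<beta>_cases by blast
      then show ?thesis using c[of e] \<beta>_bij by (auto simp: support_def bij_betw_def inj_eq)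
    qed (auto simp: support_def)
  qed
  then show ?thesis using R_num_mult[of "\<beta> d" "\<beta> (dgen x)"] c by (simp add: q_def)
qed

lemma R_num_word: "R_num G H (\<beta> d) = (\<Prod>x\<leftarrow>nf d. q x)"
proof -
  have "distinct_adj ws \<Longrightarrow> R_num G H (\<beta> (dword ws)) = (\<Prod>x\<leftarrow>ws. q x)" for ws
  proof (induction ws rule: rev_induct)
    case Nil
    have "rcosets_in G H H = {H}"
      using rcosets_in_iff[OF H_dcoset(1)] rcosets_in_H by auto
    then show ?case by (simp add: \<beta>_one R_num_def)
  next
    case (snoc x ws)
    then have "\<not> ends x (dword ws)" by (auto simp: ends_def nf_dword distinct_adj_snoc)
    then show ?case using snoc R_num_snoc[of x "dword ws"] by (simp add: distinct_adj_snoc)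
  qed
  from this[of "nf d"] show ?thesis by simp
qed

end

section \<open>Strongly transitive actions on trees\<close>

definition line_edges :: "(int \<Rightarrow> 'v) \<Rightarrow> 'v set set" where
  "line_edges \<delta> = range (\<lambda>k. {\<delta> k, \<delta> (k + 1)})"

definition dact :: "int \<times> bool \<Rightarrow> int \<Rightarrow> int" where
  "dact x k = (case x of (a, \<epsilon>) \<Rightarrow> if \<epsilon> then a - k else a + k)"

lemma dact_mult: "dact (x \<otimes>\<^bsub>D_inf\<^esub> y) k = dact x (dact y k)"
  by (cases x; cases y) (auto simp: dact_def)

lemma dact_inj: "(\<And>k. dact x k = dact y k) \<Longrightarrow> x = y"
proof -
  assume "\<And>k. dact x k = dact y k"
  from this[of 0] this[of 1] show "x = y" by (cases x; cases y) (auto simp: dact_def split: if_splits)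
qed

text \<open>Turning back would repeat a value, so injectivity makes all increments equal to the
  first one.\<close>

lemma int_isometry:
  fixes f :: "int \<Rightarrow> int"
  assumes inj: "inj f" and step: "\<And>k. f (k + 1) = f k + 1 \<or> f k = f (k + 1) + 1"
  shows "f k = dact (f 0, f 1 < f 0) k"
proof -
  have s: "f (k + 1 + 1) - f (k + 1) = f (k + 1) - f k" for k
  proof -
    have "f (k + 1 + 1) \<noteq> f k" using inj by (simp add: inj_eq)
    then show ?thesis using step[of k] step[of "k + 1"] by auto
  qed
  have const: "f (k + 1) - f k = f 1 - f 0" for k
  proof (induction k rule: int_induct[where k = 0])
    case (step1 i)
    then show ?case using s[of i] by simp
  next
    case (step2 i)
    then show ?case using s[of "i - 1"] by simp
  qed simp
  have "f k = f 0 + k * (f 1 - f 0)"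
  proof (induction k rule: int_induct[where k = 0])
    case (step1 i)
    then show ?case using const[of i] by (simp add: algebra_simps)
  next
    case (step2 i)
    then show ?case using const[of "i - 1"] by (simp add: algebra_simps)
  qed simp
  then show ?thesis using step[of 0] by (auto simp: dact_def)
qed

lemma bip_tree_geodesic_iff:
  assumes "bip_tree V Ve Vo E"
  shows "geodesic V E VA EA \<longleftrightarrow> (\<exists>\<delta>. tree_line V Ve Vo E \<delta> \<and> VA = range \<delta> \<and> EA = line_edges \<delta>)"
proof
  interpret bip_tree V Ve Vo E by (rule assms)
  assume "geodesic V E VA EA"
  then obtain \<delta> where \<delta>: "inj \<delta>" "VA = range \<delta>" "EA = line_edges \<delta>" "EA \<subseteq> E"
    by (auto simp: geodesic_def line_edges_def)
  then have "tree_line V Ve Vo E \<delta>"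
    by unfold_locales (auto simp: adj_iff line_edges_def)
  then show "\<exists>\<delta>. tree_line V Ve Vo E \<delta> \<and> VA = range \<delta> \<and> EA = line_edges \<delta>" using \<delta> by blast
next
  assume "\<exists>\<delta>. tree_line V Ve Vo E \<delta> \<and> VA = range \<delta> \<and> EA = line_edges \<delta>"
  then obtain \<delta> where \<delta>: "tree_line V Ve Vo E \<delta>" "VA = range \<delta>" "EA = line_edges \<delta>" by blast
  interpret tree_line V Ve Vo E \<delta> by (rule \<delta>(1))
  have "{\<delta> k, \<delta> (k + 1)} \<in> E" for k using adj_\<gamma>[of k] by (simp add: adj_iff)
  moreover have "VA \<subseteq> V" using \<delta>(2) by auto
  ultimately show "geodesic V E VA EA"
    unfolding geodesic_def using \<delta> inj_\<gamma> by (auto simp: line_edges_def)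
qed

text \<open>The parametrisation \<gamma> is the basic datum: the line, its distinguished edge
  between \<open>\<gamma> 0\<close> and \<open>\<gamma> 1\<close>, and the groups attached to them
  are derived from it.\<close>

locale tree_action = tree_line V Ve Vo E \<gamma> + group G
  for V Ve Vo :: "'v set" and E and \<gamma> and G :: "('g, 'm) monoid_scheme" (structure) +
  fixes \<phi> :: "'g \<Rightarrow> 'v \<Rightarrow> 'v"
  assumes lf: "locally_finite V E" and action: "\<phi> \<in> hom G (graph_aut V E)"
    and st: "strongly_transitive V E \<phi> {g \<in> carrier G. type_preserving Ve Vo (\<phi> g)}"
begin

definition Gp :: "'g set" where "Gp = {g \<in> carrier G. type_preserving Ve Vo (\<phi> g)}"
definition e :: "'v set" where "e = {\<gamma> 0, \<gamma> 1}"
definition B :: "'g set" where "B = fixator \<phi> (carrier G) e"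
definition VA :: "'v set" where "VA = range \<gamma>"
definition EA :: "'v set set" where "EA = line_edges \<gamma>"
definition Np :: "'g set" where "Np = stabilizer_of \<phi> Gp VA EA"
definition N :: "'g set" where "N = stabilizer_of \<phi> (carrier G) VA EA"
definition T :: "'g set" where "T = fixator \<phi> (carrier G) VA"

lemma aut: "g \<in> carrier G \<Longrightarrow> \<phi> g \<in> Bij V" "g \<in> carrier G \<Longrightarrow> (`) (\<phi> g) ` E = E"
  using hom_in_carrier[OF action, of g] by (auto simp: graph_aut_def)

lemma act_mult:
  assumes "g \<in> carrier G" "h \<in> carrier G" "v \<in> V"
  shows "\<phi> (g \<otimes> h) v = \<phi> g (\<phi> h v)"
  using hom_mult[OF action assms(1,2)] aut(1) assms
  by (simp add: graph_aut_def BijGroup_def compose_eq)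

lemma act_bij: "g \<in> carrier G \<Longrightarrow> bij_betw (\<phi> g) V V"
  using aut(1)[of g] by (simp add: Bij_def)

lemma act_V [simp]: "g \<in> carrier G \<Longrightarrow> v \<in> V \<Longrightarrow> \<phi> g v \<in> V"
  using act_bij by (rule bij_betwE[THEN bspec])

lemma act_inj: "g \<in> carrier G \<Longrightarrow> u \<in> V \<Longrightarrow> v \<in> V \<Longrightarrow> \<phi> g u = \<phi> g v \<longleftrightarrow> u = v"
  using bij_betw_imp_inj_on[OF act_bij, of g] by (rule inj_on_eq_iff)

lemma act_one [simp]: "v \<in> V \<Longrightarrow> \<phi> \<one> v = v"
  using act_mult[of \<one> \<one> v] act_inj[of \<one> "\<phi> \<one> v" v] by simp

lemma act_inv [simp]:
  "g \<in> carrier G \<Longrightarrow> v \<in> V \<Longrightarrow> \<phi> (inv g) (\<phi> g v) = v"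
  "g \<in> carrier G \<Longrightarrow> v \<in> V \<Longrightarrow> \<phi> g (\<phi> (inv g) v) = v"
  using act_mult[of "inv g" g v] act_mult[of g "inv g" v] by simp_all

lemma act_adj:
  assumes g: "g \<in> carrier G" and uv: "(u, v) \<in> adj"
  shows "(\<phi> g u, \<phi> g v) \<in> adj"
proof -
  have "\<phi> g ` {u, v} \<in> (`) (\<phi> g) ` E" using uv by (simp only: adj_iff imageI)
  then show ?thesis using aut(2)[OF g] by (simp add: adj_iff)
qed

lemma act_d:
  assumes g: "g \<in> carrier G" and V: "u \<in> V" "v \<in> V"
  shows "d (\<phi> g u) (\<phi> g v) = d u v"
proof (rule antisym)
  have le: "d (\<phi> g u) (\<phi> g v) \<le> d u v" if "g \<in> carrier G" "u \<in> V" "v \<in> V" for g u v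
    by (rule d_le, rule relpow_adj_map[where f = "\<phi> g"]) (use that act_adj d_relpow in auto)
  show "d (\<phi> g u) (\<phi> g v) \<le> d u v" by (rule le[OF g V])
  show "d u v \<le> d (\<phi> g u) (\<phi> g v)" using le[of "inv g" "\<phi> g u" "\<phi> g v"] g V by simp
qed

lemma act_types:
  assumes g: "g \<in> carrier G" and V: "u \<in> V" "v \<in> V"
  shows "(\<phi> g u \<in> Ve \<longleftrightarrow> u \<in> Ve) \<longleftrightarrow> (\<phi> g v \<in> Ve \<longleftrightarrow> v \<in> Ve)"
  using types_map[where f = "\<phi> g", OF act_adj[OF g] V] by blast

text \<open>An automorphism keeps or exchanges the types of all vertices at once, so a single vertex
  decides.\<close>

lemma mem_Gp:
  assumes g: "g \<in> carrier G" and v: "v \<in> V"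
  shows "g \<in> Gp \<longleftrightarrow> (\<phi> g v \<in> Ve \<longleftrightarrow> v \<in> Ve)"
proof
  assume "g \<in> Gp"
  then have "\<phi> g ` Ve = Ve" "\<phi> g ` Vo = Vo" by (auto simp: Gp_def type_preserving_def)
  then show "\<phi> g v \<in> Ve \<longleftrightarrow> v \<in> Ve" using v types by blast
next
  assume pt: "\<phi> g v \<in> Ve \<longleftrightarrow> v \<in> Ve"
  have all: "\<phi> g w \<in> Ve \<longleftrightarrow> w \<in> Ve" if "w \<in> V" for w using act_types[OF g v that] pt by blast
  have sub: "Ve \<subseteq> V" "Vo \<subseteq> V" using types by auto
  have Vo: "w \<in> Vo \<longleftrightarrow> w \<notin> Ve" if "w \<in> V" for w using that types by blast
  have img: "\<phi> g ` S = S" if S: "S \<subseteq> V" and "\<And>w. w \<in> V \<Longrightarrow> \<phi> g w \<in> S \<longleftrightarrow> w \<in> S" for S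
  proof
    show "\<phi> g ` S \<subseteq> S" using that by blast
    show "S \<subseteq> \<phi> g ` S"
    proof
      fix w assume w: "w \<in> S"
      then have wV: "w \<in> V" using S by blast
      have eq: "\<phi> g (\<phi> (inv g) w) = w" using g wV by simp
      then have "\<phi> (inv g) w \<in> S" using that(2)[of "\<phi> (inv g) w"] g wV w by simp
      then show "w \<in> \<phi> g ` S" using eq by (metis imageI)
    qed
  qed
  have "\<phi> g ` Ve = Ve" by (rule img[OF sub(1)]) (rule all)
  moreover have "\<phi> g ` Vo = Vo" by (rule img[OF sub(2)]) (simp add: Vo all g)
  ultimately show "g \<in> Gp" using g by (simp add: Gp_def type_preserving_def)
qed

lemma Gp_carrier: "g \<in> Gp \<Longrightarrow> g \<in> carrier G"
  by (simp add: Gp_def)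

lemma Gp_mult_iff: "g \<in> carrier G \<Longrightarrow> h \<in> carrier G \<Longrightarrow> g \<otimes> h \<in> Gp \<longleftrightarrow> (g \<in> Gp \<longleftrightarrow> h \<in> Gp)"
  using mem_Gp[of "g \<otimes> h" "\<gamma> 0"] mem_Gp[of g "\<phi> h (\<gamma> 0)"] mem_Gp[of h "\<gamma> 0"] act_mult[of g h "\<gamma> 0"]
  by auto

lemma Gp_one [simp]: "\<one> \<in> Gp"
  using mem_Gp[of \<one> "\<gamma> 0"] by simp

lemma Gp_inv_iff: "g \<in> carrier G \<Longrightarrow> inv g \<in> Gp \<longleftrightarrow> g \<in> Gp"
  using Gp_mult_iff[of g "inv g"] by simp

lemma Gp_subgroup: "subgroup Gp G"
  by (rule subgroup.intro) (auto simp: Gp_carrier Gp_mult_iff Gp_inv_iff)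

text \<open>The folded images of \<open>\<gamma> 0\<close> and \<open>\<gamma> 1\<close> are
  consecutive integers, hence the images of 0 and 1 under exactly one element of
  \<open>D_inf\<close>, which is the value taken here.\<close>

definition \<kappa> :: "'g \<Rightarrow> int \<times> bool" where
  "\<kappa> g = (\<rho> (\<phi> g (\<gamma> 0)), \<rho> (\<phi> g (\<gamma> 1)) < \<rho> (\<phi> g (\<gamma> 0)))"

lemma act_adj01: "g \<in> carrier G \<Longrightarrow> (\<phi> g (\<gamma> 0), \<phi> g (\<gamma> 1)) \<in> adj"
  by (rule act_adj[OF _ adj01])

lemma \<rho>_\<kappa>:
  assumes "g \<in> carrier G" "\<kappa> g = (a, \<epsilon>)"
  shows "\<rho> (\<phi> g (\<gamma> 0)) = a" "\<rho> (\<phi> g (\<gamma> 1)) = (if \<epsilon> then a - 1 else a + 1)"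
  using \<rho>_adj[OF act_adj01[OF assms(1)]] assms(2) by (auto simp: \<kappa>_def)

lemma \<kappa>_eqI:
  assumes "\<rho> (\<phi> g (\<gamma> 0)) = a" "\<rho> (\<phi> g (\<gamma> 1)) = (if \<epsilon> then a - 1 else a + 1)"
  shows "\<kappa> g = (a, \<epsilon>)"
  using assms by (auto simp: \<kappa>_def)

lemma mem_B: "b \<in> B \<longleftrightarrow> b \<in> carrier G \<and> \<phi> b (\<gamma> 0) = \<gamma> 0 \<and> \<phi> b (\<gamma> 1) = \<gamma> 1"
  by (auto simp: B_def e_def fixator_def)

lemma mem_B_\<kappa>:
  assumes "g \<in> carrier G"
  shows "g \<in> B \<longleftrightarrow> \<kappa> g = (0, False)"
proof
  show "g \<in> B \<Longrightarrow> \<kappa> g = (0, False)" by (rule \<kappa>_eqI) (simp_all add: mem_B)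
  assume "\<kappa> g = (0, False)"
  from \<rho>_\<kappa>[OF assms this] show "g \<in> B"
    using \<rho>_0[of "\<phi> g (\<gamma> 0)"] \<rho>_1[of "\<phi> g (\<gamma> 1)"] assms by (simp add: mem_B)
qed

lemma B_carrier: "b \<in> B \<Longrightarrow> b \<in> carrier G"
  by (simp add: mem_B)

lemma B_Gp: "b \<in> B \<Longrightarrow> b \<in> Gp"
  using mem_Gp[of b "\<gamma> 0"] by (simp add: mem_B)

lemma B_subgroup: "subgroup B G"
proof (rule subgroup.intro)
  show "inv b \<in> B" if "b \<in> B" for b
    using that act_inv(1)[of b "\<gamma> 0"] act_inv(1)[of b "\<gamma> 1"] by (simp add: mem_B)
qed (auto simp: mem_B act_mult)

lemma B_mult: "b \<in> B \<Longrightarrow> b' \<in> B \<Longrightarrow> b \<otimes> b' \<in> B" and B_inv: "b \<in> B \<Longrightarrow> inv b \<in> B"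
  using subgroup.m_closed[OF B_subgroup] subgroup.m_inv_closed[OF B_subgroup] by auto

lemma \<rho>_B:
  assumes "b \<in> B" "v \<in> V"
  shows "\<rho> (\<phi> b v) = \<rho> v"
  using act_d[of b "\<gamma> 0" v] act_d[of b "\<gamma> 1" v] assms by (simp add: mem_B \<rho>_def)

lemma \<kappa>_B:
  assumes "b \<in> B" "b' \<in> B" "g \<in> carrier G"
  shows "\<kappa> (b \<otimes> g \<otimes> b') = \<kappa> g"
proof -
  have "\<phi> (b \<otimes> g \<otimes> b') (\<gamma> k) = \<phi> b (\<phi> g (\<gamma> k))" if "k = 0 \<or> k = 1" for k
    using assms that by (auto simp: act_mult mem_B)
  then show ?thesis using assms by (simp add: \<kappa>_def \<rho>_B)
qed

lemma \<kappa>_B_left: "b \<in> B \<Longrightarrow> g \<in> carrier G \<Longrightarrow> \<kappa> (b \<otimes> g) = \<kappa> g"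
  and \<kappa>_B_right: "b \<in> B \<Longrightarrow> g \<in> carrier G \<Longrightarrow> \<kappa> (g \<otimes> b) = \<kappa> g"
  using \<kappa>_B[of b \<one> g] \<kappa>_B[of \<one> b g] subgroup.one_closed[OF B_subgroup] by (simp_all add: B_carrier)

lemma act_image_mult:
  "g \<in> carrier G \<Longrightarrow> h \<in> carrier G \<Longrightarrow> S \<subseteq> V \<Longrightarrow> \<phi> (g \<otimes> h) ` S = \<phi> g ` (\<phi> h ` S)"
  by (force simp: act_mult image_image intro!: image_cong)

lemma act_image_inv:
  assumes "g \<in> carrier G" "S \<subseteq> V"
  shows "\<phi> (inv g) ` (\<phi> g ` S) = S"
proof -
  have "\<phi> (inv g) (\<phi> g v) = v" if "v \<in> S" for v using that assms by auto
  then show ?thesis by (simp add: image_image)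
qed

lemma act_line: 
  assumes g: "g \<in> carrier G" and \<delta>: "tree_line V Ve Vo E \<delta>"
  shows "tree_line V Ve Vo E (\<lambda>k. \<phi> g (\<delta> k))"
proof -
  interpret l: tree_line V Ve Vo E \<delta> by (rule \<delta>)
  show ?thesis
  proof
    show "inj (\<lambda>k. \<phi> g (\<delta> k))" by (rule injI) (simp add: act_inj g)
    show "(\<phi> g (\<delta> k), \<phi> g (\<delta> (k + 1))) \<in> adj" for k by (rule act_adj[OF g l.adj_\<gamma>])
  qed
qed

lemma act_line_edges: "(`) f ` line_edges \<delta> = line_edges (\<lambda>k. f (\<delta> k))"
  by (simp add: line_edges_def image_image)

text \<open>An automorphism mapping a line onto a line matches their parametrisations up to an
  element of the infinite dihedral group, so it suffices to look at vertex sets.\<close>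

lemma mem_N: "n \<in> N \<longleftrightarrow> n \<in> carrier G \<and> (\<forall>k. \<phi> n (\<gamma> k) = \<gamma> (dact (\<kappa> n) k))"
proof
  assume n: "n \<in> N"
  then have nG: "n \<in> carrier G" and img: "\<phi> n ` range \<gamma> = range \<gamma>"
    by (auto simp: N_def stabilizer_of_def VA_def)
  define f where "f k = \<rho> (\<phi> n (\<gamma> k))" for k
  have f: "\<phi> n (\<gamma> k) = \<gamma> (f k)" for k
  proof -
    obtain j where "\<phi> n (\<gamma> k) = \<gamma> j" using img by blast
    then show ?thesis by (simp add: f_def)
  qed
  interpret l: tree_line V Ve Vo E "\<lambda>k. \<phi> n (\<gamma> k)" by (rule act_line[OF nG tree_line_axioms])
  have "inj f"
  proof (rule injI)
    fix j k assume "f j = f k"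
    then have "\<phi> n (\<gamma> j) = \<phi> n (\<gamma> k)" by (simp add: f)
    then show "j = k" using l.\<gamma>_eq by blast
  qed
  moreover have "f (k + 1) = f k + 1 \<or> f k = f (k + 1) + 1" for k
    unfolding f_def by (rule \<rho>_adj[OF l.adj_\<gamma>])
  ultimately have "f k = dact (f 0, f 1 < f 0) k" for k by (rule int_isometry)
  moreover have "(f 0, f 1 < f 0) = \<kappa> n" by (simp add: f_def \<kappa>_def)
  ultimately show "n \<in> carrier G \<and> (\<forall>k. \<phi> n (\<gamma> k) = \<gamma> (dact (\<kappa> n) k))" using f nG by simp
next
  assume n: "n \<in> carrier G \<and> (\<forall>k. \<phi> n (\<gamma> k) = \<gamma> (dact (\<kappa> n) k))"
  obtain a \<epsilon> where \<kappa>: "\<kappa> n = (a, \<epsilon>)" by (cases "\<kappa> n")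
  have surj: "range (dact (\<kappa> n)) = UNIV"
  proof -
    have "k = dact (\<kappa> n) (if \<epsilon> then a - k else k - a)" for k by (simp add: \<kappa> dact_def)
    then have "k \<in> range (dact (\<kappa> n))" for k by (rule range_eqI)
    then show ?thesis by blast
  qed
  have "\<phi> n ` VA = \<gamma> ` range (dact (\<kappa> n))" using n by (simp add: VA_def image_image)
  then have 1: "\<phi> n ` VA = VA" by (simp add: surj VA_def)
  have "line_edges (\<lambda>k. \<gamma> (dact (\<kappa> n) k)) = line_edges \<gamma>"
  proof
    show "line_edges (\<lambda>k. \<gamma> (dact (\<kappa> n) k)) \<subseteq> line_edges \<gamma>"
    proof
      fix x assume "x \<in> line_edges (\<lambda>k. \<gamma> (dact (\<kappa> n) k))"
      then obtain k where x: "x = {\<gamma> (dact (\<kappa> n) k), \<gamma> (dact (\<kappa> n) (k + 1))}" by (auto simp: line_edges_def)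
      \<comment> \<open>A reflection maps the edge from \<open>k\<close> to \<open>k + 1\<close> to
        the edge from \<open>a - k - 1\<close> to \<open>a - k\<close>, so the lower end is shifted
        by one.\<close>
      let ?j = "if \<epsilon> then a - k - 1 else a + k"
      have "x = {\<gamma> ?j, \<gamma> (?j + 1)}"
        unfolding x by (auto simp: \<kappa> dact_def algebra_simps)
      then show "x \<in> line_edges \<gamma>" unfolding line_edges_def by (rule range_eqI)
    qed
    show "line_edges \<gamma> \<subseteq> line_edges (\<lambda>k. \<gamma> (dact (\<kappa> n) k))"
    proof
      fix x assume "x \<in> line_edges \<gamma>"
      then obtain k where x: "x = {\<gamma> k, \<gamma> (k + 1)}" by (auto simp: line_edges_def)
      let ?j = "if \<epsilon> then a - k - 1 else k - a"
      have "x = {\<gamma> (dact (\<kappa> n) ?j), \<gamma> (dact (\<kappa> n) (?j + 1))}"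
        unfolding x by (auto simp: \<kappa> dact_def algebra_simps)
      then show "x \<in> line_edges (\<lambda>k. \<gamma> (dact (\<kappa> n) k))" unfolding line_edges_def by (rule range_eqI)
    qed
  qed
  then have "(`) (\<phi> n) ` EA = EA" using n by (simp add: EA_def act_line_edges)
  then show "n \<in> N" using n 1 by (simp add: N_def stabilizer_of_def)
qed

lemma N_carrier: "n \<in> N \<Longrightarrow> n \<in> carrier G"
  by (simp add: mem_N)

lemma N_act: "n \<in> N \<Longrightarrow> \<phi> n (\<gamma> k) = \<gamma> (dact (\<kappa> n) k)"
  by (simp add: mem_N)

lemma \<kappa>_act:
  assumes "\<And>k. \<phi> g (\<gamma> k) = \<gamma> (dact x k)"
  shows "\<kappa> g = x"
  using assms by (cases x) (auto simp: \<kappa>_def dact_def)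

text \<open>For elements of \<open>N\<close> no folding takes place: \<kappa> records their action
  on the line and is therefore multiplicative there.\<close>

lemma N_mult:
  assumes "n \<in> N" "m \<in> N"
  shows "n \<otimes> m \<in> N" "\<kappa> (n \<otimes> m) = \<kappa> n \<otimes>\<^bsub>D_inf\<^esub> \<kappa> m"
proof -
  have a: "\<phi> (n \<otimes> m) (\<gamma> k) = \<gamma> (dact (\<kappa> n \<otimes>\<^bsub>D_inf\<^esub> \<kappa> m) k)" for k
    using assms by (simp add: act_mult N_carrier N_act dact_mult)
  then show "\<kappa> (n \<otimes> m) = \<kappa> n \<otimes>\<^bsub>D_inf\<^esub> \<kappa> m" by (rule \<kappa>_act)
  then show "n \<otimes> m \<in> N" using a assms by (simp add: mem_N)
qed

lemma \<kappa>_one [simp]: "\<kappa> \<one> = (0, False)"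
  by (rule \<kappa>_act) (simp add: dact_def)

lemma N_inv:
  assumes "n \<in> N"
  shows "inv n \<in> N" "\<kappa> (inv n) = inv\<^bsub>D_inf\<^esub> \<kappa> n"
proof -
  have a: "\<phi> (inv n) (\<gamma> k) = \<gamma> (dact (inv\<^bsub>D_inf\<^esub> \<kappa> n) k)" for k
  proof -
    have "dact (\<kappa> n) (dact (inv\<^bsub>D_inf\<^esub> \<kappa> n) k) = k"
      by (cases "\<kappa> n") (simp add: D_inf_inv dact_def)
    then have "\<phi> n (\<gamma> (dact (inv\<^bsub>D_inf\<^esub> \<kappa> n) k)) = \<gamma> k" using assms by (simp add: N_act)
    then show ?thesis using act_inv(1)[of n "\<gamma> (dact (inv\<^bsub>D_inf\<^esub> \<kappa> n) k)"] assms by (simp add: N_carrier)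
  qed
  then show "\<kappa> (inv n) = inv\<^bsub>D_inf\<^esub> \<kappa> n" by (rule \<kappa>_act)
  then show "inv n \<in> N" using a assms by (simp add: mem_N)
qed

lemma N_one [simp]: "\<one> \<in> N"
  by (simp add: mem_N dact_def)

lemma N_subgroup: "subgroup N G"
  by (rule subgroup.intro) (auto simp: N_carrier N_mult N_inv)

lemma Np_eq: "Np = N \<inter> Gp"
  using Gp_carrier by (auto simp: Np_def N_def stabilizer_of_def)

lemma Np_N: "n \<in> Np \<Longrightarrow> n \<in> N"
  by (simp add: Np_eq)

lemma mem_T: "n \<in> T \<longleftrightarrow> n \<in> N \<and> \<kappa> n = (0, False)"
proof
  assume "n \<in> T"
  then have n: "n \<in> carrier G" "\<And>k. \<phi> n (\<gamma> k) = \<gamma> k" by (auto simp: T_def fixator_def VA_def)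
  then have "\<phi> n (\<gamma> k) = \<gamma> (dact (0, False) k)" for k by (simp add: dact_def)
  then show "n \<in> N \<and> \<kappa> n = (0, False)" using n \<kappa>_act[of n "(0, False)"] by (simp add: mem_N)
next
  assume "n \<in> N \<and> \<kappa> n = (0, False)"
  then show "n \<in> T" by (auto simp: mem_N T_def fixator_def VA_def dact_def)
qed

text \<open>An automorphism of the line that fixes two adjacent vertices is the identity on
  it.\<close>

lemma T_eq: "T = N \<inter> B"
  using mem_B_\<kappa>[OF N_carrier] by (auto simp: mem_T)

lemma T_eq': "T = Np \<inter> B"
  using T_eq B_Gp by (auto simp: Np_eq)

lemma Tp_eq: "fixator \<phi> Gp VA = T"
  using T_eq' Gp_carrier by (auto simp: fixator_def T_def Np_eq)

lemma transitive_lines: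
  assumes "tree_line V Ve Vo E \<delta>" "tree_line V Ve Vo E \<delta>'"
  shows "\<exists>g\<in>Gp. \<phi> g ` range \<delta> = range \<delta>' \<and> (`) (\<phi> g) ` line_edges \<delta> = line_edges \<delta>'"
proof -
  have geo: "geodesic V E (range \<delta>) (line_edges \<delta>)" if "tree_line V Ve Vo E \<delta>" for \<delta>
    unfolding bip_tree_geodesic_iff[OF bip_tree_axioms] by (intro exI[of _ \<delta>] conjI refl that)
  show ?thesis
    by (rule conjunct1[OF st[unfolded strongly_transitive_def, folded Gp_def], rule_format])
      (rule geo[OF assms(1)], rule geo[OF assms(2)])
qed

text \<open>Strong transitivity speaks of the stabiliser of some geodesic. Conjugating by an element
  of \<open>Gp\<close> that carries the present line to that geodesic transfers the
  property.\<close>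

lemma transitive_edges: "\<exists>n\<in>Np. \<phi> n ` {\<gamma> j, \<gamma> (j + 1)} = {\<gamma> k, \<gamma> (k + 1)}"
proof -
  obtain V' E' where geo: "geodesic V E V' E'"
    and tr: "\<forall>a\<in>E'. \<forall>b\<in>E'. \<exists>g\<in>stabilizer_of \<phi> Gp V' E'. \<phi> g ` a = b"
    using conjunct2[OF st[unfolded strongly_transitive_def, folded Gp_def]] by (elim exE conjE) (rule that)
  obtain \<delta> where \<delta>: "tree_line V Ve Vo E \<delta>" "V' = range \<delta>" "E' = line_edges \<delta>"
    using geo unfolding bip_tree_geodesic_iff[OF bip_tree_axioms] by (elim exE conjE) (rule that)
  obtain g where g: "g \<in> Gp" "\<phi> g ` VA = V'" "(`) (\<phi> g) ` EA = E'"
    using transitive_lines[OF tree_line_axioms \<delta>(1)] \<delta> by (auto simp: VA_def EA_def)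
  have gG: "g \<in> carrier G" by (rule Gp_carrier[OF g(1)])
  let ?a = "{\<gamma> j, \<gamma> (j + 1)}" and ?b = "{\<gamma> k, \<gamma> (k + 1)}"
  have ab: "?a \<in> EA" "?b \<in> EA" by (auto simp: EA_def line_edges_def)
  have "\<phi> g ` ?a \<in> E'" "\<phi> g ` ?b \<in> E'"
    unfolding g(3)[symmetric] by (rule imageI[OF ab(1)], rule imageI[OF ab(2)])
  from bspec[OF bspec[OF tr this(1)] this(2)]
  obtain h where h: "h \<in> stabilizer_of \<phi> Gp V' E'" "\<phi> h ` (\<phi> g ` ?a) = \<phi> g ` ?b" by (elim bexE) (rule that)
  then have hG: "h \<in> Gp" "h \<in> carrier G" "\<phi> h ` V' = V'" "(`) (\<phi> h) ` E' = E'"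
    using Gp_carrier by (auto simp: stabilizer_of_def)
  let ?n = "inv g \<otimes> h \<otimes> g"
  have n: "?n \<in> Gp" using g(1) hG gG by (simp add: Gp_mult_iff Gp_inv_iff)
  have act: "\<phi> ?n ` S = \<phi> (inv g) ` (\<phi> h ` (\<phi> g ` S))" if "S \<subseteq> V" for S
  proof -
    have "\<phi> g ` S \<subseteq> V" "\<phi> h ` (\<phi> g ` S) \<subseteq> V" using that gG hG by auto
    then show ?thesis using that gG hG by (simp add: act_image_mult m_assoc)
  qed
  have VA: "VA \<subseteq> V" by (auto simp: VA_def)
  have "\<phi> ?n ` VA = VA" using act[OF VA] act_image_inv[OF gG VA] g(2) hG(3) by simp
  moreover have "(`) (\<phi> ?n) ` EA = EA"
  proof -
    have sub: "x \<subseteq> V" if "x \<in> EA" for x using that by (auto simp: EA_def line_edges_def)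
    have "(`) (\<phi> ?n) ` EA = (`) (\<phi> (inv g)) ` (`) (\<phi> h) ` (`) (\<phi> g) ` EA"
      using act sub by (force simp: image_image intro!: image_cong)
    also have "\<dots> = (`) (\<phi> (inv g)) ` (`) (\<phi> g) ` EA" by (simp only: g(3) hG(4))
    also have "\<dots> = EA"
      using act_image_inv[OF gG sub] by (simp add: image_image)
    finally show ?thesis .
  qed
  ultimately have "?n \<in> Np" using n by (simp add: Np_def stabilizer_of_def)
  moreover have "\<phi> ?n ` ?a = ?b"
  proof -
    have "\<phi> ?n ` ?a = \<phi> (inv g) ` (\<phi> h ` (\<phi> g ` ?a))" by (rule act) simp
    also have "\<dots> = \<phi> (inv g) ` (\<phi> g ` ?b)" by (simp only: h(2))
    also have "\<dots> = ?b" by (rule act_image_inv[OF gG]) simp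
    finally show ?thesis .
  qed
  ultimately show ?thesis by blast
qed

text \<open>Adjacent vertices have different types, so exchanging the ends of \<open>e\<close> and
  preserving types exclude each other.\<close>

lemma fixes_edge:
  assumes g: "g \<in> carrier G" and e: "\<phi> g ` e = e"
  shows "g \<in> Gp \<Longrightarrow> g \<in> B" "g \<notin> Gp \<Longrightarrow> \<phi> g (\<gamma> 0) = \<gamma> 1 \<and> \<phi> g (\<gamma> 1) = \<gamma> 0"
proof -
  have "{\<phi> g (\<gamma> 0), \<phi> g (\<gamma> 1)} = {\<gamma> 0, \<gamma> 1}" using e by (simp add: e_def)
  then have *: "\<phi> g (\<gamma> 0) = \<gamma> 0 \<and> \<phi> g (\<gamma> 1) = \<gamma> 1 \<or> \<phi> g (\<gamma> 0) = \<gamma> 1 \<and> \<phi> g (\<gamma> 1) = \<gamma> 0"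
    by (simp add: doubleton_eq_iff)
  have t: "\<gamma> 0 \<in> Ve \<longleftrightarrow> \<gamma> 1 \<notin> Ve" by (rule adj_types[OF adj01])
  show "g \<in> Gp \<Longrightarrow> g \<in> B" using * mem_Gp[OF g, of "\<gamma> 0"] t g by (auto simp: mem_B)
  show "g \<notin> Gp \<Longrightarrow> \<phi> g (\<gamma> 0) = \<gamma> 1 \<and> \<phi> g (\<gamma> 1) = \<gamma> 0" using * mem_Gp[OF g, of "\<gamma> 0"] by auto
qed

text \<open>An element of \<open>Gp\<close> carrying \<delta> to the line may displace
  \<open>e\<close>; an element of \<open>Np\<close> moves the image of \<open>e\<close> back, and
  the product fixes \<open>e\<close> pointwise.\<close>

lemma transitive_on_lines_through_e:
  assumes \<delta>: "tree_line V Ve Vo E \<delta>" and e: "e \<in> line_edges \<delta>"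
  shows "\<exists>b\<in>B. \<phi> b ` range \<delta> = VA \<and> (`) (\<phi> b) ` line_edges \<delta> = EA"
proof -
  obtain g where g: "g \<in> Gp" "\<phi> g ` range \<delta> = VA" "(`) (\<phi> g) ` line_edges \<delta> = EA"
    using transitive_lines[OF \<delta> tree_line_axioms] by (auto simp: VA_def EA_def)
  have gG: "g \<in> carrier G" by (rule Gp_carrier[OF g(1)])
  have "\<phi> g ` e \<in> EA" using e g(3) by blast
  then obtain j where "\<phi> g ` e = {\<gamma> j, \<gamma> (j + 1)}" by (auto simp: EA_def line_edges_def)
  moreover obtain n where n: "n \<in> Np" "\<phi> n ` {\<gamma> j, \<gamma> (j + 1)} = {\<gamma> 0, \<gamma> (0 + 1)}"
    using transitive_edges[of j 0] by blast
  ultimately have ne: "\<phi> n ` (\<phi> g ` e) = e" by (simp add: e_def)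
  have nG: "n \<in> carrier G" "n \<in> Gp" "\<phi> n ` VA = VA" "(`) (\<phi> n) ` EA = EA"
    using n Gp_carrier by (auto simp: Np_def stabilizer_of_def)
  interpret l: tree_line V Ve Vo E \<delta> by (rule \<delta>)
  have sub: "e \<subseteq> V" "range \<delta> \<subseteq> V" "\<And>x. x \<in> line_edges \<delta> \<Longrightarrow> x \<subseteq> V"
    by (auto simp: e_def line_edges_def)
  have "n \<otimes> g \<in> B"
    using ne nG g(1) gG by (intro fixes_edge(1)) (simp_all add: act_image_mult sub Gp_mult_iff)
  moreover have "\<phi> (n \<otimes> g) ` range \<delta> = VA" using act_image_mult[OF nG(1) gG sub(2)] g(2) nG(3) by simp
  moreover have "(`) (\<phi> (n \<otimes> g)) ` line_edges \<delta> = EA"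
  proof -
    have "(`) (\<phi> (n \<otimes> g)) ` line_edges \<delta> = (`) (\<phi> n) ` (`) (\<phi> g) ` line_edges \<delta>"
      using act_image_mult[OF nG(1) gG sub(3)] by (force simp: image_image intro!: image_cong)
    then show ?thesis using g(3) nG(4) by simp
  qed
  ultimately show ?thesis by blast
qed

text \<open>A line through \<open>e\<close> and \<open>g e\<close> is brought onto the standard line
  by some \<open>b \<in> B\<close>, and some \<open>n \<in> Np\<close> carries \<open>e\<close> to
  \<open>b g e\<close>. This is the geometric content of the Bruhat decomposition.\<close>

lemma move_edge:
  assumes g: "g \<in> carrier G"
  shows "\<exists>b\<in>B. \<exists>n\<in>Np. \<phi> (inv n \<otimes> b \<otimes> g) ` e = e"
proof -
  interpret l: tree_line V Ve Vo E "\<lambda>k. \<phi> g (\<gamma> k)" by (rule act_line[OF g tree_line_axioms])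
  obtain \<delta> m where \<delta>: "tree_line V Ve Vo E \<delta>" "{\<delta> 0, \<delta> 1} = {\<gamma> 0, \<gamma> 1}"
      "{\<delta> m, \<delta> (m + 1)} = {\<phi> g (\<gamma> 0), \<phi> g (\<gamma> 1)}"
    using common_line[of "\<lambda>k. \<phi> g (\<gamma> k)", OF l.adj_\<gamma> l.inj_\<gamma>] by blast
  have "e \<in> line_edges \<delta>" unfolding line_edges_def e_def \<delta>(2)[symmetric] by (rule range_eqI[of _ _ 0]) simp
  then obtain b where b: "b \<in> B" "(`) (\<phi> b) ` line_edges \<delta> = EA"
    using transitive_on_lines_through_e[OF \<delta>(1)] by blast
  have "\<phi> g ` e \<in> line_edges \<delta>" using \<delta>(3) by (auto simp: line_edges_def e_def)
  then have "\<phi> b ` (\<phi> g ` e) \<in> EA" using b(2) by blast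
  then obtain j where j: "\<phi> b ` (\<phi> g ` e) = {\<gamma> j, \<gamma> (j + 1)}" by (auto simp: EA_def line_edges_def)
  obtain n where n: "n \<in> Np" "\<phi> n ` {\<gamma> 0, \<gamma> (0 + 1)} = {\<gamma> j, \<gamma> (j + 1)}"
    using transitive_edges[of 0 j] by blast
  have nG: "n \<in> carrier G" "b \<in> carrier G" using n b by (auto simp: Np_eq N_carrier B_carrier)
  have sub: "e \<subseteq> V" "\<phi> g ` e \<subseteq> V" "\<phi> b ` \<phi> g ` e \<subseteq> V" using g nG by (auto simp: e_def)
  have "\<phi> (inv n \<otimes> b \<otimes> g) ` e = \<phi> (inv n) ` (\<phi> b ` (\<phi> g ` e))"
    using sub nG g by (simp add: act_image_mult m_assoc)
  also have "\<dots> = \<phi> (inv n) ` (\<phi> n ` e)" unfolding j n(2)[symmetric] by (simp add: e_def)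
  also have "\<dots> = e" by (rule act_image_inv[OF nG(1) sub(1)])
  finally show ?thesis using b n by blast
qed

lemma Bruhat_Gp:
  assumes g: "g \<in> Gp"
  shows "\<exists>b\<in>B. \<exists>n\<in>Np. \<exists>b'\<in>B. g = b \<otimes> n \<otimes> b'"
proof -
  have gG: "g \<in> carrier G" by (rule Gp_carrier[OF g])
  obtain b n where bn: "b \<in> B" "n \<in> Np" "\<phi> (inv n \<otimes> b \<otimes> g) ` e = e" using move_edge[OF gG] by blast
  then have c: "b \<in> carrier G" "n \<in> carrier G" "b \<in> Gp" "n \<in> Gp"
    by (auto simp: Np_eq N_carrier B_carrier B_Gp)
  have "inv n \<otimes> b \<otimes> g \<in> B"
    using bn(3) c g gG by (intro fixes_edge(1)) (simp_all add: Gp_mult_iff Gp_inv_iff)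
  moreover have "g = inv b \<otimes> n \<otimes> (inv n \<otimes> b \<otimes> g)"
  proof -
    have "inv b \<otimes> n \<otimes> (inv n \<otimes> b \<otimes> g) = inv b \<otimes> (n \<otimes> inv n) \<otimes> b \<otimes> g"
      using c gG by (simp only: m_assoc m_closed inv_closed)
    then show ?thesis using c gG by simp
  qed
  ultimately show ?thesis using bn B_inv by blast
qed

text \<open>For any \<open>g\<close> outside \<open>Gp\<close>, \<open>move_edge\<close> gives an
  element outside \<open>Gp\<close> preserving \<open>e\<close>, which must exchange its ends. It
  sends the line to another line through \<open>e\<close>, and an element of \<open>B\<close> brings
  that one back.\<close>

lemma inversion_exists:
  assumes "carrier G \<noteq> Gp"
  shows "\<exists>i\<in>N. \<phi> i (\<gamma> 0) = \<gamma> 1 \<and> \<phi> i (\<gamma> 1) = \<gamma> 0"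
proof -
  obtain g where g: "g \<in> carrier G" "g \<notin> Gp" using assms Gp_carrier by blast
  obtain b n where bn: "b \<in> B" "n \<in> Np" "\<phi> (inv n \<otimes> b \<otimes> g) ` e = e" using move_edge[OF g(1)] by blast
  then have c: "b \<in> carrier G" "n \<in> carrier G" "b \<in> Gp" "n \<in> Gp"
    by (auto simp: Np_eq N_carrier B_carrier B_Gp)
  let ?j = "inv n \<otimes> b \<otimes> g"
  have j: "?j \<in> carrier G" "?j \<notin> Gp" using c g by (simp_all add: Gp_mult_iff Gp_inv_iff)
  have swap: "\<phi> ?j (\<gamma> 0) = \<gamma> 1" "\<phi> ?j (\<gamma> 1) = \<gamma> 0" using fixes_edge(2)[OF j(1) bn(3) j(2)] by auto
  interpret l: tree_line V Ve Vo E "\<lambda>k. \<phi> ?j (\<gamma> k)" by (rule act_line[OF j(1) tree_line_axioms])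
  have "e \<in> line_edges (\<lambda>k. \<phi> ?j (\<gamma> k))"
    unfolding line_edges_def using swap by (intro range_eqI[of _ _ 0]) (auto simp: e_def)
  then obtain c where c: "c \<in> B" "\<phi> c ` range (\<lambda>k. \<phi> ?j (\<gamma> k)) = VA"
      "(`) (\<phi> c) ` line_edges (\<lambda>k. \<phi> ?j (\<gamma> k)) = EA"
    using transitive_on_lines_through_e[OF l.tree_line_axioms] by blast
  have cG: "c \<in> carrier G" "\<phi> c (\<gamma> 0) = \<gamma> 0" "\<phi> c (\<gamma> 1) = \<gamma> 1" using c(1) by (auto simp: mem_B)
  have act: "\<phi> (c \<otimes> ?j) (\<gamma> k) = \<phi> c (\<phi> ?j (\<gamma> k))" for k by (rule act_mult[OF cG(1) j(1)]) simp
  have "\<phi> (c \<otimes> ?j) ` VA = VA" using c(2) by (simp add: VA_def image_image act)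
  moreover have "(`) (\<phi> (c \<otimes> ?j)) ` EA = EA" using c(3) by (simp add: EA_def act_line_edges act)
  ultimately have "c \<otimes> ?j \<in> N" using cG j by (simp add: N_def stabilizer_of_def)
  then show ?thesis using act[of 0] act[of 1] swap cG by (intro bexI[of _ "c \<otimes> ?j"]) simp_all
qed

end

section \<open>Bruhat decomposition and finiteness of double cosets\<close>

context tree_action
begin

sublocale group_subgroup G B
  by (intro group_subgroup.intro group_subgroup_axioms.intro is_group B_subgroup)

lemma swap_inv:
  assumes i: "i \<in> carrier G" "\<phi> i (\<gamma> 0) = \<gamma> 1" "\<phi> i (\<gamma> 1) = \<gamma> 0"
  shows "\<phi> (inv i) (\<gamma> 0) = \<gamma> 1" "\<phi> (inv i) (\<gamma> 1) = \<gamma> 0"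
  using act_inv(1)[OF i(1), of "\<gamma> 0"] act_inv(1)[OF i(1), of "\<gamma> 1"] i by simp_all

lemma swap_conj:
  assumes i: "i \<in> carrier G" "\<phi> i (\<gamma> 0) = \<gamma> 1" "\<phi> i (\<gamma> 1) = \<gamma> 0" and b: "b \<in> B"
  shows "i \<otimes> b \<otimes> inv i \<in> B" "inv i \<otimes> b \<otimes> i \<in> B"
proof -
  have bG: "b \<in> carrier G" and b01: "\<phi> b (\<gamma> 0) = \<gamma> 0" "\<phi> b (\<gamma> 1) = \<gamma> 1" using b by (simp_all add: mem_B)
  have "\<phi> (i \<otimes> b \<otimes> inv i) (\<gamma> k) = \<phi> i (\<phi> b (\<phi> (inv i) (\<gamma> k)))"
    "\<phi> (inv i \<otimes> b \<otimes> i) (\<gamma> k) = \<phi> (inv i) (\<phi> b (\<phi> i (\<gamma> k)))" for k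
    using bG i(1) by (simp_all add: act_mult)
  then show "i \<otimes> b \<otimes> inv i \<in> B" "inv i \<otimes> b \<otimes> i \<in> B"
    unfolding mem_B using bG i(1) by (simp_all add: i(2,3) swap_inv[OF i] b01)
qed

lemma \<kappa>_swap: "\<phi> i (\<gamma> 0) = \<gamma> 1 \<Longrightarrow> \<phi> i (\<gamma> 1) = \<gamma> 0 \<Longrightarrow> \<kappa> i = (1, True)"
  by (simp add: \<kappa>_def)

text \<open>Elements outside \<open>Gp\<close> are brought into it by an inversion \<open>i\<close>,
  which normalises \<open>B\<close> and can therefore be moved past the factor
  \<open>b'\<close>.\<close>

lemma Bruhat:
  assumes g: "g \<in> carrier G"
  shows "\<exists>b\<in>B. \<exists>n\<in>N. \<exists>b'\<in>B. g = b \<otimes> n \<otimes> b'"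
proof (cases "g \<in> Gp")
  case True
  then show ?thesis using Bruhat_Gp[OF True] Np_N by blast
next
  case False
  then have "carrier G \<noteq> Gp" using g by blast
  then obtain i where i: "i \<in> N" "\<phi> i (\<gamma> 0) = \<gamma> 1" "\<phi> i (\<gamma> 1) = \<gamma> 0" using inversion_exists by blast
  have iG: "i \<in> carrier G" by (rule N_carrier[OF i(1)])
  have "i \<notin> Gp" using mem_Gp[OF iG, of "\<gamma> 0"] i adj_types[OF adj01] by simp
  then have "g \<otimes> i \<in> Gp" using False g iG by (simp add: Gp_mult_iff)
  then obtain b n b' where bnb: "b \<in> B" "n \<in> Np" "b' \<in> B" "g \<otimes> i = b \<otimes> n \<otimes> b'" using Bruhat_Gp by blast
  then have c: "b \<in> carrier G" "n \<in> N" "n \<in> carrier G" "b' \<in> carrier G"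
    by (auto simp: Np_N N_carrier B_carrier)
  have "g = g \<otimes> i \<otimes> inv i" using g iG by (simp add: m_assoc)
  also have "\<dots> = b \<otimes> n \<otimes> b' \<otimes> inv i" by (simp only: bnb(4))
  also have "\<dots> = b \<otimes> (n \<otimes> inv i) \<otimes> (i \<otimes> b' \<otimes> inv i)"
  proof -
    have "b \<otimes> (n \<otimes> inv i) \<otimes> (i \<otimes> b' \<otimes> inv i) = b \<otimes> n \<otimes> (inv i \<otimes> i) \<otimes> b' \<otimes> inv i"
      using c iG by (simp only: m_assoc m_closed inv_closed)
    then show ?thesis using c iG by simp
  qed
  finally show ?thesis
    using bnb(1) N_mult(1)[OF c(2) N_inv(1)[OF i(1)]] swap_conj(1)[OF iG i(2,3) bnb(3)] by blast
qed

lemma N_\<kappa>_eq: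
  assumes "n \<in> N" "m \<in> N"
  shows "\<kappa> n = \<kappa> m \<longleftrightarrow> inv n \<otimes> m \<in> T"
proof -
  have "\<kappa> (inv n \<otimes> m) = inv\<^bsub>D_inf\<^esub> \<kappa> n \<otimes>\<^bsub>D_inf\<^esub> \<kappa> m" using assms by (simp add: N_mult N_inv)
  moreover have "inv\<^bsub>D_inf\<^esub> \<kappa> n \<otimes>\<^bsub>D_inf\<^esub> \<kappa> m = (0, False) \<longleftrightarrow> \<kappa> n = \<kappa> m"
    by (cases "\<kappa> n"; cases "\<kappa> m") (auto simp: D_inf_inv)
  ultimately show ?thesis using assms by (simp add: mem_T N_mult N_inv)
qed

text \<open>By the Bruhat decomposition both elements are represented by elements of
  \<open>N\<close> with the same \<kappa>, and these differ by an element of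
  \<open>T \<subseteq> B\<close>.\<close>

lemma dcoset_\<kappa>:
  assumes g: "g \<in> carrier G" and h: "h \<in> carrier G"
  shows "h \<in> dcoset G B g \<longleftrightarrow> \<kappa> h = \<kappa> g"
proof
  show "h \<in> dcoset G B g \<Longrightarrow> \<kappa> h = \<kappa> g" using g by (auto simp: mem_dcoset \<kappa>_B)
  assume eq: "\<kappa> h = \<kappa> g"
  obtain b n b' where g': "b \<in> B" "n \<in> N" "b' \<in> B" "g = b \<otimes> n \<otimes> b'" using Bruhat[OF g] by blast
  obtain c m c' where h': "c \<in> B" "m \<in> N" "c' \<in> B" "h = c \<otimes> m \<otimes> c'" using Bruhat[OF h] by blast
  note G = N_carrier[OF g'(2)] N_carrier[OF h'(2)] B_carrier[OF g'(1)] B_carrier[OF g'(3)] B_carrier[OF h'(1)] B_carrier[OF h'(3)]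
  have "\<kappa> n = \<kappa> m" using eq g' h' G by (simp add: \<kappa>_B)
  then have t: "inv n \<otimes> m \<in> B" using N_\<kappa>_eq[OF g'(2) h'(2)] T_eq by blast
  have "(c \<otimes> inv b) \<otimes> g \<otimes> (inv b' \<otimes> (inv n \<otimes> m) \<otimes> c') = c \<otimes> (inv b \<otimes> b) \<otimes> n \<otimes> (b' \<otimes> inv b') \<otimes> inv n \<otimes> m \<otimes> c'"
    unfolding g'(4) using G by (simp only: m_assoc m_closed inv_closed)
  also have "\<dots> = c \<otimes> (n \<otimes> inv n) \<otimes> m \<otimes> c'"
    using G by (simp add: m_assoc del: r_inv)
  also have "\<dots> = h" using G h'(4) by simp
  finally have "h = (c \<otimes> inv b) \<otimes> g \<otimes> (inv b' \<otimes> (inv n \<otimes> m) \<otimes> c')" by (rule sym)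
  moreover have "c \<otimes> inv b \<in> B" "inv b' \<otimes> (inv n \<otimes> m) \<otimes> c' \<in> B"
    using t g' h' by (simp_all only: B_mult B_inv)
  ultimately show "h \<in> dcoset G B g" unfolding mem_dcoset by blast
qed

text \<open>In general \<kappa> is not multiplicative, but inverting \<open>b n b'\<close> keeps the
  shape of a Bruhat decomposition, so the claim is inherited from \<open>N\<close>.\<close>

lemma \<kappa>_inv:
  assumes g: "g \<in> carrier G"
  shows "\<kappa> (inv g) = inv\<^bsub>D_inf\<^esub> \<kappa> g"
proof -
  obtain b n b' where g': "b \<in> B" "n \<in> N" "b' \<in> B" "g = b \<otimes> n \<otimes> b'" using Bruhat[OF g] by blast
  have "inv g = inv b' \<otimes> inv n \<otimes> inv b"
    using g' by (simp add: inv_mult_group m_assoc B_carrier N_carrier)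
  then show ?thesis using g' by (simp add: \<kappa>_B B_inv N_carrier N_inv B_carrier)
qed

lemma d_\<rho>: "int (d (\<gamma> 0) v) = \<bar>\<rho> v\<bar>"
  by (simp add: \<rho>_def)

lemma Gp_\<kappa>: 
  assumes g: "g \<in> carrier G"
  shows "g \<in> Gp \<longleftrightarrow> even (fst (\<kappa> g))"
proof -
  have "(\<gamma> 0 \<in> Ve \<longleftrightarrow> \<phi> g (\<gamma> 0) \<in> Ve) \<longleftrightarrow> even (d (\<gamma> 0) (\<phi> g (\<gamma> 0)))"
    by (rule relpow_adj_types[OF d_relpow]) (simp_all add: g)
  moreover have "even (d (\<gamma> 0) (\<phi> g (\<gamma> 0))) \<longleftrightarrow> even (int (d (\<gamma> 0) (\<phi> g (\<gamma> 0))))" by simp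
  ultimately show ?thesis using mem_Gp[OF g, of "\<gamma> 0"] by (auto simp: d_\<rho> \<kappa>_def)
qed

text \<open>The coset \<open>B c\<close> is determined by where \<open>c\<^sup>-\<^sup>1\<close>
  sends the two ends of \<open>e\<close>, and \<kappa> bounds their distance from
  \<open>\<gamma> 0\<close>. Local finiteness leaves finitely many possibilities; the extra 1 in the
  radius accounts for the second end.\<close>

lemma finite_rcosets_in_B:
  assumes g: "g \<in> carrier G"
  shows "finite (rcosets_in G B (dcoset G B g))"
proof -
  let ?D = "dcoset G B g"
  let ?F = "\<lambda>C. (\<phi> (inv (rep C)) (\<gamma> 0), \<phi> (inv (rep C)) (\<gamma> 1))"
  have D: "?D \<in> dcosets G B" by (rule dcoset_in_dcosets[OF g])
  have inj: "inj_on ?F (rcosets_in G B ?D)"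
  proof (rule inj_onI)
    fix C C' assume C: "C \<in> rcosets_in G B ?D" "C' \<in> rcosets_in G B ?D" and eq: "?F C = ?F C'"
    then have r: "C \<in> rcosets B" "C' \<in> rcosets B" by (auto simp: rcosets_in_def)
    note c = rcosets_rep[OF r(1)] and c' = rcosets_rep[OF r(2)]
    have "\<phi> (rep C \<otimes> inv (rep C')) (\<gamma> k) = \<gamma> k" if "k = 0 \<or> k = 1" for k
    proof -
      have "\<phi> (inv (rep C')) (\<gamma> k) = \<phi> (inv (rep C)) (\<gamma> k)" using eq that by auto
      then show ?thesis using c(2) c'(2) by (simp add: act_mult)
    qed
    then have "rep C \<otimes> inv (rep C') \<in> B" using c(2) c'(2) by (simp add: mem_B)
    then have "B #> rep C = B #> rep C'" by (simp only: rcos_eq_iff[OF c(2) c'(2)])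
    then show "C = C'" unfolding c(3) c'(3) .
  qed
  obtain a \<epsilon> where a: "inv\<^bsub>D_inf\<^esub> \<kappa> g = (a, \<epsilon>)" by (cases "inv\<^bsub>D_inf\<^esub> \<kappa> g")
  let ?S = "{v \<in> V. d (\<gamma> 0) v \<le> nat (\<bar>a\<bar> + 1)}"
  have "finite (?F ` rcosets_in G B ?D)"
  proof (rule finite_subset)
    show "finite (?S \<times> ?S)" using finite_ball[OF lf, of "\<gamma> 0"] by simp
    show "?F ` rcosets_in G B ?D \<subseteq> ?S \<times> ?S"
    proof
      fix p assume "p \<in> ?F ` rcosets_in G B ?D"
      then obtain C where C: "C \<in> rcosets_in G B ?D" "p = ?F C" by blast
      then have "C \<in> rcosets B" and rD: "rep C \<in> ?D" using rcosets_in_iff[OF D] by auto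
      then have c: "rep C \<in> carrier G" using rcosets_rep(2) by blast
      have "\<kappa> (inv (rep C)) = (a, \<epsilon>)" using rD dcoset_\<kappa>[OF g c] c a by (simp add: \<kappa>_inv)
      from \<rho>_\<kappa>[OF inv_closed[OF c] this]
      have "int (d (\<gamma> 0) (\<phi> (inv (rep C)) (\<gamma> 0))) \<le> \<bar>a\<bar> + 1" "int (d (\<gamma> 0) (\<phi> (inv (rep C)) (\<gamma> 1))) \<le> \<bar>a\<bar> + 1"
        unfolding d_\<rho> by auto
      then show "p \<in> ?S \<times> ?S" using c C(2) by (simp add: le_nat_iff)
    qed
  qed
  then show ?thesis by (rule finite_imageD[OF _ inj])
qed

lemma hecke_G: "hecke G B"
  by (intro hecke.intro hecke_axioms.intro group_subgroup_axioms finite_rcosets_in_B)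

section \<open>Passage to the type-preserving subgroup\<close>

abbreviation Gplus :: "('g, 'm) monoid_scheme" where "Gplus \<equiv> G\<lparr>carrier := Gp\<rparr>"

lemma Gplus_group: "group Gplus"
  by (rule subgroup.subgroup_is_group[OF Gp_subgroup is_group])

lemma dcoset_Gplus [simp]: "dcoset Gplus H = dcoset G H"
  by (simp add: fun_eq_iff dcoset_def)

lemma B_subgroup_Gplus: "subgroup B Gplus"
  by (rule subgroup_incl[OF B_subgroup Gp_subgroup]) (auto simp: B_Gp)

lemma rcosets_Gplus: "rcosets\<^bsub>Gplus\<^esub> B = (\<lambda>a. B #> a) ` Gp"
  by (auto simp: RCOSETS_def)

lemma rcosets_in_Gplus:
  assumes "D \<subseteq> Gp"
  shows "rcosets_in Gplus B D = rcosets_in G B D"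
proof -
  have "C \<in> (\<lambda>a. B #> a) ` Gp" if C: "C \<in> rcosets B" "C \<subseteq> D" for C
  proof -
    note r = rcosets_rep[OF C(1)]
    then have "rep C \<in> Gp" using assms C by blast
    then show ?thesis using r(3) by (metis imageI)
  qed
  moreover have "C \<in> rcosets B" if "C \<in> (\<lambda>a. B #> a) ` Gp" for C
    using that Gp_carrier by auto
  ultimately show ?thesis by (auto simp: rcosets_in_def rcosets_Gplus)
qed

lemma dcoset_Gp: "g \<in> Gp \<Longrightarrow> dcoset G B g \<subseteq> Gp"
  by (auto simp: mem_dcoset Gp_mult_iff B_Gp Gp_carrier)

lemma hecke_Gplus: "hecke Gplus B"
proof (intro hecke.intro group_subgroup.intro group_subgroup_axioms.intro hecke_axioms.intro
    Gplus_group B_subgroup_Gplus)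
  show "finite (rcosets_in Gplus B (dcoset Gplus B g))" if "g \<in> carrier Gplus" for g
    using that finite_rcosets_in_B[OF Gp_carrier] by (simp add: rcosets_in_Gplus dcoset_Gp)
qed

section \<open>Positions of adjacent chambers\<close>

text \<open>The number \<open>2 * \<rho> v - \<rho> u\<close> is the mirror image of
  \<open>\<rho> u\<close> in \<open>\<rho> v\<close>. The edges \<open>g e\<close> and
  \<open>g z e\<close> share the vertex \<open>g (\<gamma> p)\<close>, which has at most one inner
  neighbour; so if \<open>g e\<close> points inwards, \<open>g z e\<close> points outwards.\<close>

lemma panel:
  assumes g: "g \<in> carrier G" and z: "z \<in> carrier G" and po: "{p, r} = {0, 1}"
    and fx: "\<phi> z (\<gamma> p) = \<gamma> p" and move: "\<phi> z (\<gamma> r) \<noteq> \<gamma> r"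
  shows "\<rho> (\<phi> (g \<otimes> z) (\<gamma> p)) = \<rho> (\<phi> g (\<gamma> p))"
    and "inner (\<phi> g (\<gamma> p)) (\<phi> g (\<gamma> r)) \<Longrightarrow>
      \<rho> (\<phi> (g \<otimes> z) (\<gamma> r)) = 2 * \<rho> (\<phi> g (\<gamma> p)) - \<rho> (\<phi> g (\<gamma> r))"
    and "\<rho> (\<phi> (g \<otimes> z) (\<gamma> r)) = 2 * \<rho> (\<phi> g (\<gamma> p)) - \<rho> (\<phi> g (\<gamma> r)) \<or> \<rho> (\<phi> (g \<otimes> z) (\<gamma> r)) = \<rho> (\<phi> g (\<gamma> r))"
    and "(\<phi> g (\<gamma> p), \<phi> (g \<otimes> z) (\<gamma> r)) \<in> adj"
proof -
  let ?v = "\<phi> g (\<gamma> p)" and ?u = "\<phi> g (\<gamma> r)" and ?w = "\<phi> (g \<otimes> z) (\<gamma> r)"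
  have pr: "(\<gamma> p, \<gamma> r) \<in> adj" by (rule adj_\<gamma>_iff) (use po in \<open>auto simp: doubleton_eq_iff\<close>)
  have w: "?w = \<phi> g (\<phi> z (\<gamma> r))" by (rule act_mult[OF g z]) simp
  show "\<rho> (\<phi> (g \<otimes> z) (\<gamma> p)) = \<rho> ?v" using act_mult[OF g z, of "\<gamma> p"] fx by simp
  have vu: "(?v, ?u) \<in> adj" by (rule act_adj[OF g pr])
  have "(\<gamma> p, \<phi> z (\<gamma> r)) \<in> adj" using act_adj[OF z pr] fx by simp
  then show vw: "(?v, ?w) \<in> adj" unfolding w by (rule act_adj[OF g])
  show c: "\<rho> ?w = 2 * \<rho> ?v - \<rho> ?u \<or> \<rho> ?w = \<rho> ?u"
    using \<rho>_adj[OF vu] \<rho>_adj[OF vw] by arith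
  have ne: "?w \<noteq> ?u" unfolding w using act_inj[OF g, of "\<phi> z (\<gamma> r)" "\<gamma> r"] z move by simp
  show "\<rho> ?w = 2 * \<rho> ?v - \<rho> ?u" if i: "inner ?v ?u"
  proof (rule ccontr)
    assume "\<rho> ?w \<noteq> 2 * \<rho> ?v - \<rho> ?u"
    then have "\<rho> ?w = \<rho> ?u" using c by simp
    then have "inner ?v ?w" using i by (simp add: inner_def)
    then show False using inner_unique[OF vw vu _ i] ne by simp
  qed
qed

text \<open>Both edges are the unique one pointing inwards, so \<open>z\<close> and
  \<open>z'\<close> agree on both ends of \<open>e\<close>.\<close>

lemma panel_unique:
  assumes g: "g \<in> carrier G" and z: "z \<in> carrier G" "z' \<in> carrier G" and po: "{p, r} = {0, 1}"
    and fx: "\<phi> z (\<gamma> p) = \<gamma> p" "\<phi> z' (\<gamma> p) = \<gamma> p" 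
    and inner: "inner (\<phi> g (\<gamma> p)) (\<phi> (g \<otimes> z) (\<gamma> r))" "inner (\<phi> g (\<gamma> p)) (\<phi> (g \<otimes> z') (\<gamma> r))"
  shows "inv z \<otimes> z' \<in> B"
proof -
  have pr: "(\<gamma> p, \<gamma> r) \<in> adj" by (rule adj_\<gamma>_iff) (use po in \<open>auto simp: doubleton_eq_iff\<close>)
  have adj: "(\<phi> g (\<gamma> p), \<phi> (g \<otimes> y) (\<gamma> r)) \<in> adj" if "y \<in> carrier G" "\<phi> y (\<gamma> p) = \<gamma> p" for y
    using act_adj[OF g act_adj[OF that(1) pr]] that g by (simp add: act_mult)
  have "\<phi> (g \<otimes> z) (\<gamma> r) = \<phi> (g \<otimes> z') (\<gamma> r)"
    by (rule inner_unique[OF adj[OF z(1) fx(1)] adj[OF z(2) fx(2)] inner])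
  then have "\<phi> z' (\<gamma> r) = \<phi> z (\<gamma> r)" using g z by (simp add: act_mult act_inj)
  then have "\<phi> (inv z \<otimes> z') (\<gamma> r) = \<gamma> r" using z by (simp add: act_mult)
  moreover have "\<phi> (inv z \<otimes> z') (\<gamma> p) = \<gamma> p"
    using z act_inv(1)[OF z(1), of "\<gamma> p"] fx by (simp add: act_mult)
  ultimately show ?thesis using po z by (auto simp: mem_B doubleton_eq_iff)
qed

text \<open>The edge \<open>g e\<close> points outwards from \<open>g (\<gamma> 1)\<close>, that is,
  the panel of \<open>g e\<close> at this vertex has an edge nearer to \<open>e\<close>. The bounds
  exclude \<open>g e = e\<close>. The analogous \<open>near_t\<close> concerns
  \<open>g (\<gamma> 0)\<close>.\<close>

definition near_s :: "int \<times> bool \<Rightarrow> bool" where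
  "near_s x = (case x of (a, \<epsilon>) \<Rightarrow> if \<epsilon> then a \<ge> 2 else a \<le> -1)"

definition near_t :: "int \<times> bool \<Rightarrow> bool" where
  "near_t x = (case x of (a, \<epsilon>) \<Rightarrow> if \<epsilon> then a \<le> 0 else a \<ge> 1)"

text \<open>\<open>(2, True)\<close> and \<open>(0, True)\<close> are the reflections
  \<open>k \<mapsto> 2 - k\<close> and \<open>k \<mapsto> - k\<close> in the two ends of
  \<open>e\<close>, while \<open>(1, True)\<close> exchanges these ends.\<close>

lemma \<kappa>_s:
  assumes "z \<in> carrier G" "\<kappa> z = (2, True)"
  shows "\<phi> z (\<gamma> 1) = \<gamma> 1" "\<phi> z (\<gamma> 0) \<noteq> \<gamma> 0"
  using \<rho>_\<kappa>[OF assms] \<rho>_1[of "\<phi> z (\<gamma> 1)"] assms by auto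

lemma \<kappa>_t:
  assumes "z \<in> carrier G" "\<kappa> z = (0, True)"
  shows "\<phi> z (\<gamma> 0) = \<gamma> 0" "\<phi> z (\<gamma> 1) \<noteq> \<gamma> 1"
  using \<rho>_\<kappa>[OF assms] \<rho>_0[of "\<phi> z (\<gamma> 0)"] assms by auto

lemma \<kappa>_i:
  assumes "z \<in> carrier G" "\<kappa> z = (1, True)"
  shows "\<phi> z (\<gamma> 0) = \<gamma> 1" "\<phi> z (\<gamma> 1) = \<gamma> 0"
  using \<rho>_\<kappa>[OF assms] \<rho>_0[of "\<phi> z (\<gamma> 1)"] \<rho>_1[of "\<phi> z (\<gamma> 0)"] assms by auto

lemma panel_s:
  assumes g: "g \<in> carrier G" and z: "z \<in> carrier G" "\<kappa> z = (2, True)"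
  shows "\<kappa> (g \<otimes> z) = \<kappa> g \<otimes>\<^bsub>D_inf\<^esub> (2, True) \<or> near_s (\<kappa> g) \<and> \<kappa> (g \<otimes> z) = \<kappa> g"
proof -
  obtain a \<epsilon> where a: "\<kappa> g = (a, \<epsilon>)" by (cases "\<kappa> g")
  note p = panel[OF g z(1) insert_commute \<kappa>_s[OF z]]
  note \<rho> = \<rho>_\<kappa>[OF g a]
  have 1: "\<kappa> (g \<otimes> z) = \<kappa> g \<otimes>\<^bsub>D_inf\<^esub> (2, True)"
    if "\<rho> (\<phi> (g \<otimes> z) (\<gamma> 0)) = 2 * \<rho> (\<phi> g (\<gamma> 1)) - \<rho> (\<phi> g (\<gamma> 0))"
    using that p(1) \<rho> by (auto simp: \<kappa>_def[of "g \<otimes> z"] a)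
  have 2: "\<kappa> (g \<otimes> z) = \<kappa> g" if "\<rho> (\<phi> (g \<otimes> z) (\<gamma> 0)) = \<rho> (\<phi> g (\<gamma> 0))"
    using that p(1) by (simp add: \<kappa>_def)
  have 3: "inner (\<phi> g (\<gamma> 1)) (\<phi> g (\<gamma> 0))" if "\<not> near_s (\<kappa> g)"
    using that \<rho> by (auto simp: inner_def near_s_def a split: if_splits)
  show ?thesis using 1 2 3 p(2,3) by blast
qed

lemma panel_s_unique:
  assumes g: "g \<in> carrier G" "near_s (\<kappa> g)"
    and z: "z \<in> carrier G" "\<kappa> z = (2, True)" "\<kappa> (g \<otimes> z) = \<kappa> g \<otimes>\<^bsub>D_inf\<^esub> (2, True)"
    and z': "z' \<in> carrier G" "\<kappa> z' = (2, True)" "\<kappa> (g \<otimes> z') = \<kappa> g \<otimes>\<^bsub>D_inf\<^esub> (2, True)"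
  shows "inv z \<otimes> z' \<in> B"
proof -
  obtain a \<epsilon> where a: "\<kappa> g = (a, \<epsilon>)" by (cases "\<kappa> g")
  have inn: "inner (\<phi> g (\<gamma> 1)) (\<phi> (g \<otimes> y) (\<gamma> 0))" if "\<kappa> (g \<otimes> y) = \<kappa> g \<otimes>\<^bsub>D_inf\<^esub> (2, True)" for y
    using that g(2) \<rho>_\<kappa>[OF g(1) a]
    by (auto simp: inner_def near_s_def a \<kappa>_def[of "g \<otimes> y"] split: if_splits)
  show ?thesis
    by (rule panel_unique[OF g(1) z(1) z'(1) insert_commute \<kappa>_s(1)[OF z(1,2)] \<kappa>_s(1)[OF z'(1,2)]
          inn[OF z(3)] inn[OF z'(3)]])
qed

lemma panel_t:
  assumes g: "g \<in> carrier G" and z: "z \<in> carrier G" "\<kappa> z = (0, True)"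
  shows "\<kappa> (g \<otimes> z) = \<kappa> g \<otimes>\<^bsub>D_inf\<^esub> (0, True) \<or> near_t (\<kappa> g) \<and> \<kappa> (g \<otimes> z) = \<kappa> g"
proof -
  obtain a \<epsilon> where a: "\<kappa> g = (a, \<epsilon>)" by (cases "\<kappa> g")
  note p = panel[OF g z(1) refl \<kappa>_t[OF z]]
  note \<rho> = \<rho>_\<kappa>[OF g a]
  have 1: "\<kappa> (g \<otimes> z) = \<kappa> g \<otimes>\<^bsub>D_inf\<^esub> (0, True)"
    if "\<rho> (\<phi> (g \<otimes> z) (\<gamma> 1)) = 2 * \<rho> (\<phi> g (\<gamma> 0)) - \<rho> (\<phi> g (\<gamma> 1))"
    using that p(1) \<rho> by (auto simp: \<kappa>_def[of "g \<otimes> z"] a)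
  have 2: "\<kappa> (g \<otimes> z) = \<kappa> g" if "\<rho> (\<phi> (g \<otimes> z) (\<gamma> 1)) = \<rho> (\<phi> g (\<gamma> 1))"
    using that p(1) by (simp add: \<kappa>_def)
  have 3: "inner (\<phi> g (\<gamma> 0)) (\<phi> g (\<gamma> 1))" if "\<not> near_t (\<kappa> g)"
    using that \<rho> by (auto simp: inner_def near_t_def a split: if_splits)
  show ?thesis using 1 2 3 p(2,3) by blast
qed

lemma panel_t_unique:
  assumes g: "g \<in> carrier G" "near_t (\<kappa> g)"
    and z: "z \<in> carrier G" "\<kappa> z = (0, True)" "\<kappa> (g \<otimes> z) = \<kappa> g \<otimes>\<^bsub>D_inf\<^esub> (0, True)"
    and z': "z' \<in> carrier G" "\<kappa> z' = (0, True)" "\<kappa> (g \<otimes> z') = \<kappa> g \<otimes>\<^bsub>D_inf\<^esub> (0, True)"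
  shows "inv z \<otimes> z' \<in> B"
proof -
  obtain a \<epsilon> where a: "\<kappa> g = (a, \<epsilon>)" by (cases "\<kappa> g")
  have inn: "inner (\<phi> g (\<gamma> 0)) (\<phi> (g \<otimes> y) (\<gamma> 1))" if "y \<in> carrier G" "\<kappa> (g \<otimes> y) = \<kappa> g \<otimes>\<^bsub>D_inf\<^esub> (0, True)" for y
  proof -
    have "\<kappa> (g \<otimes> y) = (a, \<not> \<epsilon>)" using that a by simp
    from \<rho>_\<kappa>[OF m_closed[OF g(1) that(1)] this] \<rho>_\<kappa>[OF g(1) a] show ?thesis
      using g(2) by (auto simp: inner_def near_t_def a split: if_splits)
  qed
  show ?thesis
    by (rule panel_unique[OF g(1) z(1) z'(1) refl \<kappa>_t(1)[OF z(1,2)] \<kappa>_t(1)[OF z'(1,2)]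
          inn[OF z(1,3)] inn[OF z'(1,3)]])
qed

text \<open>Here \<open>z e = e\<close>, so \<open>g z e\<close> is \<open>g e\<close> with its ends
  exchanged and, in contrast to a reflection, only one outcome is possible.\<close>

lemma panel_i:
  assumes g: "g \<in> carrier G" and z: "z \<in> carrier G" "\<kappa> z = (1, True)"
  shows "\<kappa> (g \<otimes> z) = \<kappa> g \<otimes>\<^bsub>D_inf\<^esub> (1, True)"
proof -
  obtain a \<epsilon> where a: "\<kappa> g = (a, \<epsilon>)" by (cases "\<kappa> g")
  show ?thesis using \<rho>_\<kappa>[OF g a] \<kappa>_i[OF z] g z(1)
    by (auto simp: \<kappa>_def[of "g \<otimes> z"] a act_mult)
qed

lemma panel_i_unique:
  assumes "z \<in> carrier G" "\<kappa> z = (1, True)" "z' \<in> carrier G" "\<kappa> z' = (1, True)"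
  shows "inv z \<otimes> z' \<in> B"
  using assms \<kappa>_i[OF assms(1,2)] \<kappa>_i[OF assms(3,4)] swap_inv[OF assms(1) \<kappa>_i[OF assms(1,2)]]
  by (simp add: mem_B act_mult)

text \<open>With \<open>g = b n b'\<close> the witness is \<open>b'\<^sup>-\<^sup>1 r\<close>: then
  \<open>g z = b n r\<close>, and \<kappa> is multiplicative on \<open>N\<close>.\<close>

lemma gallery_exists:
  assumes g: "g \<in> carrier G" and r: "r \<in> N"
  shows "\<exists>z\<in>carrier G. \<kappa> z = \<kappa> r \<and> \<kappa> (g \<otimes> z) = \<kappa> g \<otimes>\<^bsub>D_inf\<^esub> \<kappa> r"
proof -
  obtain b n b' where g': "b \<in> B" "n \<in> N" "b' \<in> B" "g = b \<otimes> n \<otimes> b'" using Bruhat[OF g] by blast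
  note G = N_carrier[OF g'(2)] N_carrier[OF r] B_carrier[OF g'(1)] B_carrier[OF g'(3)]
  let ?z = "inv b' \<otimes> r"
  have "g \<otimes> ?z = b \<otimes> n \<otimes> (b' \<otimes> inv b') \<otimes> r"
    unfolding g'(4) using G by (simp only: m_assoc m_closed inv_closed)
  also have "\<dots> = b \<otimes> (n \<otimes> r)" using G by (simp add: m_assoc)
  finally have "\<kappa> (g \<otimes> ?z) = \<kappa> n \<otimes>\<^bsub>D_inf\<^esub> \<kappa> r"
    using g' r G by (simp add: \<kappa>_B_left N_mult)
  moreover have "\<kappa> g = \<kappa> n" using g' G by (simp add: \<kappa>_B)
  moreover have "\<kappa> ?z = \<kappa> r" using g' G by (simp add: \<kappa>_B_left B_inv)
  ultimately show ?thesis using G by (intro bexI[of _ ?z]) simp_all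
qed

text \<open>Two automorphisms of the line map \<open>e\<close> to a given edge, and their first
  components have opposite parity. For a reflection the target edge starts at \<open>a - 1\<close>,
  where \<open>k \<mapsto> a - k\<close> sends 1.\<close>

lemma \<kappa>_surj_even: 
  assumes "even a"
  shows "\<exists>n\<in>Np. \<kappa> n = (a, \<epsilon>)"
proof -
  obtain n where n: "n \<in> Np" "\<phi> n ` {\<gamma> 0, \<gamma> (0 + 1)} = {\<gamma> (if \<epsilon> then a - 1 else a), \<gamma> ((if \<epsilon> then a - 1 else a) + 1)}"
    using transitive_edges[of 0 "if \<epsilon> then a - 1 else a"] by blast
  have nG: "n \<in> carrier G" "n \<in> Gp" "n \<in> N" using n(1) by (auto simp: Np_eq N_carrier)
  obtain b \<delta> where b: "\<kappa> n = (b, \<delta>)" by (cases "\<kappa> n")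
  have ev: "even b" using Gp_\<kappa>[OF nG(1)] nG(2) b by simp
  have "{\<gamma> b, \<gamma> (if \<delta> then b - 1 else b + 1)} = {\<gamma> (if \<epsilon> then a - 1 else a), \<gamma> ((if \<epsilon> then a - 1 else a) + 1)}"
    using n(2) N_act[OF nG(3), of 0] N_act[OF nG(3), of 1] b
    by (cases \<delta>; cases \<epsilon>) (simp_all add: dact_def)
  then have "b = a \<and> \<delta> = \<epsilon>"
    using ev assms by (auto simp: doubleton_eq_iff split: if_splits)
  then show ?thesis using n b by blast
qed

lemma \<kappa>_surj:
  assumes "carrier G \<noteq> Gp"
  shows "\<exists>n\<in>N. \<kappa> n = x"
proof -
  obtain a \<epsilon> where x: "x = (a, \<epsilon>)" by (cases x)
  obtain i where i: "i \<in> N" "\<phi> i (\<gamma> 0) = \<gamma> 1" "\<phi> i (\<gamma> 1) = \<gamma> 0" using inversion_exists[OF assms] by blast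
  show ?thesis
  proof (cases "even a")
    case True
    then show ?thesis using \<kappa>_surj_even[of a \<epsilon>] Np_N x by blast
  next
    case False
    then have "even (if \<epsilon> then a - 1 else a + 1)" by simp
    then obtain n where n: "n \<in> Np" "\<kappa> n = (if \<epsilon> then a - 1 else a + 1, \<not> \<epsilon>)"
      using \<kappa>_surj_even by (meson bexE)
    have "\<kappa> (n \<otimes> i) = x" using n \<kappa>_swap[OF i(2,3)] N_mult(2)[OF Np_N[OF n(1)] i(1)] by (simp add: x)
    then show ?thesis using N_mult(1)[OF Np_N[OF n(1)] i(1)] by blast
  qed
qed

text \<open>The coordinates in which the reflections \<open>s\<close>, \<open>t\<close> in \<open>\<gamma> 1\<close>, \<open>\<gamma> 0\<close>
  (for \<open>G\<^sup>+\<close>), respectively \<open>s\<close> and the inversion \<open>i\<close> (for \<open>G\<close>), become the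
  standard generators.\<close>

definition \<kappa>\<^sub>p :: "'g \<Rightarrow> int \<times> bool" where
  "\<kappa>\<^sub>p g = (fst (\<kappa> g) div 2, snd (\<kappa> g))"

definition \<kappa>\<^sub>t :: "'g \<Rightarrow> int \<times> bool" where
  "\<kappa>\<^sub>t g = (if snd (\<kappa> g) then fst (\<kappa> g) - 1 else fst (\<kappa> g), snd (\<kappa> g))"

lemma \<kappa>\<^sub>p_iff: "g \<in> Gp \<Longrightarrow> \<kappa>\<^sub>p g = (a, \<epsilon>) \<longleftrightarrow> \<kappa> g = (2 * a, \<epsilon>)"
  using Gp_\<kappa>[OF Gp_carrier, of g] by (cases "\<kappa> g") (auto simp: \<kappa>\<^sub>p_def elim!: evenE)

lemma \<kappa>\<^sub>t_iff: "\<kappa>\<^sub>t g = (a, \<epsilon>) \<longleftrightarrow> \<kappa> g = (if \<epsilon> then a + 1 else a, \<epsilon>)"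
  by (cases "\<kappa> g") (auto simp: \<kappa>\<^sub>t_def)

lemma dihedral_hecke_Gplus: "dihedral_hecke Gplus B \<kappa>\<^sub>p"
proof -
  interpret P: hecke Gplus B by (rule hecke_Gplus)
  have inv_Gp: "inv\<^bsub>Gplus\<^esub> g = inv g" if "g \<in> Gp" for g
    by (rule m_inv_consistent[OF Gp_subgroup that])
  have eq: "\<kappa>\<^sub>p g = \<kappa>\<^sub>p h \<longleftrightarrow> \<kappa> g = \<kappa> h" if "g \<in> Gp" "h \<in> Gp" for g h
    using \<kappa>\<^sub>p_iff[OF that(1)] \<kappa>\<^sub>p_iff[OF that(2)] by (metis surj_pair)
  have s: "\<kappa>\<^sub>p z = dgen True \<longleftrightarrow> \<kappa> z = (2, True)" and t: "\<kappa>\<^sub>p z = dgen False \<longleftrightarrow> \<kappa> z = (0, True)"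
    if "z \<in> Gp" for z using \<kappa>\<^sub>p_iff[OF that] by (simp_all add: dgen_def)
  \<comment> \<open>Halving makes the bounds match \<open>ends_iff\<close>:
    \<open>2 * a \<ge> 2\<close> is \<open>a \<ge> 1\<close>, and \<open>2 * a \<le> -1\<close> is
    \<open>a < 0\<close>.\<close>
  have near: "ends True (\<kappa>\<^sub>p g) \<longleftrightarrow> near_s (\<kappa> g)" "ends False (\<kappa>\<^sub>p g) \<longleftrightarrow> near_t (\<kappa> g)" if "g \<in> Gp" for g
  proof -
    obtain a \<epsilon> where a: "\<kappa>\<^sub>p g = (a, \<epsilon>)" by (cases "\<kappa>\<^sub>p g")
    then have k: "\<kappa> g = (2 * a, \<epsilon>)" by (simp only: \<kappa>\<^sub>p_iff[OF that])
    show "ends True (\<kappa>\<^sub>p g) \<longleftrightarrow> near_s (\<kappa> g)" "ends False (\<kappa>\<^sub>p g) \<longleftrightarrow> near_t (\<kappa> g)"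
      unfolding a k by (auto simp: ends_iff near_s_def near_t_def)
  qed
  have mult: "\<kappa>\<^sub>p h = \<kappa>\<^sub>p g \<otimes>\<^bsub>D_inf\<^esub> dgen True \<longleftrightarrow> \<kappa> h = \<kappa> g \<otimes>\<^bsub>D_inf\<^esub> (2, True)"
      "\<kappa>\<^sub>p h = \<kappa>\<^sub>p g \<otimes>\<^bsub>D_inf\<^esub> dgen False \<longleftrightarrow> \<kappa> h = \<kappa> g \<otimes>\<^bsub>D_inf\<^esub> (0, True)" if "g \<in> Gp" "h \<in> Gp" for g h
  proof -
    obtain a \<epsilon> where a: "\<kappa>\<^sub>p g = (a, \<epsilon>)" by (cases "\<kappa>\<^sub>p g")
    then have k: "\<kappa> g = (2 * a, \<epsilon>)" by (simp only: \<kappa>\<^sub>p_iff[OF that(1)])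
    have "\<kappa>\<^sub>p g \<otimes>\<^bsub>D_inf\<^esub> dgen True = (if \<epsilon> then a - 1 else a + 1, \<not> \<epsilon>)"
      "\<kappa> g \<otimes>\<^bsub>D_inf\<^esub> (2, True) = (2 * (if \<epsilon> then a - 1 else a + 1), \<not> \<epsilon>)"
      "\<kappa>\<^sub>p g \<otimes>\<^bsub>D_inf\<^esub> dgen False = (a, \<not> \<epsilon>)" "\<kappa> g \<otimes>\<^bsub>D_inf\<^esub> (0, True) = (2 * a, \<not> \<epsilon>)"
      unfolding a k by (simp_all add: dgen_def)
    then show "\<kappa>\<^sub>p h = \<kappa>\<^sub>p g \<otimes>\<^bsub>D_inf\<^esub> dgen True \<longleftrightarrow> \<kappa> h = \<kappa> g \<otimes>\<^bsub>D_inf\<^esub> (2, True)"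
      "\<kappa>\<^sub>p h = \<kappa>\<^sub>p g \<otimes>\<^bsub>D_inf\<^esub> dgen False \<longleftrightarrow> \<kappa> h = \<kappa> g \<otimes>\<^bsub>D_inf\<^esub> (0, True)"
      by (simp_all only: \<kappa>\<^sub>p_iff[OF that(2)])
  qed
  show ?thesis
  proof
    show "\<exists>g\<in>carrier Gplus. \<kappa>\<^sub>p g = x" for x
    proof -
      obtain n where "n \<in> Np" "\<kappa> n = (2 * fst x, snd x)" using \<kappa>_surj_even[of "2 * fst x" "snd x"] by auto
      then show ?thesis by (intro bexI[of _ n]) (auto simp: Np_eq \<kappa>\<^sub>p_iff \<kappa>\<^sub>p_def)
    qed
    show "\<kappa>\<^sub>p \<one>\<^bsub>Gplus\<^esub> = (0, False)" by (simp add: \<kappa>\<^sub>p_def)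
    fix g assume "g \<in> carrier Gplus"
    then have g: "g \<in> Gp" "g \<in> carrier G" using Gp_carrier by auto
    show "\<kappa>\<^sub>p (inv\<^bsub>Gplus\<^esub> g) = inv\<^bsub>D_inf\<^esub> \<kappa>\<^sub>p g"
    proof -
      obtain a \<epsilon> where a: "\<kappa>\<^sub>p g = (a, \<epsilon>)" by (cases "\<kappa>\<^sub>p g")
      then have "\<kappa> (inv g) = (2 * (if \<epsilon> then a else - a), \<epsilon>)"
        using \<kappa>_inv[OF g(2)] \<kappa>\<^sub>p_iff[OF g(1)] by (simp add: D_inf_inv)
      then show ?thesis using inv_Gp[OF g(1)] a by (simp add: \<kappa>\<^sub>p_def D_inf_inv)
    qed
    show "\<exists>z\<in>carrier Gplus. \<kappa>\<^sub>p z = dgen x \<and> \<kappa>\<^sub>p (g \<otimes>\<^bsub>Gplus\<^esub> z) = \<kappa>\<^sub>p g \<otimes>\<^bsub>D_inf\<^esub> dgen x" for x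
    proof -
      obtain r where r: "r \<in> Np" "\<kappa> r = (if x then 2 else 0, True)"
        using \<kappa>_surj_even[of "if x then 2 else 0" True] by (cases x) auto
      obtain z where z: "z \<in> carrier G" "\<kappa> z = \<kappa> r" "\<kappa> (g \<otimes> z) = \<kappa> g \<otimes>\<^bsub>D_inf\<^esub> \<kappa> r"
        using gallery_exists[OF g(2) Np_N[OF r(1)]] by blast
      have zG: "z \<in> Gp" using Gp_\<kappa>[OF z(1)] z(2) r(2) by simp
      then have "g \<otimes> z \<in> Gp" using g z by (simp add: Gp_mult_iff)
      then show ?thesis using s[OF zG] t[OF zG] mult[OF g(1), of "g \<otimes> z"] z r zG
        by (intro bexI[of _ z]) (cases x; simp)+
    qed
    fix z assume "z \<in> carrier Gplus"
    then have z: "z \<in> Gp" "z \<in> carrier G" using Gp_carrier by auto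
    have gz: "g \<otimes> z \<in> Gp" using g z by (simp add: Gp_mult_iff)
    show "z \<in> dcoset Gplus B g \<longleftrightarrow> \<kappa>\<^sub>p z = \<kappa>\<^sub>p g" using dcoset_\<kappa>[OF g(2) z(2)] eq[OF z(1) g(1)] by simp
    fix x assume zx: "\<kappa>\<^sub>p z = dgen x"
    have far_near: "\<kappa>\<^sub>p (g \<otimes> z) = \<kappa>\<^sub>p g \<otimes>\<^bsub>D_inf\<^esub> dgen x \<or> ends x (\<kappa>\<^sub>p g) \<and> \<kappa>\<^sub>p (g \<otimes> z) = \<kappa>\<^sub>p g"
      using panel_s[OF g(2) z(2)] panel_t[OF g(2) z(2)] s[OF z(1)] t[OF z(1)] mult[OF g(1) gz] near[OF g(1)]
        eq[OF gz g(1)] zx by (cases x) simp_all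
    then show "\<kappa>\<^sub>p (g \<otimes>\<^bsub>Gplus\<^esub> z) = \<kappa>\<^sub>p g \<otimes>\<^bsub>D_inf\<^esub> dgen x" if "\<not> ends x (\<kappa>\<^sub>p g)" using that by simp
    show "\<kappa>\<^sub>p (g \<otimes>\<^bsub>Gplus\<^esub> z) = \<kappa>\<^sub>p g \<otimes>\<^bsub>D_inf\<^esub> dgen x \<or> \<kappa>\<^sub>p (g \<otimes>\<^bsub>Gplus\<^esub> z) = \<kappa>\<^sub>p g" if "ends x (\<kappa>\<^sub>p g)"
      using far_near by auto
    fix z' assume "z' \<in> carrier Gplus" and zx': "\<kappa>\<^sub>p z' = dgen x" and e: "ends x (\<kappa>\<^sub>p g)"
      and eqs: "\<kappa>\<^sub>p (g \<otimes>\<^bsub>Gplus\<^esub> z) = \<kappa>\<^sub>p g \<otimes>\<^bsub>D_inf\<^esub> dgen x" "\<kappa>\<^sub>p (g \<otimes>\<^bsub>Gplus\<^esub> z') = \<kappa>\<^sub>p g \<otimes>\<^bsub>D_inf\<^esub> dgen x"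
    then have z': "z' \<in> Gp" "z' \<in> carrier G" using Gp_carrier by auto
    have gz': "g \<otimes> z' \<in> Gp" using g z' by (simp add: Gp_mult_iff)
    show "inv\<^bsub>Gplus\<^esub> z \<otimes>\<^bsub>Gplus\<^esub> z' \<in> B"
      using panel_s_unique[OF g(2) _ z(2) _ _ z'(2)] panel_t_unique[OF g(2) _ z(2) _ _ z'(2)]
        s[OF z(1)] t[OF z(1)] s[OF z'(1)] t[OF z'(1)] mult[OF g(1) gz] mult[OF g(1) gz'] near[OF g(1)]
        zx zx' e eqs inv_Gp[OF z(1)] by (cases x) simp_all
  qed
qed

lemma dihedral_hecke_G:
  assumes ne: "carrier G \<noteq> Gp"
  shows "dihedral_hecke G B \<kappa>\<^sub>t"
proof -
  interpret P: hecke G B by (rule hecke_G)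
  have eq: "\<kappa>\<^sub>t g = \<kappa>\<^sub>t h \<longleftrightarrow> \<kappa> g = \<kappa> h" for g h
    using \<kappa>\<^sub>t_iff[of g] \<kappa>\<^sub>t_iff[of h] by (metis surj_pair)
  have s: "\<kappa>\<^sub>t z = dgen True \<longleftrightarrow> \<kappa> z = (2, True)" and i: "\<kappa>\<^sub>t z = dgen False \<longleftrightarrow> \<kappa> z = (1, True)" for z
    using \<kappa>\<^sub>t_iff[of z] by (simp_all add: dgen_def)
  \<comment> \<open>Only \<open>True\<close> is compared with the geometry here; the letter
    \<open>False\<close> stands for the inversion, for which \<open>panel_i\<close> gives the
    position outright.\<close>
  have near: "ends True (\<kappa>\<^sub>t g) \<longleftrightarrow> near_s (\<kappa> g)" for g
  proof -
    obtain a \<epsilon> where a: "\<kappa>\<^sub>t g = (a, \<epsilon>)" by (cases "\<kappa>\<^sub>t g")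
    then have k: "\<kappa> g = (if \<epsilon> then a + 1 else a, \<epsilon>)" by (simp only: \<kappa>\<^sub>t_iff)
    show ?thesis unfolding a k by (auto simp: ends_iff near_s_def)
  qed
  have mult: "\<kappa>\<^sub>t h = \<kappa>\<^sub>t g \<otimes>\<^bsub>D_inf\<^esub> dgen True \<longleftrightarrow> \<kappa> h = \<kappa> g \<otimes>\<^bsub>D_inf\<^esub> (2, True)"
      "\<kappa>\<^sub>t h = \<kappa>\<^sub>t g \<otimes>\<^bsub>D_inf\<^esub> dgen False \<longleftrightarrow> \<kappa> h = \<kappa> g \<otimes>\<^bsub>D_inf\<^esub> (1, True)" for g h
  proof -
    obtain a \<epsilon> where a: "\<kappa>\<^sub>t g = (a, \<epsilon>)" by (cases "\<kappa>\<^sub>t g")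
    then have k: "\<kappa> g = (if \<epsilon> then a + 1 else a, \<epsilon>)" by (simp only: \<kappa>\<^sub>t_iff)
    let ?b = "if \<epsilon> then a - 1 else a + 1"
    have "\<kappa>\<^sub>t g \<otimes>\<^bsub>D_inf\<^esub> dgen True = (?b, \<not> \<epsilon>)"
      "\<kappa> g \<otimes>\<^bsub>D_inf\<^esub> (2, True) = (if \<not> \<epsilon> then ?b + 1 else ?b, \<not> \<epsilon>)"
      "\<kappa>\<^sub>t g \<otimes>\<^bsub>D_inf\<^esub> dgen False = (a, \<not> \<epsilon>)"
      "\<kappa> g \<otimes>\<^bsub>D_inf\<^esub> (1, True) = (if \<not> \<epsilon> then a + 1 else a, \<not> \<epsilon>)"
      unfolding a k by (simp_all add: dgen_def)
    then show "\<kappa>\<^sub>t h = \<kappa>\<^sub>t g \<otimes>\<^bsub>D_inf\<^esub> dgen True \<longleftrightarrow> \<kappa> h = \<kappa> g \<otimes>\<^bsub>D_inf\<^esub> (2, True)"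
      "\<kappa>\<^sub>t h = \<kappa>\<^sub>t g \<otimes>\<^bsub>D_inf\<^esub> dgen False \<longleftrightarrow> \<kappa> h = \<kappa> g \<otimes>\<^bsub>D_inf\<^esub> (1, True)"
      by (simp_all only: \<kappa>\<^sub>t_iff)
  qed
  show ?thesis
  proof
    show "\<exists>g\<in>carrier G. \<kappa>\<^sub>t g = x" for x
    proof -
      obtain n where "n \<in> N" "\<kappa> n = (if snd x then fst x + 1 else fst x, snd x)" using \<kappa>_surj[OF ne] by blast
      then show ?thesis by (intro bexI[of _ n]) (auto simp: N_carrier \<kappa>\<^sub>t_def prod_eq_iff)
    qed
    show "\<kappa>\<^sub>t \<one> = (0, False)" by (simp add: \<kappa>\<^sub>t_def)
    fix g assume g: "g \<in> carrier G"
    show "\<kappa>\<^sub>t (inv g) = inv\<^bsub>D_inf\<^esub> \<kappa>\<^sub>t g"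
      using \<kappa>_inv[OF g] by (cases "\<kappa> g") (simp add: \<kappa>\<^sub>t_def D_inf_inv)
    show "\<exists>z\<in>carrier G. \<kappa>\<^sub>t z = dgen x \<and> \<kappa>\<^sub>t (g \<otimes> z) = \<kappa>\<^sub>t g \<otimes>\<^bsub>D_inf\<^esub> dgen x" for x
    proof -
      obtain r where r: "r \<in> N" "\<kappa> r = (if x then 2 else 1, True)"
        using \<kappa>_surj[OF ne] by blast
      obtain z where z: "z \<in> carrier G" "\<kappa> z = \<kappa> r" "\<kappa> (g \<otimes> z) = \<kappa> g \<otimes>\<^bsub>D_inf\<^esub> \<kappa> r"
        using gallery_exists[OF g r(1)] by blast
      then show ?thesis using s[of z] i[of z] mult[of "g \<otimes> z" g] r
        by (intro bexI[of _ z]) (cases x; simp)+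
    qed
    fix z assume z: "z \<in> carrier G"
    show "z \<in> dcoset G B g \<longleftrightarrow> \<kappa>\<^sub>t z = \<kappa>\<^sub>t g" using dcoset_\<kappa>[OF g z] eq by simp
    fix x assume zx: "\<kappa>\<^sub>t z = dgen x"
    have far_near: "\<kappa>\<^sub>t (g \<otimes> z) = \<kappa>\<^sub>t g \<otimes>\<^bsub>D_inf\<^esub> dgen x \<or> ends x (\<kappa>\<^sub>t g) \<and> \<kappa>\<^sub>t (g \<otimes> z) = \<kappa>\<^sub>t g"
      using panel_s[OF g z] panel_i[OF g z] s[of z] i[of z] mult[of "g \<otimes> z" g] near[of g]
        eq[of "g \<otimes> z" g] zx by (cases x) simp_all
    then show "\<kappa>\<^sub>t (g \<otimes> z) = \<kappa>\<^sub>t g \<otimes>\<^bsub>D_inf\<^esub> dgen x" if "\<not> ends x (\<kappa>\<^sub>t g)" using that by simp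
    show "\<kappa>\<^sub>t (g \<otimes> z) = \<kappa>\<^sub>t g \<otimes>\<^bsub>D_inf\<^esub> dgen x \<or> \<kappa>\<^sub>t (g \<otimes> z) = \<kappa>\<^sub>t g" if "ends x (\<kappa>\<^sub>t g)"
      using far_near by auto
    fix z' assume z': "z' \<in> carrier G" and zx': "\<kappa>\<^sub>t z' = dgen x" and e: "ends x (\<kappa>\<^sub>t g)"
      and eqs: "\<kappa>\<^sub>t (g \<otimes> z) = \<kappa>\<^sub>t g \<otimes>\<^bsub>D_inf\<^esub> dgen x" "\<kappa>\<^sub>t (g \<otimes> z') = \<kappa>\<^sub>t g \<otimes>\<^bsub>D_inf\<^esub> dgen x"
    show "inv z \<otimes> z' \<in> B"
      using panel_s_unique[OF g _ z _ _ z'] panel_i_unique[OF z _ z']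
        s[of z] i[of z] s[of z'] i[of z'] mult[of "g \<otimes> z" g] mult[of "g \<otimes> z'" g] near[of g]
        zx zx' e eqs by (cases x) simp_all
  qed
qed

end

section \<open>The groups \<open>N\<^sup>+/T\<close> and \<open>N/T\<close>\<close>

text \<open>The isomorphism comes with its values on cosets, which the descriptions of
  \<open>N/T\<close> refer to; the kernel condition is phrased as equality of cosets for the same
  purpose.\<close>

lemma factor_iso:
  assumes K: "group K" and T: "T \<lhd> K" and f: "f \<in> hom K Q" and surj: "f ` carrier K = carrier Q"
    and ker: "\<And>n m. n \<in> carrier K \<Longrightarrow> m \<in> carrier K \<Longrightarrow> f n = f m \<longleftrightarrow> T #>\<^bsub>K\<^esub> n = T #>\<^bsub>K\<^esub> m"
  shows "\<exists>h\<in>iso (K Mod T) Q. \<forall>n\<in>carrier K. h (T #>\<^bsub>K\<^esub> n) = f n"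
proof -
  interpret normal T K by (rule T)
  define h where "h C = f (SOME n. n \<in> carrier K \<and> C = T #>\<^bsub>K\<^esub> n)" for C
  have h: "h (T #>\<^bsub>K\<^esub> n) = f n" if n: "n \<in> carrier K" for n
  proof -
    let ?P = "\<lambda>m. m \<in> carrier K \<and> T #>\<^bsub>K\<^esub> n = T #>\<^bsub>K\<^esub> m"
    have "?P (SOME m. ?P m)" by (rule someI[of ?P n]) (simp add: n)
    then show ?thesis using ker[OF n, of "SOME m. ?P m"] by (simp add: h_def)
  qed
  have c: "carrier (K Mod T) = (\<lambda>n. T #>\<^bsub>K\<^esub> n) ` carrier K" by (rule carrier_FactGroup)
  have "h \<in> hom (K Mod T) Q"
  proof (rule homI)
    fix C assume "C \<in> carrier (K Mod T)"
    then obtain n where n: "n \<in> carrier K" "C = T #>\<^bsub>K\<^esub> n" unfolding c by blast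
    then show "h C \<in> carrier Q" using hom_in_carrier[OF f] by (simp add: h)
    fix C' assume "C' \<in> carrier (K Mod T)"
    then obtain m where m: "m \<in> carrier K" "C' = T #>\<^bsub>K\<^esub> m" unfolding c by blast
    show "h (C \<otimes>\<^bsub>K Mod T\<^esub> C') = h C \<otimes>\<^bsub>Q\<^esub> h C'"
      using n m hom_mult[OF f] by (simp add: h rcos_sum)
  qed
  moreover have "bij_betw h (carrier (K Mod T)) (carrier Q)"
    unfolding bij_betw_def
  proof
    show "inj_on h (carrier (K Mod T))" unfolding c by (rule inj_onI) (auto simp: h ker)
    show "h ` carrier (K Mod T) = carrier Q" unfolding c surj[symmetric] by (auto simp: h image_image)
  qed
  ultimately show ?thesis using h by (auto simp: iso_def)
qed

context tree_action
begin

lemma T_N: "t \<in> T \<Longrightarrow> t \<in> N" and T_B: "t \<in> T \<Longrightarrow> t \<in> B" and T_Np: "t \<in> T \<Longrightarrow> t \<in> Np"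
  using T_eq T_eq' by auto

lemma Np_subgroup: "subgroup Np G"
  unfolding Np_eq by (rule subgroups_Inter_pair[OF N_subgroup Gp_subgroup])

lemma Np_carrier: "n \<in> Np \<Longrightarrow> n \<in> carrier G"
  by (simp add: Np_eq N_carrier)

lemma T_subgroup: "subgroup T G"
  unfolding T_eq by (rule subgroups_Inter_pair[OF N_subgroup B_subgroup])

abbreviation "GN \<equiv> G\<lparr>carrier := N\<rparr>"
abbreviation "GNp \<equiv> G\<lparr>carrier := Np\<rparr>"
abbreviation "W \<equiv> GNp Mod T"
abbreviation "Wt \<equiv> GN Mod T"

lemma GN_group: "group GN" and GNp_group: "group GNp"
  by (rule subgroup.subgroup_is_group[OF N_subgroup is_group])
     (rule subgroup.subgroup_is_group[OF Np_subgroup is_group])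

lemma T_conj: "n \<in> N \<Longrightarrow> t \<in> T \<Longrightarrow> n \<otimes> t \<otimes> inv n \<in> T"
  by (cases "\<kappa> n") (auto simp: mem_T N_mult N_inv D_inf_inv)

lemma T_normal_N: "T \<lhd> GN"
  unfolding group.normal_inv_iff[OF GN_group]
proof
  show "subgroup T GN" by (rule subgroup_incl[OF T_subgroup N_subgroup]) (auto simp: T_N)
  show "\<forall>x\<in>carrier GN. \<forall>h\<in>T. x \<otimes>\<^bsub>GN\<^esub> h \<otimes>\<^bsub>GN\<^esub> inv\<^bsub>GN\<^esub> x \<in> T"
    using T_conj by (simp add: m_inv_consistent[OF N_subgroup])
qed

lemma T_normal_Np: "T \<lhd> GNp"
  unfolding group.normal_inv_iff[OF GNp_group]
proof
  show "subgroup T GNp" by (rule subgroup_incl[OF T_subgroup Np_subgroup]) (auto simp: T_Np)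
  show "\<forall>x\<in>carrier GNp. \<forall>h\<in>T. x \<otimes>\<^bsub>GNp\<^esub> h \<otimes>\<^bsub>GNp\<^esub> inv\<^bsub>GNp\<^esub> x \<in> T"
    using T_conj Np_N by (simp add: m_inv_consistent[OF Np_subgroup])
qed

text \<open>Cosets of \<open>T\<close> in \<open>N\<close> are named by values of \<kappa>, so that
  left cosets, right cosets and products can be compared in coordinates.\<close>

definition coset :: "int \<times> bool \<Rightarrow> 'g set" where
  "coset x = {n \<in> N. \<kappa> n = x}"

definition fib :: "int \<times> bool \<Rightarrow> 'g set" where
  "fib x = {g \<in> carrier G. \<kappa> g = x}"

lemma T_coset: "T = coset (0, False)"
  by (auto simp: coset_def mem_T)

lemma coset_self: "n \<in> N \<Longrightarrow> n \<in> coset (\<kappa> n)"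
  by (simp add: coset_def)

lemma coset_right:
  assumes n: "n \<in> N"
  shows "T #> n = coset (\<kappa> n)"
proof (intro equalityI subsetI)
  fix m assume "m \<in> T #> n"
  then obtain t where t: "t \<in> T" "m = t \<otimes> n" by (auto simp: r_coset_def)
  then have "t \<in> N" "\<kappa> t = (0, False)" by (auto simp: mem_T)
  then show "m \<in> coset (\<kappa> n)" using t n N_mult[of t n] by (cases "\<kappa> n") (simp add: coset_def)
next
  fix m assume "m \<in> coset (\<kappa> n)"
  then have m: "m \<in> N" "\<kappa> m = \<kappa> n" by (auto simp: coset_def)
  have "m \<otimes> inv n \<in> T" using m n by (cases "\<kappa> n") (simp add: mem_T N_mult N_inv D_inf_inv)
  moreover have "m = (m \<otimes> inv n) \<otimes> n" using m n by (simp add: m_assoc N_carrier)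
  ultimately show "m \<in> T #> n" unfolding r_coset_def by blast
qed

lemma coset_left:
  assumes n: "n \<in> N"
  shows "n <# T = coset (\<kappa> n)"
proof (intro equalityI subsetI)
  fix m assume "m \<in> n <# T"
  then obtain t where t: "t \<in> T" "m = n \<otimes> t" by (auto simp: l_coset_def)
  then have "t \<in> N" "\<kappa> t = (0, False)" by (auto simp: mem_T)
  then show "m \<in> coset (\<kappa> n)" using t n N_mult[of n t] by (cases "\<kappa> n") (simp add: coset_def)
next
  fix m assume "m \<in> coset (\<kappa> n)"
  then have m: "m \<in> N" "\<kappa> m = \<kappa> n" by (auto simp: coset_def)
  have "inv n \<otimes> m \<in> T" using m n by (cases "\<kappa> n") (simp add: mem_T N_mult N_inv D_inf_inv)
  moreover have "m = n \<otimes> (inv n \<otimes> m)" using m n by (simp add: m_assoc[symmetric] N_carrier)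
  ultimately show "m \<in> n <# T" unfolding l_coset_def by blast
qed

lemma coset_inj: "n \<in> N \<Longrightarrow> coset (\<kappa> n) = coset x \<Longrightarrow> \<kappa> n = x"
  using coset_self by (auto simp: coset_def)

lemma coset_mult:
  assumes n: "n \<in> N" and m: "m \<in> N"
  shows "coset (\<kappa> n) <#> coset (\<kappa> m) = coset (\<kappa> n \<otimes>\<^bsub>D_inf\<^esub> \<kappa> m)"
proof -
  have "(T #>\<^bsub>GN\<^esub> n) <#>\<^bsub>GN\<^esub> (T #>\<^bsub>GN\<^esub> m) = T #>\<^bsub>GN\<^esub> (n \<otimes>\<^bsub>GN\<^esub> m)"
    by (rule normal.rcos_sum[OF T_normal_N]) (simp_all add: n m)
  then show ?thesis using n m by (simp add: coset_right N_mult)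
qed

lemma B_coset:
  assumes n: "n \<in> N"
  shows "B <#> coset (\<kappa> n) = B #> n" "coset (\<kappa> n) <#> B = n <# B"
    "B <#> coset (\<kappa> n) <#> B = dcoset G B n"
proof -
  have nG: "n \<in> carrier G" and T1: "\<one> \<in> T" using n N_carrier subgroup.one_closed[OF T_subgroup] by auto
  show 1: "B <#> coset (\<kappa> n) = B #> n"
  proof (intro equalityI subsetI)
    fix g assume "g \<in> B <#> coset (\<kappa> n)"
    then obtain b t where "b \<in> B" "t \<in> T" "g = b \<otimes> (t \<otimes> n)"
      unfolding coset_right[OF n, symmetric] by (auto simp: set_mult_def r_coset_def)
    then have "g = (b \<otimes> t) \<otimes> n" "b \<otimes> t \<in> B" using nG T_B B_mult by (auto simp: m_assoc B_carrier)
    then show "g \<in> B #> n" unfolding r_coset_def by blast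
  next
    fix g assume "g \<in> B #> n"
    then show "g \<in> B <#> coset (\<kappa> n)" using coset_self[OF n] by (auto simp: set_mult_def r_coset_def)
  qed
  show "coset (\<kappa> n) <#> B = n <# B"
  proof (intro equalityI subsetI)
    fix g assume "g \<in> coset (\<kappa> n) <#> B"
    then obtain b t where "b \<in> B" "t \<in> T" "g = n \<otimes> t \<otimes> b"
      unfolding coset_left[OF n, symmetric] by (auto simp: set_mult_def l_coset_def)
    then have "g = n \<otimes> (t \<otimes> b)" "t \<otimes> b \<in> B" using nG T_B B_mult by (auto simp: m_assoc B_carrier)
    then show "g \<in> n <# B" unfolding l_coset_def by blast
  next
    fix g assume "g \<in> n <# B"
    then show "g \<in> coset (\<kappa> n) <#> B" using coset_self[OF n] by (auto simp: set_mult_def l_coset_def)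
  qed
  show "B <#> coset (\<kappa> n) <#> B = dcoset G B n" by (simp add: 1 dcoset_def)
qed

lemma dcoset_fib: "g \<in> carrier G \<Longrightarrow> dcoset G B g = fib (\<kappa> g)"
  using dcosets_props(2)[OF dcoset_in_dcosets, of g] by (auto simp: fib_def dcoset_\<kappa>)

lemma BcosetB: "n \<in> N \<Longrightarrow> B <#> coset (\<kappa> n) <#> B = fib (\<kappa> n)"
  using B_coset(3) dcoset_fib N_carrier by simp

lemma carrier_W: "carrier W = (\<lambda>n. coset (\<kappa> n)) ` Np"
  by (auto simp: carrier_FactGroup coset_right Np_N)

lemma carrier_Wt: "carrier Wt = (\<lambda>n. coset (\<kappa> n)) ` N"
  by (auto simp: carrier_FactGroup coset_right)

lemma one_W [simp]: "\<one>\<^bsub>W\<^esub> = T" and one_Wt [simp]: "\<one>\<^bsub>Wt\<^esub> = T"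
  by (simp_all add: one_FactGroup)

lemma mult_W [simp]: "monoid.mult W = set_mult G" "monoid.mult Wt = set_mult G"
  by (simp_all add: FactGroup_def fun_eq_iff)

lemma W_group: "group W" and Wt_group: "group Wt"
  by (rule normal.factorgroup_is_group[OF T_normal_Np]) (rule normal.factorgroup_is_group[OF T_normal_N])

lemma Np_\<kappa>: "n \<in> N \<Longrightarrow> n \<in> Np \<longleftrightarrow> even (fst (\<kappa> n))"
  using Gp_\<kappa>[OF N_carrier] by (auto simp: Np_eq)

lemma W_members: 
  assumes "w \<in> carrier W" "n \<in> w"
  shows "n \<in> Np" "w = coset (\<kappa> n)"
proof -
  obtain m where m: "m \<in> Np" "w = coset (\<kappa> m)" using assms by (auto simp: carrier_W)
  then have "n \<in> N" "\<kappa> n = \<kappa> m" using assms by (auto simp: coset_def)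
  then show "n \<in> Np" "w = coset (\<kappa> n)" using m Np_N Np_\<kappa> by auto
qed

lemma Wt_members: 
  assumes "w \<in> carrier Wt" "n \<in> w"
  shows "n \<in> N" "w = coset (\<kappa> n)"
  using assms by (auto simp: carrier_Wt coset_def)

lemma W_products:
  "\<forall>w\<in>carrier W. \<forall>n\<in>w. n <# B = w <#> B \<and> B #> n = B <#> w \<and> dcoset G B n = B <#> w <#> B"
  "\<forall>w\<in>carrier Wt. \<forall>n\<in>w. n <# B = w <#> B \<and> B #> n = B <#> w \<and> dcoset G B n = B <#> w <#> B"
proof -
  have key: "n <# B = w <#> B \<and> B #> n = B <#> w \<and> dcoset G B n = B <#> w <#> B"
    if n: "n \<in> N" and w: "w = coset (\<kappa> n)" for n w
    unfolding w by (simp add: B_coset(1,2)[OF n] dcoset_def)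
  show "\<forall>w\<in>carrier W. \<forall>n\<in>w. n <# B = w <#> B \<and> B #> n = B <#> w \<and> dcoset G B n = B <#> w <#> B"
    by (intro ballI, rule key) (rule Np_N[OF W_members(1)], assumption+, rule W_members(2))
  show "\<forall>w\<in>carrier Wt. \<forall>n\<in>w. n <# B = w <#> B \<and> B #> n = B <#> w \<and> dcoset G B n = B <#> w <#> B"
    by (intro ballI, rule key) (rule Wt_members(1), assumption+, rule Wt_members(2))
qed

lemma Bruhat_W:
  "Gp = (\<Union>w\<in>carrier W. B <#> w <#> B)" "disjoint_family_on (\<lambda>w. B <#> w <#> B) (carrier W)"
  "carrier G = (\<Union>w\<in>carrier Wt. B <#> w <#> B)" "disjoint_family_on (\<lambda>w. B <#> w <#> B) (carrier Wt)"
proof -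
  show "disjoint_family_on (\<lambda>w. B <#> w <#> B) (carrier W)"
    unfolding disjoint_family_on_def using BcosetB Np_N by (auto simp: carrier_W fib_def)
  show "disjoint_family_on (\<lambda>w. B <#> w <#> B) (carrier Wt)"
    unfolding disjoint_family_on_def using BcosetB by (auto simp: carrier_Wt fib_def)
  have \<kappa>: "\<exists>n\<in>N. \<kappa> n = \<kappa> g" if gG: "g \<in> carrier G" for g
  proof -
    obtain b n b' where "b \<in> B" "n \<in> N" "b' \<in> B" "g = b \<otimes> n \<otimes> b'" using Bruhat[OF gG] by blast
    then show ?thesis using \<kappa>_B[of b b' n] N_carrier by auto
  qed
  show "carrier G = (\<Union>w\<in>carrier Wt. B <#> w <#> B)"
  proof (intro equalityI subsetI)
    fix g assume g: "g \<in> carrier G"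
    then obtain n where "n \<in> N" "\<kappa> n = \<kappa> g" using \<kappa> by blast
    then show "g \<in> (\<Union>w\<in>carrier Wt. B <#> w <#> B)"
      using g BcosetB[of n] by (auto simp: carrier_Wt fib_def intro!: bexI[of _ n])
  next
    fix g assume "g \<in> (\<Union>w\<in>carrier Wt. B <#> w <#> B)"
    then show "g \<in> carrier G" using BcosetB by (auto simp: carrier_Wt fib_def)
  qed
  show "Gp = (\<Union>w\<in>carrier W. B <#> w <#> B)"
  proof (intro equalityI subsetI)
    fix g assume g: "g \<in> Gp"
    then have gG: "g \<in> carrier G" by (rule Gp_carrier)
    then obtain n where n: "n \<in> N" "\<kappa> n = \<kappa> g" using \<kappa> by blast
    then have "n \<in> Np" using Gp_\<kappa>[OF gG] g Np_\<kappa> by auto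
    then show "g \<in> (\<Union>w\<in>carrier W. B <#> w <#> B)"
      using n gG BcosetB[of n] by (auto simp: carrier_W fib_def intro!: bexI[of _ n])
  next
    fix g assume "g \<in> (\<Union>w\<in>carrier W. B <#> w <#> B)"
    then obtain n where "n \<in> Np" "g \<in> fib (\<kappa> n)" using BcosetB Np_N by (auto simp: carrier_W)
    then show "g \<in> Gp" using Gp_\<kappa>[of g] Np_\<kappa>[OF Np_N] by (auto simp: fib_def)
  qed
qed

lemma restrict_\<kappa>:
  assumes "n \<in> N" "m \<in> N"
  shows "restrict (\<phi> n) VA = restrict (\<phi> m) VA \<longleftrightarrow> \<kappa> n = \<kappa> m"
proof
  assume eq: "restrict (\<phi> n) VA = restrict (\<phi> m) VA"
  show "\<kappa> n = \<kappa> m"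
  proof (rule dact_inj)
    fix k
    have "restrict (\<phi> n) VA (\<gamma> k) = restrict (\<phi> m) VA (\<gamma> k)" using eq by simp
    then show "dact (\<kappa> n) k = dact (\<kappa> m) k" using assms by (simp add: VA_def N_act)
  qed
next
  assume eq: "\<kappa> n = \<kappa> m"
  show "restrict (\<phi> n) VA = restrict (\<phi> m) VA"
    by (rule restrict_ext) (use eq assms in \<open>auto simp: VA_def N_act\<close>)
qed

lemma N_img: "n \<in> N \<Longrightarrow> \<phi> n ` VA = VA" "n \<in> N \<Longrightarrow> (`) (\<phi> n) ` EA = EA"
  by (auto simp: N_def stabilizer_of_def)

lemma EA_sub: "x \<in> EA \<Longrightarrow> x \<subseteq> VA" and VA_sub: "VA \<subseteq> V"
  by (auto simp: EA_def line_edges_def VA_def)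

lemma restrict_edges: "(`) (restrict f VA) ` EA = (`) f ` EA"
proof (rule image_cong[OF refl])
  fix x assume "x \<in> EA"
  then show "restrict f VA ` x = f ` x" using EA_sub[of x] by (intro image_cong) auto
qed

text \<open>Members of \<open>Bij VA\<close> are extensional, which is why the action is restricted
  to the line. Edges of the line lie inside \<open>VA\<close>, so restriction does not change their
  images.\<close>

lemma restrict_hom: "(\<lambda>n. restrict (\<phi> n) VA) \<in> hom GN (graph_aut VA EA)"
proof (rule homI)
  have Bij: "restrict (\<phi> n) VA \<in> Bij VA" if "n \<in> N" for n
  proof -
    have "inj_on (\<phi> n) VA"
      using bij_betw_imp_inj_on[OF act_bij[OF N_carrier[OF that]]] VA_sub by (rule inj_on_subset)
    then show ?thesis using N_img(1)[OF that] by (simp add: Bij_def bij_betw_def inj_on_restrict_eq)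
  qed
  fix n assume "n \<in> carrier GN"
  then have n: "n \<in> N" by simp
  show "restrict (\<phi> n) VA \<in> carrier (graph_aut VA EA)"
  proof -
    have "(`) (restrict (\<phi> n) VA) ` EA = EA" unfolding restrict_edges by (rule N_img(2)[OF n])
    then show ?thesis using Bij[OF n] by (simp add: graph_aut_def)
  qed
  fix m assume "m \<in> carrier GN"
  then have m: "m \<in> N" by simp
  have "restrict (\<phi> (n \<otimes> m)) VA = compose VA (restrict (\<phi> n) VA) (restrict (\<phi> m) VA)"
  proof (rule ext)
    fix v
    show "restrict (\<phi> (n \<otimes> m)) VA v = compose VA (restrict (\<phi> n) VA) (restrict (\<phi> m) VA) v"
    proof (cases "v \<in> VA")
      case True
      then have "\<phi> m v \<in> VA" using N_img(1)[OF m] by blast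
      then show ?thesis using True VA_sub n m by (auto simp: compose_eq act_mult N_carrier)
    qed (simp add: compose_def)
  qed
  then show "restrict (\<phi> (n \<otimes>\<^bsub>GN\<^esub> m)) VA = restrict (\<phi> n) VA \<otimes>\<^bsub>graph_aut VA EA\<^esub> restrict (\<phi> m) VA"
    using Bij n m by (simp add: graph_aut_def BijGroup_def)
qed

lemma \<gamma>_type: "\<gamma> k \<in> Ve \<longleftrightarrow> (\<gamma> 0 \<in> Ve \<longleftrightarrow> even k)"
proof -
  have "(\<gamma> 0 \<in> Ve \<longleftrightarrow> \<gamma> k \<in> Ve) \<longleftrightarrow> even (d (\<gamma> 0) (\<gamma> k))"
    by (rule relpow_adj_types[OF d_relpow]) simp_all
  moreover have "even (d (\<gamma> 0) (\<gamma> k)) \<longleftrightarrow> even (int (d (\<gamma> 0) (\<gamma> k)))" by simp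
  ultimately show ?thesis by (auto simp: d_\<rho>)
qed

text \<open>Read along \<gamma>, an automorphism is an injective walk on the integers, to which
  \<open>int_isometry\<close> applies.\<close>

lemma graph_aut_line:
  assumes f: "f \<in> carrier (graph_aut VA EA)"
  shows "\<exists>x. \<forall>k. f (\<gamma> k) = \<gamma> (dact x k)"
proof -
  have bij: "bij_betw f VA VA" and edges: "(`) f ` EA = EA" using f by (auto simp: graph_aut_def Bij_def)
  define h where "h k = \<rho> (f (\<gamma> k))" for k
  have h: "f (\<gamma> k) = \<gamma> (h k)" for k
  proof -
    have "f (\<gamma> k) \<in> VA" using bij_betwE[OF bij] by (auto simp: VA_def)
    then show ?thesis by (auto simp: h_def VA_def)
  qed
  have "inj h"
  proof (rule injI)
    fix j k assume "h j = h k"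
    then have eq: "f (\<gamma> j) = f (\<gamma> k)" by (simp add: h)
    have "\<gamma> j = \<gamma> k" by (rule inj_onD[OF bij_betw_imp_inj_on[OF bij] eq]) (auto simp: VA_def)
    then show "j = k" by simp
  qed
  moreover have "h (k + 1) = h k + 1 \<or> h k = h (k + 1) + 1" for k
  proof -
    have "{\<gamma> k, \<gamma> (k + 1)} \<in> EA" by (auto simp: EA_def line_edges_def)
    then have "f ` {\<gamma> k, \<gamma> (k + 1)} \<in> EA" using edges by blast
    then have "{\<gamma> (h k), \<gamma> (h (k + 1))} \<in> EA" by (simp add: h)
    then obtain j where "{\<gamma> (h k), \<gamma> (h (k + 1))} = {\<gamma> j, \<gamma> (j + 1)}" by (auto simp: EA_def line_edges_def)
    then show ?thesis by (auto simp: doubleton_eq_iff)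
  qed
  ultimately have hk: "h k = dact (h 0, h 1 < h 0) k" for k by (rule int_isometry)
  show ?thesis by (intro exI allI, subst h, rule arg_cong[OF hk])
qed

lemma restrict_surj:
  assumes ne: "carrier G \<noteq> Gp"
  shows "(\<lambda>n. restrict (\<phi> n) VA) ` N = carrier (graph_aut VA EA)"
proof (intro equalityI subsetI)
  fix f assume "f \<in> (\<lambda>n. restrict (\<phi> n) VA) ` N"
  then show "f \<in> carrier (graph_aut VA EA)" using hom_in_carrier[OF restrict_hom] by auto
next
  fix f assume f: "f \<in> carrier (graph_aut VA EA)"
  obtain x where x: "\<And>k. f (\<gamma> k) = \<gamma> (dact x k)" using graph_aut_line[OF f] by blast
  obtain n where n: "n \<in> N" "\<kappa> n = x" using \<kappa>_surj[OF ne] by blast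
  have "f = restrict (\<phi> n) VA"
  proof (rule extensionalityI)
    show "f \<in> extensional VA" using f by (simp add: graph_aut_def Bij_def)
  qed (use n x in \<open>auto simp: VA_def N_act\<close>)
  then show "f \<in> (\<lambda>n. restrict (\<phi> n) VA) ` N" using n by blast
qed

lemma restrict_type:
  assumes n: "n \<in> N"
  shows "restrict (\<phi> n) VA \<in> carrier (bip_aut VA EA Ve Vo) \<longleftrightarrow> n \<in> Np"
proof -
  let ?f = "restrict (\<phi> n) VA"
  have f: "?f \<in> carrier (graph_aut VA EA)" using hom_in_carrier[OF restrict_hom, of n] n by simp
  have mem: "?f \<in> carrier (bip_aut VA EA Ve Vo) \<longleftrightarrow> ?f ` (VA \<inter> Ve) = VA \<inter> Ve \<and> ?f ` (VA \<inter> Vo) = VA \<inter> Vo"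
    using f by (simp add: bip_aut_def type_preserving_def)
  have img: "?f ` (VA \<inter> S) = \<phi> n ` (VA \<inter> S)" for S by (intro image_cong) auto
  show ?thesis
  proof
    assume "n \<in> Np"
    then have t: "\<phi> n ` Ve = Ve" "\<phi> n ` Vo = Vo" by (auto simp: Np_eq Gp_def type_preserving_def)
    have "\<phi> n ` (VA \<inter> S) = VA \<inter> \<phi> n ` S" if "S \<subseteq> V" for S
    proof -
      have "\<phi> n ` (VA \<inter> S) = \<phi> n ` VA \<inter> \<phi> n ` S"
        by (rule inj_on_image_Int[OF bij_betw_imp_inj_on[OF act_bij[OF N_carrier[OF n]]] VA_sub that])
      then show ?thesis using N_img(1)[OF n] by simp
    qed
    then show "?f \<in> carrier (bip_aut VA EA Ve Vo)" unfolding mem img using t types by auto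
  next
    assume "?f \<in> carrier (bip_aut VA EA Ve Vo)"
    then have t: "\<phi> n ` (VA \<inter> Ve) = VA \<inter> Ve" "\<phi> n ` (VA \<inter> Vo) = VA \<inter> Vo" unfolding mem img by auto
    have "\<phi> n (\<gamma> 0) \<in> Ve \<longleftrightarrow> \<gamma> 0 \<in> Ve"
    proof (cases "\<gamma> 0 \<in> Ve")
      case True
      then have "\<phi> n (\<gamma> 0) \<in> \<phi> n ` (VA \<inter> Ve)" by (auto simp: VA_def)
      then show ?thesis using t True by simp
    next
      case False
      then have "\<gamma> 0 \<in> Vo" using types \<gamma>_V[of 0] by blast
      then have "\<phi> n (\<gamma> 0) \<in> \<phi> n ` (VA \<inter> Vo)" by (auto simp: VA_def)
      then show ?thesis using t False types by auto
    qed
    then show "n \<in> Np" using mem_Gp[OF N_carrier[OF n] \<gamma>_V] n by (simp add: Np_eq)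
  qed
qed

lemma restrict_surj_p: "(\<lambda>n. restrict (\<phi> n) VA) ` Np = carrier (bip_aut VA EA Ve Vo)"
proof (intro equalityI subsetI)
  fix f assume "f \<in> (\<lambda>n. restrict (\<phi> n) VA) ` Np"
  then show "f \<in> carrier (bip_aut VA EA Ve Vo)" using restrict_type Np_N by auto
next
  fix f assume f: "f \<in> carrier (bip_aut VA EA Ve Vo)"
  then have f': "f \<in> carrier (graph_aut VA EA)" "f ` (VA \<inter> Ve) = VA \<inter> Ve" "f ` (VA \<inter> Vo) = VA \<inter> Vo"
    by (auto simp: bip_aut_def type_preserving_def)
  obtain x where x: "\<And>k. f (\<gamma> k) = \<gamma> (dact x k)" using graph_aut_line[OF f'(1)] by blast
  have "\<gamma> (dact x 0) \<in> Ve \<longleftrightarrow> \<gamma> 0 \<in> Ve"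
  proof (cases "\<gamma> 0 \<in> Ve")
    case True
    then have "f (\<gamma> 0) \<in> f ` (VA \<inter> Ve)" by (auto simp: VA_def)
    then show ?thesis using f' True x[of 0] by simp
  next
    case False
    then have "\<gamma> 0 \<in> Vo" using types \<gamma>_V[of 0] by blast
    then have "f (\<gamma> 0) \<in> f ` (VA \<inter> Vo)" by (auto simp: VA_def)
    then show ?thesis using f' False x[of 0] types by auto
  qed
  then have "even (fst x)" using \<gamma>_type[of "dact x 0"] by (cases x) (auto simp: dact_def split: if_splits)
  then obtain n where n: "n \<in> Np" "\<kappa> n = x" using \<kappa>_surj_even[of "fst x" "snd x"] by auto
  have "f = restrict (\<phi> n) VA"
  proof (rule extensionalityI)
    show "f \<in> extensional VA" using f' by (simp add: graph_aut_def Bij_def)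
  qed (use n Np_N x in \<open>auto simp: VA_def N_act\<close>)
  then show "f \<in> (\<lambda>n. restrict (\<phi> n) VA) ` Np" using n by blast
qed

lemma coset_kernel:
  assumes "n \<in> N" "m \<in> N"
  shows "restrict (\<phi> n) VA = restrict (\<phi> m) VA \<longleftrightarrow> T #> n = T #> m"
  using restrict_\<kappa>[OF assms] coset_inj[OF assms(1), of "\<kappa> m"]
  by (auto simp: coset_right assms)

lemma W_iso: "\<exists>h\<in>iso W (bip_aut VA EA Ve Vo). \<forall>n\<in>Np. h (T #> n) = restrict (\<phi> n) VA"
proof -
  have hom: "(\<lambda>n. restrict (\<phi> n) VA) \<in> hom GNp (bip_aut VA EA Ve Vo)"
    using restrict_type Np_N hom_mult[OF restrict_hom] by (intro homI) (auto simp: bip_aut_def)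
  have surj: "(\<lambda>n. restrict (\<phi> n) VA) ` carrier GNp = carrier (bip_aut VA EA Ve Vo)"
    using restrict_surj_p by simp
  have ker: "restrict (\<phi> n) VA = restrict (\<phi> m) VA \<longleftrightarrow> T #>\<^bsub>GNp\<^esub> n = T #>\<^bsub>GNp\<^esub> m"
    if "n \<in> carrier GNp" "m \<in> carrier GNp" for n m
    using that coset_kernel[OF Np_N Np_N] by simp
  show ?thesis using factor_iso[OF GNp_group T_normal_Np hom surj ker] by simp
qed

lemma Wt_iso:
  assumes ne: "carrier G \<noteq> Gp"
  shows "\<exists>h\<in>iso Wt (graph_aut VA EA). \<forall>n\<in>N. h (T #> n) = restrict (\<phi> n) VA"
proof -
  have surj: "(\<lambda>n. restrict (\<phi> n) VA) ` carrier GN = carrier (graph_aut VA EA)"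
    using restrict_surj[OF ne] by simp
  have ker: "restrict (\<phi> n) VA = restrict (\<phi> m) VA \<longleftrightarrow> T #>\<^bsub>GN\<^esub> n = T #>\<^bsub>GN\<^esub> m"
    if "n \<in> carrier GN" "m \<in> carrier GN" for n m
    using that coset_kernel by simp
  show ?thesis using factor_iso[OF GN_group T_normal_N restrict_hom surj ker] by simp
qed

lemma restrict_fibre:
  assumes "n \<in> N"
  shows "{m \<in> N. restrict (\<phi> m) VA = restrict (\<phi> n) VA} = coset (\<kappa> n)"
    "n \<in> Np \<Longrightarrow> {m \<in> Np. restrict (\<phi> m) VA = restrict (\<phi> n) VA} = coset (\<kappa> n)"
proof -
  show 1: "{m \<in> N. restrict (\<phi> m) VA = restrict (\<phi> n) VA} = coset (\<kappa> n)"
    using restrict_\<kappa>[OF _ assms] by (auto simp: coset_def)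
  show "{m \<in> Np. restrict (\<phi> m) VA = restrict (\<phi> n) VA} = coset (\<kappa> n)" if n: "n \<in> Np"
  proof -
    have "m \<in> Np" if "m \<in> coset (\<kappa> n)" for m
      using that n Np_\<kappa>[of m] Np_\<kappa>[OF assms] by (auto simp: coset_def)
    then show ?thesis unfolding 1[symmetric] using Np_N by auto
  qed
qed

text \<open>The elements inducing a given automorphism form one coset of \<open>T\<close>, so the
  double coset they span is a fibre of \<kappa>, and different automorphisms have different values
  of \<kappa>.\<close>

lemma param_bij_p:
  "bij_betw (\<lambda>f. B <#> {n \<in> Np. restrict (\<phi> n) VA = f} <#> B) (carrier (bip_aut VA EA Ve Vo)) (dcosets Gplus B)"
  unfolding bij_betw_def restrict_surj_p[symmetric]
proof
  have F: "B <#> {m \<in> Np. restrict (\<phi> m) VA = restrict (\<phi> n) VA} <#> B = fib (\<kappa> n)" if "n \<in> Np" for n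
    using that restrict_fibre(2)[OF Np_N] BcosetB[OF Np_N] by simp
  show "inj_on (\<lambda>f. B <#> {n \<in> Np. restrict (\<phi> n) VA = f} <#> B) ((\<lambda>n. restrict (\<phi> n) VA) ` Np)"
  proof (rule inj_onI; elim imageE)
    fix f f' n m assume nm: "n \<in> Np" "f = restrict (\<phi> n) VA" "m \<in> Np" "f' = restrict (\<phi> m) VA"
      and "B <#> {n \<in> Np. restrict (\<phi> n) VA = f} <#> B = B <#> {n \<in> Np. restrict (\<phi> n) VA = f'} <#> B"
    then have "fib (\<kappa> n) = fib (\<kappa> m)" using F by simp
    then have "\<kappa> n = \<kappa> m" using nm Np_carrier by (auto simp: fib_def)
    then show "f = f'" using nm restrict_\<kappa>[OF Np_N Np_N] by simp
  qed
  show "(\<lambda>f. B <#> {n \<in> Np. restrict (\<phi> n) VA = f} <#> B) ` (\<lambda>n. restrict (\<phi> n) VA) ` Np = dcosets Gplus B"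
  proof (intro equalityI subsetI)
    fix D assume "D \<in> (\<lambda>f. B <#> {n \<in> Np. restrict (\<phi> n) VA = f} <#> B) ` (\<lambda>n. restrict (\<phi> n) VA) ` Np"
    then obtain n where n: "n \<in> Np" "D = dcoset G B n" using F dcoset_fib[OF Np_carrier] by auto
    then show "D \<in> dcosets Gplus B" by (auto simp: dcosets_def Np_eq)
  next
    fix D assume "D \<in> dcosets Gplus B"
    then obtain g where g: "g \<in> Gp" "D = fib (\<kappa> g)" using dcoset_fib[OF Gp_carrier] by (auto simp: dcosets_def)
    have "even (fst (\<kappa> g))" using Gp_\<kappa>[OF Gp_carrier[OF g(1)]] g(1) by simp
    then obtain n where n: "n \<in> Np" "\<kappa> n = \<kappa> g" using \<kappa>_surj_even[of "fst (\<kappa> g)" "snd (\<kappa> g)"] by auto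
    then show "D \<in> (\<lambda>f. B <#> {n \<in> Np. restrict (\<phi> n) VA = f} <#> B) ` (\<lambda>n. restrict (\<phi> n) VA) ` Np"
      using F[OF n(1)] g(2) by (auto intro!: rev_image_eqI[of n])
  qed
qed

lemma param_bij:
  assumes ne: "carrier G \<noteq> Gp"
  shows "bij_betw (\<lambda>f. B <#> {n \<in> N. restrict (\<phi> n) VA = f} <#> B) (carrier (graph_aut VA EA)) (dcosets G B)"
  unfolding bij_betw_def restrict_surj[OF ne, symmetric]
proof
  have F: "B <#> {m \<in> N. restrict (\<phi> m) VA = restrict (\<phi> n) VA} <#> B = fib (\<kappa> n)" if "n \<in> N" for n
    using that restrict_fibre(1) BcosetB by simp
  show "inj_on (\<lambda>f. B <#> {n \<in> N. restrict (\<phi> n) VA = f} <#> B) ((\<lambda>n. restrict (\<phi> n) VA) ` N)"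
  proof (rule inj_onI; elim imageE)
    fix f f' n m assume nm: "n \<in> N" "f = restrict (\<phi> n) VA" "m \<in> N" "f' = restrict (\<phi> m) VA"
      and "B <#> {n \<in> N. restrict (\<phi> n) VA = f} <#> B = B <#> {n \<in> N. restrict (\<phi> n) VA = f'} <#> B"
    then have "fib (\<kappa> n) = fib (\<kappa> m)" using F by simp
    then have "\<kappa> n = \<kappa> m" using nm N_carrier by (auto simp: fib_def)
    then show "f = f'" using nm restrict_\<kappa> by simp
  qed
  show "(\<lambda>f. B <#> {n \<in> N. restrict (\<phi> n) VA = f} <#> B) ` (\<lambda>n. restrict (\<phi> n) VA) ` N = dcosets G B"
  proof (intro equalityI subsetI)
    fix D assume "D \<in> (\<lambda>f. B <#> {n \<in> N. restrict (\<phi> n) VA = f} <#> B) ` (\<lambda>n. restrict (\<phi> n) VA) ` N"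
    then obtain n where n: "n \<in> N" "D = dcoset G B n" using F dcoset_fib[OF N_carrier] by auto
    then show "D \<in> dcosets G B" by (auto simp: dcosets_def N_carrier)
  next
    fix D assume "D \<in> dcosets G B"
    then obtain g where g: "g \<in> carrier G" "D = fib (\<kappa> g)" using dcoset_fib by (auto simp: dcosets_def)
    obtain n where n: "n \<in> N" "\<kappa> n = \<kappa> g" using \<kappa>_surj[OF ne] by blast
    then show "D \<in> (\<lambda>f. B <#> {n \<in> N. restrict (\<phi> n) VA = f} <#> B) ` (\<lambda>n. restrict (\<phi> n) VA) ` N"
      using F[OF n(1)] g(2) by (auto intro!: rev_image_eqI[of n])
  qed
qed

end

lemma dihedral_words:
  assumes M: "group M" and \<mu>: "\<mu> \<in> iso D_inf M"
    and s: "s = \<mu> (dgen True)" and t: "t = \<mu> (dgen False)"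
  shows "generate M {s, t} = carrier M" "s \<noteq> \<one>\<^bsub>M\<^esub>" "t \<noteq> \<one>\<^bsub>M\<^esub>"
    "s \<otimes>\<^bsub>M\<^esub> s = \<one>\<^bsub>M\<^esub>" "t \<otimes>\<^bsub>M\<^esub> t = \<one>\<^bsub>M\<^esub>"
    "\<forall>w\<in>carrier M. \<exists>!ws. reduced_word M {s, t} w ws"
    "\<forall>w\<in>carrier M. \<forall>ws. reduced_word M {s, t} w ws \<longrightarrow> distinct_adj ws"
proof -
  interpret M: group M by (rule M)
  have hom: "\<mu> \<in> hom D_inf M" and bij: "bij_betw \<mu> UNIV (carrier M)" using \<mu> by (auto simp: iso_def)
  interpret \<mu>: group_hom D_inf M \<mu> by unfold_locales (rule hom)
  have inj: "\<mu> x = \<mu> y \<longleftrightarrow> x = y" for x y using bij by (auto simp: bij_betw_def inj_eq)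
  have one: "\<mu> (0, False) = \<one>\<^bsub>M\<^esub>" using \<mu>.hom_one by simp
  have cl: "\<mu> x \<in> carrier M" for x using bij by (auto simp: bij_betw_def)
  show "s \<noteq> \<one>\<^bsub>M\<^esub>" "t \<noteq> \<one>\<^bsub>M\<^esub>" unfolding s t one[symmetric] inj by (simp_all add: dgen_def)
  show "s \<otimes>\<^bsub>M\<^esub> s = \<one>\<^bsub>M\<^esub>" "t \<otimes>\<^bsub>M\<^esub> t = \<one>\<^bsub>M\<^esub>"
    unfolding s t one[symmetric]
    using hom_mult[OF hom, of "dgen True" "dgen True"] hom_mult[OF hom, of "dgen False" "dgen False"]
    by simp_all
  have surj: "\<exists>x. w = \<mu> x" if "w \<in> carrier M" for w
    using that bij_betw_imp_surj_on[OF bij] by blast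
  have red: "reduced_word M {s, t} (\<mu> d) ws \<longleftrightarrow> ws = map (\<lambda>x. \<mu> (dgen x)) (nf d)" for d ws
    unfolding s t by (rule reduced_word_dihedral[OF M.monoid_axioms \<mu>])
  show "\<forall>w\<in>carrier M. \<exists>!ws. reduced_word M {s, t} w ws"
  proof
    fix w assume "w \<in> carrier M"
    then obtain d where w: "w = \<mu> d" using surj by blast
    show "\<exists>!ws. reduced_word M {s, t} w ws" unfolding w red by simp
  qed
  show "\<forall>w\<in>carrier M. \<forall>ws. reduced_word M {s, t} w ws \<longrightarrow> distinct_adj ws"
  proof (intro ballI allI impI)
    fix w ws assume "w \<in> carrier M" and r: "reduced_word M {s, t} w ws"
    then obtain d where w: "w = \<mu> d" using surj by blast
    have "inj (\<lambda>x. \<mu> (dgen x))" by (rule injI) (auto simp: inj dgen_def split: if_splits)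
    then have i: "inj_on (\<lambda>x. \<mu> (dgen x)) (set (nf d))" by (rule inj_on_subset) simp
    have "ws = map (\<lambda>x. \<mu> (dgen x)) (nf d)" using r unfolding w red .
    then show "distinct_adj ws" using distinct_adj_map_iff[OF i] by simp
  qed
  show "generate M {s, t} = carrier M"
  proof (intro equalityI subsetI)
    fix w assume "w \<in> generate M {s, t}"
    then show "w \<in> carrier M" using M.generate_in_carrier[of "{s, t}"] cl s t by auto
  next
    fix w assume "w \<in> carrier M"
    then obtain d where w: "w = \<mu> d" using surj by blast
    have "\<mu> (dword ws) \<in> generate M {s, t}" for ws
    proof (induction ws)
      case Nil
      then show ?case by (simp add: one generate.one)
    next
      case (Cons x ws)
      have "\<mu> (dgen x) \<in> generate M {s, t}" by (rule generate.incl) (cases x; simp add: s t)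
      then show ?case using Cons hom_mult[OF hom] by (simp add: generate.eng)
    qed
    from this[of "nf d"] show "w \<in> generate M {s, t}" by (simp add: w)
  qed
qed

section \<open>The split extension and the edges next to \<open>e\<close>\<close>

context tree_action
begin

lemma Np_normal_N: "Np \<lhd> GN"
  unfolding group.normal_inv_iff[OF GN_group]
proof
  show "subgroup Np GN" by (rule subgroup_incl[OF Np_subgroup N_subgroup]) (auto simp: Np_N)
  show "\<forall>x\<in>carrier GN. \<forall>h\<in>Np. x \<otimes>\<^bsub>GN\<^esub> h \<otimes>\<^bsub>GN\<^esub> inv\<^bsub>GN\<^esub> x \<in> Np"
    by (auto simp: m_inv_consistent[OF N_subgroup] Np_eq N_mult N_inv Gp_mult_iff Gp_inv_iff N_carrier)
qed

lemma Np_coset: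
  assumes n: "n \<in> N"
  shows "Np #> n = {m \<in> N. m \<in> Gp \<longleftrightarrow> n \<in> Gp}"
proof (intro equalityI subsetI)
  fix m assume "m \<in> Np #> n"
  then show "m \<in> {m \<in> N. m \<in> Gp \<longleftrightarrow> n \<in> Gp}"
    using n by (auto simp: r_coset_def Np_eq N_mult Gp_mult_iff N_carrier)
next
  fix m assume "m \<in> {m \<in> N. m \<in> Gp \<longleftrightarrow> n \<in> Gp}"
  then have m: "m \<in> N" "m \<in> Gp \<longleftrightarrow> n \<in> Gp" by auto
  have "m \<otimes> inv n \<in> Np" using m n by (simp add: Np_eq N_mult N_inv Gp_mult_iff Gp_inv_iff N_carrier)
  moreover have "m = (m \<otimes> inv n) \<otimes> n" using m n by (simp add: m_assoc N_carrier)
  ultimately show "m \<in> Np #> n" unfolding r_coset_def by blast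
qed

lemma Np_coset_eq:
  assumes "n \<in> N" "m \<in> N"
  shows "Np #> n = Np #> m \<longleftrightarrow> (n \<in> Gp \<longleftrightarrow> m \<in> Gp)"
proof
  assume "Np #> n = Np #> m"
  moreover have "n \<in> Np #> n" by (simp add: Np_coset assms)
  ultimately show "n \<in> Gp \<longleftrightarrow> m \<in> Gp" by (simp add: Np_coset assms)
next
  assume "n \<in> Gp \<longleftrightarrow> m \<in> Gp"
  then show "Np #> n = Np #> m" by (simp add: Np_coset assms)
qed

lemma quotient_Z2:
  assumes ne: "carrier G \<noteq> Gp"
  shows "GN Mod Np \<cong> integer_mod_group 2"
proof -
  let ?f = "\<lambda>n. if n \<in> Gp then 0 else 1 :: int"
  obtain i where i: "i \<in> N" "\<kappa> i = (1, True)" using \<kappa>_surj[OF ne] by blast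
  then have iG: "i \<notin> Gp" using Gp_\<kappa>[OF N_carrier] by auto
  have hom: "?f \<in> hom GN (integer_mod_group 2)"
    by (rule homI) (auto simp: carrier_integer_mod_group Gp_mult_iff N_carrier)
  have surj: "?f ` carrier GN = carrier (integer_mod_group 2)"
  proof -
    have "0 \<in> ?f ` N" by (rule rev_image_eqI[of \<one>]) simp_all
    moreover have "1 \<in> ?f ` N" using iG i(1) by (intro rev_image_eqI[of i]) simp_all
    moreover have "carrier (integer_mod_group 2) = {0, 1}" by (auto simp: carrier_integer_mod_group)
    ultimately show ?thesis by auto
  qed
  have ker: "?f n = ?f m \<longleftrightarrow> Np #>\<^bsub>GN\<^esub> n = Np #>\<^bsub>GN\<^esub> m" if "n \<in> carrier GN" "m \<in> carrier GN" for n m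
    using that Np_coset_eq by simp
  show ?thesis using factor_iso[OF GN_group Np_normal_N hom surj ker] unfolding is_iso_def by blast
qed

lemma split_extension:
  assumes ne: "carrier G \<noteq> Gp"
  shows "\<exists>p\<in>hom Wt (GN Mod Np).
     (\<forall>n\<in>N. p (T #> n) = Np #> n) \<and> p ` carrier Wt = carrier (GN Mod Np) \<and>
     kernel Wt (GN Mod Np) p = carrier W \<and>
     (\<exists>\<sigma>\<in>hom (GN Mod Np) Wt. \<forall>x\<in>carrier (GN Mod Np). p (\<sigma> x) = x)" (is ?split)
    and "carrier W \<lhd> Wt"
proof -
  \<comment> \<open>All elements of a coset of \<open>T\<close> agree on membership in
    \<open>Gp\<close>, so quantifying over the members of \<open>C\<close> avoids choosing
    one.\<close>
  define p where "p C = {m \<in> N. \<exists>c\<in>C. m \<in> Gp \<longleftrightarrow> c \<in> Gp}" for C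
  have p: "p (T #> n) = Np #> n" if n: "n \<in> N" for n
  proof -
    have "c \<in> Gp \<longleftrightarrow> n \<in> Gp" if "c \<in> coset (\<kappa> n)" for c
      using that Gp_\<kappa>[OF N_carrier] n by (auto simp: coset_def)
    then show ?thesis using coset_self[OF n] unfolding coset_right[OF n] Np_coset[OF n] p_def by blast
  qed
  have cQ: "carrier (GN Mod Np) = (\<lambda>n. Np #> n) ` N" by (simp add: carrier_FactGroup)
  have cW: "carrier Wt = (\<lambda>n. T #> n) ` N" by (simp add: carrier_FactGroup)
  have mQ: "(Np #> n) \<otimes>\<^bsub>GN Mod Np\<^esub> (Np #> m) = Np #> (n \<otimes> m)" if "n \<in> N" "m \<in> N" for n m
    using normal.rcos_sum[OF Np_normal_N, of n m] that by simp
  have mW: "(T #> n) \<otimes>\<^bsub>Wt\<^esub> (T #> m) = T #> (n \<otimes> m)" if "n \<in> N" "m \<in> N" for n m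
    using normal.rcos_sum[OF T_normal_N, of n m] that by simp
  have Q: "group (GN Mod Np)" by (rule normal.factorgroup_is_group[OF Np_normal_N])
  have hom: "p \<in> hom Wt (GN Mod Np)"
    unfolding cW hom_def cQ using p mQ mW N_mult(1) by (auto simp: cW cQ)
  have surj: "p ` carrier Wt = carrier (GN Mod Np)" unfolding cW cQ using p by (auto simp: image_image)
  have oneQ: "\<one>\<^bsub>GN Mod Np\<^esub> = Np #> \<one>" using Np_carrier by (auto simp: one_FactGroup r_coset_def)
  have ker: "kernel Wt (GN Mod Np) p = carrier W"
  proof -
    have "kernel Wt (GN Mod Np) p = {C \<in> (\<lambda>n. T #> n) ` N. p C = Np #> \<one>}"
      by (simp only: kernel_def cW oneQ)
    also have "\<dots> = (\<lambda>n. T #> n) ` {n \<in> N. p (T #> n) = Np #> \<one>}" by blast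
    also have "{n \<in> N. p (T #> n) = Np #> \<one>} = Np"
      using p Np_coset_eq[OF _ N_one] by (auto simp: Np_eq)
    also have "(\<lambda>n. T #> n) ` Np = carrier W" by (simp add: carrier_FactGroup)
    finally show ?thesis .
  qed
  interpret p: group_hom Wt "GN Mod Np" p
    using Wt_group Q hom by (simp add: group_hom_def group_hom_axioms_def)
  show "carrier W \<lhd> Wt" using p.normal_kernel unfolding ker .
  obtain i where i: "i \<in> N" "\<kappa> i = (1, True)" using \<kappa>_surj[OF ne] by blast
  then have iG: "i \<notin> Gp" using Gp_\<kappa>[OF N_carrier] by auto
  have ii: "i \<otimes> i \<in> T" using i by (simp add: mem_T N_mult)
  \<comment> \<open>The section sends the non-trivial class to the coset of the inversion, whose
    square acts trivially on the line and hence lies in \<open>T\<close>.\<close>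
  define \<sigma> where "\<sigma> C = T #> (if C = Np #> \<one> then \<one> else i)" for C
  have \<sigma>: "\<sigma> (Np #> n) = T #> (if n \<in> Gp then \<one> else i)" if "n \<in> N" for n
    unfolding \<sigma>_def using Np_coset_eq[OF that N_one] by simp
  have "\<sigma> \<in> hom (GN Mod Np) Wt"
  proof (rule homI)
    fix C assume "C \<in> carrier (GN Mod Np)"
    then obtain n where n: "n \<in> N" "C = Np #> n" unfolding cQ by blast
    then show "\<sigma> C \<in> carrier Wt" unfolding cW n(2) \<sigma>[OF n(1)] using i by (intro imageI) simp
    fix C' assume "C' \<in> carrier (GN Mod Np)"
    then obtain m where m: "m \<in> N" "C' = Np #> m" unfolding cQ by blast
    let ?c = "\<lambda>n. if n \<in> Gp then \<one> else i"
    have c: "?c n \<in> N" for n using i by simp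
    have "\<kappa> (?c n \<otimes> ?c m) = \<kappa> (?c (n \<otimes> m))"
      using i n(1) m(1) iG by (auto simp: N_mult Gp_mult_iff N_carrier)
    then have "T #> (?c n \<otimes> ?c m) = T #> ?c (n \<otimes> m)"
      using coset_right[OF N_mult(1)[OF c c], of n m] coset_right[OF c, of "n \<otimes> m"] by simp
    then show "\<sigma> (C \<otimes>\<^bsub>GN Mod Np\<^esub> C') = \<sigma> C \<otimes>\<^bsub>Wt\<^esub> \<sigma> C'"
      unfolding n(2) m(2) mQ[OF n(1) m(1)] \<sigma>[OF n(1)] \<sigma>[OF m(1)] \<sigma>[OF N_mult(1)[OF n(1) m(1)]] mW[OF c c]
      by (rule sym)
  qed
  moreover have "p (\<sigma> x) = x" if "x \<in> carrier (GN Mod Np)" for x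
  proof -
    obtain n where n: "n \<in> N" "x = Np #> n" using \<open>x \<in> carrier (GN Mod Np)\<close> unfolding cQ by blast
    have c: "(if n \<in> Gp then \<one> else i) \<in> N" using i by simp
    show ?thesis unfolding n(2) \<sigma>[OF n(1)] p[OF c] Np_coset_eq[OF c n(1)] using iG by simp
  qed
  ultimately show ?split using hom p surj ker by blast
qed

lemma act_e: "n \<in> N \<Longrightarrow> \<phi> n ` e = {\<gamma> (dact (\<kappa> n) 0), \<gamma> (dact (\<kappa> n) 1)}"
  by (simp add: e_def N_act)

lemma neighbours: "{c \<in> EA. c \<noteq> e \<and> c \<inter> e \<noteq> {}} = {{\<gamma> 1, \<gamma> 2}, {\<gamma> (-1), \<gamma> 0}}"
proof (intro equalityI subsetI)
  fix c assume "c \<in> {c \<in> EA. c \<noteq> e \<and> c \<inter> e \<noteq> {}}"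
  then obtain k where c: "c = {\<gamma> k, \<gamma> (k + 1)}" "c \<noteq> e" "c \<inter> e \<noteq> {}" by (auto simp: EA_def line_edges_def)
  then have "k = 1 \<or> k = -1" by (auto simp: e_def)
  then show "c \<in> {{\<gamma> 1, \<gamma> 2}, {\<gamma> (-1), \<gamma> 0}}" using c(1) by auto
next
  have "{\<gamma> 1, \<gamma> (1 + 1)} \<in> EA" "{\<gamma> (-1), \<gamma> (-1 + 1)} \<in> EA" unfolding EA_def line_edges_def by (rule rangeI)+
  moreover fix c assume "c \<in> {{\<gamma> 1, \<gamma> 2}, {\<gamma> (-1), \<gamma> 0}}"
  ultimately show "c \<in> {c \<in> EA. c \<noteq> e \<and> c \<inter> e \<noteq> {}}" by (auto simp: e_def doubleton_eq_iff)
qed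

lemma card_neighbours: "card {c \<in> EA. c \<noteq> e \<and> c \<inter> e \<noteq> {}} = 2"
  unfolding neighbours by (simp add: doubleton_eq_iff)

text \<open>Two elements of \<open>Np\<close> with the same effect on \<open>e\<close> differ by a
  type-preserving element stabilising \<open>e\<close>, hence by an element of
  \<open>N \<inter> B = T\<close>.\<close>

lemma chamber_unique:
  assumes "c \<in> EA"
  shows "\<exists>!w. w \<in> carrier W \<and> (\<forall>n\<in>w. \<phi> n ` e = c)"
proof -
  obtain k where k: "c = {\<gamma> k, \<gamma> (k + 1)}" using assms by (auto simp: EA_def line_edges_def)
  obtain n where n: "n \<in> Np" "\<phi> n ` e = c" using transitive_edges[of 0 k] by (auto simp: k e_def)
  show ?thesis
  proof (rule ex1I[of _ "coset (\<kappa> n)"])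
    have "\<phi> m ` e = c" if "m \<in> coset (\<kappa> n)" for m
      using that n(2) act_e[OF Np_N[OF n(1)]] act_e[of m] by (simp add: coset_def)
    then show "coset (\<kappa> n) \<in> carrier W \<and> (\<forall>m\<in>coset (\<kappa> n). \<phi> m ` e = c)"
      using n(1) by (auto simp: carrier_W)
  next
    fix w assume w: "w \<in> carrier W \<and> (\<forall>n\<in>w. \<phi> n ` e = c)"
    then obtain m where m: "m \<in> Np" "w = coset (\<kappa> m)" by (auto simp: carrier_W)
    then have me: "\<phi> m ` e = c" using w coset_self[OF Np_N] by blast
    have G: "n \<in> carrier G" "m \<in> carrier G" "n \<in> Gp" "m \<in> Gp" using n m by (auto simp: Np_eq N_carrier)
    have sub: "e \<subseteq> V" by (simp add: e_def)
    have "\<phi> (inv n \<otimes> m) ` e = \<phi> (inv n) ` (\<phi> n ` e)"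
      using G sub me n(2) by (simp add: act_image_mult)
    then have "\<phi> (inv n \<otimes> m) ` e = e" by (simp only: act_image_inv[OF G(1) sub])
    then have "inv n \<otimes> m \<in> B" using G by (intro fixes_edge(1)) (simp_all add: Gp_mult_iff Gp_inv_iff)
    then have "inv n \<otimes> m \<in> T" using n m by (simp add: T_eq N_mult N_inv Np_N)
    then show "w = coset (\<kappa> n)" using N_\<kappa>_eq[OF Np_N[OF n(1)] Np_N[OF m(1)]] m(2) by simp
  qed
qed

text \<open>Two automorphisms of the line move \<open>e\<close> to this edge; parity excludes the
  translation by 1 and leaves the reflection in \<open>\<gamma> 1\<close>.\<close>

lemma reflection_s:
  assumes "w \<in> carrier W" "\<forall>n\<in>w. \<phi> n ` e = {\<gamma> 1, \<gamma> 2}"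
  shows "w = coset (2, True)"
proof -
  obtain n where n: "n \<in> Np" "w = coset (\<kappa> n)" using assms(1) by (auto simp: carrier_W)
  obtain a \<epsilon> where a: "\<kappa> n = (a, \<epsilon>)" by (cases "\<kappa> n")
  have "{\<gamma> (dact (\<kappa> n) 0), \<gamma> (dact (\<kappa> n) 1)} = {\<gamma> 1, \<gamma> 2}"
    using assms(2) n coset_self[OF Np_N[OF n(1)]] act_e[OF Np_N[OF n(1)]] by auto
  moreover have "even a" using n(1) Np_\<kappa>[OF Np_N[OF n(1)]] a by simp
  ultimately have "\<kappa> n = (2, True)" by (auto simp: a dact_def doubleton_eq_iff split: if_splits)
  then show ?thesis using n by simp
qed

lemma reflection_t:
  assumes "w \<in> carrier W" "\<forall>n\<in>w. \<phi> n ` e = {\<gamma> (-1), \<gamma> 0}"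
  shows "w = coset (0, True)"
proof -
  obtain n where n: "n \<in> Np" "w = coset (\<kappa> n)" using assms(1) by (auto simp: carrier_W)
  obtain a \<epsilon> where a: "\<kappa> n = (a, \<epsilon>)" by (cases "\<kappa> n")
  have "{\<gamma> (dact (\<kappa> n) 0), \<gamma> (dact (\<kappa> n) 1)} = {\<gamma> (-1), \<gamma> 0}"
    using assms(2) n coset_self[OF Np_N[OF n(1)]] act_e[OF Np_N[OF n(1)]] by auto
  moreover have "even a" using n(1) Np_\<kappa>[OF Np_N[OF n(1)]] a by simp
  ultimately have "\<kappa> n = (0, True)" by (auto simp: a dact_def doubleton_eq_iff split: if_splits)
  then show ?thesis using n by simp
qed

text \<open>Inverse coordinate changes to \<open>\<kappa>\<^sub>p\<close> and
  \<open>\<kappa>\<^sub>t\<close>: \<open>\<iota>\<^sub>p\<close> embeds \<open>D_inf\<close> as the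
  subgroup with even first component, and \<open>\<iota>\<^sub>t\<close> is the automorphism
  shifting all reflections by one.\<close>

definition \<iota>\<^sub>p :: "int \<times> bool \<Rightarrow> int \<times> bool" where "\<iota>\<^sub>p x = (2 * fst x, snd x)"
definition \<iota>\<^sub>t :: "int \<times> bool \<Rightarrow> int \<times> bool" where "\<iota>\<^sub>t x = (if snd x then fst x + 1 else fst x, snd x)"

lemma \<iota>\<^sub>p_mult: "\<iota>\<^sub>p (x \<otimes>\<^bsub>D_inf\<^esub> y) = \<iota>\<^sub>p x \<otimes>\<^bsub>D_inf\<^esub> \<iota>\<^sub>p y"
  by (cases x; cases y) (auto simp: \<iota>\<^sub>p_def)

lemma \<iota>\<^sub>t_mult: "\<iota>\<^sub>t (x \<otimes>\<^bsub>D_inf\<^esub> y) = \<iota>\<^sub>t x \<otimes>\<^bsub>D_inf\<^esub> \<iota>\<^sub>t y"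
  by (cases x; cases y) (auto simp: \<iota>\<^sub>t_def)

lemma \<iota>_inj: "\<iota>\<^sub>p x = \<iota>\<^sub>p y \<longleftrightarrow> x = y" "\<iota>\<^sub>t x = \<iota>\<^sub>t y \<longleftrightarrow> x = y"
  by (cases x; cases y; auto simp: \<iota>\<^sub>p_def \<iota>\<^sub>t_def)+

lemma \<iota>\<^sub>p_rep: "\<exists>n\<in>Np. \<kappa> n = \<iota>\<^sub>p x"
  unfolding \<iota>\<^sub>p_def by (rule \<kappa>_surj_even) simp

lemma \<iota>\<^sub>p_ex: "n \<in> Np \<Longrightarrow> \<exists>x. \<kappa> n = \<iota>\<^sub>p x"
  using Np_\<kappa>[OF Np_N, of n] by (intro exI[of _ "(fst (\<kappa> n) div 2, snd (\<kappa> n))"]) (simp add: \<iota>\<^sub>p_def)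

lemma \<iota>\<^sub>t_ex: "\<exists>x. y = \<iota>\<^sub>t x"
  by (rule exI[of _ "(if snd y then fst y - 1 else fst y, snd y)"]) (simp add: \<iota>\<^sub>t_def prod_eq_iff)

definition \<mu>\<^sub>p :: "int \<times> bool \<Rightarrow> 'g set" where "\<mu>\<^sub>p x = coset (\<iota>\<^sub>p x)"
definition \<mu>\<^sub>t :: "int \<times> bool \<Rightarrow> 'g set" where "\<mu>\<^sub>t x = coset (\<iota>\<^sub>t x)"

lemma \<mu>\<^sub>p_iso: "\<mu>\<^sub>p \<in> iso D_inf W"
proof -
  have "\<mu>\<^sub>p \<in> hom D_inf W"
  proof (rule homI)
    fix x y
    obtain n m where n: "n \<in> Np" "\<kappa> n = \<iota>\<^sub>p x" and m: "m \<in> Np" "\<kappa> m = \<iota>\<^sub>p y" using \<iota>\<^sub>p_rep by meson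
    show "\<mu>\<^sub>p x \<in> carrier W" using n by (auto simp: \<mu>\<^sub>p_def carrier_W intro!: rev_image_eqI[of n])
    show "\<mu>\<^sub>p (x \<otimes>\<^bsub>D_inf\<^esub> y) = \<mu>\<^sub>p x \<otimes>\<^bsub>W\<^esub> \<mu>\<^sub>p y"
      using coset_mult[OF Np_N[OF n(1)] Np_N[OF m(1)]] n(2) m(2) by (simp add: \<mu>\<^sub>p_def \<iota>\<^sub>p_mult)
  qed
  moreover have "inj \<mu>\<^sub>p"
  proof (rule injI)
    fix x y assume eq: "\<mu>\<^sub>p x = \<mu>\<^sub>p y"
    obtain n where n: "n \<in> Np" "\<kappa> n = \<iota>\<^sub>p x" using \<iota>\<^sub>p_rep by blast
    then have "\<iota>\<^sub>p x = \<iota>\<^sub>p y" using coset_inj[OF Np_N[OF n(1)], of "\<iota>\<^sub>p y"] eq by (simp add: \<mu>\<^sub>p_def)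
    then show "x = y" by (simp add: \<iota>_inj)
  qed
  moreover have "range \<mu>\<^sub>p = carrier W"
  proof (intro equalityI subsetI)
    show "w \<in> carrier W" if "w \<in> range \<mu>\<^sub>p" for w
      using that hom_in_carrier[OF calculation(1)] by auto
    fix w assume "w \<in> carrier W"
    then obtain n where "n \<in> Np" "w = coset (\<kappa> n)" by (auto simp: carrier_W)
    then show "w \<in> range \<mu>\<^sub>p" using \<iota>\<^sub>p_ex[of n] by (auto simp: \<mu>\<^sub>p_def)
  qed
  ultimately show ?thesis by (simp add: iso_def bij_betw_def)
qed

lemma \<mu>\<^sub>t_iso:
  assumes ne: "carrier G \<noteq> Gp"
  shows "\<mu>\<^sub>t \<in> iso D_inf Wt"
proof -
  have hom: "\<mu>\<^sub>t \<in> hom D_inf Wt"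
  proof (rule homI)
    fix x y
    obtain n m where n: "n \<in> N" "\<kappa> n = \<iota>\<^sub>t x" and m: "m \<in> N" "\<kappa> m = \<iota>\<^sub>t y" using \<kappa>_surj[OF ne] by meson
    show "\<mu>\<^sub>t x \<in> carrier Wt" using n by (auto simp: \<mu>\<^sub>t_def carrier_Wt intro!: rev_image_eqI[of n])
    show "\<mu>\<^sub>t (x \<otimes>\<^bsub>D_inf\<^esub> y) = \<mu>\<^sub>t x \<otimes>\<^bsub>Wt\<^esub> \<mu>\<^sub>t y"
      using coset_mult[OF n(1) m(1)] n(2) m(2) by (simp add: \<mu>\<^sub>t_def \<iota>\<^sub>t_mult)
  qed
  moreover have "inj \<mu>\<^sub>t"
  proof (rule injI)
    fix x y assume eq: "\<mu>\<^sub>t x = \<mu>\<^sub>t y"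
    obtain n where n: "n \<in> N" "\<kappa> n = \<iota>\<^sub>t x" using \<kappa>_surj[OF ne] by blast
    then have "\<iota>\<^sub>t x = \<iota>\<^sub>t y" using coset_inj[OF n(1), of "\<iota>\<^sub>t y"] eq by (simp add: \<mu>\<^sub>t_def)
    then show "x = y" by (simp add: \<iota>_inj)
  qed
  moreover have "range \<mu>\<^sub>t = carrier Wt"
  proof (intro equalityI subsetI)
    show "w \<in> carrier Wt" if "w \<in> range \<mu>\<^sub>t" for w using that hom_in_carrier[OF hom] by auto
    fix w assume "w \<in> carrier Wt"
    then obtain n where "n \<in> N" "w = coset (\<kappa> n)" by (auto simp: carrier_Wt)
    then show "w \<in> range \<mu>\<^sub>t" using \<iota>\<^sub>t_ex[of "\<kappa> n"] by (auto simp: \<mu>\<^sub>t_def)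
  qed
  ultimately show ?thesis by (simp add: iso_def bij_betw_def)
qed

lemma isos_D_inf:
  "bip_aut VA EA Ve Vo \<cong> D_inf" "carrier G \<noteq> Gp \<Longrightarrow> Wt \<cong> D_inf"
proof -
  obtain h where h: "h \<in> iso W (bip_aut VA EA Ve Vo)" using W_iso by blast
  show "bip_aut VA EA Ve Vo \<cong> D_inf"
    using group.iso_set_sym[OF D_inf_group iso_set_trans[OF \<mu>\<^sub>p_iso h]] unfolding is_iso_def by blast
  show "Wt \<cong> D_inf" if "carrier G \<noteq> Gp"
    using group.iso_set_sym[OF D_inf_group \<mu>\<^sub>t_iso[OF that]] unfolding is_iso_def by blast
qed

section \<open>The Hecke algebra of \<open>G\<^sup>+\<close>\<close>

abbreviation "Hp \<equiv> hecke_algebra Gplus B"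
abbreviation "Ht \<equiv> hecke_algebra G B"

interpretation P: dihedral_hecke Gplus B \<kappa>\<^sub>p
  by (rule dihedral_hecke_Gplus)

lemma \<beta>\<^sub>p: "P.\<beta> x = fib (\<iota>\<^sub>p x)"
proof -
  have "g \<in> carrier G \<and> \<kappa> g = \<iota>\<^sub>p x \<longleftrightarrow> g \<in> Gp \<and> \<kappa>\<^sub>p g = x" for g
    using \<kappa>\<^sub>p_iff[of g "fst x" "snd x"] Gp_\<kappa>[of g] Gp_carrier[of g] by (auto simp: \<iota>\<^sub>p_def)
  then show ?thesis by (auto simp: P.\<beta>_def fib_def)
qed

lemma BwB_p: "B <#> \<mu>\<^sub>p x <#> B = P.\<beta> x"
proof -
  obtain n where n: "n \<in> Np" "\<kappa> n = \<iota>\<^sub>p x" using \<iota>\<^sub>p_rep by blast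
  then show ?thesis using BcosetB[OF Np_N[OF n(1)]] by (simp add: \<mu>\<^sub>p_def \<beta>\<^sub>p)
qed

lemma Delta_p: "Delta G B (\<mu>\<^sub>p x) = basis_elt (P.\<beta> x)"
  by (simp add: Delta_def BwB_p)

lemma q_p: "R_num Gplus B (B <#> \<mu>\<^sub>p (dgen x) <#> B) = P.q x"
  by (simp add: BwB_p P.q_def)

lemma W_cases: "w \<in> carrier W \<Longrightarrow> \<exists>x. w = \<mu>\<^sub>p x"
proof -
  assume "w \<in> carrier W"
  moreover have "range \<mu>\<^sub>p = carrier W" using \<mu>\<^sub>p_iso by (simp add: iso_def bij_betw_def)
  ultimately show "\<exists>x. w = \<mu>\<^sub>p x" by blast
qed

lemma dcosets_p_sub: "D \<in> dcosets Gplus B \<Longrightarrow> D \<subseteq> Gp" "D \<in> dcosets Gplus B \<Longrightarrow> D \<in> dcosets G B"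
  using dcoset_Gp Gp_carrier by (auto simp: dcosets_def)

lemma dcosets_p_iff:
  assumes "D \<in> dcosets G B"
  shows "D \<in> dcosets Gplus B \<longleftrightarrow> rep D \<in> Gp"
proof
  assume "D \<in> dcosets Gplus B"
  then show "rep D \<in> Gp" using dcosets_props(1)[OF assms] dcosets_p_sub by blast
next
  assume "rep D \<in> Gp"
  moreover have "D = dcoset G B (rep D)" using dcosets_props(1,3)[OF assms] by simp
  ultimately show "D \<in> dcosets Gplus B" by (auto simp: dcosets_def)
qed

lemma Hp_sub: "f \<in> carrier (Hp :: ('k::comm_ring_1, _) module) \<Longrightarrow> f \<in> carrier (Ht :: ('k, _) module)"
  using dcosets_p_sub by (auto simp: hecke_algebra_def fin_supp_def)

text \<open>Products of elements of \<open>Gp\<close> stay in \<open>Gp\<close>, so no double coset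
  outside \<open>Gp\<close> can occur, and inside \<open>Gp\<close> both groups have the same right
  cosets. This makes the algebra of \<open>Gplus\<close> a subring of that of
  \<open>G\<close>.\<close>

lemma Hp_mult:
  assumes "f \<in> carrier (Hp :: ('k::comm_ring_1, _) module)" "g \<in> carrier (Hp :: ('k, _) module)"
  shows "f \<otimes>\<^bsub>Ht\<^esub> g = f \<otimes>\<^bsub>Hp\<^esub> g"
proof
  fix D
  have supp: "D1 \<in> dcosets Gplus B" "D2 \<in> dcosets Gplus B" if "f D1 \<noteq> 0" "g D2 \<noteq> 0" for D1 D2
    using that assms by (auto simp: hecke_algebra_def fin_supp_def)
  show "(f \<otimes>\<^bsub>Ht\<^esub> g) D = (f \<otimes>\<^bsub>Hp\<^esub> g) D"
  proof (cases "D \<in> dcosets G B")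
    case False
    then have "D \<notin> dcosets Gplus B" using dcosets_p_sub by blast
    then show ?thesis using False by (simp add: hecke_algebra_def)
  next
    case True
    have coeff: "hecke_coeff G B D1 D2 (rep D) = (if D \<in> dcosets Gplus B then hecke_coeff Gplus B D1 D2 (rep D) else 0)"
      if D12: "D1 \<in> dcosets Gplus B" "D2 \<in> dcosets Gplus B" for D1 D2
    proof (cases "D \<in> dcosets Gplus B")
      case True
      then show ?thesis using dcosets_p_sub D12 by (simp add: hecke_coeff_def rcosets_in_Gplus)
    next
      case False
      then have D: "rep D \<notin> Gp" using dcosets_p_iff[OF True] by simp
      have "rep C \<otimes> rep C' \<notin> B #> rep D" if C: "C \<in> rcosets_in G B D1" "C' \<in> rcosets_in G B D2" for C C'
      proof
        assume "rep C \<otimes> rep C' \<in> B #> rep D"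
        then obtain b where b: "b \<in> B" "rep C \<otimes> rep C' = b \<otimes> rep D" by (auto simp: r_coset_def)
        have "rep C \<in> Gp" "rep C' \<in> Gp"
          using C D12 dcosets_p_sub rcosets_in_iff by blast+
        then have "b \<otimes> rep D \<in> Gp" unfolding b(2)[symmetric] by (simp add: Gp_mult_iff Gp_carrier)
        then show False using D b(1) rep_dcoset_closed[OF True] B_Gp by (simp add: Gp_mult_iff B_carrier)
      qed
      then have empty: "{(C, C'). C \<in> rcosets_in G B D1 \<and> C' \<in> rcosets_in G B D2 \<and> rep C \<otimes> rep C' \<in> B #> rep D} = {}"
        by blast
      show ?thesis unfolding hecke_coeff_def empty using False by simp
    qed
    show ?thesis using True supp coeff by (auto simp: hecke_algebra_def intro!: sum.cong sum.neutral)
  qed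
qed

lemma Hp_simps:
  "\<one>\<^bsub>Ht\<^esub> = \<one>\<^bsub>Hp\<^esub>" "\<zero>\<^bsub>Ht\<^esub> = \<zero>\<^bsub>Hp\<^esub>" "f \<oplus>\<^bsub>Ht\<^esub> g = f \<oplus>\<^bsub>Hp\<^esub> g" "k \<odot>\<^bsub>Ht\<^esub> f = k \<odot>\<^bsub>Hp\<^esub> f"
  by (simp_all add: hecke_algebra_def)

lemma R_num_p: "R_num G B (P.\<beta> x) = R_num Gplus B (P.\<beta> x)"
  using dcosets_p_sub(1)[OF P.\<beta>_dcosets] by (simp add: R_num_def rcosets_in_Gplus)

context
  fixes s t assumes s: "s = \<mu>\<^sub>p (dgen True)" and t: "t = \<mu>\<^sub>p (dgen False)"
begin

lemma reduced_p: "reduced_word W {s, t} (\<mu>\<^sub>p x) ws \<longleftrightarrow> ws = map (\<lambda>y. \<mu>\<^sub>p (dgen y)) (nf x)"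
  unfolding s t by (rule reduced_word_dihedral[OF group.is_monoid[OF W_group] \<mu>\<^sub>p_iso])

lemma generates_p:
  "generates_algebra (Hp :: ('k::comm_ring_1, _) module) {\<one>\<^bsub>Hp\<^esub>, Delta G B s, Delta G B t}"
proof -
  interpret D: dihedral_algebra "Hp :: ('k, _) module" "dcosets Gplus B" P.coeff B P.\<beta> P.q
    by (rule P.hecke_dihedral_algebra)
  show ?thesis using D.generates[of True] by (simp add: s t Delta_p D.T_def)
qed

lemma word_p:
  assumes w: "w \<in> carrier W" and r: "reduced_word W {s, t} w ws"
  shows "Delta G B w = word_prod (Hp :: ('k::comm_ring_1, _) module) (map (Delta G B) ws)"
    "Delta G B w = word_prod (Ht :: ('k::comm_ring_1, _) module) (map (Delta G B) ws)"
    "R_num Gplus B (B <#> w <#> B) = (\<Prod>r\<leftarrow>ws. R_num Gplus B (B <#> r <#> B))"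
    "R_num G B (B <#> w <#> B) = (\<Prod>r\<leftarrow>ws. R_num G B (B <#> r <#> B))"
proof -
  obtain x where x: "w = \<mu>\<^sub>p x" using W_cases[OF w] by blast
  have ws: "ws = map (\<lambda>y. \<mu>\<^sub>p (dgen y)) (nf x)" using r unfolding x reduced_p .
  interpret D: dihedral_algebra "Hp :: ('k, _) module" "dcosets Gplus B" P.coeff B P.\<beta> P.q
    by (rule P.hecke_dihedral_algebra)
  show 1: "Delta G B w = word_prod (Hp :: ('k, _) module) (map (Delta G B) ws)"
    using D.T_word[of x] by (simp add: x ws Delta_p D.T_def o_def)
  have "set fs \<subseteq> carrier (Hp :: ('k, _) module) \<Longrightarrow> word_prod (Ht :: ('k, _) module) fs = word_prod Hp fs" for fs
  proof (induction fs)
    case (Cons f fs)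
    then show ?case using D.R.word_prod_closed[of fs] by (simp add: Hp_mult)
  qed (simp add: Hp_simps)
  moreover have "set (map (Delta G B) ws) \<subseteq> carrier (Hp :: ('k, _) module)"
  proof
    fix f :: "_ \<Rightarrow> 'k" assume "f \<in> set (map (Delta G B) ws)"
    then obtain y where "f = Delta G B (\<mu>\<^sub>p (dgen y))" unfolding ws by auto
    then show "f \<in> carrier Hp" using D.T_closed[of "dgen y"] by (simp only: Delta_p D.T_def)
  qed
  ultimately show "Delta G B w = word_prod (Ht :: ('k, _) module) (map (Delta G B) ws)" using 1 by simp
  show 2: "R_num Gplus B (B <#> w <#> B) = (\<Prod>r\<leftarrow>ws. R_num Gplus B (B <#> r <#> B))"
    using P.R_num_word[of x] by (simp add: x ws BwB_p o_def P.q_def)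
  show "R_num G B (B <#> w <#> B) = (\<Prod>r\<leftarrow>ws. R_num G B (B <#> r <#> B))"
    using 2 by (simp add: x ws BwB_p o_def R_num_p)
qed

lemma mult_p:
  fixes q \<Delta>
  assumes q: "q = (\<lambda>r. R_num Gplus B (B <#> r <#> B))"
    and \<Delta>: "\<Delta> = (Delta G B :: 'g set \<Rightarrow> 'g set \<Rightarrow> int)"
    and r: "r \<in> {s, t}" and w: "w \<in> carrier W"
  shows "begins_with W {s, t} w r \<Longrightarrow>
      \<Delta> r \<otimes>\<^bsub>Hp\<^esub> \<Delta> w = int (q r) \<odot>\<^bsub>Hp\<^esub> \<Delta> (r \<otimes>\<^bsub>W\<^esub> w) \<oplus>\<^bsub>Hp\<^esub> (int (q r) - 1) \<odot>\<^bsub>Hp\<^esub> \<Delta> w"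
    "ends_with W {s, t} w r \<Longrightarrow>
      \<Delta> w \<otimes>\<^bsub>Hp\<^esub> \<Delta> r = int (q r) \<odot>\<^bsub>Hp\<^esub> \<Delta> (w \<otimes>\<^bsub>W\<^esub> r) \<oplus>\<^bsub>Hp\<^esub> (int (q r) - 1) \<odot>\<^bsub>Hp\<^esub> \<Delta> w"
    "\<not> begins_with W {s, t} w r \<Longrightarrow> \<Delta> r \<otimes>\<^bsub>Hp\<^esub> \<Delta> w = \<Delta> (r \<otimes>\<^bsub>W\<^esub> w)"
    "\<not> ends_with W {s, t} w r \<Longrightarrow> \<Delta> w \<otimes>\<^bsub>Hp\<^esub> \<Delta> r = \<Delta> (w \<otimes>\<^bsub>W\<^esub> r)"
proof -
  interpret D: dihedral_algebra "Hp :: (int, _) module" "dcosets Gplus B" P.coeff B P.\<beta> P.q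
    by (rule P.hecke_dihedral_algebra)
  obtain x where x: "w = \<mu>\<^sub>p x" using W_cases[OF w] by blast
  obtain y where y: "r = \<mu>\<^sub>p (dgen y)" using r s t by blast
  have b: "begins_with W {s, t} w r \<longleftrightarrow> begins y x" "ends_with W {s, t} w r \<longleftrightarrow> ends y x"
    unfolding x y s t using begins_with_dihedral[OF group.is_monoid[OF W_group] \<mu>\<^sub>p_iso]
      ends_with_dihedral[OF group.is_monoid[OF W_group] \<mu>\<^sub>p_iso] by auto
  have hom: "\<mu>\<^sub>p \<in> hom D_inf W" using \<mu>\<^sub>p_iso by (simp add: iso_def)
  have m: "r \<otimes>\<^bsub>W\<^esub> w = \<mu>\<^sub>p (dgen y \<otimes>\<^bsub>D_inf\<^esub> x)" "w \<otimes>\<^bsub>W\<^esub> r = \<mu>\<^sub>p (x \<otimes>\<^bsub>D_inf\<^esub> dgen y)"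
    unfolding x y by (rule hom_mult[OF hom, symmetric]; simp)+
  have T: "\<Delta> (\<mu>\<^sub>p z) = D.T z" for z by (simp add: \<Delta> Delta_p D.T_def)
  have qr: "q r = P.q y" unfolding q y by (rule q_p)
  show "begins_with W {s, t} w r \<Longrightarrow>
      \<Delta> r \<otimes>\<^bsub>Hp\<^esub> \<Delta> w = int (q r) \<odot>\<^bsub>Hp\<^esub> \<Delta> (r \<otimes>\<^bsub>W\<^esub> w) \<oplus>\<^bsub>Hp\<^esub> (int (q r) - 1) \<odot>\<^bsub>Hp\<^esub> \<Delta> w"
    unfolding b m qr using D.T_dgen_mult(2)[of y x] by (simp only: x y T)
  show "ends_with W {s, t} w r \<Longrightarrow>
      \<Delta> w \<otimes>\<^bsub>Hp\<^esub> \<Delta> r = int (q r) \<odot>\<^bsub>Hp\<^esub> \<Delta> (w \<otimes>\<^bsub>W\<^esub> r) \<oplus>\<^bsub>Hp\<^esub> (int (q r) - 1) \<odot>\<^bsub>Hp\<^esub> \<Delta> w"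
    unfolding b m qr using D.T_mult_dgen(2)[of y x] by (simp only: x y T)
  show "\<not> begins_with W {s, t} w r \<Longrightarrow> \<Delta> r \<otimes>\<^bsub>Hp\<^esub> \<Delta> w = \<Delta> (r \<otimes>\<^bsub>W\<^esub> w)"
    unfolding b m unfolding x y T by (rule D.T_dgen_mult(1))
  show "\<not> ends_with W {s, t} w r \<Longrightarrow> \<Delta> w \<otimes>\<^bsub>Hp\<^esub> \<Delta> r = \<Delta> (w \<otimes>\<^bsub>W\<^esub> r)"
    unfolding b m unfolding x y T by (rule D.T_mult_dgen(1))
qed

end

end

lemma eval_quadratic_rel:
  fixes A :: "(int, 'x \<Rightarrow> int) module"
  assumes A: "fs_algebra A S c u" and gen: "gen ` L \<subseteq> carrier A" and x: "x \<in> L"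
  shows "free_ring_eval A gen (quadratic_rel (free_ring L) q (letter x)) =
    gen x \<otimes>\<^bsub>A\<^esub> gen x \<ominus>\<^bsub>A\<^esub> (int q \<odot>\<^bsub>A\<^esub> \<one>\<^bsub>A\<^esub> \<oplus>\<^bsub>A\<^esub> (int q - 1) \<odot>\<^bsub>A\<^esub> gen x)"
    "quadratic_rel (free_ring L) q (letter x) \<in> carrier (free_ring L)"
proof -
  interpret fs_algebra A S c u by (rule A)
  interpret F: fs_algebra "free_ring L" "lists L" "\<lambda>xs ys. basis_elt (xs @ ys)" "[]"
    by (rule free_ring_fs_algebra)
  note ev = R.free_ring_eval_hom[OF gen]
  interpret ev: ring_hom_ring "free_ring L" A "free_ring_eval A gen"
    by (rule ring_hom_ringI2[OF F.is_ring is_ring ev(1)])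
  have l: "letter x \<in> carrier (free_ring L)" by (rule letter_in_free_ring[OF x])
  have g: "gen x \<in> carrier A" using gen x by blast
  \<comment> \<open>Applied to the identity map, \<open>additive_int_smult\<close> identifies scalar
    multiples with integer multiples in \<open>A\<close>.\<close>
  have "id \<in> ring_hom A A" by (rule ring_hom_memI) auto
  then have sm: "[k] \<cdot>\<^bsub>A\<^esub> f = k \<odot>\<^bsub>A\<^esub> f" if "f \<in> carrier A" for k :: int and f
    using additive_int_smult[OF A is_ring, of id f k] that by simp
  have ev_sm: "free_ring_eval A gen (k \<odot>\<^bsub>free_ring L\<^esub> f) = k \<odot>\<^bsub>A\<^esub> free_ring_eval A gen f"
    if "f \<in> carrier (free_ring L)" for k f
    using additive_int_smult[OF free_ring_fs_algebra is_ring ev(1) that, of k] sm that by simp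
  show "quadratic_rel (free_ring L) q (letter x) \<in> carrier (free_ring L)"
    using l by (simp add: quadratic_rel_def F.smult_closed)
  show "free_ring_eval A gen (quadratic_rel (free_ring L) q (letter x)) =
    gen x \<otimes>\<^bsub>A\<^esub> gen x \<ominus>\<^bsub>A\<^esub> (int q \<odot>\<^bsub>A\<^esub> \<one>\<^bsub>A\<^esub> \<oplus>\<^bsub>A\<^esub> (int q - 1) \<odot>\<^bsub>A\<^esub> gen x)"
    using l x by (simp add: quadratic_rel_def F.smult_closed ev_sm ev(2) a_minus_def)
qed

section \<open>Edge inversions\<close>

lemma (in dihedral_algebra) T_quadratic:
  "T (dgen x) \<otimes>\<^bsub>A\<^esub> T (dgen x) \<ominus>\<^bsub>A\<^esub> (of_nat (q x) \<odot>\<^bsub>A\<^esub> \<one>\<^bsub>A\<^esub> \<oplus>\<^bsub>A\<^esub> (of_nat (q x) - 1) \<odot>\<^bsub>A\<^esub> T (dgen x)) = \<zero>\<^bsub>A\<^esub>"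
  unfolding T_square by (simp add: R.r_neg smult_closed a_minus_def)

text \<open>For \<open>q x = 1\<close> the term with factor \<open>q x - 1\<close> vanishes, and the
  two branches of the multiplication rule agree.\<close>

lemma (in dihedral_algebra) T_mult_involution:
  assumes "q x = 1"
  shows "T (dgen x) \<otimes>\<^bsub>A\<^esub> T d = T (dgen x \<otimes>\<^bsub>D_inf\<^esub> d)" "T d \<otimes>\<^bsub>A\<^esub> T (dgen x) = T (d \<otimes>\<^bsub>D_inf\<^esub> dgen x)"
proof -
  show "T (dgen x) \<otimes>\<^bsub>A\<^esub> T d = T (dgen x \<otimes>\<^bsub>D_inf\<^esub> d)"
  proof (cases "begins x d")
    case True
    show ?thesis unfolding T_dgen_mult(2)[OF True] using assms by (simp add: smult_eq add_eq)
  qed (rule T_dgen_mult(1))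
  show "T d \<otimes>\<^bsub>A\<^esub> T (dgen x) = T (d \<otimes>\<^bsub>D_inf\<^esub> dgen x)"
  proof (cases "ends x d")
    case True
    show ?thesis unfolding T_mult_dgen(2)[OF True] using assms by (simp add: smult_eq add_eq)
  qed (rule T_mult_dgen(1))
qed

lemma (in hecke) hecke_pair: "hecke_pair G H"
  unfolding hecke_pair_def using is_group sub fin by blast

text \<open>Trivial instance of the elimination condition in \<open>dihedral_presentation\<close>: a
  generator letter is its own one-letter word.\<close>

lemma letter_in_ideal:
  assumes R: "ring R" and rels: "rels \<subseteq> carrier (free_ring L)" and x: "x \<in> L" and gen: "gen x \<in> carrier R"
  shows "gen x = word_prod R [gen x] \<and>
    letter x \<ominus>\<^bsub>free_ring L\<^esub> word_prod (free_ring L) [letter x] \<in> Idl\<^bsub>free_ring L\<^esub> rels"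
proof -
  interpret R: ring R by (rule R)
  interpret F: fs_algebra "free_ring L" "lists L" "\<lambda>xs ys. basis_elt (xs @ ys)" "[]"
    by (rule free_ring_fs_algebra)
  have "\<zero>\<^bsub>free_ring L\<^esub> \<in> Idl\<^bsub>free_ring L\<^esub> rels"
    by (rule additive_subgroup.zero_closed[OF ideal.axioms(1)[OF F.R.genideal_ideal[OF rels]]])
  then show ?thesis using gen letter_in_free_ring[OF x] by (simp add: a_minus_def F.R.r_neg)
qed

text \<open>A ring \<open>R = P \<oplus> a P\<close> in which the involution \<open>a\<close> normalises the subring \<open>P\<close>.\<close>

lemma twisted_tensor_Z2:
  fixes act :: "int \<Rightarrow> 'r \<Rightarrow> 'r" and R :: "('r, 'm) ring_scheme" and P :: "('r, 'n) ring_scheme"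
  assumes R: "ring R" and P: "ring P" and sub: "\<And>f. f \<in> carrier P \<Longrightarrow> f \<in> carrier R"
    and mult: "\<And>f g. f \<in> carrier P \<Longrightarrow> g \<in> carrier P \<Longrightarrow> f \<otimes>\<^bsub>P\<^esub> g = f \<otimes>\<^bsub>R\<^esub> g"
    and add: "\<And>f g. f \<oplus>\<^bsub>P\<^esub> g = f \<oplus>\<^bsub>R\<^esub> g" and one: "\<one>\<^bsub>P\<^esub> = \<one>\<^bsub>R\<^esub>" and zero: "\<zero>\<^bsub>P\<^esub> = \<zero>\<^bsub>R\<^esub>"
    and a: "a \<in> carrier R" "a \<otimes>\<^bsub>R\<^esub> a = \<one>\<^bsub>R\<^esub>"
    and conj: "\<And>f. f \<in> carrier P \<Longrightarrow> a \<otimes>\<^bsub>R\<^esub> f \<otimes>\<^bsub>R\<^esub> a \<in> carrier P"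
    and surj: "\<And>r. r \<in> carrier R \<Longrightarrow> \<exists>f\<in>carrier P. \<exists>g\<in>carrier P. r = f \<oplus>\<^bsub>R\<^esub> a \<otimes>\<^bsub>R\<^esub> g"
    and uniq: "\<And>f g f' g'. f \<in> carrier P \<Longrightarrow> g \<in> carrier P \<Longrightarrow> f' \<in> carrier P \<Longrightarrow> g' \<in> carrier P \<Longrightarrow>
      f \<oplus>\<^bsub>R\<^esub> a \<otimes>\<^bsub>R\<^esub> g = f' \<oplus>\<^bsub>R\<^esub> a \<otimes>\<^bsub>R\<^esub> g' \<Longrightarrow> f = f' \<and> g = g'"
    and act: "\<And>f. act 0 f = f" "\<And>f. act 1 f = a \<otimes>\<^bsub>R\<^esub> f \<otimes>\<^bsub>R\<^esub> a"
  shows "ring_action (integer_mod_group 2) P act"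
    and "twisted_tensor (integer_mod_group 2) P act \<simeq> R"
proof -
  interpret R: ring R by (rule R)
  interpret P: ring P by (rule P)
  let ?Z = "integer_mod_group 2"
  let ?TT = "twisted_tensor ?Z P act"
  have Z: "carrier ?Z = {0, 1}" by (auto simp: carrier_integer_mod_group)
  note [simp] = sub a
  have aa: "a \<otimes>\<^bsub>R\<^esub> (a \<otimes>\<^bsub>R\<^esub> f) = f" if "f \<in> carrier R" for f
    using that by (simp add: R.m_assoc[symmetric])
  have conj_conj: "a \<otimes>\<^bsub>R\<^esub> (a \<otimes>\<^bsub>R\<^esub> f \<otimes>\<^bsub>R\<^esub> a) \<otimes>\<^bsub>R\<^esub> a = f" if "f \<in> carrier R" for f
    using that by (simp add: R.m_assoc aa)
  have act_closed: "act \<omega> f \<in> carrier P" if "\<omega> \<in> carrier ?Z" "f \<in> carrier P" for \<omega> f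
    using that by (auto simp: Z act conj)
  have iso: "act \<omega> \<in> ring_iso P P" if \<omega>: "\<omega> \<in> carrier ?Z" for \<omega>
  proof -
    have "act \<omega> \<in> ring_hom P P"
    proof (rule ring_hom_memI)
      fix f g assume fg: "f \<in> carrier P" "g \<in> carrier P"
      then show "act \<omega> (f \<otimes>\<^bsub>P\<^esub> g) = act \<omega> f \<otimes>\<^bsub>P\<^esub> act \<omega> g"
        using \<omega> mult[OF act_closed[OF \<omega>] act_closed[OF \<omega>], of f g] by (auto simp: Z act mult R.m_assoc aa)
      show "act \<omega> (f \<oplus>\<^bsub>P\<^esub> g) = act \<omega> f \<oplus>\<^bsub>P\<^esub> act \<omega> g"
        using \<omega> fg by (auto simp: Z act add R.l_distr R.r_distr)
    qed (use \<omega> act_closed in \<open>auto simp: Z act one\<close>)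
    moreover have "act \<omega> (act \<omega> f) = f" if "f \<in> carrier P" for f
      using that \<omega> by (auto simp: Z act conj_conj)
    then have "bij_betw (act \<omega>) (carrier P) (carrier P)"
      by (intro bij_betw_byWitness[where f' = "act \<omega>"]) (simp_all add: act_closed[OF \<omega>] image_subset_iff)
    ultimately show ?thesis by (simp add: ring_iso_def)
  qed
  have "act ((\<omega> + \<omega>') mod 2) f = act \<omega> (act \<omega>' f)"
    if "\<omega> \<in> carrier ?Z" "\<omega>' \<in> carrier ?Z" "f \<in> carrier P" for \<omega> \<omega>' f
    using that by (auto simp: Z act conj_conj)
  then show action: "ring_action ?Z P act"
    unfolding ring_action_def using iso P by (auto simp: act)
  \<comment> \<open>The pure tensor of \<omega> and \<open>r\<close> goes to the \<omega>-th power
    of \<open>a\<close> times \<open>r\<close>. The twist in the product matches the rule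
    \<open>r a = a (a r a)\<close>.\<close>
  define \<Phi> where "\<Phi> F = F 0 \<oplus>\<^bsub>R\<^esub> a \<otimes>\<^bsub>R\<^esub> F 1" for F :: "int \<Rightarrow> 'r"
  have c: "F \<omega> \<in> carrier P" "\<omega> \<noteq> 0 \<Longrightarrow> \<omega> \<noteq> 1 \<Longrightarrow> F \<omega> = \<zero>\<^bsub>P\<^esub>" if "F \<in> carrier ?TT" for F \<omega>
    using that by (auto simp: twisted_tensor_def Z)
  have cI: "F \<in> carrier ?TT" if "\<And>\<omega>. F \<omega> \<in> carrier P" "\<And>\<omega>. \<omega> \<noteq> 0 \<Longrightarrow> \<omega> \<noteq> 1 \<Longrightarrow> F \<omega> = \<zero>\<^bsub>P\<^esub>" for F
  proof -
    have "{\<omega>. F \<omega> \<noteq> \<zero>\<^bsub>P\<^esub>} \<subseteq> {0, 1}" using that(2) by blast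
    moreover from this have "finite {\<omega>. F \<omega> \<noteq> \<zero>\<^bsub>P\<^esub>}" by (rule finite_subset) simp
    ultimately show ?thesis using that(1) by (simp add: twisted_tensor_def Z)
  qed
  have act0: "act \<omega> \<zero>\<^bsub>P\<^esub> = \<zero>\<^bsub>P\<^esub>" if "\<omega> \<in> carrier ?Z" for \<omega>
    using that by (auto simp: Z act zero)
  \<comment> \<open>Sums over supports are replaced by sums over all pairs in the two-element group;
    there each element is its own inverse, so \<open>inv\<close> disappears.\<close>
  have prod: "(F \<otimes>\<^bsub>?TT\<^esub> F') x = finsum P (\<lambda>(\<omega>, \<omega>'). act \<omega>' (F \<omega>) \<otimes>\<^bsub>P\<^esub> F' \<omega>')
      {(\<omega>, \<omega>'). \<omega> \<in> {0, 1} \<and> \<omega>' \<in> {0, 1} \<and> (\<omega> + \<omega>') mod 2 = x}"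
    if F: "F \<in> carrier ?TT" "F' \<in> carrier ?TT" for F F' x
    unfolding twisted_tensor_def monoid.simps
  proof (rule P.add.finprod_mono_neutral_cong_left)
    have "{(\<omega>, \<omega>'). \<omega> \<in> {0, 1 :: int} \<and> \<omega>' \<in> {0, 1 :: int} \<and> (\<omega> + \<omega>') mod 2 = x} \<subseteq> {0, 1} \<times> {0, 1}" by blast
    then show "finite {(\<omega>, \<omega>'). \<omega> \<in> {0, 1 :: int} \<and> \<omega>' \<in> {0, 1 :: int} \<and> (\<omega> + \<omega>') mod 2 = x}"
      by (rule finite_subset) simp
    show "{(\<omega>, \<omega>'). F \<omega> \<noteq> \<zero>\<^bsub>P\<^esub> \<and> F' \<omega>' \<noteq> \<zero>\<^bsub>P\<^esub> \<and> \<omega> \<otimes>\<^bsub>?Z\<^esub> \<omega>' = x}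
        \<subseteq> {(\<omega>, \<omega>'). \<omega> \<in> {0, 1} \<and> \<omega>' \<in> {0, 1} \<and> (\<omega> + \<omega>') mod 2 = x}"
      using c(2)[OF F(1)] c(2)[OF F(2)] by auto
  next
    fix y assume "y \<in> {(\<omega>, \<omega>'). \<omega> \<in> {0, 1} \<and> \<omega>' \<in> {0, 1} \<and> (\<omega> + \<omega>') mod 2 = x} -
        {(\<omega>, \<omega>'). F \<omega> \<noteq> \<zero>\<^bsub>P\<^esub> \<and> F' \<omega>' \<noteq> \<zero>\<^bsub>P\<^esub> \<and> \<omega> \<otimes>\<^bsub>?Z\<^esub> \<omega>' = x}"
    then obtain \<omega> \<omega>' where y: "y = (\<omega>, \<omega>')" "\<omega>' \<in> carrier ?Z" "F \<omega> = \<zero>\<^bsub>P\<^esub> \<or> F' \<omega>' = \<zero>\<^bsub>P\<^esub>" by (auto simp: Z)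
    have "act \<omega>' (F \<omega>) \<in> carrier P" using act_closed[OF y(2) c(1)[OF F(1)]] .
    then show "(case y of (\<omega>, \<omega>') \<Rightarrow> act \<omega>' (F \<omega>) \<otimes>\<^bsub>P\<^esub> F' \<omega>') = \<zero>\<^bsub>P\<^esub>"
      using y c(1)[OF F(2)] act0[OF y(2)] by auto
  next
    fix y assume "y \<in> {(\<omega>, \<omega>'). F \<omega> \<noteq> \<zero>\<^bsub>P\<^esub> \<and> F' \<omega>' \<noteq> \<zero>\<^bsub>P\<^esub> \<and> \<omega> \<otimes>\<^bsub>?Z\<^esub> \<omega>' = x}"
    then obtain \<omega> \<omega>' where y: "y = (\<omega>, \<omega>')" "F' \<omega>' \<noteq> \<zero>\<^bsub>P\<^esub>" by auto
    then have "\<omega>' \<in> {0, 1}" using c(2)[OF F(2)] by blast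
    then have "inv\<^bsub>?Z\<^esub> \<omega>' = \<omega>'" by auto
    then show "(case y of (\<omega>, \<omega>') \<Rightarrow> act (inv\<^bsub>?Z\<^esub> \<omega>') (F \<omega>) \<otimes>\<^bsub>P\<^esub> F' \<omega>') = (case y of (\<omega>, \<omega>') \<Rightarrow> act \<omega>' (F \<omega>) \<otimes>\<^bsub>P\<^esub> F' \<omega>')"
      by (simp add: y(1))
  next
    show "(\<lambda>(\<omega>, \<omega>'). act \<omega>' (F \<omega>) \<otimes>\<^bsub>P\<^esub> F' \<omega>') \<in>
        {(\<omega>, \<omega>'). \<omega> \<in> {0, 1} \<and> \<omega>' \<in> {0, 1} \<and> (\<omega> + \<omega>') mod 2 = x} \<rightarrow> carrier P"
      using act_closed c(1)[OF F(1)] c(1)[OF F(2)] by (auto simp: Z)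
  qed
  have S0: "{(\<omega>, \<omega>'). \<omega> \<in> {0, 1 :: int} \<and> \<omega>' \<in> {0, 1 :: int} \<and> (\<omega> + \<omega>') mod 2 = 0} = {(0, 0), (1, 1)}"
    and S1: "{(\<omega>, \<omega>'). \<omega> \<in> {0, 1 :: int} \<and> \<omega>' \<in> {0, 1 :: int} \<and> (\<omega> + \<omega>') mod 2 = 1} = {(0, 1), (1, 0)}"
    by auto
  have p0: "(F \<otimes>\<^bsub>?TT\<^esub> F') 0 = F 0 \<otimes>\<^bsub>P\<^esub> F' 0 \<oplus>\<^bsub>P\<^esub> act 1 (F 1) \<otimes>\<^bsub>P\<^esub> F' 1"
    and p1: "(F \<otimes>\<^bsub>?TT\<^esub> F') 1 = act 1 (F 0) \<otimes>\<^bsub>P\<^esub> F' 1 \<oplus>\<^bsub>P\<^esub> F 1 \<otimes>\<^bsub>P\<^esub> F' 0"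
    if F: "F \<in> carrier ?TT" "F' \<in> carrier ?TT" for F F'
  proof -
    have cl: "F \<omega> \<in> carrier P" "F' \<omega> \<in> carrier P" "act 1 (F \<omega>) \<in> carrier P" for \<omega>
      using c(1)[OF F(1)] c(1)[OF F(2)] act_closed[of 1] by (simp_all add: Z)
    show "(F \<otimes>\<^bsub>?TT\<^esub> F') 0 = F 0 \<otimes>\<^bsub>P\<^esub> F' 0 \<oplus>\<^bsub>P\<^esub> act 1 (F 1) \<otimes>\<^bsub>P\<^esub> F' 1"
      unfolding prod[OF F] S0 by (simp add: cl act(1))
    show "(F \<otimes>\<^bsub>?TT\<^esub> F') 1 = act 1 (F 0) \<otimes>\<^bsub>P\<^esub> F' 1 \<oplus>\<^bsub>P\<^esub> F 1 \<otimes>\<^bsub>P\<^esub> F' 0"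
      unfolding prod[OF F] S1 by (simp add: cl act(1))
  qed
  have "\<Phi> \<in> ring_hom ?TT R"
  proof (rule ring_hom_memI)
    fix F F' assume F: "F \<in> carrier ?TT" "F' \<in> carrier ?TT"
    note cs = c(1)[OF F(1)] c(1)[OF F(2)]
    show "\<Phi> F \<in> carrier R" using cs by (simp add: \<Phi>_def)
    show "\<Phi> (F \<otimes>\<^bsub>?TT\<^esub> F') = \<Phi> F \<otimes>\<^bsub>R\<^esub> \<Phi> F'"
      using cs conj[OF cs(1)] unfolding \<Phi>_def p0[OF F] p1[OF F] act(2)
      by (simp add: add mult R.l_distr R.r_distr R.m_assoc aa R.a_ac)
    show "\<Phi> (F \<oplus>\<^bsub>?TT\<^esub> F') = \<Phi> F \<oplus>\<^bsub>R\<^esub> \<Phi> F'"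
      using cs by (simp add: \<Phi>_def twisted_tensor_def add R.r_distr R.a_ac)
  next
    show "\<Phi> \<one>\<^bsub>?TT\<^esub> = \<one>\<^bsub>R\<^esub>" by (simp add: \<Phi>_def twisted_tensor_def one zero)
  qed
  moreover have "inj_on \<Phi> (carrier ?TT)"
  proof (rule inj_onI)
    fix F F' assume F: "F \<in> carrier ?TT" "F' \<in> carrier ?TT" and eq: "\<Phi> F = \<Phi> F'"
    have "F 0 = F' 0 \<and> F 1 = F' 1"
      by (rule uniq[OF c(1)[OF F(1)] c(1)[OF F(1)] c(1)[OF F(2)] c(1)[OF F(2)] eq[unfolded \<Phi>_def]])
    then have "F x = F' x" for x
      using c(2)[OF F(1), of x] c(2)[OF F(2), of x] by (cases "x = 0 \<or> x = 1") auto
    then show "F = F'" by (rule ext)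
  qed
  moreover have "\<Phi> ` carrier ?TT = carrier R"
  proof (intro equalityI subsetI)
    fix r assume "r \<in> \<Phi> ` carrier ?TT"
    then show "r \<in> carrier R" using ring_hom_closed[OF calculation(1)] by blast
  next
    fix r assume "r \<in> carrier R"
    then obtain f g where fg: "f \<in> carrier P" "g \<in> carrier P" "r = f \<oplus>\<^bsub>R\<^esub> a \<otimes>\<^bsub>R\<^esub> g" using surj by blast
    define F where "F x = (if x = 0 then f else if x = 1 then g else \<zero>\<^bsub>P\<^esub>)" for x :: int
    have "F \<in> carrier ?TT" by (rule cI) (simp_all add: F_def fg)
    moreover have "r = \<Phi> F" by (simp add: \<Phi>_def F_def fg)
    ultimately show "r \<in> \<Phi> ` carrier ?TT" by blast
  qed
  ultimately have "\<Phi> \<in> ring_iso ?TT R" by (simp add: ring_iso_def bij_betw_def)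
  then show "?TT \<simeq> R" unfolding is_ring_iso_def by blast
qed

section \<open>Presentation for type-preserving elements; complex group algebras\<close>

context tree_action
begin

interpretation P: dihedral_hecke Gplus B \<kappa>\<^sub>p
  by (rule dihedral_hecke_Gplus)

declare mult_W [simp del] mult_FactGroup [simp del]

lemma presentation_p:
  fixes q \<Delta>
  assumes \<Delta>: "\<Delta> = (Delta G B :: 'g set \<Rightarrow> 'g set \<Rightarrow> int)"
    and q: "q = (\<lambda>r. R_num Gplus B (B <#> r <#> B))"
    and s: "s = \<mu>\<^sub>p (dgen True)" and t: "t = \<mu>\<^sub>p (dgen False)"
  shows "ring_presentation (Hp :: (int, _) module) {Gen_s, Gen_t} (\<lambda>x. case x of Gen_s \<Rightarrow> \<Delta> s | Gen_t \<Rightarrow> \<Delta> t)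
    {quadratic_rel (free_ring {Gen_s, Gen_t}) (q s) (letter Gen_s),
     quadratic_rel (free_ring {Gen_s, Gen_t}) (q t) (letter Gen_t)}"
    (is "ring_presentation _ ?L ?gen ?rels")
proof -
  interpret D: dihedral_algebra "Hp :: (int, _) module" "dcosets Gplus B" P.coeff B P.\<beta> P.q
    by (rule P.hecke_dihedral_algebra)
  interpret F: fs_algebra "free_ring ?L" "lists ?L" "\<lambda>xs ys. basis_elt (xs @ ys)" "[]"
    by (rule free_ring_fs_algebra)
  define l where "l x = (if x then Gen_s else Gen_t)" for x
  have l: "l x \<in> ?L" "?gen (l x) = D.T (dgen x)" for x
    by (cases x; simp add: l_def \<Delta> s t Delta_p D.T_def)+
  have L: "\<exists>x. y = l x" if "y \<in> ?L" for y
    using that by (auto simp: l_def intro: exI[of _ True] exI[of _ False])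
  have gen: "?gen ` ?L \<subseteq> carrier Hp"
  proof (rule image_subsetI)
    fix y assume "y \<in> ?L"
    then obtain x where y: "y = l x" using L by blast
    show "?gen y \<in> carrier Hp" unfolding y l(2) by simp
  qed
  have ql: "quadratic_rel (free_ring ?L) (P.q x) (letter (l x)) \<in> ?rels" for x
    by (cases x) (simp_all add: l_def q s t q_p)
  have rels: "\<exists>x. f = quadratic_rel (free_ring ?L) (P.q x) (letter (l x))" if "f \<in> ?rels" for f
    using that by (auto simp: l_def q s t q_p intro: exI[of _ True] exI[of _ False])
  have relc: "?rels \<subseteq> carrier (free_ring ?L)"
    using eval_quadratic_rel(2)[OF D.fs_algebra_axioms gen] by simp
  show ?thesis
  proof (rule dihedral_presentation[OF P.hecke_dihedral_algebra gen relc, where l = l])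
    fix f assume "f \<in> ?rels"
    then obtain x where f: "f = quadratic_rel (free_ring ?L) (P.q x) (letter (l x))" using rels by blast
    show "free_ring_eval Hp ?gen f = \<zero>\<^bsub>Hp\<^esub>"
      unfolding f eval_quadratic_rel(1)[OF D.fs_algebra_axioms gen l(1)] l(2) using D.T_quadratic[of x] by simp
  next
    fix y assume y: "y \<in> ?L"
    then obtain x where x: "y = l x" using L by blast
    have "?gen y \<in> carrier Hp" using gen y by blast
    from letter_in_ideal[OF D.is_ring relc y, of ?gen, OF this]
    show "\<exists>ws. ?gen y = word_prod Hp (map (\<lambda>x. ?gen (l x)) ws) \<and>
        letter y \<ominus>\<^bsub>free_ring ?L\<^esub> word_prod (free_ring ?L) (map (\<lambda>x. letter (l x)) ws) \<in> Idl\<^bsub>free_ring ?L\<^esub> ?rels"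
      by (intro exI[of _ "[x]"]) (simp only: x list.map)
  qed (rule l(1) l(2) subsetD[OF F.R.genideal_self[OF relc] ql])+
qed

lemma Hp_group_algebra: "algebra_isomorphic (Hp :: (complex, _) module) (monoid_algebra D_inf)"
  by (rule dihedral_algebra_iso_group_algebra[OF P.hecke_dihedral_algebra])

text \<open>For \<open>G = Gp\<close> the two Hecke algebras coincide; otherwise the dihedral
  structure has generators \<open>s\<close> and \<open>i\<close>. The parameters differ, but over
  the complex numbers the same group algebra results.\<close>

lemma Ht_group_algebra: "algebra_isomorphic (Ht :: (complex, _) module) (monoid_algebra D_inf)"
proof (cases "carrier G = Gp")
  case True
  then have "Gplus = G" by (metis partial_object.surjective partial_object.update_convs(1))
  then show ?thesis using Hp_group_algebra by simp
next
  case False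
  show ?thesis
    by (rule dihedral_algebra_iso_group_algebra[OF dihedral_hecke.hecke_dihedral_algebra[OF dihedral_hecke_G[OF False]]])
qed

text \<open>Rewrites words in \<open>s, t\<close> as words in \<open>s, i\<close> by means of
  \<open>t = i s i\<close>; for instance \<open>dgen False\<close> becomes
  \<open>(-1, True)\<close>. Its companion \<open>swap\<close> exchanges the two generators and
  corresponds to conjugation by \<open>i\<close>.\<close>

definition \<nu> :: "int \<times> bool \<Rightarrow> int \<times> bool" where
  "\<nu> x = (if snd x then 2 * fst x - 1 else 2 * fst x, snd x)"

definition swap :: "int \<times> bool \<Rightarrow> int \<times> bool" where
  "swap x = (if snd x then 1 - fst x else - fst x, snd x)"

lemma \<nu>: "\<iota>\<^sub>t (\<nu> x) = \<iota>\<^sub>p x" "\<mu>\<^sub>t (\<nu> x) = \<mu>\<^sub>p x" "\<nu> (dgen True) = dgen True"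
  by (simp_all add: \<mu>\<^sub>p_def \<mu>\<^sub>t_def \<nu>_def \<iota>\<^sub>p_def \<iota>\<^sub>t_def dgen_def)

lemma \<nu>_ex: "even (fst (\<iota>\<^sub>t y)) \<Longrightarrow> \<exists>x. y = \<nu> x"
  by (rule exI[of _ "(fst (\<iota>\<^sub>t y) div 2, snd y)"]) (auto simp: \<nu>_def \<iota>\<^sub>t_def prod_eq_iff)

lemma \<nu>_even: "even (fst (\<iota>\<^sub>t (\<nu> x)))"
  by (simp add: \<nu> \<iota>\<^sub>p_def)

lemma dgen_False_odd: "even (fst (\<iota>\<^sub>t (dgen False \<otimes>\<^bsub>D_inf\<^esub> y))) \<longleftrightarrow> odd (fst (\<iota>\<^sub>t y))"
  by (cases y) (auto simp: \<iota>\<^sub>t_def dgen_def)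

lemma swap_swap: "swap (swap x) = x" and swap_dgen: "swap (dgen y) = dgen (\<not> y)"
  and swap_mult: "swap (x \<otimes>\<^bsub>D_inf\<^esub> z) = swap x \<otimes>\<^bsub>D_inf\<^esub> swap z"
  and swap_\<nu>: "dgen False \<otimes>\<^bsub>D_inf\<^esub> \<nu> x \<otimes>\<^bsub>D_inf\<^esub> dgen False = \<nu> (swap x)"
  by (cases x; cases z; cases y; auto simp: swap_def \<nu>_def dgen_def)+

context
  fixes i assumes ne: "carrier G \<noteq> Gp" and i: "i \<in> N" "\<phi> i (\<gamma> 0) = \<gamma> 1" "\<phi> i (\<gamma> 1) = \<gamma> 0"
begin

interpretation Q: dihedral_hecke G B \<kappa>\<^sub>t
  by (rule dihedral_hecke_G[OF ne])

lemma iG: "i \<in> carrier G"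
  by (rule N_carrier[OF i(1)])

lemma iT: "i <# T = \<mu>\<^sub>t (dgen False)"
  using coset_left[OF i(1)] \<kappa>_swap[OF i(2,3)] by (simp add: \<mu>\<^sub>t_def \<iota>\<^sub>t_def dgen_def)

lemma iT_members:
  assumes "n \<in> i <# T"
  shows "\<phi> n ` (e \<inter> Ve) = e \<inter> Vo" "\<phi> n ` (e \<inter> Vo) = e \<inter> Ve"
proof -
  have n: "n \<in> N" "\<kappa> n = (1, True)"
    using assms unfolding iT by (simp_all add: \<mu>\<^sub>t_def \<iota>\<^sub>t_def dgen_def coset_def)
  note sw = \<kappa>_i[OF N_carrier[OF n(1)] n(2)]
  have Vo: "\<gamma> k \<in> Vo \<longleftrightarrow> \<gamma> k \<notin> Ve" for k
    using bip \<gamma>_V[of k] by (auto simp: bipartition_def)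
  have e1: "\<gamma> 1 \<in> Ve \<longleftrightarrow> \<gamma> 0 \<notin> Ve" using \<gamma>_type[of 1] by simp
  have "e \<inter> Ve = (if \<gamma> 0 \<in> Ve then {\<gamma> 0} else {\<gamma> 1})" "e \<inter> Vo = (if \<gamma> 0 \<in> Ve then {\<gamma> 1} else {\<gamma> 0})"
    using Vo e1 by (auto simp: e_def)
  then show "\<phi> n ` (e \<inter> Ve) = e \<inter> Vo" "\<phi> n ` (e \<inter> Vo) = e \<inter> Ve" using sw by simp_all
qed

text \<open>As \<open>i\<close> exchanges the ends of \<open>e\<close>, it normalises
  \<open>B\<close>, so factors from \<open>B\<close> pass from one side of \<open>i\<close> to the
  other.\<close>

lemma dcoset_i: "dcoset G B i = B #> i" "dcoset G B i = i <# B"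
proof -
  note Bc = B_carrier and sc = swap_conj[OF iG i(2,3)]
  have one: "\<one> \<in> B" by (rule subgroup.one_closed[OF B_subgroup])
  have "x \<in> B #> i \<and> x \<in> i <# B" if x': "x \<in> dcoset G B i" for x
  proof -
    obtain b c where x: "b \<in> B" "c \<in> B" "x = b \<otimes> i \<otimes> c" using x' by (auto simp: mem_dcoset)
    have "x = (b \<otimes> (i \<otimes> c \<otimes> inv i)) \<otimes> i" using x iG Bc by (simp add: m_assoc)
    moreover have "x = i \<otimes> ((inv i \<otimes> b \<otimes> i) \<otimes> c)"
      using x iG Bc by (simp add: m_assoc[symmetric])
    moreover have "b \<otimes> (i \<otimes> c \<otimes> inv i) \<in> B" "(inv i \<otimes> b \<otimes> i) \<otimes> c \<in> B"
      using x sc by (simp_all add: B_mult)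
    ultimately show ?thesis unfolding r_coset_def l_coset_def by blast
  qed
  moreover have "x \<in> dcoset G B i" if x: "x \<in> B #> i" for x
  proof -
    obtain b where b: "b \<in> B" "x = b \<otimes> i" using x by (auto simp: r_coset_def)
    then have "x = b \<otimes> i \<otimes> \<one>" using iG Bc by simp
    then show ?thesis unfolding mem_dcoset using b(1) one by blast
  qed
  moreover have "x \<in> dcoset G B i" if x: "x \<in> i <# B" for x
  proof -
    obtain b where b: "b \<in> B" "x = i \<otimes> b" using x by (auto simp: l_coset_def)
    then have "x = \<one> \<otimes> i \<otimes> b" using iG Bc by simp
    then show ?thesis unfolding mem_dcoset using b(1) one by blast
  qed
  ultimately show "dcoset G B i = B #> i" "dcoset G B i = i <# B" by blast+
qed

lemma \<beta>\<^sub>t: "Q.\<beta> x = fib (\<iota>\<^sub>t x)"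
proof -
  have "g \<in> carrier G \<and> \<kappa> g = \<iota>\<^sub>t x \<longleftrightarrow> g \<in> carrier G \<and> \<kappa>\<^sub>t g = x" for g
    using \<kappa>\<^sub>t_iff[of g "fst x" "snd x"] by (auto simp: \<iota>\<^sub>t_def)
  then show ?thesis by (auto simp: Q.\<beta>_def fib_def)
qed

lemma \<beta>\<^sub>t_\<nu>: "Q.\<beta> (\<nu> x) = P.\<beta> x"
  by (simp add: \<beta>\<^sub>t \<beta>\<^sub>p \<nu>)

lemma BwB_t: "B <#> \<mu>\<^sub>t x <#> B = Q.\<beta> x"
proof -
  obtain n where n: "n \<in> N" "\<kappa> n = \<iota>\<^sub>t x" using \<kappa>_surj[OF ne] by blast
  then show ?thesis using BcosetB[OF n(1)] by (simp add: \<mu>\<^sub>t_def \<beta>\<^sub>t)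
qed

lemma Delta_t: "Delta G B (\<mu>\<^sub>t x) = basis_elt (Q.\<beta> x)"
  by (simp add: Delta_def BwB_t)

lemma Wt_cases: "w \<in> carrier Wt \<Longrightarrow> \<exists>x. w = \<mu>\<^sub>t x"
proof -
  assume "w \<in> carrier Wt"
  moreover have "range \<mu>\<^sub>t = carrier Wt" using \<mu>\<^sub>t_iso[OF ne] by (simp add: iso_def bij_betw_def)
  ultimately show "\<exists>x. w = \<mu>\<^sub>t x" by blast
qed

lemma \<mu>\<^sub>t_closed: "\<mu>\<^sub>t x \<in> carrier Wt"
proof -
  have "range \<mu>\<^sub>t = carrier Wt" using \<mu>\<^sub>t_iso[OF ne] by (simp add: iso_def bij_betw_def)
  then show ?thesis by blast
qed

lemma \<mu>\<^sub>t_mult: "\<mu>\<^sub>t x \<otimes>\<^bsub>Wt\<^esub> \<mu>\<^sub>t y = \<mu>\<^sub>t (x \<otimes>\<^bsub>D_inf\<^esub> y)"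
  using \<mu>\<^sub>t_iso[OF ne] hom_mult[of \<mu>\<^sub>t D_inf Wt x y] by (simp add: iso_def)

text \<open>\<open>B i B\<close> is the single right coset \<open>B i\<close>. The double coset of
  \<open>s\<close> lies in \<open>Gp\<close>, so its degree is the same in both groups.\<close>

lemma q_t: "Q.q False = 1" "Q.q True = P.q True"
proof -
  have "Q.\<beta> (dgen False) = fib (\<kappa> i)" using \<kappa>_swap[OF i(2,3)] by (simp add: \<beta>\<^sub>t \<iota>\<^sub>t_def dgen_def)
  then have D: "Q.\<beta> (dgen False) = B #> i" using dcoset_fib[OF iG] dcoset_i(1) by simp
  have "rcosets_in G B (B #> i) = {B #> i}"
  proof (intro equalityI subsetI)
    fix C assume "C \<in> rcosets_in G B (B #> i)"
    then have C: "C \<in> rcosets B" "rep C \<in> B #> i"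
      using rcosets_in_iff[OF Q.\<beta>_dcosets[of "dgen False"]] D by auto
    obtain x where x: "x \<in> carrier G" "C = B #> x" using C(1) by (auto simp: RCOSETS_def)
    have "rep C \<in> B #> x" using x rep_in[OF rcos_self[OF x(1) B_subgroup]] by simp
    then have "B #> x = B #> rep C" by (rule repr_independence[OF _ x(1) B_subgroup])
    also have "\<dots> = B #> i" by (rule repr_independence[OF C(2) iG B_subgroup, symmetric])
    finally show "C \<in> {B #> i}" using x(2) by simp
  qed (use iG in \<open>auto simp: rcosets_in_def\<close>)
  then show "Q.q False = 1" by (simp add: Q.q_def D R_num_def)
  show "Q.q True = P.q True" using \<beta>\<^sub>t_\<nu>[of "dgen True"] R_num_p by (simp add: Q.q_def P.q_def \<nu>)
qed

lemma iT_closed: "i <# T \<in> carrier Wt"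
  unfolding iT by (rule \<mu>\<^sub>t_closed)

lemma inv_iT: "inv\<^bsub>Wt\<^esub> (i <# T) = i <# T"
proof -
  have "\<mu>\<^sub>t (0, False) = \<one>\<^bsub>Wt\<^esub>" by (simp add: \<mu>\<^sub>t_def \<iota>\<^sub>t_def T_coset)
  then show ?thesis unfolding iT
    by (intro group.inv_equality[OF Wt_group]) (simp_all add: \<mu>\<^sub>t_closed \<mu>\<^sub>t_mult)
qed

lemma iT_conj: "(i <# T) \<otimes>\<^bsub>Wt\<^esub> \<mu>\<^sub>p x \<otimes>\<^bsub>Wt\<^esub> inv\<^bsub>Wt\<^esub> (i <# T) = \<mu>\<^sub>p (swap x)"
  unfolding inv_iT unfolding iT \<nu>(2)[symmetric] \<mu>\<^sub>t_mult swap_\<nu> ..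

lemma generates_t:
  "generates_algebra (Ht :: ('k::comm_ring_1, _) module) {\<one>\<^bsub>Ht\<^esub>, Delta G B (i <# T), Delta G B (\<mu>\<^sub>p (dgen True))}"
proof -
  interpret D: dihedral_algebra "Ht :: ('k, _) module" "dcosets G B" Q.coeff B Q.\<beta> Q.q
    by (rule Q.hecke_dihedral_algebra)
  have "\<mu>\<^sub>p (dgen True) = \<mu>\<^sub>t (dgen True)" using \<nu>(2)[of "dgen True"] by (simp add: \<nu>(3))
  then show ?thesis using D.generates[of False] by (simp add: iT Delta_t D.T_def)
qed

lemma Delta_i_mult:
  assumes "w \<in> carrier Wt"
  shows "Delta G B (i <# T) \<otimes>\<^bsub>Ht\<^esub> Delta G B w = (Delta G B ((i <# T) \<otimes>\<^bsub>Wt\<^esub> w) :: _ \<Rightarrow> 'k::comm_ring_1)"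
proof -
  interpret D: dihedral_algebra "Ht :: ('k, _) module" "dcosets G B" Q.coeff B Q.\<beta> Q.q
    by (rule Q.hecke_dihedral_algebra)
  obtain x where x: "w = \<mu>\<^sub>t x" using Wt_cases[OF assms] by blast
  show ?thesis unfolding x iT \<mu>\<^sub>t_mult Delta_t using D.T_mult_involution(1)[OF q_t(1), of x] by (simp only: D.T_def)
qed

lemma \<mu>\<^sub>p_closed: "\<mu>\<^sub>p x \<in> carrier W"
proof -
  have "range \<mu>\<^sub>p = carrier W" using \<mu>\<^sub>p_iso by (simp add: iso_def bij_betw_def)
  then show ?thesis by blast
qed

lemma \<mu>\<^sub>p_mult: "\<mu>\<^sub>p x \<otimes>\<^bsub>W\<^esub> \<mu>\<^sub>p y = \<mu>\<^sub>p (x \<otimes>\<^bsub>D_inf\<^esub> y)"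
  using \<mu>\<^sub>p_iso hom_mult[of \<mu>\<^sub>p D_inf W x y] by (simp add: iso_def)

text \<open>Conjugation by the coset of \<open>i\<close> does it; on \<open>W\<close> it is an
  involution and hence its own inverse.\<close>

lemma bar_exists: "\<exists>bar\<in>iso W W. bar (\<mu>\<^sub>p (dgen True)) = \<mu>\<^sub>p (dgen False) \<and> bar (\<mu>\<^sub>p (dgen False)) = \<mu>\<^sub>p (dgen True)"
proof -
  define bar where "bar w = (i <# T) \<otimes>\<^bsub>Wt\<^esub> w \<otimes>\<^bsub>Wt\<^esub> inv\<^bsub>Wt\<^esub> (i <# T)" for w
  have bar: "bar (\<mu>\<^sub>p x) = \<mu>\<^sub>p (swap x)" for x unfolding bar_def by (rule iT_conj)
  have "bar \<in> hom W W"
  proof (rule homI)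
    fix w v assume "w \<in> carrier W" "v \<in> carrier W"
    then obtain x y where "w = \<mu>\<^sub>p x" "v = \<mu>\<^sub>p y" using W_cases by metis
    then show "bar w \<in> carrier W" "bar (w \<otimes>\<^bsub>W\<^esub> v) = bar w \<otimes>\<^bsub>W\<^esub> bar v"
      by (simp_all only: \<mu>\<^sub>p_mult bar \<mu>\<^sub>p_closed swap_mult)
  qed
  moreover have "bar w \<in> carrier W" "bar (bar w) = w" if w: "w \<in> carrier W" for w
  proof -
    obtain x where "w = \<mu>\<^sub>p x" using W_cases[OF w] by blast
    then show "bar w \<in> carrier W" "bar (bar w) = w" by (simp_all only: bar \<mu>\<^sub>p_closed swap_swap)
  qed
  then have "bij_betw bar (carrier W) (carrier W)" by (intro bij_betw_byWitness[where f' = bar]) auto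
  ultimately have "bar \<in> iso W W" by (simp add: iso_def)
  moreover have "bar (\<mu>\<^sub>p (dgen True)) = \<mu>\<^sub>p (dgen False)" "bar (\<mu>\<^sub>p (dgen False)) = \<mu>\<^sub>p (dgen True)"
    by (simp_all only: bar swap_dgen not_True_eq_False not_False_eq_True)
  ultimately show ?thesis by blast
qed

text \<open>Every element of \<open>W\<close> is a word in the two reflections, so a homomorphism is
  determined by their images.\<close>

lemma bar_unique:
  assumes bar: "bar \<in> iso W W" "bar (\<mu>\<^sub>p (dgen True)) = \<mu>\<^sub>p (dgen False)" "bar (\<mu>\<^sub>p (dgen False)) = \<mu>\<^sub>p (dgen True)"
  shows "bar (\<mu>\<^sub>p x) = \<mu>\<^sub>p (swap x)"
proof -
  have hom: "bar \<in> hom W W" using bar(1) by (simp add: iso_def)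
  have gen: "bar (\<mu>\<^sub>p (dgen y)) = \<mu>\<^sub>p (swap (dgen y))" for y by (cases y) (simp_all add: bar swap_dgen)
  have one: "\<mu>\<^sub>p (0, False) = \<one>\<^bsub>W\<^esub>" by (simp add: \<mu>\<^sub>p_def \<iota>\<^sub>p_def T_coset)
  have "bar (\<mu>\<^sub>p (dword ws)) = \<mu>\<^sub>p (swap (dword ws))" for ws
  proof (induction ws)
    case Nil
    have "swap (0, False) = (0, False)" by (simp add: swap_def)
    then show ?case using hom_one[OF hom W_group W_group] one by simp
  next
    case (Cons y ws)
    have "bar (\<mu>\<^sub>p (dgen y) \<otimes>\<^bsub>W\<^esub> \<mu>\<^sub>p (dword ws)) = bar (\<mu>\<^sub>p (dgen y)) \<otimes>\<^bsub>W\<^esub> bar (\<mu>\<^sub>p (dword ws))"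
      by (rule hom_mult[OF hom \<mu>\<^sub>p_closed \<mu>\<^sub>p_closed])
    then show ?case unfolding gen Cons.IH \<mu>\<^sub>p_mult swap_mult[symmetric] by simp
  qed
  from this[of "nf x"] show ?thesis by simp
qed

text \<open>With \<open>a\<close> the basis element of \<open>i\<close>, parity of the first
  coordinate splits the basis of \<open>Ht\<close> into the double cosets inside \<open>Gp\<close>
  and their multiples by \<open>a\<close>. This is the decomposition that
  \<open>twisted_tensor_Z2\<close> requires.\<close>

lemma twisted_tensor_t:
  assumes bar: "bar \<in> iso W W" "bar (\<mu>\<^sub>p (dgen True)) = \<mu>\<^sub>p (dgen False)" "bar (\<mu>\<^sub>p (dgen False)) = \<mu>\<^sub>p (dgen True)"
  shows "\<forall>w\<in>carrier W. bar w = (i <# T) \<otimes>\<^bsub>Wt\<^esub> w \<otimes>\<^bsub>Wt\<^esub> inv\<^bsub>Wt\<^esub> (i <# T)"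
    and "\<exists>act. ring_action (integer_mod_group 2) (Hp :: (int, _) module) act \<and>
      (\<forall>w\<in>carrier W. act 1 (Delta G B w) = Delta G B (bar w)) \<and>
      twisted_tensor (integer_mod_group 2) (Hp :: (int, _) module) act \<simeq> (Ht :: (int, _) module)"
proof -
  note bar' = bar_unique[OF bar]
  show "\<forall>w\<in>carrier W. bar w = (i <# T) \<otimes>\<^bsub>Wt\<^esub> w \<otimes>\<^bsub>Wt\<^esub> inv\<^bsub>Wt\<^esub> (i <# T)"
  proof
    fix w assume "w \<in> carrier W"
    then obtain x where x: "w = \<mu>\<^sub>p x" using W_cases by blast
    show "bar w = (i <# T) \<otimes>\<^bsub>Wt\<^esub> w \<otimes>\<^bsub>Wt\<^esub> inv\<^bsub>Wt\<^esub> (i <# T)" unfolding x bar' iT_conj ..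
  qed
  interpret D: dihedral_algebra "Ht :: (int, _) module" "dcosets G B" Q.coeff B Q.\<beta> Q.q
    by (rule Q.hecke_dihedral_algebra)
  interpret DP: dihedral_algebra "Hp :: (int, _) module" "dcosets Gplus B" P.coeff B P.\<beta> P.q
    by (rule P.hecke_dihedral_algebra)
  define a where "a = D.T (dgen False)"
  have a: "a \<in> carrier Ht" by (simp add: a_def)
  have aT: "a \<otimes>\<^bsub>Ht\<^esub> D.T x = D.T (dgen False \<otimes>\<^bsub>D_inf\<^esub> x)" "D.T x \<otimes>\<^bsub>Ht\<^esub> a = D.T (x \<otimes>\<^bsub>D_inf\<^esub> dgen False)" for x
    unfolding a_def by (rule D.T_mult_involution[OF q_t(1)])+
  have aa: "a \<otimes>\<^bsub>Ht\<^esub> a = \<one>\<^bsub>Ht\<^esub>" using aT(1)[of "dgen False"] by (simp add: a_def D.T_one)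
  have aaf: "a \<otimes>\<^bsub>Ht\<^esub> (a \<otimes>\<^bsub>Ht\<^esub> f) = f" if "f \<in> carrier Ht" for f
    using that a aa by (simp add: D.R.m_assoc[symmetric])
  have TP: "DP.T x = D.T (\<nu> x)" for x by (simp add: D.T_def DP.T_def \<beta>\<^sub>t_\<nu>)
  have TPc: "D.T (\<nu> x) \<in> carrier Hp" for x unfolding TP[symmetric] by simp
  have conj: "a \<otimes>\<^bsub>Ht\<^esub> f \<otimes>\<^bsub>Ht\<^esub> a \<in> carrier Hp" if "f \<in> carrier Hp" for f
    using that
  proof (induction f rule: DP.carrier_induct)
    case zero
    then show ?case using a by (simp flip: Hp_simps(2)) (simp add: Hp_simps)
  next
    case (add k x f)
    have f: "f \<in> carrier Ht" by (rule Hp_sub[OF add(1)])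
    have "a \<otimes>\<^bsub>Ht\<^esub> (k \<odot>\<^bsub>Ht\<^esub> D.T (\<nu> x) \<oplus>\<^bsub>Ht\<^esub> f) \<otimes>\<^bsub>Ht\<^esub> a =
        k \<odot>\<^bsub>Ht\<^esub> (a \<otimes>\<^bsub>Ht\<^esub> D.T (\<nu> x) \<otimes>\<^bsub>Ht\<^esub> a) \<oplus>\<^bsub>Ht\<^esub> (a \<otimes>\<^bsub>Ht\<^esub> f \<otimes>\<^bsub>Ht\<^esub> a)"
      using a f by (simp add: D.R.l_distr D.R.r_distr D.smult_closed D.smult_mult_left D.smult_mult_right)
    also have "\<dots> = k \<odot>\<^bsub>Hp\<^esub> D.T (\<nu> (swap x)) \<oplus>\<^bsub>Hp\<^esub> (a \<otimes>\<^bsub>Ht\<^esub> f \<otimes>\<^bsub>Ht\<^esub> a)"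
      unfolding aT swap_\<nu> Hp_simps ..
    also have "\<dots> \<in> carrier Hp" using TPc add(2) by (simp add: DP.smult_closed)
    finally show ?case unfolding TP Hp_simps .
  qed
  \<comment> \<open>Multiplication by \<open>a\<close> changes the parity of the first coordinate,
    so \<open>a f\<close> vanishes on the double cosets inside \<open>Gp\<close>. Evaluating there
    yields the uniqueness of the decomposition.\<close>
  have odd: "(a \<otimes>\<^bsub>Ht\<^esub> f) U = 0" if "f \<in> carrier Hp" "U \<in> dcosets Gplus B" for f U
    using that(1)
  proof (induction f rule: DP.carrier_induct)
    case zero
    have "a \<otimes>\<^bsub>Ht\<^esub> \<zero>\<^bsub>Ht\<^esub> = \<zero>\<^bsub>Ht\<^esub>" using a by simp
    then show ?case unfolding Hp_simps(2)[symmetric] by (simp add: D.zero_eq)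
  next
    case (add k x f)
    have f: "f \<in> carrier Ht" by (rule Hp_sub[OF add(1)])
    let ?y = "dgen False \<otimes>\<^bsub>D_inf\<^esub> \<nu> x"
    have "a \<otimes>\<^bsub>Ht\<^esub> (k \<odot>\<^bsub>Ht\<^esub> D.T (\<nu> x) \<oplus>\<^bsub>Ht\<^esub> f) = k \<odot>\<^bsub>Ht\<^esub> D.T ?y \<oplus>\<^bsub>Ht\<^esub> a \<otimes>\<^bsub>Ht\<^esub> f"
      using a f by (simp add: D.R.r_distr D.smult_closed D.smult_mult_right aT)
    then have "(a \<otimes>\<^bsub>Ht\<^esub> (k \<odot>\<^bsub>Ht\<^esub> D.T (\<nu> x) \<oplus>\<^bsub>Ht\<^esub> f)) U = k * D.T ?y U"
      using add(2) by (simp add: D.add_eq D.smult_eq)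
    moreover have "U \<noteq> Q.\<beta> ?y"
    proof
      assume U: "U = Q.\<beta> ?y"
      have "rep U \<in> U" using dcosets_props(1)[OF dcosets_p_sub(2)[OF that(2)]] .
      then have "rep U \<in> Gp" "rep U \<in> carrier G" "\<kappa> (rep U) = \<iota>\<^sub>t ?y"
        using dcosets_p_sub(1)[OF that(2)] U by (auto simp: \<beta>\<^sub>t fib_def)
      then have "even (fst (\<iota>\<^sub>t ?y))" using Gp_\<kappa>[of "rep U"] by simp
      then show False unfolding dgen_False_odd using \<nu>_even by blast
    qed
    ultimately show ?case unfolding TP Hp_simps by (simp add: D.T_def basis_elt_def)
  qed
  have surj: "\<exists>f\<in>carrier Hp. \<exists>g\<in>carrier Hp. r = f \<oplus>\<^bsub>Ht\<^esub> a \<otimes>\<^bsub>Ht\<^esub> g" if "r \<in> carrier Ht" for r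
    using that
  proof (induction r rule: D.carrier_induct)
    case zero
    have "\<zero>\<^bsub>Ht\<^esub> = \<zero>\<^bsub>Ht\<^esub> \<oplus>\<^bsub>Ht\<^esub> a \<otimes>\<^bsub>Ht\<^esub> \<zero>\<^bsub>Ht\<^esub>" using a by simp
    then show ?case using DP.R.zero_closed unfolding Hp_simps(2) by blast
  next
    case (add k y r)
    then obtain f g where fg: "f \<in> carrier Hp" "g \<in> carrier Hp" "r = f \<oplus>\<^bsub>Ht\<^esub> a \<otimes>\<^bsub>Ht\<^esub> g" by blast
    note fgt = Hp_sub[OF fg(1)] Hp_sub[OF fg(2)]
    show ?case
    proof (cases "even (fst (\<iota>\<^sub>t y))")
      case True
      then obtain x where x: "y = \<nu> x" using \<nu>_ex by blast
      have "k \<odot>\<^bsub>Ht\<^esub> D.T y \<oplus>\<^bsub>Ht\<^esub> r = (k \<odot>\<^bsub>Hp\<^esub> DP.T x \<oplus>\<^bsub>Hp\<^esub> f) \<oplus>\<^bsub>Ht\<^esub> a \<otimes>\<^bsub>Ht\<^esub> g"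
        unfolding fg(3) x TP Hp_simps(3,4)[symmetric] using fgt a by (simp add: D.smult_closed D.R.a_assoc)
      moreover have "k \<odot>\<^bsub>Hp\<^esub> DP.T x \<oplus>\<^bsub>Hp\<^esub> f \<in> carrier Hp" using fg(1) by (simp add: DP.smult_closed)
      ultimately show ?thesis using fg(2) by blast
    next
      case False
      then have "even (fst (\<iota>\<^sub>t (dgen False \<otimes>\<^bsub>D_inf\<^esub> y)))" unfolding dgen_False_odd .
      then obtain x where x: "dgen False \<otimes>\<^bsub>D_inf\<^esub> y = \<nu> x" using \<nu>_ex by blast
      \<comment> \<open>An odd basis element is \<open>a\<close> times an even one, namely its own
        product with \<open>a\<close>, since \<open>a\<close> is an involution.\<close>
      have y: "D.T y = a \<otimes>\<^bsub>Ht\<^esub> D.T (\<nu> x)"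
        unfolding x[symmetric] aT(1)[symmetric] by (rule aaf[symmetric]) simp
      have "k \<odot>\<^bsub>Ht\<^esub> D.T y \<oplus>\<^bsub>Ht\<^esub> r = f \<oplus>\<^bsub>Ht\<^esub> a \<otimes>\<^bsub>Ht\<^esub> (k \<odot>\<^bsub>Hp\<^esub> DP.T x \<oplus>\<^bsub>Hp\<^esub> g)"
        unfolding fg(3) y TP Hp_simps(3,4)[symmetric] using fgt a
        by (simp add: D.smult_closed D.R.r_distr D.smult_mult_right D.R.a_ac)
      moreover have "k \<odot>\<^bsub>Hp\<^esub> DP.T x \<oplus>\<^bsub>Hp\<^esub> g \<in> carrier Hp" using fg(2) by (simp add: DP.smult_closed)
      ultimately show ?thesis using fg(1) by blast
    qed
  qed
  have uniq: "f = f' \<and> g = g'"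
    if H: "f \<in> carrier Hp" "g \<in> carrier Hp" "f' \<in> carrier Hp" "g' \<in> carrier Hp"
      and eq: "f \<oplus>\<^bsub>Ht\<^esub> a \<otimes>\<^bsub>Ht\<^esub> g = f' \<oplus>\<^bsub>Ht\<^esub> a \<otimes>\<^bsub>Ht\<^esub> g'" for f g f' g'
  proof -
    note t = Hp_sub[OF H(1)] Hp_sub[OF H(2)] Hp_sub[OF H(3)] Hp_sub[OF H(4)]
    have f: "f = f'"
    proof
      fix U
      show "f U = f' U"
      proof (cases "U \<in> dcosets Gplus B")
        case True
        then show ?thesis using fun_cong[OF eq, of U] odd[OF H(2) True] odd[OF H(4) True] by (simp add: D.add_eq)
      next
        case False
        then show ?thesis using fin_supp_outside[of f "dcosets Gplus B"] fin_supp_outside[of f' "dcosets Gplus B"] H(1,3)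
          by (simp add: DP.carrier_eq)
      qed
    qed
    then have "a \<otimes>\<^bsub>Ht\<^esub> g = a \<otimes>\<^bsub>Ht\<^esub> g'" using eq t a by simp
    then have "a \<otimes>\<^bsub>Ht\<^esub> (a \<otimes>\<^bsub>Ht\<^esub> g) = a \<otimes>\<^bsub>Ht\<^esub> (a \<otimes>\<^bsub>Ht\<^esub> g')" by simp
    then show ?thesis using f t by (simp only: aaf)
  qed
  define act where "act \<omega> f = (if \<omega> = 0 then f else a \<otimes>\<^bsub>Ht\<^esub> f \<otimes>\<^bsub>Ht\<^esub> a)" for \<omega> :: int and f
  have act: "act 0 f = f" "act 1 f = a \<otimes>\<^bsub>Ht\<^esub> f \<otimes>\<^bsub>Ht\<^esub> a" for f by (simp_all add: act_def)
  note tt = twisted_tensor_Z2[OF D.is_ring DP.is_ring Hp_sub Hp_mult[symmetric] Hp_simps(3)[symmetric]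
      Hp_simps(1)[symmetric] Hp_simps(2)[symmetric] a aa conj surj uniq act]
  have "act 1 (Delta G B w) = Delta G B (bar w)" if w: "w \<in> carrier W" for w
  proof -
    obtain x where x: "w = \<mu>\<^sub>p x" using W_cases[OF w] by blast
    have "act 1 (D.T (\<nu> x)) = D.T (\<nu> (swap x))" unfolding act aT swap_\<nu> ..
    then show ?thesis unfolding x bar' Delta_p by (simp only: D.T_def \<beta>\<^sub>t_\<nu>)
  qed
  then show "\<exists>act. ring_action (integer_mod_group 2) (Hp :: (int, _) module) act \<and>
      (\<forall>w\<in>carrier W. act 1 (Delta G B w) = Delta G B (bar w)) \<and>
      twisted_tensor (integer_mod_group 2) (Hp :: (int, _) module) act \<simeq> (Ht :: (int, _) module)"
    using tt by blast
qed

text \<open>The dihedral structure of \<open>Ht\<close> uses the letters for \<open>s\<close> and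
  \<open>i\<close>, with \<open>i i = 1\<close> as the quadratic relation of parameter 1. The letter
  for \<open>t\<close> is eliminated by the last relation; its own quadratic relation evaluates to
  zero because it does so in \<open>Hp\<close>.\<close>

lemma presentation_t:
  fixes q \<Delta>
  assumes \<Delta>: "\<Delta> = (Delta G B :: 'g set \<Rightarrow> 'g set \<Rightarrow> int)"
    and q: "q = (\<lambda>r. R_num Gplus B (B <#> r <#> B))"
    and s: "s = \<mu>\<^sub>p (dgen True)" and t: "t = \<mu>\<^sub>p (dgen False)"
    and L: "L = {Gen_s, Gen_t, Gen_i}" and F: "F = free_ring L"
  shows "\<Delta> (i <# T) \<in> Units (Ht :: (int, _) module)"
    and "inv\<^bsub>(Ht :: (int, _) module)\<^esub> (\<Delta> (i <# T)) = \<Delta> (i <# T)"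
    and "ring_presentation (Ht :: (int, _) module) L (\<lambda>x. case x of Gen_s \<Rightarrow> \<Delta> s | Gen_t \<Rightarrow> \<Delta> t | Gen_i \<Rightarrow> \<Delta> (i <# T))
    {quadratic_rel F (q s) (letter Gen_s), quadratic_rel F (q t) (letter Gen_t),
     letter Gen_i \<otimes>\<^bsub>F\<^esub> letter Gen_i \<ominus>\<^bsub>F\<^esub> \<one>\<^bsub>F\<^esub>,
     letter Gen_i \<otimes>\<^bsub>F\<^esub> letter Gen_s \<otimes>\<^bsub>F\<^esub> letter Gen_i \<ominus>\<^bsub>F\<^esub> letter Gen_t}"
    (is "ring_presentation _ L ?gen ?rels")
proof -
  interpret D: dihedral_algebra "Ht :: (int, _) module" "dcosets G B" Q.coeff B Q.\<beta> Q.q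
    by (rule Q.hecke_dihedral_algebra)
  interpret DP: dihedral_algebra "Hp :: (int, _) module" "dcosets Gplus B" P.coeff B P.\<beta> P.q
    by (rule P.hecke_dihedral_algebra)
  interpret F: fs_algebra F "lists L" "\<lambda>xs ys. basis_elt (xs @ ys)" "[]"
    unfolding F by (rule free_ring_fs_algebra)
  have Di: "\<Delta> (i <# T) = D.T (dgen False)" by (simp add: \<Delta> iT Delta_t D.T_def)
  have Ds: "\<Delta> s = D.T (dgen True)"
    using \<beta>\<^sub>t_\<nu>[of "dgen True"] by (simp add: \<Delta> s Delta_p D.T_def \<nu>(3))
  have Dt: "\<Delta> t = DP.T (dgen False)" by (simp add: \<Delta> t Delta_p DP.T_def)
  have Dt': "\<Delta> t = D.T (\<nu> (dgen False))" by (simp add: \<Delta> t Delta_p D.T_def \<beta>\<^sub>t_\<nu>)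
  note inv = D.T_mult_involution[OF q_t(1)]
  have ii: "\<Delta> (i <# T) \<otimes>\<^bsub>Ht\<^esub> \<Delta> (i <# T) = \<one>\<^bsub>Ht\<^esub>" unfolding Di inv(1) by (simp add: D.T_one)
  have isi: "\<Delta> (i <# T) \<otimes>\<^bsub>Ht\<^esub> \<Delta> s \<otimes>\<^bsub>Ht\<^esub> \<Delta> (i <# T) = \<Delta> t"
    unfolding Di Ds Dt' inv using swap_\<nu>[of "dgen True"] by (simp add: \<nu>(3) swap_dgen)
  have ic: "\<Delta> (i <# T) \<in> carrier (Ht :: (int, _) module)" by (simp add: Di)
  show "\<Delta> (i <# T) \<in> Units (Ht :: (int, _) module)" using ic ii by (auto simp: Units_def)
  show "inv\<^bsub>(Ht :: (int, _) module)\<^esub> (\<Delta> (i <# T)) = \<Delta> (i <# T)" by (rule D.R.inv_char[OF ic ic ii ii])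
  define l where "l x = (if x then Gen_s else Gen_i)" for x
  have l: "l x \<in> L" "?gen (l x) = D.T (dgen x)" for x
    by (cases x; simp add: l_def L Di Ds)+
  have gen: "?gen ` L \<subseteq> carrier Ht" by (auto simp: L Di Ds Dt')
  have letters [simp]: "letter x \<in> carrier F" if "x \<in> L" for x unfolding F by (rule letter_in_free_ring[OF that])
  have Ls [simp]: "Gen_s \<in> L" "Gen_t \<in> L" "Gen_i \<in> L" by (simp_all add: L)
  note eq = eval_quadratic_rel[OF D.fs_algebra_axioms gen, folded F]
  have relc: "?rels \<subseteq> carrier F" using eq(2) by simp
  note ev = D.R.free_ring_eval_hom[OF gen, folded F]
  interpret ev: ring_hom_ring F Ht "free_ring_eval Ht ?gen"
    by (rule ring_hom_ringI2[OF F.is_ring D.is_ring ev(1)])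
  have qs: "q s = Q.q True" "q t = P.q False" by (simp_all add: q s t q_p q_t)
  have in_rels: "f \<in> Idl\<^bsub>F\<^esub> ?rels" if "f \<in> ?rels" for f using F.R.genideal_self[OF relc] that by blast
  show "ring_presentation (Ht :: (int, _) module) L ?gen ?rels"
  proof (rule dihedral_presentation[OF Q.hecke_dihedral_algebra gen relc[unfolded F], where l = l, folded F])
    have 1: "free_ring_eval Ht ?gen (quadratic_rel F (q s) (letter Gen_s)) = \<zero>\<^bsub>Ht\<^esub>"
      using eq(1)[OF Ls(1), of "q s"] D.T_quadratic[of True] by (simp only: gen_letter.case Ds qs of_nat_id id_apply)
    have "\<Delta> t \<otimes>\<^bsub>Ht\<^esub> \<Delta> t = int (q t) \<odot>\<^bsub>Ht\<^esub> \<one>\<^bsub>Ht\<^esub> \<oplus>\<^bsub>Ht\<^esub> (int (q t) - 1) \<odot>\<^bsub>Ht\<^esub> \<Delta> t"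
      unfolding Dt qs Hp_simps using Hp_mult[OF DP.T_closed DP.T_closed] DP.T_square[of False] by simp
    then have 2: "free_ring_eval Ht ?gen (quadratic_rel F (q t) (letter Gen_t)) = \<zero>\<^bsub>Ht\<^esub>"
      unfolding eq(1)[OF Ls(2)] gen_letter.case
      by (simp add: D.smult_closed D.R.r_neg a_minus_def Dt')
    have 3: "free_ring_eval Ht ?gen (letter Gen_i \<otimes>\<^bsub>F\<^esub> letter Gen_i \<ominus>\<^bsub>F\<^esub> \<one>\<^bsub>F\<^esub>) = \<zero>\<^bsub>Ht\<^esub>"
      by (simp add: a_minus_def ev(2) ii D.R.r_neg)
    have 4: "free_ring_eval Ht ?gen (letter Gen_i \<otimes>\<^bsub>F\<^esub> letter Gen_s \<otimes>\<^bsub>F\<^esub> letter Gen_i \<ominus>\<^bsub>F\<^esub> letter Gen_t) = \<zero>\<^bsub>Ht\<^esub>"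
      using D.T_closed by (simp add: a_minus_def ev(2) isi D.R.r_neg Dt')
    show "free_ring_eval Ht ?gen f = \<zero>\<^bsub>Ht\<^esub>" if "f \<in> ?rels" for f
      using that 1 2 3 4 by blast
    show "quadratic_rel F (Q.q x) (letter (l x)) \<in> Idl\<^bsub>F\<^esub> ?rels" for x
    proof (cases x)
      case True
      then show ?thesis by (intro in_rels) (simp add: l_def qs)
    next
      case False
      \<comment> \<open>With parameter 1 the quadratic relation collapses to the relation for the
        square of \<open>Gen_i\<close>.\<close>
      have "(of_nat 1 :: int) \<odot>\<^bsub>F\<^esub> \<one>\<^bsub>F\<^esub> \<oplus>\<^bsub>F\<^esub> (of_nat 1 - 1) \<odot>\<^bsub>F\<^esub> letter Gen_i = \<one>\<^bsub>F\<^esub>"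
        by (simp add: F.smult_eq F.add_eq)
      then have "quadratic_rel F (Q.q x) (letter (l x)) = letter Gen_i \<otimes>\<^bsub>F\<^esub> letter Gen_i \<ominus>\<^bsub>F\<^esub> \<one>\<^bsub>F\<^esub>"
        using False by (simp only: quadratic_rel_def q_t l_def if_False)
      then show ?thesis by (intro in_rels) simp
    qed
    fix y assume y: "y \<in> L"
    show "\<exists>ws. ?gen y = word_prod Ht (map (\<lambda>x. ?gen (l x)) ws) \<and>
        letter y \<ominus>\<^bsub>F\<^esub> word_prod F (map (\<lambda>x. letter (l x)) ws) \<in> Idl\<^bsub>F\<^esub> ?rels"
    proof (cases "y = Gen_t")
      case False
      then obtain x where x: "y = l x" using y by (auto simp: L l_def intro: that[of True] that[of False])
      have "?gen y \<in> carrier Ht" using gen y by blast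
      from letter_in_ideal[OF D.is_ring relc[unfolded F] y, of ?gen, folded F, OF this]
      show ?thesis by (intro exI[of _ "[x]"]) (simp only: x list.map)
    next
      case True
      \<comment> \<open>The word \<open>i s i\<close> replaces the letter for \<open>t\<close>; the
        relation in the list has the opposite sign, hence the negation that follows.\<close>
      let ?p = "letter Gen_i \<otimes>\<^bsub>F\<^esub> letter Gen_s \<otimes>\<^bsub>F\<^esub> letter Gen_i"
      have p: "?p \<in> carrier F" by simp
      have "\<ominus>\<^bsub>F\<^esub> (?p \<ominus>\<^bsub>F\<^esub> letter Gen_t) \<in> Idl\<^bsub>F\<^esub> ?rels"
        by (rule additive_subgroup.a_inv_closed[OF ideal.axioms(1)[OF F.R.genideal_ideal[OF relc]] in_rels]) simp
      moreover have "\<ominus>\<^bsub>F\<^esub> (?p \<ominus>\<^bsub>F\<^esub> letter Gen_t) = letter Gen_t \<ominus>\<^bsub>F\<^esub> ?p"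
        using p by (simp add: a_minus_def F.R.minus_add F.R.a_comm)
      moreover have word: "word_prod F (map (\<lambda>x. letter (l x)) [False, True, False]) = ?p"
        by (simp add: l_def F.R.m_assoc)
      ultimately have "letter y \<ominus>\<^bsub>F\<^esub> word_prod F (map (\<lambda>x. letter (l x)) [False, True, False]) \<in> Idl\<^bsub>F\<^esub> ?rels"
        unfolding True word by metis
      moreover have "?gen y = word_prod Ht (map (\<lambda>x. ?gen (l x)) [False, True, False])"
        using isi by (simp add: True l_def Di Ds D.R.m_assoc)
      ultimately show ?thesis by blast
    qed
  qed (rule l)+
qed

end

end

section \<open>Reparametrising the geodesic\<close>

lemma line_edges_reverse: "line_edges (\<lambda>k. \<gamma> (1 - k)) = line_edges \<gamma>"
proof -
  have "1 - (k + 1) = - k" "- k + 1 = 1 - k" for k :: int by simp_all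
  then have "line_edges (\<lambda>k. \<gamma> (1 - k)) = range (\<lambda>k. {\<gamma> (- k), \<gamma> (- k + 1)})"
    by (simp only: line_edges_def insert_commute)
  also have "\<dots> = (\<lambda>k. {\<gamma> k, \<gamma> (k + 1)}) ` range uminus" by (simp only: image_image)
  finally show ?thesis by (simp only: surj_uminus line_edges_def)
qed

lemma range_reverse: "range (\<lambda>k::int. \<gamma> (1 - k)) = range \<gamma>"
proof -
  have "\<gamma> k \<in> range (\<lambda>k. \<gamma> (1 - k))" for k by (rule image_eqI[of _ _ "1 - k"]) simp_all
  then show ?thesis by auto
qed

lemma (in tree_line) tree_line_shift: "tree_line V Ve Vo E (\<lambda>j. \<gamma> (k + j))"
proof
  show "inj (\<lambda>j. \<gamma> (k + j))" by (rule injI) simp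
  show "(\<gamma> (k + j), \<gamma> (k + (j + 1))) \<in> adj" for j using adj_\<gamma>[of "k + j"] by (simp add: algebra_simps)
qed

lemma range_shift: "range (\<lambda>j::int. \<gamma> (k + j)) = range \<gamma>"
proof -
  have "\<gamma> j \<in> range (\<lambda>j. \<gamma> (k + j))" for j by (rule image_eqI[of _ _ "j - k"]) simp_all
  then show ?thesis by auto
qed

lemma line_edges_shift: "line_edges (\<lambda>j. \<gamma> (k + j)) = line_edges \<gamma>"
  using range_shift[of "\<lambda>j. {\<gamma> j, \<gamma> (j + 1)}" k] by (simp add: line_edges_def add.assoc)

theorem theorem4p4:
  fixes V Ve Vo VA e :: "'v set"
    and E EA :: "'v set set"
    and G Gplus :: "('g, 'm) monoid_scheme"
    and \<phi> :: "'g \<Rightarrow> 'v \<Rightarrow> 'v"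
    and Gp B Np N Tp T :: "'g set"
    and W Wt :: "'g set monoid"
    and HCp HC :: "(complex, 'g set \<Rightarrow> complex) module"
    and HZp HZ :: "(int, 'g set \<Rightarrow> int) module"
  assumes tree: "tree V E" and lf: "locally_finite V E"
    and types: "bipartition V E Ve Vo"
    and group: "group G" and action: "\<phi> \<in> hom G (graph_aut V E)"
    and Gp: "Gp = {g \<in> carrier G. type_preserving Ve Vo (\<phi> g)}"
    and Gplus: "Gplus = G\<lparr>carrier := Gp\<rparr>"
    and st: "strongly_transitive V E \<phi> Gp"
    and e: "e \<in> E"
    and B: "B = fixator \<phi> (carrier G) e"
    and A: "geodesic V E VA EA" and eA: "e \<in> EA"
    and Np: "Np = stabilizer_of \<phi> Gp VA EA" and Tp: "Tp = fixator \<phi> Gp VA"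
    and N: "N = stabilizer_of \<phi> (carrier G) VA EA" and T: "T = fixator \<phi> (carrier G) VA"
    and W: "W = (G\<lparr>carrier := Np\<rparr>) Mod Tp" and Wt: "Wt = (G\<lparr>carrier := N\<rparr>) Mod T"
    and HCp: "HCp = hecke_algebra Gplus B" and HC: "HC = hecke_algebra G B"
    and HZp: "HZp = hecke_algebra Gplus B" and HZ: "HZ = hecke_algebra G B"
  shows
    "hecke_pair G B \<and> hecke_pair Gplus B \<and>
     (carrier G \<noteq> Gp \<longrightarrow> (\<exists>i\<in>carrier G. inverts_edge \<phi> i e \<and> i \<in> N)) \<and>

     \<comment> \<open>(1)\<close>
     algebra_isomorphic HC (monoid_algebra D_inf) \<and>
     algebra_isomorphic HCp (monoid_algebra D_inf) \<and>

     \<comment> \<open>(2) parametrization of the canonical bases by automorphisms\<close>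
     bij_betw (\<lambda>f. B <#>\<^bsub>G\<^esub> {n \<in> Np. restrict (\<phi> n) VA = f} <#>\<^bsub>G\<^esub> B)
       (carrier (bip_aut VA EA Ve Vo)) (dcosets Gplus B) \<and>
     (carrier G \<noteq> Gp \<longrightarrow>
        bij_betw (\<lambda>f. B <#>\<^bsub>G\<^esub> {n \<in> N. restrict (\<phi> n) VA = f} <#>\<^bsub>G\<^esub> B)
          (carrier (graph_aut VA EA)) (dcosets G B)) \<and>

     \<comment> \<open>(2)(a)(i)\<close>
     (\<forall>f\<in>carrier (bip_aut VA EA Ve Vo). \<exists>n\<in>Np. \<forall>v\<in>VA. \<phi> n v = f v) \<and>
     Tp \<lhd> (G\<lparr>carrier := Np\<rparr>) \<and>
     (\<exists>h\<in>iso W (bip_aut VA EA Ve Vo). \<forall>n\<in>Np. h (Tp #>\<^bsub>G\<^esub> n) = restrict (\<phi> n) VA) \<and>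
     bip_aut VA EA Ve Vo \<cong> D_inf \<and>

     \<comment> \<open>(2)(a)(ii)\<close>
     Tp = Np \<inter> B \<and>
     (\<forall>w\<in>carrier W. \<forall>n\<in>w.
        n <#\<^bsub>G\<^esub> B = w <#>\<^bsub>G\<^esub> B \<and> B #>\<^bsub>G\<^esub> n = B <#>\<^bsub>G\<^esub> w \<and>
        dcoset G B n = B <#>\<^bsub>G\<^esub> w <#>\<^bsub>G\<^esub> B) \<and>

     \<comment> \<open>(2)(a)(iii)\<close>
     Gp = (\<Union>w\<in>carrier W. B <#>\<^bsub>G\<^esub> w <#>\<^bsub>G\<^esub> B) \<and>
     disjoint_family_on (\<lambda>w. B <#>\<^bsub>G\<^esub> w <#>\<^bsub>G\<^esub> B) (carrier W) \<and>

     \<comment> \<open>(2)(b)\<close>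
     (carrier G \<noteq> Gp \<longrightarrow>
        \<comment> \<open>(i)\<close>
        (\<forall>f\<in>carrier (graph_aut VA EA). \<exists>n\<in>N. \<forall>v\<in>VA. \<phi> n v = f v) \<and>
        T \<lhd> (G\<lparr>carrier := N\<rparr>) \<and> T = Tp \<and>
        (\<exists>h\<in>iso Wt (graph_aut VA EA). \<forall>n\<in>N. h (T #>\<^bsub>G\<^esub> n) = restrict (\<phi> n) VA) \<and>
        Np \<lhd> (G\<lparr>carrier := N\<rparr>) \<and>
        (G\<lparr>carrier := N\<rparr>) Mod Np \<cong> integer_mod_group 2 \<and>
        carrier W \<lhd> Wt \<and>
        (\<exists>p\<in>hom Wt ((G\<lparr>carrier := N\<rparr>) Mod Np).
           (\<forall>n\<in>N. p (T #>\<^bsub>G\<^esub> n) = Np #>\<^bsub>G\<^esub> n) \<and>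
           p ` carrier Wt = carrier ((G\<lparr>carrier := N\<rparr>) Mod Np) \<and>
           kernel Wt ((G\<lparr>carrier := N\<rparr>) Mod Np) p = carrier W \<and>
           (\<exists>\<sigma>\<in>hom ((G\<lparr>carrier := N\<rparr>) Mod Np) Wt.
              \<forall>x\<in>carrier ((G\<lparr>carrier := N\<rparr>) Mod Np). p (\<sigma> x) = x)) \<and>
        Wt \<cong> D_inf \<and>
        \<comment> \<open>(ii)\<close>
        T \<subseteq> B \<and>
        (\<forall>w\<in>carrier Wt. \<forall>n\<in>w.
           n <#\<^bsub>G\<^esub> B = w <#>\<^bsub>G\<^esub> B \<and> B #>\<^bsub>G\<^esub> n = B <#>\<^bsub>G\<^esub> w \<and>
           dcoset G B n = B <#>\<^bsub>G\<^esub> w <#>\<^bsub>G\<^esub> B) \<and>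
        \<comment> \<open>(iii)\<close>
        carrier G = (\<Union>w\<in>carrier Wt. B <#>\<^bsub>G\<^esub> w <#>\<^bsub>G\<^esub> B) \<and>
        disjoint_family_on (\<lambda>w. B <#>\<^bsub>G\<^esub> w <#>\<^bsub>G\<^esub> B) (carrier Wt)) \<and>

     \<comment> \<open>each edge of the geodesic adjacent to e is the image of e under a unique element of W\<close>
     card {a \<in> EA. a \<noteq> e \<and> a \<inter> e \<noteq> {}} = 2 \<and>
     (\<forall>a\<in>EA. a \<noteq> e \<and> a \<inter> e \<noteq> {} \<longrightarrow> (\<exists>!w. w \<in> carrier W \<and> (\<forall>n\<in>w. \<phi> n ` e = a))) \<and>

     \<comment> \<open>s and t map e to its two neighbouring edges a and b\<close>
     (\<forall>s\<in>carrier W. \<forall>t\<in>carrier W. \<forall>a b.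
        {c \<in> EA. c \<noteq> e \<and> c \<inter> e \<noteq> {}} = {a, b} \<and> a \<noteq> b \<and>
        (\<forall>n\<in>s. \<phi> n ` e = a) \<and> (\<forall>n\<in>t. \<phi> n ` e = b) \<longrightarrow>

        generate W {s, t} = carrier W \<and> s \<noteq> \<one>\<^bsub>W\<^esub> \<and> t \<noteq> \<one>\<^bsub>W\<^esub> \<and>
        s \<otimes>\<^bsub>W\<^esub> s = \<one>\<^bsub>W\<^esub> \<and> t \<otimes>\<^bsub>W\<^esub> t = \<one>\<^bsub>W\<^esub> \<and>
        (\<forall>w\<in>carrier W. \<exists>!ws. reduced_word W {s, t} w ws) \<and>
        (\<forall>w\<in>carrier W. \<forall>ws. reduced_word W {s, t} w ws \<longrightarrow> distinct_adj ws) \<and>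

        \<comment> \<open>(2), generators\<close>
        generates_algebra HCp {\<one>\<^bsub>HCp\<^esub>, Delta G B s, Delta G B t} \<and>
        (\<forall>w\<in>carrier W. \<forall>ws. reduced_word W {s, t} w ws \<longrightarrow>
           Delta G B w = word_prod HCp (map (Delta G B) ws) \<and>
           Delta G B w = word_prod HC (map (Delta G B) ws) \<and>
           R_num Gplus B (B <#>\<^bsub>G\<^esub> w <#>\<^bsub>G\<^esub> B) =
             (\<Prod>r\<leftarrow>ws. R_num Gplus B (B <#>\<^bsub>G\<^esub> r <#>\<^bsub>G\<^esub> B)) \<and>
           R_num G B (B <#>\<^bsub>G\<^esub> w <#>\<^bsub>G\<^esub> B) =
             (\<Prod>r\<leftarrow>ws. R_num G B (B <#>\<^bsub>G\<^esub> r <#>\<^bsub>G\<^esub> B))) \<and>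

        \<comment> \<open>(3)(a)\<close>
        (let q = (\<lambda>r. R_num Gplus B (B <#>\<^bsub>G\<^esub> r <#>\<^bsub>G\<^esub> B));
             \<Delta> = Delta G B :: 'g set \<Rightarrow> 'g set \<Rightarrow> int;
             F = free_ring {Gen_s, Gen_t}
         in
         (\<forall>r\<in>{s, t}. \<forall>w\<in>carrier W.
            (begins_with W {s, t} w r \<longrightarrow>
               \<Delta> r \<otimes>\<^bsub>HZp\<^esub> \<Delta> w =
                 int (q r) \<odot>\<^bsub>HZp\<^esub> \<Delta> (r \<otimes>\<^bsub>W\<^esub> w) \<oplus>\<^bsub>HZp\<^esub> (int (q r) - 1) \<odot>\<^bsub>HZp\<^esub> \<Delta> w) \<and>
            (ends_with W {s, t} w r \<longrightarrow>
               \<Delta> w \<otimes>\<^bsub>HZp\<^esub> \<Delta> r =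
                 int (q r) \<odot>\<^bsub>HZp\<^esub> \<Delta> (w \<otimes>\<^bsub>W\<^esub> r) \<oplus>\<^bsub>HZp\<^esub> (int (q r) - 1) \<odot>\<^bsub>HZp\<^esub> \<Delta> w) \<and>
            (\<not> begins_with W {s, t} w r \<longrightarrow> \<Delta> r \<otimes>\<^bsub>HZp\<^esub> \<Delta> w = \<Delta> (r \<otimes>\<^bsub>W\<^esub> w)) \<and>
            (\<not> ends_with W {s, t} w r \<longrightarrow> \<Delta> w \<otimes>\<^bsub>HZp\<^esub> \<Delta> r = \<Delta> (w \<otimes>\<^bsub>W\<^esub> r))) \<and>
         ring_presentation HZp {Gen_s, Gen_t}
           (\<lambda>x. case x of Gen_s \<Rightarrow> \<Delta> s | Gen_t \<Rightarrow> \<Delta> t)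
           {quadratic_rel F (q s) (letter Gen_s), quadratic_rel F (q t) (letter Gen_t)}) \<and>

        \<comment> \<open>(2) and (3)(b), the case of an edge inversion i\<close>
        (carrier G \<noteq> Gp \<longrightarrow>
          (\<forall>i\<in>carrier G. inverts_edge \<phi> i e \<and> i \<in> N \<longrightarrow>
            dcoset G B i = B #>\<^bsub>G\<^esub> i \<and> dcoset G B i = i <#\<^bsub>G\<^esub> B \<and>
            (let iT = i <#\<^bsub>G\<^esub> T in
             iT \<in> carrier Wt \<and>
             (\<forall>n\<in>iT. \<phi> n ` (e \<inter> Ve) = e \<inter> Vo \<and> \<phi> n ` (e \<inter> Vo) = e \<inter> Ve) \<and>
             iT \<otimes>\<^bsub>Wt\<^esub> s \<otimes>\<^bsub>Wt\<^esub> inv\<^bsub>Wt\<^esub> iT = t \<and>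
             generates_algebra HC {\<one>\<^bsub>HC\<^esub>, Delta G B iT, Delta G B s} \<and>
             (\<forall>w\<in>carrier Wt.
                Delta G B iT \<otimes>\<^bsub>HC\<^esub> Delta G B w = Delta G B (iT \<otimes>\<^bsub>Wt\<^esub> w)) \<and>

             \<comment> \<open>(3)(b)\<close>
             (\<exists>bar\<in>iso W W. bar s = t \<and> bar t = s) \<and>
             (\<forall>bar\<in>iso W W. bar s = t \<and> bar t = s \<longrightarrow>
                (\<forall>w\<in>carrier W. bar w = iT \<otimes>\<^bsub>Wt\<^esub> w \<otimes>\<^bsub>Wt\<^esub> inv\<^bsub>Wt\<^esub> iT) \<and>
                (\<exists>act. ring_action (integer_mod_group 2) HZp act \<and>
                   (\<forall>w\<in>carrier W. act 1 (Delta G B w) = Delta G B (bar w)) \<and>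
                   twisted_tensor (integer_mod_group 2) HZp act \<simeq> HZ)) \<and>
             (let q = (\<lambda>r. R_num Gplus B (B <#>\<^bsub>G\<^esub> r <#>\<^bsub>G\<^esub> B));
                  \<Delta> = Delta G B :: 'g set \<Rightarrow> 'g set \<Rightarrow> int;
                  F = free_ring {Gen_s, Gen_t, Gen_i}
              in
              \<comment> \<open>the inverse of Delta_i, so that Gen_i stands for it in the last relation below\<close>
              \<Delta> iT \<in> Units HZ \<and> inv\<^bsub>HZ\<^esub> (\<Delta> iT) = \<Delta> iT \<and>
              ring_presentation HZ {Gen_s, Gen_t, Gen_i}
                (\<lambda>x. case x of Gen_s \<Rightarrow> \<Delta> s | Gen_t \<Rightarrow> \<Delta> t | Gen_i \<Rightarrow> \<Delta> iT)
                {quadratic_rel F (q s) (letter Gen_s), quadratic_rel F (q t) (letter Gen_t),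
                 letter Gen_i \<otimes>\<^bsub>F\<^esub> letter Gen_i \<ominus>\<^bsub>F\<^esub> \<one>\<^bsub>F\<^esub>,
                 letter Gen_i \<otimes>\<^bsub>F\<^esub> letter Gen_s \<otimes>\<^bsub>F\<^esub> letter Gen_i \<ominus>\<^bsub>F\<^esub> letter Gen_t}
             )))))"
proof -
  have bt: "bip_tree V Ve Vo E" by (rule bip_tree.intro[OF tree types])
  have action_on: "tree_action V Ve Vo E \<delta> G \<phi>" if "tree_line V Ve Vo E \<delta>" for \<delta>
    using that group lf action st unfolding Gp by (intro tree_action.intro tree_action_axioms.intro)
  obtain \<gamma>\<^sub>0 where \<gamma>\<^sub>0: "tree_line V Ve Vo E \<gamma>\<^sub>0" "VA = range \<gamma>\<^sub>0" "EA = line_edges \<gamma>\<^sub>0"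
    using A unfolding bip_tree_geodesic_iff[OF bt] by blast
  obtain k where k: "e = {\<gamma>\<^sub>0 k, \<gamma>\<^sub>0 (k + 1)}" using eA unfolding \<gamma>\<^sub>0(3) by (auto simp: line_edges_def)
  \<comment> \<open>The shift gives the distinguished edge the ends \<open>\<gamma> 0\<close> and
    \<open>\<gamma> 1\<close>.\<close>
  define \<gamma> where "\<gamma> j = \<gamma>\<^sub>0 (k + j)" for j
  have \<gamma>: "tree_line V Ve Vo E \<gamma>" "VA = range \<gamma>" "EA = line_edges \<gamma>" "e = {\<gamma> 0, \<gamma> 1}"
    unfolding \<gamma>_def using tree_line.tree_line_shift[OF \<gamma>\<^sub>0(1)] \<gamma>\<^sub>0(2,3) k
    by (simp_all add: range_shift line_edges_shift)
  \<comment> \<open>Stated for every admissible parametrisation, because the claims about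
    \<open>s\<close> and \<open>t\<close> may call for the reversed one.\<close>
  have sets: "e = tree_action.e \<delta>" "VA = tree_action.VA \<delta>" "EA = tree_action.EA \<delta>"
      "Gp = tree_action.Gp Ve Vo G \<phi>" "B = tree_action.B \<delta> G \<phi>" "N = tree_action.N \<delta> G \<phi>"
      "T = tree_action.T \<delta> G \<phi>" "Np = tree_action.Np Ve Vo \<delta> G \<phi>" "Tp = tree_action.T \<delta> G \<phi>"
    if \<delta>: "tree_line V Ve Vo E \<delta>" "VA = range \<delta>" "EA = line_edges \<delta>" "e = {\<delta> 0, \<delta> 1}" for \<delta>
  proof -
    interpret M: tree_action V Ve Vo E \<delta> G \<phi> by (rule action_on[OF \<delta>(1)])
    show 1: "e = M.e" "VA = M.VA" "EA = M.EA" using \<delta> by (simp_all add: M.e_def M.VA_def M.EA_def)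
    show 2: "Gp = M.Gp" by (simp add: Gp M.Gp_def)
    show "B = M.B" "N = M.N" "T = M.T" "Np = M.Np"
      by (simp_all add: B N T Np M.B_def M.N_def M.T_def M.Np_def 1[symmetric] 2[symmetric])
    show "Tp = M.T" unfolding Tp 1 2 by (rule M.Tp_eq)
  qed
  interpret L: tree_action V Ve Vo E \<gamma> G \<phi> by (rule action_on[OF \<gamma>(1)])
  note L = HCp HC HZp HZ W Wt Gplus sets[OF \<gamma>]
  show ?thesis
  proof (intro conjI, goal_cases)
    case 1
    show ?case unfolding L by (rule hecke.hecke_pair[OF L.hecke_G])
  next
    case 2
    show ?case unfolding L by (rule hecke.hecke_pair[OF L.hecke_Gplus])
  next
    case 3
    show ?case
    proof
      assume "carrier G \<noteq> Gp"
      then obtain i where i: "i \<in> L.N" "\<phi> i (\<gamma> 0) = \<gamma> 1" "\<phi> i (\<gamma> 1) = \<gamma> 0"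
        unfolding L using L.inversion_exists by blast
      moreover have "\<gamma> 0 \<noteq> \<gamma> 1" using L.inj_\<gamma> by (simp add: inj_eq)
      ultimately have "inverts_edge \<phi> i L.e" unfolding inverts_edge_def L.e_def by blast
      then show "\<exists>i\<in>carrier G. inverts_edge \<phi> i e \<and> i \<in> N"
        unfolding L using i(1) L.N_carrier by blast
    qed
  next
    case 4
    show ?case unfolding L by (rule L.Ht_group_algebra)
  next
    case 5
    show ?case unfolding L by (rule L.Hp_group_algebra)
  next
    case 6
    show ?case unfolding L by (rule L.param_bij_p)
  next
    case 7
    show ?case unfolding L using L.param_bij by blast
  next
    case 8
    show ?case unfolding L
    proof
      fix f assume "f \<in> carrier (bip_aut L.VA L.EA Ve Vo)"
      then obtain n where "n \<in> L.Np" "f = restrict (\<phi> n) L.VA" using L.restrict_surj_p by blast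
      then show "\<exists>n\<in>L.Np. \<forall>v\<in>L.VA. \<phi> n v = f v" by auto
    qed
  next
    case 9
    show ?case unfolding L by (rule L.T_normal_Np)
  next
    case 10
    show ?case unfolding L by (rule L.W_iso)
  next
    case 11
    show ?case unfolding L by (rule L.isos_D_inf(1))
  next
    case 12
    show ?case unfolding L by (rule L.T_eq')
  next
    case 13
    show ?case unfolding L by (rule L.W_products(1))
  next
    case 14
    show ?case unfolding L by (rule L.Bruhat_W(1))
  next
    case 15
    show ?case unfolding L by (rule L.Bruhat_W(2))
  next
    case 16
    show ?case
    proof (intro impI conjI, goal_cases)
      case 1
      then show ?case unfolding L
      proof (intro ballI)
        fix f assume "carrier G \<noteq> L.Gp" "f \<in> carrier (graph_aut L.VA L.EA)"
        then obtain n where "n \<in> L.N" "f = restrict (\<phi> n) L.VA" using L.restrict_surj by blast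
        then show "\<exists>n\<in>L.N. \<forall>v\<in>L.VA. \<phi> n v = f v" by auto
      qed
    next
      case 2
      show ?case unfolding L by (rule L.T_normal_N)
    next
      case 3
      show ?case unfolding L ..
    next
      case 4
      then show ?case unfolding L by (rule L.Wt_iso)
    next
      case 5
      show ?case unfolding L by (rule L.Np_normal_N)
    next
      case 6
      then show ?case unfolding L by (rule L.quotient_Z2)
    next
      case 7
      then show ?case unfolding L by (rule L.split_extension(2))
    next
      case 8
      then show ?case unfolding L by (rule L.split_extension(1))
    next
      case 9
      then show ?case unfolding L by (rule L.isos_D_inf(2))
    next
      case 10
      show ?case unfolding L using L.T_B by blast
    next
      case 11
      show ?case unfolding L by (rule L.W_products(2))
    next
      case 12
      show ?case unfolding L by (rule L.Bruhat_W(3))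
    next
      case 13
      show ?case unfolding L by (rule L.Bruhat_W(4))
    qed
  next
    case 17
    show ?case unfolding L by (rule L.card_neighbours)
  next
    case 18
    show ?case unfolding L using L.chamber_unique by blast
  next
    case 19
    show ?case
    proof (intro ballI allI impI, goal_cases)
      case st: (1 s t a b)
      \<comment> \<open>The statement leaves open at which end of \<open>e\<close> the edge
        \<open>a\<close> lies. Reversing the line if necessary puts it at \<open>\<delta> 1\<close>,
        so that \<open>s\<close> becomes the reflection in \<open>\<delta> 1\<close>.\<close>
      obtain \<delta> where \<delta>: "tree_line V Ve Vo E \<delta>" "VA = range \<delta>" "EA = line_edges \<delta>" "e = {\<delta> 0, \<delta> 1}"
        and ab: "a = {\<delta> 1, \<delta> 2}" "b = {\<delta> (-1), \<delta> 0}"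
      proof -
        have "{{\<gamma> 1, \<gamma> 2}, {\<gamma> (-1), \<gamma> 0}} = {a, b}" using L.neighbours st(3) unfolding L by simp
        then consider "a = {\<gamma> 1, \<gamma> 2}" "b = {\<gamma> (-1), \<gamma> 0}" | "a = {\<gamma> (-1), \<gamma> 0}" "b = {\<gamma> 1, \<gamma> 2}"
          by (auto simp only: doubleton_eq_iff)
        then show ?thesis
        proof cases
          case 1
          then show ?thesis by (rule that[OF \<gamma>])
        next
          case 2
          show ?thesis
            by (rule that[OF L.tree_line_reverse]) (use 2 \<gamma> in \<open>auto simp: range_reverse line_edges_reverse\<close>)
        qed
      qed
      interpret M: tree_action V Ve Vo E \<delta> G \<phi> by (rule action_on[OF \<delta>(1)])
      note M = HCp HC HZp HZ W Wt Gplus sets[OF \<delta>]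
      have s: "s = M.\<mu>\<^sub>p (dgen True)"
        using M.reflection_s[of s] st(1,3) unfolding M ab by (simp add: M.\<mu>\<^sub>p_def M.\<iota>\<^sub>p_def dgen_def)
      have t: "t = M.\<mu>\<^sub>p (dgen False)"
        using M.reflection_t[of t] st(2,3) unfolding M ab by (simp add: M.\<mu>\<^sub>p_def M.\<iota>\<^sub>p_def dgen_def)
      note words = dihedral_words[OF M.W_group M.\<mu>\<^sub>p_iso s t]
      show ?case
      proof (intro conjI, goal_cases)
        case 1 show ?case unfolding M by (rule words(1))
      next
        case 2 show ?case unfolding M by (rule words(2))
      next
        case 3 show ?case unfolding M by (rule words(3))
      next
        case 4 show ?case unfolding M by (rule words(4))
      next
        case 5 show ?case unfolding M by (rule words(5))
      next
        case 6 show ?case unfolding M by (rule words(6))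
      next
        case 7 show ?case unfolding M by (rule words(7))
      next
        case 8 show ?case unfolding M by (rule M.generates_p[OF s t])
      next
        case 9 show ?case unfolding M
          by (intro ballI allI impI conjI; rule M.word_p[OF s t]; assumption)
      next
        case 10
        show ?case unfolding Let_def M
        proof (intro conjI ballI impI, goal_cases)
          case (1 r w)
          show ?case by (rule M.mult_p(1)[OF s t refl refl 1])
        next
          case (2 r w)
          show ?case by (rule M.mult_p(2)[OF s t refl refl 2])
        next
          case (3 r w)
          show ?case by (rule M.mult_p(3)[OF s t refl refl 3])
        next
          case (4 r w)
          show ?case by (rule M.mult_p(4)[OF s t refl refl 4])
        next
          case 5
          show ?case by (rule M.presentation_p[OF refl refl s t])
        qed
      next
        case 11
        show ?case
        proof (intro impI ballI, goal_cases)
          case (1 i)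
          then have ne: "carrier G \<noteq> M.Gp" and iN: "i \<in> M.N" and "inverts_edge \<phi> i M.e" unfolding M by simp_all
          then have "\<phi> i (\<delta> 0) = \<delta> 1" "\<phi> i (\<delta> 1) = \<delta> 0"
            by (auto simp: inverts_edge_def M.e_def doubleton_eq_iff)
          note i = ne iN this
          note pres = M.presentation_t[OF i refl refl s t refl refl]
          show ?case unfolding Let_def M
          proof (intro conjI, goal_cases)
            case 1 show ?case by (rule M.dcoset_i(1)[OF i])
          next
            case 2 show ?case by (rule M.dcoset_i(2)[OF i])
          next
            case 3 show ?case by (rule M.iT_closed[OF i])
          next
            case 4 show ?case by (intro ballI conjI; rule M.iT_members[OF i]; assumption)
          next
            case 5 show ?case unfolding s t M.iT_conj[OF i] M.swap_dgen by simp
          next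
            case 6 show ?case unfolding s by (rule M.generates_t[OF i])
          next
            case 7 show ?case by (intro ballI; rule M.Delta_i_mult[OF i]; assumption)
          next
            case 8 show ?case unfolding s t by (rule M.bar_exists[OF i])
          next
            case 9
            show ?case unfolding s t
            proof (intro ballI impI, elim conjE, rule conjI, goal_cases)
              case (1 bar)
              show ?case by (rule M.twisted_tensor_t(1)[OF i 1])
            next
              case (2 bar)
              show ?case by (rule M.twisted_tensor_t(2)[OF i 2])
            qed
          next
            case 10 show ?case by (rule pres(1))
          next
            case 11 show ?case by (rule pres(2))
          next
            case 12 show ?case by (rule pres(3))
          qed
        qed
      qed
    qed
  qed
qed

end
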